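(* Let $(A,d\mathfrak{m})$ be a measure space of volume $1$, and let $(M,F)$ be a forward complete Berwald $n$-manifold with $|\mathbf{K}_M|\leq k$, $\Lambda_F\leq \Lambda$, and $\mathfrak{i}_M\geq\varsigma$ (where $\varsigma>0$). There exists a constant $\mathfrak{r}=\mathfrak{r}(n,k,\Lambda,\varsigma)>0$, depending only on $n,k,\Lambda,\varsigma$, such that for each $0<r<\mathfrak{r}$, each $p\in M$ and each measurable map $f:A\rightarrow B^+_p(r)$, there exists a unique point $q\in B^+_p(r)$ with $V(q)=0$, where $V$ is the vector field on $\overline{B^+_p(r)}$ defined by \[ V(x):=-\int_{A}\exp_x^{-1} f(a)\,d\mathfrak{m}(a). \] This point $q$ is called the center of mass $\mathscr{C}(f)$ of $f$. In particular, $V$ is differentiable, and the map $V_{*q}$ is non-degenerate at $q=\mathscr{C}(f)$, where $V_*:TB^+_p(r)\rightarrow TB^+_p(r)$ is defined by \[ V_*(X)=X^i\frac{\partial V^k}{\partial x^i}\frac{\partial}{\partial x^k},\qquad X=X^i\frac{\partial}{\partial x^i}, \] and $(x^i,y^i)$ is a local coordinate system of $TB^+_p(r)$.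
   Context: A Finsler $n$-manifold $(M,F)$ is a connected smooth $n$-manifold with a Finsler metric $F:TM\to[0,\infty)$ (smooth off the zero section, $F(x,cy)=cF(x,y)$ for $c>0$, fundamental tensor $g_{ij}(x,y)=\frac12\frac{\partial^2F^2}{\partial y^i\partial y^j}$ positive definite for $y\neq0$); $F$ need not be reversible. For $y\in T_xM\setminus\{0\}$, $g_y(u,v)=g_{ij}(x,y)u^iv^j$; $SM=\{y\in TM:F(y)=1\}$. $d(p,q)$ is the infimum of $F$-lengths of curves from $p$ to $q$ (possibly non-symmetric), $B^+_p(r)=\{q:d(p,q)<r\}$ is the forward ball. Forward complete means that every geodesic extends to all positive times. $\mathfrak{i}_M=\inf_{p}d(p,\mathrm{Cut}_p)$ is the injectivity radius, $\mathrm{Cut}_p$ being the cut locus of $p$. $\exp_x^{-1}$ denotes the inverse of $\exp_x$ restricted to $\{y\in T_xM:F(y)<\mathfrak{i}_M\}$. Chern connection: the forms $\omega^i_j=\Gamma^i_{jk}(x,y)\,dx^k$ on $\pi^*TM$ determined by $\Gamma^i_{jk}=\Gamma^i_{kj}$ and $dg_{ij}-g_{kj}\omega^k_i-g_{ik}\omega^k_j=\frac{2A_{ijk}}{F}(dy^k+N^k_l\,dx^l)$, with $A_{ijk}=\frac F4\frac{\partial^3F^2}{\partial y^i\partial y^j\partial y^k}$, $N^k_l=\Gamma^k_{lm}y^m$. $(M,F)$ is Berwald if $\frac{\partial\Gamma^i_{jk}}{\partial y^s}=0$. The curvature is $\Omega^i_j=d\omega^i_j-\omega^k_j\wedge\omega^i_k=\frac12R^i_{j\,kl}dx^k\wedge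 dx^l+P^i_{j\,kl}dx^k\wedge\frac{dy^l+N^l_sdx^s}{F}$. With $R_{jikl}=g_{is}R^s_{j\,kl}$ the flag curvature is $\mathbf K(y,V)=\frac{V^iy^jR_{jikl}y^lV^k}{g_y(y,y)g_y(V,V)-[g_y(y,V)]^2}$; $|\mathbf{K}_M|\le k$ means that all flag curvatures lie in $[-k,k]$. Uniformity constant: $\Lambda_F=\sup\frac{g_X(Y,Y)}{g_Z(Y,Y)}$ over all $X,Y,Z\in SM$ based at a common point.
   Formalization: For n=1, Berwald also requires Γ(x,-y)=Γ(x,y); with only ∂Γ/∂y=0 the claim fails for n=1. The constant is stated for each fixed underlying set of points and of A; one constant for all follows by transporting M to a fixed set and pushing the measure forward to M. *)

theory Defs
  imports "HOL-Probability.Probability"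
begin

section \<open>Smooth functions and smooth manifolds\<close>

text \<open>Directional derivative at \<open>z\<close> along \<open>X\<close>; it is used for partial derivatives by taking
  \<open>X\<close> to be a standard basis vector.\<close>

definition dird :: "('a::real_normed_vector \<Rightarrow> real) \<Rightarrow> 'a \<Rightarrow> 'a \<Rightarrow> real" where
  "dird f z X = deriv (\<lambda>t. f (z + t *\<^sub>R X)) 0"

text \<open>Meaningful for open \<open>S\<close>.\<close>

primrec Ck_on :: "nat \<Rightarrow> 'a::real_normed_vector set \<Rightarrow> ('a \<Rightarrow> 'b::real_normed_vector) \<Rightarrow> bool" where
  "Ck_on 0 S f \<longleftrightarrow> continuous_on S f"
| "Ck_on (Suc m) S f \<longleftrightarrow>
     (\<forall>x\<in>S. f differentiable (at x)) \<and> (\<forall>v. Ck_on m S (\<lambda>x. frechet_derivative f (at x) v))"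

definition smooth_on :: "'a::real_normed_vector set \<Rightarrow> ('a \<Rightarrow> 'b::real_normed_vector) \<Rightarrow> bool" where
  "smooth_on S f \<longleftrightarrow> (\<forall>m. Ck_on m S f)"

text \<open>A chart is a pair of its domain and its coordinate map; the values of the coordinate map
  outside the domain are irrelevant. The dimension of the manifold is \<open>CARD('n)\<close>.\<close>

type_synonym ('m, 'n) chart = "'m set \<times> ('m \<Rightarrow> real ^ 'n)"

text \<open>A tangent vector at \<open>x\<close> is represented by the family of its coordinate vectors with respect to
  all charts of the atlas around \<open>x\<close> (which are related by the differentials of the transition maps),
  extended by \<open>0\<close> to all other charts.\<close>

type_synonym ('m, 'n) tvec = "('m, 'n) chart \<Rightarrow> real ^ 'n"

text \<open>The point set of the manifold is the carrier of the topology \<open>topo\<close>, and \<open>fnorm M x y\<close> is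
  \<open>F(x,y)\<close>.\<close>

record ('m, 'n) finsler_space =
  topo :: "'m topology"
  atlas :: "('m, 'n) chart set"
  fnorm :: "'m \<Rightarrow> ('m, 'n) tvec \<Rightarrow> real"

abbreviation points :: "('m, 'n::finite) finsler_space \<Rightarrow> 'm set" where
  "points M \<equiv> topspace (topo M)"

definition charts_at :: "('m, 'n::finite) finsler_space \<Rightarrow> 'm \<Rightarrow> ('m, 'n) chart set" where
  "charts_at M x = {c \<in> atlas M. x \<in> fst c}"

definition chart_inv :: "('m, 'n::finite) chart \<Rightarrow> real ^ 'n \<Rightarrow> 'm" where
  "chart_inv c = inv_into (fst c) (snd c)"

definition transition ::
    "('m, 'n::finite) chart \<Rightarrow> ('m, 'n) chart \<Rightarrow> real ^ 'n \<Rightarrow> real ^ 'n" where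
  "transition c c' = snd c' \<circ> chart_inv c"

text \<open>The structure of a connected smooth manifold of dimension \<open>CARD('n)\<close>. The atlas need not be
  maximal.\<close>

definition smooth_manifold :: "('m, 'n::finite) finsler_space \<Rightarrow> bool" where
  "smooth_manifold M \<longleftrightarrow>
     Hausdorff_space (topo M) \<and> second_countable (topo M) \<and>
     connected_space (topo M) \<and> points M \<noteq> {} \<and>
     (\<forall>c\<in>atlas M. openin (topo M) (fst c) \<and> open (snd c ` fst c) \<and>
        homeomorphic_map (subtopology (topo M) (fst c)) (top_of_set (snd c ` fst c)) (snd c)) \<and>
     (\<Union>c\<in>atlas M. fst c) = points M \<and>
     (\<forall>c\<in>atlas M. \<forall>c'\<in>atlas M. smooth_on (snd c ` (fst c \<inter> fst c')) (transition c c'))"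

definition tangent :: "('m, 'n::finite) finsler_space \<Rightarrow> 'm \<Rightarrow> ('m, 'n) tvec set" where
  "tangent M x =
     {v. (\<forall>c\<in>charts_at M x. \<forall>c'\<in>charts_at M x.
            v c' = frechet_derivative (transition c c') (at (snd c x)) (v c)) \<and>
         (\<forall>c. c \<notin> charts_at M x \<longrightarrow> v c = 0)}"

text \<open>The tangent vector \<open>u\<^sup>i \<partial>/\<partial>x\<^sup>i\<close> at \<open>x\<close> in the chart \<open>c\<close>.\<close>

definition coord_tvec ::
    "('m, 'n::finite) finsler_space \<Rightarrow> ('m, 'n) chart \<Rightarrow> 'm \<Rightarrow> real ^ 'n \<Rightarrow> ('m, 'n) tvec" where
  "coord_tvec M c x u = (\<lambda>c'. if c' \<in> charts_at M x
     then frechet_derivative (transition c c') (at (snd c x)) u else 0)"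

definition tscale :: "real \<Rightarrow> ('m, 'n::finite) tvec \<Rightarrow> ('m, 'n) tvec" where
  "tscale a v = (\<lambda>c. a *\<^sub>R v c)"

definition tzero :: "('m, 'n::finite) tvec" where
  "tzero = (\<lambda>c. 0)"


section \<open>Local expressions: fundamental tensor, Chern connection, curvature\<close>

text \<open>In a chart, a Finsler metric is a function \<open>L\<close> of \<open>z = (x, y)\<close>. Tangent vectors of the
  coordinate domain in \<open>TM\<close> are written as pairs \<open>X = (\<xi>, \<eta>)\<close> with \<open>dx\<^sup>k(X) = \<xi>\<^sup>k\<close> and
  \<open>dy\<^sup>k(X) = \<eta>\<^sup>k\<close>.\<close>

type_synonym 'n tpoint = "(real ^ 'n) \<times> (real ^ 'n)"
type_synonym 'n lmetric = "'n tpoint \<Rightarrow> real"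

definition local_metric :: "('m, 'n::finite) finsler_space \<Rightarrow> ('m, 'n) chart \<Rightarrow> 'n lmetric" where
  "local_metric M c = (\<lambda>(\<xi>, u). fnorm M (chart_inv c \<xi>) (coord_tvec M c (chart_inv c \<xi>) u))"

definition pd_y :: "'n::finite \<Rightarrow> ('n tpoint \<Rightarrow> real) \<Rightarrow> 'n tpoint \<Rightarrow> real" where
  "pd_y i f z = dird f z (0, axis i 1)"

definition fund :: "'n::finite lmetric \<Rightarrow> 'n \<Rightarrow> 'n \<Rightarrow> 'n tpoint \<Rightarrow> real" where
  "fund L i j = (\<lambda>z. 1/2 * pd_y i (pd_y j (\<lambda>w. (L w)\<^sup>2)) z)"

text \<open>\<open>g\<^sub>y(u,v)\<close> for \<open>z = (x,y)\<close>.\<close>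

definition fund_form :: "'n::finite lmetric \<Rightarrow> 'n tpoint \<Rightarrow> real ^ 'n \<Rightarrow> real ^ 'n \<Rightarrow> real" where
  "fund_form L z u v = (\<Sum>i\<in>UNIV. \<Sum>j\<in>UNIV. fund L i j z * u $ i * v $ j)"

definition cartan :: "'n::finite lmetric \<Rightarrow> 'n \<Rightarrow> 'n \<Rightarrow> 'n \<Rightarrow> 'n tpoint \<Rightarrow> real" where
  "cartan L i j k = (\<lambda>z. L z / 4 * pd_y i (pd_y j (pd_y k (\<lambda>w. (L w)\<^sup>2))) z)"

text \<open>\<open>G i j k\<close> stands for \<open>\<Gamma>\<^sup>i\<^sub>j\<^sub>k\<close> at one point; the next two definitions are \<open>\<omega>\<^sup>i\<^sub>j(X)\<close> and
  \<open>N\<^sup>k\<^sub>l\<close>.\<close>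

definition conn_of :: "('n::finite \<Rightarrow> 'n \<Rightarrow> 'n \<Rightarrow> real) \<Rightarrow> 'n \<Rightarrow> 'n \<Rightarrow> 'n tpoint \<Rightarrow> real" where
  "conn_of G i j X = (\<Sum>k\<in>UNIV. G i j k * fst X $ k)"

definition nonlin_of :: "('n::finite \<Rightarrow> 'n \<Rightarrow> 'n \<Rightarrow> real) \<Rightarrow> 'n tpoint \<Rightarrow> 'n \<Rightarrow> 'n \<Rightarrow> real" where
  "nonlin_of G z k l = (\<Sum>m\<in>UNIV. G k l m * snd z $ m)"

text \<open>The two defining conditions of the Chern connection: torsion freeness and almost
  \<open>g\<close>-compatibility, the latter as an identity of 1-forms at \<open>z\<close>. They determine the coefficients
  pointwise.\<close>

definition is_chern :: "'n::finite lmetric \<Rightarrow> 'n tpoint \<Rightarrow> ('n \<Rightarrow> 'n \<Rightarrow> 'n \<Rightarrow> real) \<Rightarrow> bool" where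
  "is_chern L z G \<longleftrightarrow>
     (\<forall>i j k. G i j k = G i k j) \<and>
     (\<forall>i j X. dird (fund L i j) z X
          - (\<Sum>k\<in>UNIV. fund L k j z * conn_of G k i X)
          - (\<Sum>k\<in>UNIV. fund L i k z * conn_of G k j X)
        = (\<Sum>k\<in>UNIV. 2 * cartan L i j k z / L z *
             (snd X $ k + (\<Sum>l\<in>UNIV. nonlin_of G z k l * fst X $ l))))"

definition chern :: "'n::finite lmetric \<Rightarrow> 'n tpoint \<Rightarrow> 'n \<Rightarrow> 'n \<Rightarrow> 'n \<Rightarrow> real" where
  "chern L z = (THE G. is_chern L z G)"

definition conn_form :: "'n::finite lmetric \<Rightarrow> 'n \<Rightarrow> 'n \<Rightarrow> 'n tpoint \<Rightarrow> 'n tpoint \<Rightarrow> real" where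
  "conn_form L i j z = conn_of (chern L z) i j"

text \<open>Exterior derivative of a 1-form \<open>\<alpha>\<close> and wedge product of covectors, with the convention
  \<open>(\<alpha> \<and> \<beta>)(X,Y) = \<alpha>(X) \<beta>(Y) - \<alpha>(Y) \<beta>(X)\<close>.\<close>

definition ext_deriv ::
    "('n::finite tpoint \<Rightarrow> 'n tpoint \<Rightarrow> real) \<Rightarrow> 'n tpoint \<Rightarrow> 'n tpoint \<Rightarrow> 'n tpoint \<Rightarrow> real" where
  "ext_deriv \<alpha> z X Y = dird (\<lambda>w. \<alpha> w Y) z X - dird (\<lambda>w. \<alpha> w X) z Y"

definition wedge ::
    "('n::finite tpoint \<Rightarrow> real) \<Rightarrow> ('n tpoint \<Rightarrow> real) \<Rightarrow> 'n tpoint \<Rightarrow> 'n tpoint \<Rightarrow> real" where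
  "wedge \<alpha> \<beta> X Y = \<alpha> X * \<beta> Y - \<alpha> Y * \<beta> X"

definition curv_form ::
    "'n::finite lmetric \<Rightarrow> 'n \<Rightarrow> 'n \<Rightarrow> 'n tpoint \<Rightarrow> 'n tpoint \<Rightarrow> 'n tpoint \<Rightarrow> real" where
  "curv_form L i j z X Y = ext_deriv (conn_form L i j) z X Y
     - (\<Sum>k\<in>UNIV. wedge (conn_form L k j z) (conn_form L i k z) X Y)"

definition dx_form :: "'n::finite \<Rightarrow> 'n tpoint \<Rightarrow> real" where
  "dx_form k X = fst X $ k"

definition dely_form :: "'n::finite lmetric \<Rightarrow> 'n tpoint \<Rightarrow> 'n \<Rightarrow> 'n tpoint \<Rightarrow> real" where
  "dely_form L z l X =
     (snd X $ l + (\<Sum>s\<in>UNIV. nonlin_of (chern L z) z l s * fst X $ s)) / L z"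

text \<open>\<open>hh_curv L z i j k l\<close> is \<open>R\<^sup>i\<^sub>j\<^sub>k\<^sub>l\<close>, the antisymmetric coefficients of the \<open>dx \<and> dx\<close> part of
  the curvature form.\<close>

definition hh_curv :: "'n::finite lmetric \<Rightarrow> 'n tpoint \<Rightarrow> 'n \<Rightarrow> 'n \<Rightarrow> 'n \<Rightarrow> 'n \<Rightarrow> real" where
  "hh_curv L z = (THE R.
     (\<forall>i j k l. R i j k l = - R i j l k) \<and>
     (\<exists>P :: 'n \<Rightarrow> 'n \<Rightarrow> 'n \<Rightarrow> 'n \<Rightarrow> real. \<forall>i j X Y. curv_form L i j z X Y =
        1/2 * (\<Sum>k\<in>UNIV. \<Sum>l\<in>UNIV. R i j k l * wedge (dx_form k) (dx_form l) X Y)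
        + (\<Sum>k\<in>UNIV. \<Sum>l\<in>UNIV. P i j k l * wedge (dx_form k) (dely_form L z l) X Y)))"

text \<open>\<open>low_curv L z j i k l\<close> is \<open>R\<^sub>j\<^sub>i\<^sub>k\<^sub>l = g\<^sub>i\<^sub>s R\<^sup>s\<^sub>j\<^sub>k\<^sub>l\<close>.\<close>

definition low_curv :: "'n::finite lmetric \<Rightarrow> 'n tpoint \<Rightarrow> 'n \<Rightarrow> 'n \<Rightarrow> 'n \<Rightarrow> 'n \<Rightarrow> real" where
  "low_curv L z j i k l = (\<Sum>s\<in>UNIV. fund L i s z * hh_curv L z s j k l)"

definition flag_curv :: "'n::finite lmetric \<Rightarrow> 'n tpoint \<Rightarrow> real ^ 'n \<Rightarrow> real" where
  "flag_curv L z V = (let y = snd z in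
     (\<Sum>i\<in>UNIV. \<Sum>j\<in>UNIV. \<Sum>k\<in>UNIV. \<Sum>l\<in>UNIV.
        V $ i * y $ j * low_curv L z j i k l * y $ l * V $ k)
     / (fund_form L z y y * fund_form L z V V - (fund_form L z y V)\<^sup>2))"


section \<open>Finsler manifolds, the Berwald condition and bounds\<close>

definition finsler_manifold :: "('m, 'n::finite) finsler_space \<Rightarrow> bool" where
  "finsler_manifold M \<longleftrightarrow>
     smooth_manifold M \<and>
     (\<forall>x\<in>points M. \<forall>y\<in>tangent M x. 0 \<le> fnorm M x y) \<and>
     (\<forall>x\<in>points M. \<forall>y\<in>tangent M x. \<forall>a>0. fnorm M x (tscale a y) = a * fnorm M x y) \<and>
     (\<forall>c\<in>atlas M. smooth_on ((snd c ` fst c) \<times> (UNIV - {0})) (local_metric M c)) \<and>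
     (\<forall>c\<in>atlas M. \<forall>x\<in>fst c. \<forall>y. y \<noteq> 0 \<longrightarrow>
        (\<forall>v. v \<noteq> 0 \<longrightarrow> 0 < fund_form (local_metric M c) (snd c x, y) v v))"

text \<open>The condition \<open>\<partial>\<Gamma>\<^sup>i\<^sub>j\<^sub>k/\<partial>y\<^sup>s = 0\<close> says that \<open>\<Gamma>\<^sup>i\<^sub>j\<^sub>k\<close> depends on \<open>x\<close> only. In dimension one the
  punctured tangent spaces are disconnected, so there the two half lines must be matched explicitly;
  in dimension at least two the second clause is void.\<close>

definition berwald :: "('m, 'n::finite) finsler_space \<Rightarrow> bool" where
  "berwald M \<longleftrightarrow> (\<forall>c\<in>atlas M. \<forall>x\<in>fst c. \<forall>y. y \<noteq> 0 \<longrightarrow>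
     (\<forall>i j k s. pd_y s (\<lambda>z. chern (local_metric M c) z i j k) (snd c x, y) = 0) \<and>
     (CARD('n) = 1 \<longrightarrow>
        chern (local_metric M c) (snd c x, - y) = chern (local_metric M c) (snd c x, y)))"

definition flag_curv_bounded :: "('m, 'n::finite) finsler_space \<Rightarrow> real \<Rightarrow> bool" where
  "flag_curv_bounded M k \<longleftrightarrow> (\<forall>c\<in>atlas M. \<forall>x\<in>fst c. \<forall>y V.
     y \<noteq> 0 \<and> V \<notin> span {y} \<longrightarrow> flag_curv (local_metric M c) (snd c x, y) V \<in> {- k..k})"

definition indicatrix :: "('m, 'n::finite) finsler_space \<Rightarrow> 'm \<Rightarrow> ('m, 'n) tvec set" where
  "indicatrix M x = {y \<in> tangent M x. fnorm M x y = 1}"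

definition uniformity_const :: "('m, 'n::finite) finsler_space \<Rightarrow> ereal" where
  "uniformity_const M = Sup {ereal (fund_form (local_metric M c) (snd c x, X c) (Y c) (Y c)
        / fund_form (local_metric M c) (snd c x, Z c) (Y c) (Y c)) | x c X Y Z.
      x \<in> points M \<and> c \<in> charts_at M x \<and>
      X \<in> indicatrix M x \<and> Y \<in> indicatrix M x \<and> Z \<in> indicatrix M x}"


section \<open>Curves, distance, geodesics, exponential map, cut locus\<close>

text \<open>Velocity at \<open>t\<close> of a curve with parameter interval \<open>I\<close>; one-sided at end points of \<open>I\<close>.\<close>

definition velocity ::
    "('m, 'n::finite) finsler_space \<Rightarrow> real set \<Rightarrow> (real \<Rightarrow> 'm) \<Rightarrow> real \<Rightarrow> ('m, 'n) tvec" where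
  "velocity M I \<gamma> t = (\<lambda>c. if c \<in> charts_at M (\<gamma> t)
     then vector_derivative (snd c \<circ> \<gamma>) (at t within I) else 0)"

definition C1_curve :: "('m, 'n::finite) finsler_space \<Rightarrow> real set \<Rightarrow> (real \<Rightarrow> 'm) \<Rightarrow> bool" where
  "C1_curve M I \<gamma> \<longleftrightarrow>
     continuous_map (top_of_set I) (topo M) \<gamma> \<and>
     (\<forall>t\<in>I. \<forall>c\<in>charts_at M (\<gamma> t).
        (snd c \<circ> \<gamma>) differentiable (at t within I) \<and>
        continuous (at t within I) (\<lambda>s. vector_derivative (snd c \<circ> \<gamma>) (at s within I)))"

text \<open>Piecewise \<open>C\<^sup>1\<close>: there are finitely many break points, and the curve is \<open>C\<^sup>1\<close> up to the end
  points on every closed interval without break points in its interior.\<close>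

definition pw_C1_curve :: "('m, 'n::finite) finsler_space \<Rightarrow> (real \<Rightarrow> 'm) \<Rightarrow> bool" where
  "pw_C1_curve M \<gamma> \<longleftrightarrow> (\<exists>S. finite S \<and>
     (\<forall>a b. 0 \<le> a \<and> a < b \<and> b \<le> 1 \<and> {a<..<b} \<inter> S = {} \<longrightarrow> C1_curve M {a..b} \<gamma>))"

definition curve_length :: "('m, 'n::finite) finsler_space \<Rightarrow> (real \<Rightarrow> 'm) \<Rightarrow> real" where
  "curve_length M \<gamma> = integral {0..1} (\<lambda>t. fnorm M (\<gamma> t) (velocity M {0..1} \<gamma> t))"

definition fdist :: "('m, 'n::finite) finsler_space \<Rightarrow> 'm \<Rightarrow> 'm \<Rightarrow> real" where
  "fdist M p q = Inf {curve_length M \<gamma> | \<gamma>. pw_C1_curve M \<gamma> \<and> \<gamma> 0 = p \<and> \<gamma> 1 = q}"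

definition fball :: "('m, 'n::finite) finsler_space \<Rightarrow> 'm \<Rightarrow> real \<Rightarrow> 'm set" where
  "fball M p r = {q \<in> points M. fdist M p q < r}"

text \<open>The (constant speed) geodesic equation \<open>x\<^sup>i'' + \<Gamma>\<^sup>i\<^sub>j\<^sub>k(x, x') x\<^sup>j' x\<^sup>k' = 0\<close>. Constant curves are
  included, because the quadratic term vanishes for \<open>x' = 0\<close> whatever \<open>\<Gamma>\<close> is there.\<close>

definition geodesic_on :: "('m, 'n::finite) finsler_space \<Rightarrow> real set \<Rightarrow> (real \<Rightarrow> 'm) \<Rightarrow> bool" where
  "geodesic_on M I \<gamma> \<longleftrightarrow>
     continuous_map (top_of_set I) (topo M) \<gamma> \<and>
     (\<forall>t\<in>I. \<forall>c\<in>charts_at M (\<gamma> t).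
        (snd c \<circ> \<gamma>) differentiable (at t within I) \<and>
        ((\<lambda>s. vector_derivative (snd c \<circ> \<gamma>) (at s within I)) has_vector_derivative
           (let x = snd c (\<gamma> t); v = vector_derivative (snd c \<circ> \<gamma>) (at t within I) in
             (\<chi> i. - (\<Sum>j\<in>UNIV. \<Sum>k\<in>UNIV. chern (local_metric M c) (x, v) i j k * v $ j * v $ k))))
          (at t within I))"

definition forward_complete :: "('m, 'n::finite) finsler_space \<Rightarrow> bool" where
  "forward_complete M \<longleftrightarrow> (\<forall>\<gamma> a. 0 < a \<and> geodesic_on M {0..<a} \<gamma> \<longrightarrow>
     (\<exists>\<gamma>'. geodesic_on M {0..} \<gamma>' \<and> (\<forall>t\<in>{0..<a}. \<gamma>' t = \<gamma> t)))"

definition fexp :: "('m, 'n::finite) finsler_space \<Rightarrow> 'm \<Rightarrow> ('m, 'n) tvec \<Rightarrow> 'm" where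
  "fexp M x y = (THE q. \<exists>\<gamma>. geodesic_on M {0..1} \<gamma> \<and> \<gamma> 0 = x \<and>
     velocity M {0..1} \<gamma> 0 = y \<and> \<gamma> 1 = q)"

text \<open>The cut locus consists of the points at which the unit speed geodesics from \<open>p\<close> cease to be
  minimizing.\<close>

definition cut_time :: "('m, 'n::finite) finsler_space \<Rightarrow> 'm \<Rightarrow> ('m, 'n) tvec \<Rightarrow> ereal" where
  "cut_time M p y = Sup {ereal t | t. 0 < t \<and> fdist M p (fexp M p (tscale t y)) = t}"

definition cut_locus :: "('m, 'n::finite) finsler_space \<Rightarrow> 'm \<Rightarrow> 'm set" where
  "cut_locus M p = {fexp M p (tscale t y) | t y. y \<in> indicatrix M p \<and> cut_time M p y = ereal t}"

text \<open>The distance to an empty cut locus is infinite.\<close>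

definition inj_radius :: "('m, 'n::finite) finsler_space \<Rightarrow> ereal" where
  "inj_radius M = (INF p\<in>points M. INF q\<in>cut_locus M p. ereal (fdist M p q))"

definition exp_dom :: "('m, 'n::finite) finsler_space \<Rightarrow> 'm \<Rightarrow> ('m, 'n) tvec set" where
  "exp_dom M x = {y \<in> tangent M x. ereal (fnorm M x y) < inj_radius M}"

definition exp_inv :: "('m, 'n::finite) finsler_space \<Rightarrow> 'm \<Rightarrow> 'm \<Rightarrow> ('m, 'n) tvec" where
  "exp_inv M x = the_inv_into (exp_dom M x) (fexp M x)"


section \<open>The centre of mass\<close>

definition borel_of_space :: "('m, 'n::finite) finsler_space \<Rightarrow> 'm measure" where
  "borel_of_space M = sigma (points M) {U. openin (topo M) U}"

definition mass_field ::
    "('m, 'n::finite) finsler_space \<Rightarrow> 'a measure \<Rightarrow> ('a \<Rightarrow> 'm) \<Rightarrow> 'm \<Rightarrow> ('m, 'n) tvec" where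
  "mass_field M A f x = (\<lambda>c. - (\<integral>a. exp_inv M x (f a) c \<partial>A))"

text \<open>The integrals in \<open>mass_field\<close> make sense at \<open>x\<close>, i.e. no default values of the inverse
  function or of the integral enter.\<close>

definition mass_field_defined ::
    "('m, 'n::finite) finsler_space \<Rightarrow> 'a measure \<Rightarrow> ('a \<Rightarrow> 'm) \<Rightarrow> 'm \<Rightarrow> bool" where
  "mass_field_defined M A f x \<longleftrightarrow>
     inj_on (fexp M x) (exp_dom M x) \<and> f ` space A \<subseteq> fexp M x ` exp_dom M x \<and>
     (\<forall>c\<in>charts_at M x. integrable A (\<lambda>a. exp_inv M x (f a) c))"

definition center_of_mass ::
    "('m, 'n::finite) finsler_space \<Rightarrow> 'm \<Rightarrow> real \<Rightarrow> 'a measure \<Rightarrow> ('a \<Rightarrow> 'm) \<Rightarrow> 'm" where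
  "center_of_mass M p r A f = (THE q. q \<in> fball M p r \<and> mass_field M A f q = tzero)"

text \<open>The components of a vector field in the chart \<open>c\<close>, as functions of the coordinates.\<close>

definition field_coords ::
    "('m, 'n::finite) chart \<Rightarrow> ('m \<Rightarrow> ('m, 'n) tvec) \<Rightarrow> real ^ 'n \<Rightarrow> real ^ 'n" where
  "field_coords c V \<xi> = V (chart_inv c \<xi>) c"

text \<open>Differentiability of a vector field on a set of points; the derivative is taken relative to the
  set, which matters only at its boundary points.\<close>

definition field_differentiable_on ::
    "('m, 'n::finite) finsler_space \<Rightarrow> ('m \<Rightarrow> ('m, 'n) tvec) \<Rightarrow> 'm set \<Rightarrow> bool" where
  "field_differentiable_on M V B \<longleftrightarrow> (\<forall>x\<in>B. \<forall>c\<in>charts_at M x.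
     field_coords c V differentiable (at (snd c x) within snd c ` (fst c \<inter> B)))"

text \<open>\<open>V\<^sub>*\<close> at \<open>x\<close> in the local coordinates given by \<open>c\<close>.\<close>

definition field_push ::
    "('m, 'n::finite) chart \<Rightarrow> ('m \<Rightarrow> ('m, 'n) tvec) \<Rightarrow> 'm \<Rightarrow> real ^ 'n \<Rightarrow> real ^ 'n" where
  "field_push c V x X =
     (\<chi> k. \<Sum>i\<in>UNIV. X $ i * dird (\<lambda>\<xi>. field_coords c V \<xi> $ k) (snd c x) (axis i 1))"

end

theory Submission
 imports Defs
begin

text \<open>
In a Berwald space the Chern connection is an affine torsion-free connection, and parallel transport
preserves the fundamental tensors. Along the geodesic from \<open>x\<close> to \<open>q\<close> the Jacobi equation, read in
the inner product \<open>g\<^sub>N\<close> with \<open>N\<close> parallel, therefore bounds \<open>\<nabla>\<^sub>X E + X\<close> for \<open>E(x) = exp_inv M x q\<close>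
in norm by \<open>2 * ka\<close> times the norm of \<open>X\<close>, with \<open>ka\<close> of order \<open>k * r^2\<close>; the uniformity
constant lets one change \<open>N\<close>. Averaging gives \<open>\<nabla>\<^sub>X V \<approx> X\<close>. If \<open>F V\<close> were minimal but nonzero at some point
of the closed ball, a move along \<open>- V\<close> would decrease it, while convexity of the squared distance from \<open>p\<close>
keeps one in the ball; so \<open>V\<close> has a zero. Along a geodesic with velocity \<open>T\<close> the function \<open>g\<^sub>T(T, V)\<close>
increases strictly, which makes the zero unique, and there \<open>V\<^sub>* = \<nabla> V\<close> is injective.
\<close>

text \<open>\<open>F\<close> need not be reversible, and this shapes the proof. The outward radial
  vector at \<open>x\<close> is \<open>- exp_inv M x p\<close>, so Jacobi fields starting at
  \<open>x\<close> are read in \<open>g\<close> at the negative of the velocity; passing to another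
  reference vector costs the uniformity constant, and so does reversing a distance. No energy with
  gradient \<open>V\<close> is used, which is why \<open>F V\<close> itself is minimised. What the
  Berwald condition adds beyond parallel transport: the geodesic field is quadratic in the velocity,
  hence smooth across the zero section, and geodesics may be run backwards. The exponential map is
  thus differentiable jointly in foot point and vector, zero vectors included. Distance, cut locus
  and exponential map are available only through infima and descriptions. That short geodesics are
  minimal, and that \<open>exp\<close> is injective below the injectivity radius, has to be derived:
  from the Gauss lemma on small balls and from cutting a corner between two minimal geodesics.
  Conjugate points are excluded while the curvature bound times \<open>F^2\<close> is at most
  \<open>1/4\<close>, a condition uniform over all manifolds in question.\<close>

lemmas hvd_sub = has_vector_derivative_within_subset and htw_open = has_derivative_transform_within_open

abbreviation (input) hvd (infix "hvd" 50) where "f hvd D \<equiv> f has_vector_derivative D"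
abbreviation (input) hfd (infix "hfd" 50) where "f hfd D \<equiv> f has_derivative D"
abbreviation (input) hrd (infix "hrd" 50) where "f hrd D \<equiv> f has_real_derivative D"
abbreviation (input) scaleR_infix (infixr "*R" 75) where "scaleR_infix \<equiv> scaleR"
abbreviation (input) "ci \<equiv> chart_inv"

section \<open>Calculus of iterated derivatives\<close>

abbreviation fd :: "('a::real_normed_vector => 'b::real_normed_vector) => 'a => 'a => 'b" where
"fd f x \<equiv> frechet_derivative f (at x)"

lemma fd_eqI: "(f hfd f') (at x) ==> fd f x = f'"
by (rule frechet_derivative_at[symmetric])

lemma fd_works: "f differentiable (at x) ==> (f hfd fd f x) (at x)"
by (simp add: frechet_derivative_works)

lemma fd_linear: "f differentiable (at x) ==> linear (fd f x)"
by (rule linear_frechet_derivative)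

lemma fd_cong_open:
assumes "open S" "x \<in> S" "!!y. y \<in> S ==> f y = g y"
shows "fd f x = fd g x" "f differentiable (at x) \<longleftrightarrow> g differentiable (at x)"
proof -
have *: "(f hfd D) (at x) \<longleftrightarrow> (g hfd D) (at x)" for D
 using htw_open[OF _ assms(1,2), of f D UNIV g]
  htw_open[OF _ assms(1,2), of g D UNIV f] assms(3) by auto
show "fd f x = fd g x" unfolding frechet_derivative_def using * by simp
show "f differentiable (at x) \<longleftrightarrow> g differentiable (at x)" unfolding differentiable_def using * by simp
qed

lemma Ck_on_cong:
assumes "open S"
shows "(!!x. x \<in> S ==> f x = g x) ==> Ck_on m S f \<longleftrightarrow> Ck_on m S g"
proof (induction m arbitrary: f g)
case 0 thus ?case by (simp cong: continuous_on_cong)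
next
case (Suc m)
have "f differentiable (at x) \<longleftrightarrow> g differentiable (at x)" if "x \<in> S" for x
 using fd_cong_open(2)[OF assms that] Suc.prems by blast
moreover have "Ck_on m S (%x. fd f x v) \<longleftrightarrow> Ck_on m S (%x. fd g x v)" for v
 by (rule Suc.IH) (metis Suc.prems assms fd_cong_open(1))
ultimately show ?case by simp
qed

lemma Ck_on_subset: "Ck_on m S f ==> T <= S ==> Ck_on m T f"
by (induction m arbitrary: f) (auto intro: continuous_on_subset)

lemma Ck_on_SucD: "Ck_on (Suc m) S f ==> Ck_on m S f"
proof (induction m arbitrary: f)
case 0 thus ?case
 by (auto intro!: continuous_at_imp_continuous_on differentiable_imp_continuous_within)
next
case (Suc m) thus ?case by (metis Ck_on.simps(2))
qed

lemma Ck_on_le: "Ck_on m S f ==> k <= m ==> Ck_on k S f"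
by (induction m) (auto simp: le_Suc_eq dest: Ck_on_SucD simp del: Ck_on.simps(2))

lemma Ck_on_continuous: "Ck_on m S f ==> continuous_on S f"
using Ck_on_le[of m S f 0] by simp

lemma Ck_on_has_derivative: "Ck_on (Suc m) S f ==> x \<in> S ==> (f hfd fd f x) (at x)"
by (simp add: fd_works)

lemma Ck_on_fd: "Ck_on (Suc m) S f ==> Ck_on m S (%x. fd f x v)"
by simp

text \<open>The derivative may be given by any formula valid on the open set \<open>S\<close>. The
  closure rules below all reduce to this and a differentiation rule.\<close>

lemma Ck_on_SucI:
assumes "open S" and "!!x. x \<in> S ==> (f hfd f' x) (at x)" "!!v. Ck_on m S (%x. f' x v)"
shows "Ck_on (Suc m) S f"
proof -
have "fd f x = f' x" if "x \<in> S" for x by (rule fd_eqI) (rule assms(2)[OF that])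
hence "Ck_on m S (%x. fd f x v)" for v
 using Ck_on_cong[OF assms(1), of "%x. fd f x v" "%x. f' x v" m] assms(3) by auto
thus ?thesis using assms(2) by (auto simp: differentiable_def)
qed

lemma Ck_on_const: "open S ==> Ck_on m S (%x. c)"
proof (induction m arbitrary: c)
case (Suc m) thus ?case by (intro Ck_on_SucI[where f' = "%_ _. 0"]) auto
qed simp

lemma Ck_on_bounded_linear:
assumes "open S" "bounded_linear h" shows "Ck_on m S h"
proof (cases m)
case 0 with assms show ?thesis by (simp add: linear_continuous_on)
next
case (Suc k) show ?thesis unfolding Suc
 by (rule Ck_on_SucI[where f' = "%_. h"]) (auto simp: assms Ck_on_const bounded_linear_imp_has_derivative)
qed

lemma Ck_on_add:
assumes "open S" shows "Ck_on m S f ==> Ck_on m S g ==> Ck_on m S (%x. f x + g x)"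
proof (induction m arbitrary: f g)
case 0 thus ?case by (auto intro: continuous_on_add)
next
case (Suc m)
have "((%x. f x + g x) hfd (%v. fd f x v + fd g x v)) (at x)" if "x \<in> S" for x
 by (rule has_derivative_add; rule fd_works) (use Suc.prems that in auto)
thus ?case using Suc.prems
 by (intro Ck_on_SucI[where f' = "%x v. fd f x v + fd g x v"] assms Suc.IH) auto
qed

lemma Ck_on_compose_linear:
assumes "open S" "bounded_linear h" shows "Ck_on m S f ==> Ck_on m S (%x. h (f x))"
proof (induction m arbitrary: f)
case 0 thus ?case using assms by (auto intro: bounded_linear.continuous_on)
next
case (Suc m)
thus ?case
 by (intro Ck_on_SucI[where f' = "%x v. h (fd f x v)"] assms Suc.IH)
   (auto intro: bounded_linear.has_derivative[OF assms(2)] fd_works)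
qed

text \<open>The product rule expresses the derivative by two terms of the same bilinear shape, which
  is what the induction on \<open>m\<close> needs. Products of reals and scalar multiples are
  instances.\<close>

lemma Ck_on_bilinear:
assumes "open S" "bounded_bilinear h"
shows "Ck_on m S f ==> Ck_on m S g ==> Ck_on m S (%x. h (f x) (g x))"
proof (induction m arbitrary: f g)
case 0 thus ?case using assms by (auto intro: bounded_bilinear.continuous_on)
next
case (Suc m)
show ?case
proof (rule Ck_on_SucI[where f' = "%x v. h (f x) (fd g x v) + h (fd f x v) (g x)"])
 show "((%x. h (f x) (g x)) hfd (%v. h (f x) (fd g x v) + h (fd f x v) (g x))) (at x)"
  if "x \<in> S" for x
  by (rule bounded_bilinear.FDERIV[OF assms(2)]) (use Suc.prems that in "auto intro: fd_works")
 show "Ck_on m S (%x. h (f x) (fd g x v) + h (fd f x v) (g x))" for v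
  by (intro Ck_on_add assms Suc.IH Ck_on_fd Suc.prems Ck_on_SucD)
qed (rule assms)
qed

lemmas Ck_on_mult = Ck_on_bilinear[OF _ bounded_bilinear_mult]
lemmas Ck_on_scaleR = Ck_on_bilinear[OF _ bounded_bilinear_scaleR]

lemma Ck_on_sum: "open S ==> (!!i. i \<in> I ==> Ck_on m S (f i)) ==> Ck_on m S (%x. \<Sum>i\<in>I. f i x)"
by (induction I rule: infinite_finite_induct) (auto intro: Ck_on_const Ck_on_add)

lemma Ck_on_prod:
fixes f :: "'i => 'a::real_normed_vector => real"
shows "open S ==> (!!i. i \<in> I ==> Ck_on m S (f i)) ==> Ck_on m S (%x. \<Prod>i\<in>I. f i x)"
by (induction I rule: infinite_finite_induct) (auto intro: Ck_on_const Ck_on_mult)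

lemma Ck_on_inverse:
fixes f :: "'a::real_normed_vector => real"
assumes "open S" shows "(!!x. x \<in> S ==> f x ~= 0) ==> Ck_on m S f ==> Ck_on m S (%x. inverse (f x))"
proof (induction m)
case 0 thus ?case by (auto intro: continuous_on_inverse)
next
case (Suc m)
show ?case
proof (rule Ck_on_SucI[where f' = "%x v. - (inverse (f x) * fd f x v * inverse (f x))"])
 show "((%x. inverse (f x)) hfd (%v. - (inverse (f x) * fd f x v * inverse (f x)))) (at x)"
  if "x \<in> S" for x
  by (rule Deriv.has_derivative_inverse[of f x, OF Suc.prems(1)[OF that]])
    (rule Ck_on_has_derivative[OF Suc.prems(2) that])
 have "Ck_on m S (%x. inverse (f x) * fd f x v * inverse (f x))" for v
  by (intro Ck_on_mult assms Suc.IH Ck_on_fd Suc.prems Ck_on_SucD[OF Suc.prems(2)])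
 from Ck_on_compose_linear[OF assms bounded_linear_minus[OF bounded_linear_ident] this]
 show "Ck_on m S (%x. - (inverse (f x) * fd f x v * inverse (f x)))" for v .
qed (rule assms)
qed

text \<open>Affine inner maps are those that occur later: freezing the fibre variable, or projecting
  to the base point. The derivative is again a composite with the same affine map, so the induction
  closes at once.\<close>

lemma Ck_on_compose_affine:
assumes "open S" "open T" "bounded_linear l" "!!x. x \<in> T ==> a + l x \<in> S"
shows "Ck_on m S f ==> Ck_on m T (%x. f (a + l x))"
proof (induction m arbitrary: f)
case 0
have "continuous_on T (%x. a + l x)" by (intro continuous_intros linear_continuous_on assms)
thus ?case using 0 assms(4) continuous_on_compose2[of S f T "%x. a + l x"] by auto
next
case (Suc m)
show ?case
proof (rule Ck_on_SucI[where f' = "%x v. fd f (a + l x) (l v)"])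
 show "((%x. f (a + l x)) hfd (%v. fd f (a + l x) (l v))) (at x)" if "x \<in> T" for x
 proof -
  have 1: "((%x. a + l x) hfd l) (at x)"
   by (auto intro!: derivative_eq_intros bounded_linear_imp_has_derivative assms)
  have 2: "(f hfd fd f (a + l x)) (at (a + l x))"
   using Suc.prems assms(4)[OF that] by (auto intro: fd_works)
  show ?thesis using diff_chain_at[OF 1 2] by (simp add: o_def)
 qed
 show "Ck_on m T (%x. fd f (a + l x) (l v))" for v by (rule Suc.IH) (use Suc.prems in auto)
qed (rule assms)
qed

section \<open>Smooth functions, symmetry of second derivatives and Taylor bounds\<close>

lemma smooth_onD: "smooth_on S f ==> Ck_on m S f"
by (simp add: smooth_on_def)

lemma smooth_on_fd: "smooth_on S f ==> smooth_on S (%x. fd f x v)"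
unfolding smooth_on_def using Ck_on_fd by blast

lemma smooth_on_mult:
fixes f g :: "'a::real_normed_vector => real"
shows "open S ==> smooth_on S f ==> smooth_on S g ==> smooth_on S (%x. f x * g x)"
by (simp add: smooth_on_def Ck_on_mult)

lemma smooth_on_hfd:
"smooth_on S f ==> x \<in> S ==> (f hfd fd f x) (at x)"
using smooth_onD[of S f "Suc 0"] Ck_on_has_derivative by blast

text \<open>Ties the \<open>deriv\<close> along a line, on which the definitions are built, to the
  Frechet derivative, in which all later calculus is done.\<close>

lemma dird_eq_fd:
assumes "f differentiable (at z)" shows "dird f z X = fd f z X"
proof -
have 1: "((%t. z + t *R X) hfd (%t. t *R X)) (at 0)"
 by (auto intro!: derivative_eq_intros)
have "(f hfd fd f z) (at (z + 0 *R X))" using fd_works[OF assms] by simp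
from diff_chain_at[OF 1 this]
have "((%t. f (z + t *R X)) hfd (%t. fd f z (t *R X))) (at 0)" by (simp add: o_def)
moreover have "fd f z (t *R X) = fd f z X * t" for t
 using linear_cmul[OF fd_linear[OF assms]] by simp
ultimately have "((%t. f (z + t *R X)) has_field_derivative fd f z X) (at 0)"
 by (simp add: has_field_derivative_def)
thus ?thesis unfolding dird_def by (rule DERIV_imp_deriv)
qed

lemma has_real_derivative_line:
assumes "f differentiable (at (x + t *R v))"
shows "((%t. f (x + t *R v)) hrd fd f (x + t *R v) v) (at t)"
proof -
have 1: "((%t. x + t *R v) hfd (%t. t *R v)) (at t)"
 by (auto intro!: derivative_eq_intros)
from diff_chain_at[OF 1 fd_works[OF assms]]
have "((%t. f (x + t *R v)) hfd (%s. fd f (x + t *R v) (s *R v))) (at t)" by (simp add: o_def)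
moreover have "fd f (x + t *R v) (s *R v) = fd f (x + t *R v) v * s" for s
 using linear_cmul[OF fd_linear[OF assms]] by simp
ultimately show ?thesis by (simp add: has_field_derivative_def)
qed

text \<open>Two mean value steps: along \<open>u\<close> for the increment of \<open>f\<close> in
  direction \<open>s *R v\<close>, then along \<open>v\<close> for the derivative in direction
  \<open>u\<close>. Convexity of \<open>C\<close> keeps the whole parallelogram inside.\<close>

lemma second_difference:
fixes f :: "'a::real_normed_vector => real"
assumes "convex C" "open C" "Ck_on 2 C f" "x \<in> C" "x + s *R u \<in> C" "x + s *R v \<in> C"
 "x + s *R u + s *R v \<in> C" "0 < s"
shows "EX a b. 0 < a & a < s & 0 < b & b < s & x + a *R u + b *R v \<in> C &
 f (x + s *R u + s *R v) - f (x + s *R u) - f (x + s *R v) + f x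
  = s * s * fd (%y. fd f y u) (x + a *R u + b *R v) v"
proof -
have C1: "f differentiable (at y)" and C2: "(%y. fd f y u) differentiable (at y)" if "y \<in> C" for y u
 using assms(3) that by (auto simp: numeral_2_eq_2)
have in_C: "x + a *R u + b *R v \<in> C" if "0 <= a" "a <= s" "0 <= b" "b <= s" for a b
proof -
 have seg: "p + c *R w \<in> C" if "p \<in> C" "p + s *R w \<in> C" "0 <= c" "c <= s" for p c w
 proof -
  have "p + c *R w = (1 - c/s) *R p + (c/s) *R (p + s *R w)"
   using \<open>0 < s\<close> by (simp add: algebra_simps)
  also have "... \<in> C" using that \<open>0 < s\<close> by (intro convexD[OF assms(1)]) (auto simp: field_simps)
  finally show ?thesis .
 qed
 have "x + a *R u \<in> C" "x + s *R v + a *R u \<in> C"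
  using seg[of x u a] seg[of "x + s *R v" u a] assms that by (auto simp: algebra_simps)
 thus ?thesis using seg[of "x + a *R u" v b] that by (auto simp: algebra_simps)
qed
define ph where "ph t = f (x + s *R v + t *R u) - f (x + t *R u)" for t
have "EX a. 0 < a & a < s & ph s - ph 0 = (s - 0) * (fd f (x + s *R v + a *R u) u - fd f (x + a *R u) u)"
proof (rule MVT2[OF assms(8)])
 fix t assume t: "0 <= t" "t <= s"
 have "x + s *R v + t *R u \<in> C" "x + t *R u \<in> C"
  using in_C[of t s] in_C[of t 0] t by (auto simp: algebra_simps)
 thus "(ph hrd fd f (x + s *R v + t *R u) u - fd f (x + t *R u) u) (at t)"
  unfolding ph_def by (intro DERIV_diff has_real_derivative_line C1)
qed
then obtain a where a: "0 < a" "a < s"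
 "ph s - ph 0 = s * (fd f (x + s *R v + a *R u) u - fd f (x + a *R u) u)" by auto
have "EX b. 0 < b & b < s & fd f (x + a *R u + s *R v) u - fd f (x + a *R u + 0 *R v) u
  = (s - 0) * fd (%y. fd f y u) (x + a *R u + b *R v) v"
 by (rule MVT2[OF assms(8)]) (use a in "auto intro!: has_real_derivative_line C2 in_C")
then obtain b where b: "0 < b" "b < s" "fd f (x + a *R u + s *R v) u - fd f (x + a *R u) u
  = s * fd (%y. fd f y u) (x + a *R u + b *R v) v" by auto
have "f (x + s *R u + s *R v) - f (x + s *R u) - f (x + s *R v) + f x = ph s - ph 0"
 by (simp add: ph_def algebra_simps)
also have "... = s * s * fd (%y. fd f y u) (x + a *R u + b *R v) v"
 using a b by (simp add: algebra_simps)
finally show ?thesis using a b in_C[of a b] by force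
qed

text \<open>Schwarz's theorem. The second difference is symmetric in \<open>u\<close> and
  \<open>v\<close>, so it equals \<open>s * s\<close> times either mixed derivative at points near
  \<open>x\<close>; continuity then rules out different values at \<open>x\<close>.\<close>

lemma fd_fd_commute:
fixes f :: "'a::real_normed_vector => real"
assumes "open S" "x \<in> S" "Ck_on 2 S f"
shows "fd (%y. fd f y u) x v = fd (%y. fd f y v) x u"
proof (rule ccontr)
let ?A = "%y. fd (%y. fd f y u) y v" and ?B = "%y. fd (%y. fd f y v) y u"
assume ne: "?A x ~= ?B x"
define e where "e = \<bar>?A x - ?B x\<bar> / 2"
have "e > 0" using ne by (simp add: e_def)
have cont: "isCont ?A x" "isCont ?B x"
 using assms by (auto simp: numeral_2_eq_2 continuous_on_eq_continuous_at)
obtain d1 where d1: "d1 > 0" "!!y. dist y x < d1 ==> \<bar>?A y - ?A x\<bar> < e"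
 using cont(1) \<open>e > 0\<close> unfolding continuous_at_eps_delta dist_real_def by blast
obtain d2 where d2: "d2 > 0" "!!y. dist y x < d2 ==> \<bar>?B y - ?B x\<bar> < e"
 using cont(2) \<open>e > 0\<close> unfolding continuous_at_eps_delta dist_real_def by blast
obtain d3 where d3: "d3 > 0" "ball x d3 <= S" using assms(1,2) open_contains_ball by blast
define d where "d = min d1 (min d2 d3)"
have d: "d > 0" using d1 d2 d3 by (simp add: d_def)
\<comment> \<open>Small enough that the parallelogram spanned by \<open>s *R u\<close> and
  \<open>s *R v\<close> stays within distance \<open>d / 2\<close> of \<open>x\<close>; the summand
  1 avoids a zero denominator.\<close>
define s where "s = d / (2 * (norm u + norm v + 1))"
have s: "0 < s" unfolding s_def using d by (intro divide_pos_pos mult_pos_pos) (auto intro: add_nonneg_pos)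
have inb: "x + a *R u + b *R v \<in> ball x d" if "0 <= a" "a <= s" "0 <= b" "b <= s" for a b
proof -
 have "norm (a *R u + b *R v) <= a * norm u + b * norm v"
  using norm_triangle_ineq[of "a *R u" "b *R v"] that by simp
 also have "... <= s * norm u + s * norm v" using that by (intro add_mono mult_right_mono) auto
 also have "... <= s * (norm u + norm v + 1)" using s by (simp add: algebra_simps)
 also have "... = d / 2"
 proof -
  have "norm u + norm v + 1 > 0" by (intro add_nonneg_pos) auto
  thus ?thesis by (simp add: s_def field_simps)
 qed
 also have "... < d" using d by simp
 finally have "dist (x + (a *R u + b *R v)) x < d" by (simp add: dist_norm)
 thus ?thesis by (simp only: mem_ball dist_commute add.assoc)
qed
have C: "Ck_on 2 (ball x d) f" by (rule Ck_on_subset[OF assms(3)]) (use d3(2) in "auto simp: d_def")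
obtain a b where ab: "x + a *R u + b *R v \<in> ball x d"
 "f (x + s *R u + s *R v) - f (x + s *R u) - f (x + s *R v) + f x = s * s * ?A (x + a *R u + b *R v)"
 using second_difference[OF convex_ball open_ball C, where s=s and u=u and v=v and x=x] s inb[of 0 0] inb[of s 0] inb[of 0 s] inb[of s s]
 by auto
have swap: "x + s *R v + s *R u = x + s *R u + s *R v" by (simp add: algebra_simps)
obtain a' b' where ab': "x + a' *R v + b' *R u \<in> ball x d"
 "f (x + s *R u + s *R v) - f (x + s *R v) - f (x + s *R u) + f x = s * s * ?B (x + a' *R v + b' *R u)"
 using second_difference[OF convex_ball open_ball C, where s=s and u=v and v=u and x=x] s inb[of 0 0] inb[of s 0] inb[of 0 s] inb[of s s]
 unfolding swap by auto
have "s * s * ?A (x + a *R u + b *R v) = s * s * ?B (x + a' *R v + b' *R u)"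
 using ab(2) ab'(2) by linarith
hence "?A (x + a *R u + b *R v) = ?B (x + a' *R v + b' *R u)" using s by simp
moreover have "\<bar>?A (x + a *R u + b *R v) - ?A x\<bar> < e" by (rule d1) (use ab in "simp add: d_def dist_commute")
moreover have "\<bar>?B (x + a' *R v + b' *R u) - ?B x\<bar> < e" by (rule d2) (use ab' in "simp add: d_def dist_commute")
ultimately show False unfolding e_def by (auto simp: abs_if split: if_splits)
qed

lemma fd_bounded_on_compact:
fixes f :: "'a::euclidean_space => 'b::real_normed_vector"
assumes "Ck_on (Suc 0) S f" "compact C" "C <= S"
obtains K where "K > 0" "!!x v. x \<in> C ==> norm (fd f x v) <= K * norm v"
proof -
have "ALL b. EX B. ALL x:C. norm (fd f x b) <= B"
proof
 fix b
 have "continuous_on C (%x. fd f x b)" using assms by (auto intro: continuous_on_subset)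
 hence "bounded ((%x. fd f x b) ` C)" using assms(2) compact_continuous_image compact_imp_bounded by blast
 thus "EX B. ALL x:C. norm (fd f x b) <= B" by (auto simp: bounded_iff)
qed
then obtain B where B: "!!b x. x \<in> C ==> norm (fd f x b) <= B b" by metis
define K where "K = (\<Sum>b\<in>Basis. \<bar>B b\<bar>) + 1"
have "norm (fd f x v) <= K * norm v" if "x \<in> C" for x v
proof -
 have lin: "linear (fd f x)" using assms that by (auto intro: fd_linear)
 have "fd f x v = fd f x (\<Sum>b\<in>Basis. (v \<bullet> b) *R b)" by (simp add: euclidean_representation)
 also have "... = (\<Sum>b\<in>Basis. (v \<bullet> b) *R fd f x b)"
  by (simp add: linear_sum[OF lin] linear_cmul[OF lin])
 also have "norm ... <= (\<Sum>b\<in>Basis. norm v * \<bar>B b\<bar>)"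
  using B[OF that] by (intro sum_norm_le) (auto intro!: mult_mono Basis_le_norm order_trans[OF _ abs_ge_self])
 also have "... <= K * norm v" by (simp add: K_def sum_distrib_left[symmetric] algebra_simps)
 finally show ?thesis .
qed
moreover have "K > 0" unfolding K_def by (intro add_nonneg_pos sum_nonneg) auto
ultimately show ?thesis using that by blast
qed

lemma C1_lipschitz:
fixes f :: "'a::euclidean_space => 'b::real_normed_vector"
assumes "Ck_on (Suc 0) S f" "compact C" "C <= S" "convex C"
obtains K where "K > 0" "!!x y. x \<in> C ==> y \<in> C ==> norm (f x - f y) <= K * norm (x - y)"
 "!!x v. x \<in> C ==> norm (fd f x v) <= K * norm v"
proof -
obtain K where K: "K > 0" "!!x v. x \<in> C ==> norm (fd f x v) <= K * norm v"
 using fd_bounded_on_compact[OF assms(1-3)] by blast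
have "norm (f x - f y) <= K * norm (x - y)" if "x \<in> C" "y \<in> C" for x y
proof (rule differentiable_bound[OF assms(4) _ _ that])
 fix z assume z: "z \<in> C"
 show "(f hfd fd f z) (at z within C)"
  by (rule has_derivative_at_withinI[OF fd_works]) (use assms z in auto)
 show "onorm (fd f z) <= K" by (rule onorm_le) (rule K(2)[OF z])
qed
with K that show ?thesis by blast
qed

text \<open>The Lipschitz bound for \<open>fd f\<close> is assembled from the basis directions. The
  quadratic remainder follows from the mean value inequality for \<open>f\<close> minus its
  linearisation at \<open>x\<close>, along the segment.\<close>

lemma C2_taylor:
fixes f :: "'a::euclidean_space => 'b::real_normed_vector"
assumes "Ck_on 2 S f" "compact C" "C <= S" "convex C"
obtains K where "K > 0"
 "!!x y v. x \<in> C ==> y \<in> C ==> norm (fd f x v - fd f y v) <= K * norm (x - y) * norm v"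
 "!!x y. x \<in> C ==> y \<in> C ==> norm (f y - f x - fd f x (y - x)) <= K * (norm (y - x))^2"
proof -
have "ALL b. EX K>0. ALL x:C. ALL y:C. norm (fd f x b - fd f y b) <= K * norm (x - y)"
proof
 fix b
 have "Ck_on (Suc 0) S (%x. fd f x b)" using assms(1) by (simp add: numeral_2_eq_2)
 from C1_lipschitz[OF this assms(2-4)]
 show "EX K>0. ALL x:C. ALL y:C. norm (fd f x b - fd f y b) <= K * norm (x - y)" by metis
qed
then obtain B where B: "!!b. B b > 0" "!!b x y. x \<in> C ==> y \<in> C ==> norm (fd f x b - fd f y b) <= B b * norm (x - y)"
 by metis
define K where "K = (\<Sum>b\<in>Basis. B b) + 1"
have K: "K > 0" unfolding K_def using B(1) by (intro add_nonneg_pos sum_nonneg) (auto intro: less_imp_le)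
have diff: "f differentiable (at x)" if "x \<in> C" for x using assms(1,3) that by (auto simp: numeral_2_eq_2)
have lip: "norm (fd f x v - fd f y v) <= K * norm (x - y) * norm v" if "x \<in> C" "y \<in> C" for x y v
proof -
 have lin: "linear (%v. fd f x v - fd f y v)"
  using that by (intro linear_compose_sub fd_linear diff)
 have "fd f x v - fd f y v = (%v. fd f x v - fd f y v) (\<Sum>b\<in>Basis. (v \<bullet> b) *R b)"
  by (simp add: euclidean_representation)
 also have "... = (\<Sum>b\<in>Basis. (v \<bullet> b) *R (fd f x b - fd f y b))"
  unfolding linear_sum[OF lin] by (rule sum.cong[OF refl]) (rule linear_cmul[OF lin])
 also have "norm ... <= (\<Sum>b\<in>Basis. norm v * (B b * norm (x - y)))"
  using B(2)[OF that] by (intro sum_norm_le) (auto intro!: mult_mono Basis_le_norm)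
 also have "... = (\<Sum>b\<in>Basis. B b) * (norm (x - y) * norm v)"
  by (simp add: sum_distrib_left sum_distrib_right algebra_simps)
 also have "... <= K * (norm (x - y) * norm v)" unfolding K_def by (intro mult_right_mono) auto
 finally show ?thesis by (simp add: mult.assoc)
qed
have "norm (f y - f x - fd f x (y - x)) <= K * (norm (y - x))^2" if xy: "x \<in> C" "y \<in> C" for x y
proof -
 have seg: "closed_segment x y <= C" using xy assms(4) by (simp add: closed_segment_subset)
 have "norm ((%z. f z - fd f x z) y - (%z. f z - fd f x z) x) <= (K * norm (y - x)) * norm (y - x)"
 proof (rule differentiable_bound[of "closed_segment x y"])
  fix z assume z: "z \<in> closed_segment x y"
  hence zC: "z \<in> C" using seg by blast
  have "(fd f x hfd fd f x) (at z)"
   by (rule bounded_linear_imp_has_derivative[OF has_derivative_bounded_linear[OF fd_works[OF diff[OF xy(1)]]]])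
  thus "((%z. f z - fd f x z) hfd (%v. fd f z v - fd f x v)) (at z within closed_segment x y)"
   by (rule has_derivative_diff[OF has_derivative_at_withinI[OF fd_works[OF diff[OF zC]]] has_derivative_at_withinI])
  have "norm (z - x) <= norm (y - x)" using z segment_bound(1) by (metis norm_minus_commute)
  hence "norm (fd f z v - fd f x v) <= (K * norm (y - x)) * norm v" for v
   using lip[OF zC xy(1), of v] K by (smt (verit) mult_left_mono mult_right_mono norm_ge_zero)
  thus "onorm (%v. fd f z v - fd f x v) <= K * norm (y - x)" by (rule onorm_le)
 qed auto
 thus ?thesis unfolding linear_diff[OF fd_linear[OF diff[OF xy(1)]]] by (simp add: power2_eq_square algebra_simps)
qed
with K lip that show ?thesis by blast
qed

section \<open>Linear algebra behind the Chern connection\<close>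

lemma lin_axis:
fixes f :: "real ^ 'n::finite => 'b::real_vector"
assumes "linear f" shows "f u = (\<Sum>i\<in>UNIV. (u $ i) *R f (axis i 1))"
proof -
have "f u = f (\<Sum>i\<in>UNIV. (u $ i) *R axis i 1)"
 using basis_expansion[of u] by (simp add: scalar_mult_eq_scaleR)
thus ?thesis by (simp add: linear_sum[OF assms] linear_cmul[OF assms])
qed

lemma linear_ext_axis:
fixes f g :: "real ^ 'n::finite => 'b::real_vector"
assumes "linear f" "linear g" "!!i. f (axis i 1) = g (axis i 1)" shows "f u = g u"
unfolding lin_axis[OF assms(1), of u] lin_axis[OF assms(2), of u] assms(3) ..

text \<open>The values of \<open>g v\<close> on the basis define an endomorphism \<open>T\<close>;
  positivity makes it injective, hence surjective in finite dimension.\<close>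

lemma riesz_ex1:
fixes g :: "real ^ 'n::finite => real ^ 'n => real"
assumes "!!w. linear (%v. g v w)" "!!v. linear (g v)" "!!v. v ~= 0 ==> 0 < g v v" "linear l"
shows "\<exists>!v. ALL w. g v w = l w"
proof -
define T where "T v = (\<chi> i. g v (axis i 1))" for v
have linT: "linear T"
 by (rule linearI) (simp_all add: T_def vec_eq_iff linear_add[OF assms(1)] linear_cmul[OF assms(1)])
have eq: "g v w = l w" if "T v = (\<chi> i. l (axis i 1))" for v w
 by (rule linear_ext_axis[OF assms(2,4)]) (use that in "simp add: T_def vec_eq_iff")
have "v = 0" if "T v = 0" for v
proof (rule ccontr)
 assume "v ~= 0"
 moreover have "g v v = 0"
  by (rule linear_ext_axis[OF assms(2) linear_zero]) (use that in "simp add: T_def vec_eq_iff")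
 ultimately show False using assms(3)[of v] by simp
qed
hence "inj T" using linear_injective_0[OF linT] by blast
then obtain v where "T v = (\<chi> i. l (axis i 1))"
 using linear_injective_imp_surjective[OF linT] by (metis surjD)
hence v: "ALL w. g v w = l w" using eq by blast
moreover have "v' = v" if "ALL w. g v' w = l w" for v'
proof (rule ccontr)
 assume "v' ~= v"
 hence "0 < g (v' - v) (v' - v)" using assms(3)[of "v' - v"] by simp
 thus False using v that by (simp add: linear_diff[OF assms(1)])
qed
ultimately show ?thesis by blast
qed

text \<open>The Koszul argument in three stages: first \<open>Ga(y,y)\<close>, where all Cartan terms drop out, then
\<open>Ga(y,\<cdot>)\<close> and finally \<open>Ga\<close>.\<close>

lemma koszul_unique:
fixes g :: "real ^ 'n::finite => real ^ 'n => real" and Ga Ga' :: "real ^ 'n => real ^ 'n => real ^ 'n"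
assumes g: "!!w. linear (%v. g v w)" "!!v. linear (g v)" "!!v. v ~= 0 ==> 0 < g v v" "!!u w. g u w = g w u"
 and C: "!!u w. linear (%v. C v u w)" "!!v u w. C v u w = C v w u" "!!v w. C v y w = 0"
 and sym: "!!u v. Ga u v = Ga v u" "!!u v. Ga' u v = Ga' v u"
 and E: "!!X u w. A X u w - g (Ga u X) w - g u (Ga w X) = C (Ga y X) u w"
  "!!X u w. A X u w - g (Ga' u X) w - g u (Ga' w X) = C (Ga' y X) u w"
shows "Ga u v = Ga' u v"
proof -
define D where "D u v = Ga u v - Ga' u v" for u v
have symD: "D u v = D v u" for u v unfolding D_def using sym by simp
have ED: "g (D u X) w + g u (D w X) + C (D y X) u w = 0" for X u w
proof -
 have "g (Ga u X) w - g (Ga' u X) w + (g u (Ga w X) - g u (Ga' w X)) + (C (Ga y X) u w - C (Ga' y X) u w) = 0"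
  using E(1)[of X u w] E(2)[of X u w] by linarith
 thus ?thesis
  by (simp add: D_def linear_diff[OF g(1)] linear_diff[OF g(2)] linear_diff[OF C(1)])
qed
have K: "2 * g (D u X) w = - C (D y X) u w - C (D y u) X w + C (D y w) u X" for u X w
proof -
 have "g u (D w X) = g (D w X) u" "g X (D w u) = g (D w u) X" "g u (D X w) = g (D X w) u"
  "D X u = D u X" "D X w = D w X" "D w u = D u w"
  using symD g(4) by auto
 thus ?thesis using ED[of u X w] ED[of X u w] ED[of u w X] g(4) by (smt (verit))
qed
have pos: "d = 0" if "!!w. g d w = 0" for d using g(3)[of d] that[of d] by fastforce
have C0: "C v w y = 0" for v w using C(2)[of v w y] C(3) by simp
have D0: "C 0 u w = 0" for u w using linear_0[OF C(1)] .
have 1: "D y y = 0" by (rule pos) (use K[of y y] C(3) C0 in simp)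
have 2: "D y X = 0" for X by (rule pos) (use K[of y X] C(3) C0 D0 1 in simp)
have "D u v = 0" by (rule pos) (use K[of u v] 2 D0 in simp)
thus ?thesis by (simp add: D_def)
qed

text \<open>The same stages as for uniqueness, now as Koszul formulas solved by Riesz
  representation: \<open>G0\<close> for \<open>Ga y y\<close>, \<open>N u\<close> for
  \<open>Ga y u\<close>, and then \<open>Ga\<close>. Each right-hand side contains the Cartan form
  only at vectors supplied by the previous stage.\<close>

lemma koszul_exists:
fixes g :: "real ^ 'n::finite => real ^ 'n => real"
assumes g: "!!w. linear (%v. g v w)" "!!v. linear (g v)" "!!v. v ~= 0 ==> 0 < g v v" "!!u w. g u w = g w u"
 and A: "!!u w. linear (%X. A X u w)" "!!X w. linear (%u. A X u w)" "!!X u w. A X u w = A X w u"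
 and C: "!!u w. linear (%v. C v u w)" "!!v u w. C v u w = C v w u" "!!v u w. C v u w = C u v w"
  "!!v w. C v y w = 0"
obtains Ga :: "real ^ 'n => real ^ 'n => real ^ 'n"
where "!!v. linear (%u. Ga u v)" "!!u v. Ga u v = Ga v u"
 "!!X u w. A X u w - g (Ga u X) w - g u (Ga w X) = C (Ga y X) u w"
proof -
define R where "R l = (THE v. ALL w. g v w = l w)" for l
have R: "g (R l) w = l w" if "linear l" for l w
 using theI'[OF riesz_ex1[OF g(1-3) that]] unfolding R_def by blast
have A3: "linear (A X u)" for X u using A(2)[of X u] unfolding A(3)[of X u] by simp
have C2: "linear (%u. C v u w)" for v w using C(1)[of v w] unfolding C(3)[of _ v] by simp
have C3: "linear (%w. C v u w)" for v u using C2[of v u] unfolding C(2)[of v u] by simp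
have sc: "linear (%x. c * f x)" if "linear f" for f :: "real ^ 'n => real" and c
 using linear_compose_scale_right[OF that, of c] by simp
have C0: "C v w y = 0" "C y v w = 0" for v w using C by metis+
define l0 where "l0 w = A y y w - 1/2 * A w y y" for w
define G0 where "G0 = R l0"
have lin0: "linear l0" unfolding l0_def by (intro linear_compose_sub sc A A3)
define lN where "lN u w = 1/2 * (A y u w + A u y w - A w u y - C G0 u w)" for u w
have linN: "linear (lN u)" "linear (%u. lN u w)" for u w
 unfolding lN_def by (intro linear_compose_sub linear_compose_add sc A A3 C C2 C3)+
define N where "N u = R (lN u)" for u
have gN: "g (N u) w = lN u w" for u w unfolding N_def by (rule R[OF linN(1)])
have ginj: "a = b" if "!!w. g a w = g b w" for a b
proof (rule ccontr)
 assume "a ~= b"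
 hence "0 < g (a - b) (a - b)" using g(3)[of "a - b"] by simp
 thus False using that by (simp add: linear_diff[OF g(1)])
qed
have Nlin: "linear N"
 by (rule linearI; rule ginj)
   (simp_all add: gN linear_add[OF g(1)] linear_cmul[OF g(1)] linear_add[OF linN(2)] linear_cmul[OF linN(2)])
\<comment> \<open>The second stage reproduces the first at \<open>y\<close>, because every Cartan
  term with an argument \<open>y\<close> vanishes.\<close>
have Ny: "N y = G0"
proof (rule ginj)
 fix w show "g (N y) w = g G0 w"
  unfolding gN G0_def R[OF lin0] lN_def l0_def using C0 A(3)[of w y y] C(4) by (simp add: algebra_simps)
qed
define l where "l u X w = 1/2 * (A X u w + A u X w - A w u X - C (N X) u w - C (N u) X w + C (N w) u X)" for u X w
have CN: "linear (%w. C (N w) u X)" for u X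
 using linear_compose[OF Nlin C(1)] by (simp add: o_def)
have linl: "linear (l u X)" "linear (%u. l u X w)" for u X w
 unfolding l_def by (intro linear_compose_sub linear_compose_add sc A A3 C C2 C3 CN)+
define Ga where "Ga u X = R (l u X)" for u X
have gGa: "g (Ga u X) w = l u X w" for u X w unfolding Ga_def by (rule R[OF linl(1)])
show ?thesis
proof
 show "linear (%u. Ga u v)" for v
  by (rule linearI; rule ginj)
    (simp_all add: gGa linear_add[OF g(1)] linear_cmul[OF g(1)] linear_add[OF linl(2)] linear_cmul[OF linl(2)])
 show "Ga u v = Ga v u" for u v
  by (rule ginj) (simp add: gGa l_def A(3)[of _ u v] C(2)[of _ u v])
 show "A X u w - g (Ga u X) w - g u (Ga w X) = C (Ga y X) u w" for X u w
 proof -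
  have "Ga y X = N X"
   by (rule ginj) (simp add: gGa gN l_def lN_def Ny C0 C(4) A(3)[of _ y X])
  moreover have "g (Ga u X) w + g u (Ga w X) = A X u w - C (N X) u w"
   unfolding g(4)[of u] gGa l_def
   using A(3)[of X w u] A(3)[of w X u] A(3)[of u X w] C(2)[of "N X" w u] C(2)[of "N u" w X] C(2)[of "N w" X u]
   by (simp add: algebra_simps)
  ultimately show ?thesis by simp
 qed
qed
qed

section \<open>Connection coefficients as bilinear maps\<close>

lemma pd_y_eq_fd: "f differentiable (at z) ==> pd_y i f z = fd f z (0, axis i 1)"
unfolding pd_y_def by (rule dird_eq_fd)

lemma linear_Pair0: "linear f ==> linear (%u. f (0, u))" "linear f ==> linear (%u. f (u, 0))"
for f :: "'a::real_vector \<times> 'b::real_vector => 'c::real_vector"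
by (auto intro!: linearI simp: linear_add[of f, symmetric] linear_cmul[of f, symmetric])

definition Gam :: "('n::finite => 'n => 'n => real) => real ^ 'n => real ^ 'n => real ^ 'n" where
"Gam G u v = (\<chi> i. \<Sum>j\<in>UNIV. \<Sum>k\<in>UNIV. G i j k * u $ j * v $ k)"

lemma linear_Gam: "linear (%u. Gam G u v)" "linear (Gam G u)"
by (auto intro!: linearI simp: Gam_def vec_eq_iff sum_distrib_left algebra_simps sum.distrib)

lemma sum_axis: "(\<Sum>j\<in>UNIV. f j * axis i (1::real) $ j) = f (i::'n::finite)"
by (simp add: axis_def if_distrib[of "(*) _"] sum.delta cong: if_cong)

lemma Gam_axis: "Gam G (axis j 1) v = (\<chi> i. \<Sum>k\<in>UNIV. G i j k * v $ k)" "Gam G (axis j 1) (axis k 1) = (\<chi> i. G i j k)"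
proof -
show 1: "Gam G (axis j 1) v = (\<chi> i. \<Sum>k\<in>UNIV. G i j k * v $ k)" for v
proof -
 have "(\<Sum>a\<in>UNIV. \<Sum>k\<in>UNIV. G i a k * axis j 1 $ a * v $ k) = (\<Sum>a\<in>UNIV. (\<Sum>k\<in>UNIV. G i a k * v $ k) * axis j 1 $ a)" for i
  by (simp add: sum_distrib_left mult_ac)
 thus ?thesis by (simp add: Gam_def sum_axis)
qed
show "Gam G (axis j 1) (axis k 1) = (\<chi> i. G i j k)" unfolding 1 by (simp add: sum_axis)
qed

lemma nonlin_of_eq: "nonlin_of G z k l = Gam G (axis l 1) (snd z) $ k"
by (simp add: nonlin_of_def Gam_axis)

section \<open>Finsler geometry in one chart\<close>

text \<open>Euler's relations for functions positively homogeneous of degree \<open>m\<close> in the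
  fibre. The first carries a factor \<open>t\<close> on the left, so that no truncated exponent
  \<open>m - 1\<close> appears when \<open>m = 0\<close>.\<close>

lemma fd_homogeneous:
fixes f :: "'n::finite tpoint => real"
assumes "!!t. 0 < t ==> f differentiable (at (x, t *R y))"
 and "open V" "y \<in> V" "!!t w. 0 < t ==> w \<in> V ==> f (x, t *R w) = t ^ m * f (x, w)"
shows "0 < t ==> t * fd f (x, t *R y) (0, w) = t ^ m * fd f (x, y) (0, w)"
 and "fd f (x, y) (0, y) = m * f (x, y)"
proof -
assume t: "0 < t"
have 1: "((%w. (x, t *R w)) hfd (%h. (0, t *R h))) (at y)" for t
 by (auto intro!: derivative_eq_intros)
have 2: "((%w. f (x, t *R w)) hfd (%h. fd f (x, t *R y) (0, t *R h))) (at y)" if "0 < t" for t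
 using diff_chain_at[OF 1 fd_works[OF assms(1)[OF that]]] by (simp add: o_def)
have 3: "((%w. t ^ m * f (x, w)) hfd (%h. t ^ m * fd f (x, y) (0, h))) (at y)"
 using has_derivative_mult_right[OF 2[of 1], of "t ^ m"] by simp
have 4: "((%w. t ^ m * f (x, w)) hfd (%h. fd f (x, t *R y) (0, t *R h))) (at y)"
 by (rule htw_open[OF 2[OF t] assms(2,3)]) (use assms(4) t in auto)
have "fd f (x, t *R y) (0, t *R w) = t ^ m * fd f (x, y) (0, w)"
 using fun_cong[OF has_derivative_unique[OF 3 4], of w] by simp
moreover have "(0, t *R w) = t *R (0, w)" by simp
ultimately show "t * fd f (x, t *R y) (0, w) = t ^ m * fd f (x, y) (0, w)"
 using linear_cmul[OF fd_linear[OF assms(1)[OF t]]] by (metis real_scaleR_def)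
next
have 1: "((%t. (x, t *R y)) hfd (%h. (0, h *R y))) (at (1::real))"
 by (auto intro!: derivative_eq_intros)
have d: "f differentiable (at (x, 1 *R y))" by (rule assms(1)) simp
have 2: "((%t. f (x, t *R y)) hfd (%h. fd f (x, y) (0, h *R y))) (at 1)"
 using diff_chain_at[OF 1 fd_works[OF d]] by (simp add: o_def)
have "((%t. t ^ m * f (x, y)) hrd m * f (x, y)) (at 1)"
 by (auto intro!: derivative_eq_intros)
hence "((%t. t ^ m * f (x, y)) hfd (%h. m * f (x, y) * h)) (at 1)"
 by (simp add: has_field_derivative_def)
from htw_open[OF this, of "{0<..}" "%t. f (x, t *R y)"]
have 3: "((%t. f (x, t *R y)) hfd (%h. m * f (x, y) * h)) (at 1)"
 using assms(3,4) by auto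
show "fd f (x, y) (0, y) = m * f (x, y)"
 using fun_cong[OF has_derivative_unique[OF 2 3], of 1] by simp
qed

lemma Gam_commute:
assumes "ALL i j k. C i j k = C i k j" shows "Gam C u v = Gam C v u"
proof -
have "Gam C u v $ i = Gam C v u $ i" for i
proof -
 have e: "C i j k * u $ j * v $ k = C i k j * v $ k * u $ j" for j k
  by (subst assms[rule_format, of i j k]) (simp add: mult_ac)
 have "Gam C u v $ i = (\<Sum>j\<in>UNIV. \<Sum>k\<in>UNIV. C i k j * v $ k * u $ j)"
  unfolding Gam_def by (simp only: vec_lambda_beta e)
 also have "... = (\<Sum>k\<in>UNIV. \<Sum>j\<in>UNIV. C i k j * v $ k * u $ j)" by (rule sum.swap)
 finally show ?thesis unfolding Gam_def by simp
qed
thus ?thesis by (simp add: vec_eq_iff)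
qed

locale cmetric =
fixes L :: "'n::finite lmetric" and U :: "(real ^ 'n) set"
assumes openU: "open U"
 and smoothL: "smooth_on (U \<times> (UNIV - {0})) L"
 and homL: "x \<in> U ==> 0 < t ==> L (x, t *R y) = t * L (x, y)"
 and nonnegL: "x \<in> U ==> 0 <= L (x, y)"
 and posdef: "x \<in> U ==> y ~= 0 ==> v ~= 0 ==> 0 < fund_form L (x, y) v v"
begin

abbreviation S :: "'n tpoint set" where "S \<equiv> U \<times> (UNIV - {0})"

text \<open>\<open>Q\<close> is the squared norm, and \<open>Q1\<close>, \<open>Q2\<close>,
  \<open>Q3\<close> are its successive derivatives along tangent vectors
  \<open>(\<xi>, \<eta>)\<close> of the coordinate domain in \<open>TM\<close>, so that base and
  fibre directions are handled together. \<open>DG z X\<close> is the derivative of the fundamental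
  tensor along \<open>X\<close>; on fibre directions it is the tensor \<open>2 A / F\<close> of the
  Chern connection.\<close>

definition Q where "Q z = (L z)^2"
definition Q1 where "Q1 h z = fd Q z h"
definition Q2 where "Q2 h k z = fd (Q1 h) z k"
definition Q3 where "Q3 h k l z = fd (Q2 h k) z l"
definition G where "G z u w = 1/2 * Q2 (0, u) (0, w) z"
definition DG where "DG z X u w = 1/2 * Q3 (0, u) (0, w) X z"

lemma openS: "open S"
by (rule open_Times[OF openU open_delete[OF open_UNIV]])

lemma smoothQ: "smooth_on S Q"
unfolding Q_def power2_eq_square by (intro smooth_on_mult openS smoothL)

lemma smoothQ1: "smooth_on S (Q1 h)"
unfolding Q1_def by (rule smooth_on_fd[OF smoothQ])

lemma smoothQ2: "smooth_on S (Q2 h k)"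
unfolding Q2_def by (rule smooth_on_fd[OF smoothQ1])

lemma diff_Q: "z \<in> S ==> Q differentiable (at z)" "z \<in> S ==> Q1 h differentiable (at z)"
 "z \<in> S ==> Q2 h k differentiable (at z)"
using smooth_on_hfd smoothQ smoothQ1 smoothQ2 unfolding differentiable_def by blast+

lemma Q2_sym: "z \<in> S ==> Q2 h k z = Q2 k h z"
unfolding Q2_def Q1_def by (rule fd_fd_commute[OF openS _ smooth_onD[OF smoothQ]])

lemma Q3_sym: assumes "z \<in> S" shows "Q3 h k l z = Q3 h l k z" "Q3 h k l z = Q3 k h l z"
proof -
show "Q3 h k l z = Q3 h l k z"
 unfolding Q3_def Q2_def by (rule fd_fd_commute[OF openS assms smooth_onD[OF smoothQ1]])
show "Q3 h k l z = Q3 k h l z"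
 unfolding Q3_def by (subst fd_cong_open(1)[OF openS assms Q2_sym]) simp_all
qed

lemma linear_Q1: "z \<in> S ==> linear (%h. Q1 h z)"
unfolding Q1_def by (rule fd_linear[OF diff_Q(1)])

lemma linear_Q2: assumes "z \<in> S" shows "linear (%k. Q2 h k z)" "linear (%h. Q2 h k z)"
proof -
show 1: "linear (%k. Q2 h k z)" for h
 unfolding Q2_def by (rule fd_linear[OF diff_Q(2)[OF assms]])
show "linear (%h. Q2 h k z)"
proof -
 have "(%h. Q2 h k z) = (%h. Q2 k h z)" by (rule ext) (rule Q2_sym[OF assms])
 thus ?thesis using 1[of k] by simp
qed
qed

lemma linear_Q3: assumes "z \<in> S"
shows "linear (%l. Q3 h k l z)" "linear (%k. Q3 h k l z)" "linear (%h. Q3 h k l z)"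
proof -
show 1: "linear (%l. Q3 h k l z)" for h k
 unfolding Q3_def by (rule fd_linear[OF diff_Q(3)[OF assms]])
show 2: "linear (%k. Q3 h k l z)" for h l
proof -
 have "(%k. Q3 h k l z) = (%k. Q3 h l k z)" by (rule ext) (rule Q3_sym(1)[OF assms])
 thus ?thesis using 1[of h l] by simp
qed
have "(%h. Q3 h k l z) = (%h. Q3 k h l z)" by (rule ext) (rule Q3_sym(2)[OF assms])
thus "linear (%h. Q3 h k l z)" using 2[of k l] by simp
qed

lemma linear_half: "linear f ==> linear (%x. 1/2 * f x)" for f :: "'c::real_vector => real"
using linear_compose_scale_right[of f "1/2"] by simp

lemma lin_G: assumes "z \<in> S" shows "linear (G z u)" "linear (%u. G z u w)"
unfolding G_def by (rule linear_half linear_Pair0 linear_Q2[OF assms])+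

lemma linear_DG: assumes "z \<in> S"
shows "linear (%X. DG z X u w)" "linear (%u. DG z X u w)" "linear (DG z X u)"
unfolding DG_def
by (rule linear_half linear_Q3[OF assms] linear_Pair0(1)[OF linear_Q3(2)[OF assms]]
  linear_Pair0(1)[OF linear_Q3(3)[OF assms]])+

lemma G_sym: "z \<in> S ==> G z u w = G z w u"
unfolding G_def by (simp add: Q2_sym)

lemma DG_sym: "z \<in> S ==> DG z X u w = DG z X w u" "z \<in> S ==> DG z (0, v) u w = DG z (0, u) v w"
unfolding DG_def using Q3_sym by metis+

lemma G_smooth: "smooth_on S (%z. G z u w)"
proof -
have "Ck_on m S (%z. G z u w)" for m
 unfolding G_def by (intro Ck_on_mult Ck_on_const openS smooth_onD[OF smoothQ2])
thus ?thesis by (simp add: smooth_on_def)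
qed

lemma G_has_derivative: "z \<in> S ==> ((%z. G z u w) hfd (%X. DG z X u w)) (at z)"
unfolding G_def DG_def Q3_def
by (rule has_derivative_mult_right[OF fd_works[OF diff_Q(3)]])

lemma fund_eq: "z \<in> S ==> fund L i j z = G z (axis j 1) (axis i 1)"
proof -
assume z: "z \<in> S"
have "pd_y j (%w. (L w)^2) z = Q1 (0, axis j 1) z" if "z \<in> S" for z
 using pd_y_eq_fd[OF diff_Q(1)[OF that]] unfolding Q1_def Q_def by simp
hence "fd (pd_y j (%w. (L w)^2)) z = fd (Q1 (0, axis j 1)) z"
 "pd_y j (%w. (L w)^2) differentiable (at z) \<longleftrightarrow> Q1 (0, axis j 1) differentiable (at z)"
 using fd_cong_open[OF openS z, of "pd_y j (%w. (L w)^2)"] by blast+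
thus ?thesis using diff_Q(2)[OF z]
 by (simp add: fund_def pd_y_eq_fd G_def Q2_def)
qed

lemma fund_form_eq: "z \<in> S ==> fund_form L z u w = G z u w"
proof -
assume z: "z \<in> S"
have "G z u w = (\<Sum>i\<in>UNIV. u $ i * G z (axis i 1) w)" for w
 using lin_axis[OF lin_G(2)[OF z], where u=u] by simp
moreover have "G z u w = (\<Sum>j\<in>UNIV. w $ j * G z u (axis j 1))" for u
 using lin_axis[OF lin_G(1)[OF z], where u=w] by simp
ultimately have "G z u w = (\<Sum>i\<in>UNIV. u $ i * (\<Sum>j\<in>UNIV. w $ j * G z (axis i 1) (axis j 1)))"
 by (metis (no_types, lifting) sum.cong)
thus ?thesis
 by (simp add: fund_form_def fund_eq[OF z] sum_distrib_left mult_ac G_sym[OF z, of "axis j 1" "axis i 1" for i j])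
qed

lemma cartan_eq: "z \<in> S ==> cartan L i j k z = L z / 2 * DG z (0, axis k 1) (axis i 1) (axis j 1)"
proof -
assume z: "z \<in> S"
let ?f = "%k. pd_y k (%w. (L w)^2)"
have 1: "?f k z = Q1 (0, axis k 1) z" if "z \<in> S" for k z
 using pd_y_eq_fd[OF diff_Q(1)[OF that]] unfolding Q1_def Q_def by simp
have 2: "pd_y j (?f k) z = Q2 (0, axis k 1) (0, axis j 1) z" if "z \<in> S" for z
 using fd_cong_open[OF openS that, OF 1[of _ k]] diff_Q(2)[OF that]
 by (simp add: pd_y_eq_fd Q2_def)
have 3: "pd_y i (pd_y j (?f k)) z = Q3 (0, axis k 1) (0, axis j 1) (0, axis i 1) z"
 using fd_cong_open[OF openS z, OF 2] diff_Q(3)[OF z]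
 by (simp add: pd_y_eq_fd Q3_def)
show ?thesis unfolding cartan_def 3 DG_def using Q3_sym[OF z] by simp
qed

lemma L_scale: "x \<in> U ==> 0 < t ==> Q (x, t *R y) = t^2 * Q (x, y)"
by (simp add: Q_def homL power_mult_distrib)

lemma slit: "open (UNIV - {0::real ^ 'n})" by (intro open_delete open_UNIV)

lemma Q1_scale: "(x, y) \<in> S ==> 0 < t ==> Q1 (0, w) (x, t *R y) = t * Q1 (0, w) (x, y)"
and Euler1: "(x, y) \<in> S ==> Q1 (0, y) (x, y) = 2 * Q (x, y)"
proof -
assume z: "(x, y) \<in> S"
have d: "Q differentiable (at (x, t *R y))" if "0 < t" for t using z that by (intro diff_Q) auto
have h: "Q (x, t *R w) = t ^ 2 * Q (x, w)" if "0 < t" for t w using z that L_scale by auto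
show "Q1 (0, w) (x, t *R y) = t * Q1 (0, w) (x, y)" if "0 < t"
 using fd_homogeneous(1)[OF d slit _ h that] z that by (simp add: Q1_def power2_eq_square)
show "Q1 (0, y) (x, y) = 2 * Q (x, y)"
 using fd_homogeneous(2)[OF d slit _ h] z by (simp add: Q1_def)
qed

lemma G_scale: "(x, y) \<in> S ==> 0 < t ==> G (x, t *R y) u w = G (x, y) u w"
and Euler2: "(x, y) \<in> S ==> Q2 (0, w) (0, y) (x, y) = Q1 (0, w) (x, y)"
proof -
assume z: "(x, y) \<in> S"
have d: "Q1 (0, w) differentiable (at (x, t *R y))" if "0 < t" for t w using z that by (intro diff_Q) auto
have h: "Q1 (0, u) (x, t *R w) = t ^ 1 * Q1 (0, u) (x, w)" if "0 < t" "w \<in> UNIV - {0}" for t u w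
 using z that Q1_scale by auto
show "G (x, t *R y) u w = G (x, y) u w" if "0 < t"
 using fd_homogeneous(1)[OF d slit _ h that] z that by (simp add: G_def Q2_def)
show "Q2 (0, w) (0, y) (x, y) = Q1 (0, w) (x, y)"
 using fd_homogeneous(2)[OF d slit _ h] z by (simp add: Q2_def)
qed

lemma G_y: "(x, y) \<in> S ==> G (x, y) y w = 1/2 * Q1 (0, w) (x, y)"
"(x, y) \<in> S ==> G (x, y) y y = Q (x, y)"
using Euler2[of x y w] Euler2[of x y y] Euler1[of x y] Q2_sym[of "(x, y)" "(0, y)" "(0, w)"] by (auto simp: G_def)

text \<open>The first identity is homogeneity of degree 0 of \<open>g\<close> together with the
  total symmetry of the vertical third derivative. The other two arise by differentiating the Euler
  identities along the base with \<open>y\<close> held fixed.\<close>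

lemma DG_y: assumes "(x, y) \<in> S" shows "DG (x, y) (0, v) y w = 0" "DG (x, y) (X, 0) y w = 1/2 * Q2 (0, w) (X, 0) (x, y)"
 "DG (x, y) (X, 0) y y = Q1 (X, 0) (x, y)"
proof -
have d: "(%z. G z v w) differentiable (at (x, t *R y))" if "0 < t" for t v w
 unfolding differentiable_def using G_has_derivative[of "(x, t *R y)"] assms that by auto
have h: "G (x, t *R a) v w = t ^ 0 * G (x, a) v w" if "0 < t" "a \<in> UNIV - {0}" for t a v w
 using assms that G_scale by auto
have "DG (x, y) (0, y) v w = 0"
 using fd_homogeneous(2)[OF d slit _ h] assms fd_eqI[OF G_has_derivative[OF assms]] by simp
thus "DG (x, y) (0, v) y w = 0" using DG_sym(2)[OF assms] by metis
have 1: "((%xi. (xi, y)) hfd (%X. (X, 0))) (at x)"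
 by (auto intro!: derivative_eq_intros)
have a: "((%xi. Q2 (0, w) (0, y) (xi, y)) hfd (%X. Q3 (0, w) (0, y) (X, 0) (x, y))) (at x)" for w
 using diff_chain_at[OF 1 fd_works[OF diff_Q(3)[OF assms]]] by (simp add: o_def Q3_def)
have b: "((%xi. Q1 (0, w) (xi, y)) hfd (%X. Q2 (0, w) (X, 0) (x, y))) (at x)" for w
 using diff_chain_at[OF 1 fd_works[OF diff_Q(2)[OF assms]]] by (simp add: o_def Q2_def)
have c: "((%xi. Q2 (0, w) (0, y) (xi, y)) hfd (%X. Q2 (0, w) (X, 0) (x, y))) (at x)" for w
 by (rule htw_open[OF b openU]) (use assms Euler2 in auto)
have e: "Q3 (0, w) (0, y) (X, 0) (x, y) = Q2 (0, w) (X, 0) (x, y)" for w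
 using has_derivative_unique[OF a c] by metis
thus "DG (x, y) (X, 0) y w = 1/2 * Q2 (0, w) (X, 0) (x, y)"
 unfolding DG_def using Q3_sym[OF assms] by metis
have "((%xi. Q (xi, y)) hfd (%X. Q1 (X, 0) (x, y))) (at x)"
 using diff_chain_at[OF 1 fd_works[OF diff_Q(1)[OF assms]]] by (simp add: o_def Q1_def)
hence f: "((%xi. 2 * Q (xi, y)) hfd (%X. 2 * Q1 (X, 0) (x, y))) (at x)"
 by (rule has_derivative_mult_right)
have "((%xi. 2 * Q (xi, y)) hfd (%X. Q2 (0, y) (X, 0) (x, y))) (at x)"
 by (rule htw_open[OF b openU]) (use assms Euler1 in auto)
from has_derivative_unique[OF f this] have "Q2 (0, y) (X, 0) (x, y) = 2 * Q1 (X, 0) (x, y)" by metis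
thus "DG (x, y) (X, 0) y y = Q1 (X, 0) (x, y)" using e[of y] by (simp add: DG_def)
qed

lemma G_pos: "(x, y) \<in> S ==> v ~= 0 ==> 0 < G (x, y) v v"
using posdef[of x y v] fund_form_eq[of "(x, y)"] by auto

lemma L_pos: "x \<in> U ==> y ~= 0 ==> 0 < L (x, y)"
using G_pos[of x y y] G_y(2)[of x y] nonnegL[of x y] by (auto simp: Q_def less_le)

lemma L_zero: "x \<in> U ==> L (x, 0) = 0"
using homL[of x 2 0] by simp

subsection \<open>The Chern connection\<close>

text \<open>Replaces the conditions on indices by identities between multilinear maps, the form in
  which the Koszul lemmas apply.\<close>

lemma is_chern_iff:
assumes z: "z \<in> S"
shows "is_chern L z C \<longleftrightarrow> (ALL i j k. C i j k = C i k j) &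
 (ALL X u w. DG z X u w - G z (Gam C u (fst X)) w - G z u (Gam C w (fst X))
   = DG z (0, snd X + Gam C (snd z) (fst X)) u w)"
proof -
obtain x y where xy: "z = (x, y)" by (cases z)
define Lh where "Lh X u w = DG z X u w - G z (Gam C u (fst X)) w - G z u (Gam C w (fst X))" for X u w
define Rh where "Rh X u w = DG z (0, snd X + Gam C (snd z) (fst X)) u w" for X u w
have cG: "linear (%u. G z (Gam C u v) w)" "linear (%w. G z u (Gam C w v))" for u v w
 using linear_compose[OF linear_Gam(1) lin_G(2)[OF z]] linear_compose[OF linear_Gam(1) lin_G(1)[OF z]]
 by (auto simp: o_def)
have linL: "linear (%u. Lh X u w)" "linear (Lh X u)" for X u w
 unfolding Lh_def by (intro linear_compose_sub linear_DG lin_G z cG)+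
have linR: "linear (%u. Rh X u w)" "linear (Rh X u)" for X u w
 unfolding Rh_def by (intro linear_DG z)+
have dG: "dird (fund L i j) z X = DG z X (axis i 1) (axis j 1)" for i j X
proof -
 have e: "fund L i j w = G w (axis i 1) (axis j 1)" if "w \<in> S" for w
  using fund_eq[OF that] G_sym[OF that] by simp
 have "(%z. G z (axis i 1) (axis j 1)) differentiable (at z)"
  using G_has_derivative[OF z] unfolding differentiable_def by blast
 thus ?thesis
  using fd_cong_open[OF openS z, OF e] fd_eqI[OF G_has_derivative[OF z]] by (simp add: dird_eq_fd)
qed
have gl: "(\<Sum>k\<in>UNIV. fund L k j z * conn_of C k i X) = G z (Gam C (axis i 1) (fst X)) (axis j 1)" for i j X
 using lin_axis[OF lin_G(2)[OF z], where u = "Gam C (axis i 1) (fst X)"]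
 by (simp add: Gam_axis conn_of_def fund_eq[OF z] mult_ac G_sym[OF z, of "axis j 1"])
have gr: "(\<Sum>k\<in>UNIV. fund L i k z * conn_of C k j X) = G z (axis i 1) (Gam C (axis j 1) (fst X))" for i j X
 using lin_axis[OF lin_G(1)[OF z], where u = "Gam C (axis j 1) (fst X)"]
 by (simp add: Gam_axis conn_of_def fund_eq[OF z] mult_ac G_sym[OF z, of "axis i 1"])
\<comment> \<open>Symmetry of the coefficients enters here: \<open>nonlin_of\<close> contracts
  \<open>y\<close> with the last lower index, \<open>Gam C (snd z)\<close> with the first
  one.\<close>
have cr: "(\<Sum>k\<in>UNIV. 2 * cartan L i j k z / L z * (snd X $ k + (\<Sum>l\<in>UNIV. nonlin_of C z k l * fst X $ l)))
  = Rh X (axis i 1) (axis j 1)" if sym: "ALL i j k. C i j k = C i k j" for i j X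
proof -
 have "(\<Sum>l\<in>UNIV. nonlin_of C z k l * fst X $ l) = Gam C (snd z) (fst X) $ k" for k
 proof -
  have "Gam C (snd z) (fst X) = Gam C (fst X) (snd z)"
   by (rule Gam_commute[OF sym])
  also have "... = (\<Sum>l\<in>UNIV. (fst X $ l) *R Gam C (axis l 1) (snd z))"
   by (rule lin_axis[OF linear_Gam(1)])
  finally show ?thesis by (simp add: nonlin_of_eq mult_ac)
 qed
 moreover have "L z ~= 0" using L_pos z xy by force
 ultimately show ?thesis
  using lin_axis[OF linear_Pair0(1)[OF linear_DG(1)[OF z, where u="axis i 1" and w="axis j 1"]],
    where u = "snd X + Gam C (snd z) (fst X)"]
  by (simp add: Rh_def cartan_eq[OF z] mult_ac)
qed
have "(ALL i j X. Lh X (axis i 1) (axis j 1) = Rh X (axis i 1) (axis j 1)) \<longleftrightarrow> (ALL X u w. Lh X u w = Rh X u w)"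
proof
 assume a: "ALL i j X. Lh X (axis i 1) (axis j 1) = Rh X (axis i 1) (axis j 1)"
 have b: "Lh X (axis i 1) w = Rh X (axis i 1) w" for X i w
  by (rule linear_ext_axis[OF linL(2) linR(2)]) (rule a[rule_format])
 have "Lh X u w = Rh X u w" for X u w by (rule linear_ext_axis[OF linL(1) linR(1)]) (rule b)
 thus "ALL X u w. Lh X u w = Rh X u w" by blast
qed simp
thus ?thesis
 unfolding is_chern_def dG gl gr using cr unfolding Lh_def[symmetric] Rh_def[symmetric] by auto
qed

lemma DG_split: "z \<in> S ==> DG z (X, v) u w = DG z (X, 0) u w + DG z (0, v) u w"
using linear_add[OF linear_DG(1), where ?b1.0 = "(X, 0)" and ?b2.0 = "(0, v)"] by fastforce

text \<open>The vertical part of the compatibility condition holds identically, as both sides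
  contain the same Cartan term. What remains concerns base directions and is the Koszul situation,
  with the base derivative of \<open>g\<close> as \<open>A\<close> and its fibre derivative as
  \<open>C\<close>.\<close>

lemma chern_ex1: assumes z: "(x, y) \<in> S" shows "\<exists>!C. is_chern L (x, y) C"
proof -
let ?z = "(x, y)"
note lin = lin_G[OF z] linear_DG[OF z]
have pos: "!!v. v ~= 0 ==> 0 < G ?z v v" using G_pos[OF z] .
have C0: "DG ?z (0, v) y w = 0" for v w using DG_y(1)[OF z] .
obtain Ga where Ga: "!!v. linear (%u. Ga u v)" "!!u v. Ga u v = Ga v u"
 "!!X u w. DG ?z (X, 0) u w - G ?z (Ga u X) w - G ?z u (Ga w X) = DG ?z (0, Ga y X) u w"
 using koszul_exists[of "G ?z" "%X. DG ?z (X, 0)" "%v. DG ?z (0, v)" y, OF lin(2) lin(1) pos G_sym[OF z]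
  linear_Pair0(2)[OF lin(3)] lin(4) DG_sym(1)[OF z] linear_Pair0(1)[OF lin(3)] DG_sym(1)[OF z] DG_sym(2)[OF z] C0]
 by blast
define C where "C i j k = Ga (axis j 1) (axis k 1) $ i" for i j k
have GamC: "Gam C u v = Ga u v" for u v
proof -
 have l2: "linear (Ga u)" for u using Ga(1)[of u] unfolding Ga(2)[of _ u] .
 have "Gam C (axis j 1) v = Ga (axis j 1) v" for j v
  by (rule linear_ext_axis[OF linear_Gam(2) l2]) (simp add: Gam_axis(2) C_def)
 thus ?thesis by (rule linear_ext_axis[OF linear_Gam(1) Ga(1)])
qed
have eqv: "(ALL X u w. DG ?z X u w - G ?z (Gam C u (fst X)) w - G ?z u (Gam C w (fst X))
   = DG ?z (0, snd X + Gam C (snd ?z) (fst X)) u w) \<longleftrightarrow>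
  (ALL X u w. DG ?z (X, 0) u w - G ?z (Gam C u X) w - G ?z u (Gam C w X) = DG ?z (0, Gam C y X) u w)" for C
proof -
 have "DG ?z X u w - p - q = DG ?z (0, snd X + v) u w \<longleftrightarrow> DG ?z (fst X, 0) u w - p - q = DG ?z (0, v) u w"
  for X u w v p q
  using DG_split[OF z, of "fst X" "snd X" u w] linear_add[OF linear_Pair0(1)[OF lin(3)], of "snd X" v u w]
  by auto
 thus ?thesis by (metis fst_conv snd_conv)
qed
have ex: "is_chern L ?z C"
 unfolding is_chern_iff[OF z] eqv using Ga(3) GamC Ga(2) by (auto simp: C_def)
have "C' = C" if a: "is_chern L ?z C'" for C'
proof -
 note b = a[unfolded is_chern_iff[OF z] eqv] and c = ex[unfolded is_chern_iff[OF z] eqv]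
 have "Gam C' u v = Gam C u v" for u v
  by (rule koszul_unique[of "G ?z" "%v. DG ?z (0, v)" y "Gam C'" "Gam C" "%X. DG ?z (X, 0)", OF lin(2) lin(1) pos
   G_sym[OF z] linear_Pair0(1)[OF lin(3)] DG_sym(1)[OF z] C0 Gam_commute[OF conjunct1[OF b]]
   Gam_commute[OF conjunct1[OF c]] conjunct2[OF b, rule_format] conjunct2[OF c, rule_format]])
 from this[of "axis j 1" "axis k 1" for j k] show ?thesis
  unfolding Gam_axis(2) by (auto simp: fun_eq_iff vec_eq_iff)
qed
with ex show ?thesis by blast
qed

definition Ga where "Ga z = Gam (chern L z)"

lemma Ga_lin: "linear (%u. Ga z u v)" "linear (Ga z u)"
unfolding Ga_def by (rule linear_Gam)+

lemma chern_is: "z \<in> S ==> is_chern L z (chern L z)"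
unfolding chern_def using theI'[OF chern_ex1] by (cases z) auto

lemma chern_sym: "z \<in> S ==> chern L z i j k = chern L z i k j"
using chern_is is_chern_iff by blast

lemma Ga_sym: "z \<in> S ==> Ga z u v = Ga z v u"
unfolding Ga_def by (rule Gam_commute) (simp add: chern_sym)

lemma metric_derivative:
"z \<in> S ==> DG z X u w = G z (Ga z u (fst X)) w + G z u (Ga z w (fst X)) + DG z (0, snd X + Ga z (snd z) (fst X)) u w"
using chern_is[of z] is_chern_iff[of z] unfolding Ga_def by (smt (verit))

text \<open>The derivative of \<open>F^2\<close> vanishes on horizontal vectors
  \<open>(X, - Ga (x, y) y X)\<close>; in other words, parallel transport preserves
  \<open>F\<close>.\<close>

lemma Q_horizontal: "(x, y) \<in> S ==> Q1 (X, 0) (x, y) = Q1 (0, Ga (x, y) y X) (x, y)"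
using metric_derivative[of "(x, y)" "(X, 0)" y y] DG_y(1)[of x y _ y] DG_y(3)[of x y X]
 G_y(1)[of x y "Ga (x, y) y X"] G_sym[of "(x, y)" y] by simp

text \<open>On the diagonal the connection is expressed by derivatives of \<open>F^2\<close> alone.
  This makes its behaviour under a change of charts accessible.\<close>

lemma spray: "(x, y) \<in> S ==> 2 * G (x, y) (Ga (x, y) y y) w = Q2 (0, w) (y, 0) (x, y) - Q1 (w, 0) (x, y)"
using metric_derivative[of "(x, y)" "(y, 0)" y w] metric_derivative[of "(x, y)" "(w, 0)" y y]
 DG_y(1)[of x y] DG_y(2)[of x y y w] DG_y(3)[of x y w]
 G_sym[of "(x, y)" y] Ga_sym[of "(x, y)" w y] by simp

end

section \<open>Smooth dependence of the connection on the point\<close>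

lemma smooth_on_const: "open S ==> smooth_on S (%x. c)"
by (simp add: smooth_on_def Ck_on_const)

lemma smooth_on_add: "open S ==> smooth_on S f ==> smooth_on S g ==> smooth_on S (%x. f x + g x)"
by (simp add: smooth_on_def Ck_on_add)

lemma smooth_on_sum: "open S ==> (!!i. i \<in> I ==> smooth_on S (f i)) ==> smooth_on S (%x. \<Sum>i\<in>I. f i x)"
by (simp add: smooth_on_def Ck_on_sum)

lemma smooth_on_prod:
fixes f :: "'i => 'a::real_normed_vector => real"
shows "open S ==> (!!i. i \<in> I ==> smooth_on S (f i)) ==> smooth_on S (%x. \<Prod>i\<in>I. f i x)"
by (simp add: smooth_on_def Ck_on_prod)

lemma smooth_on_inverse:
fixes f :: "'a::real_normed_vector => real"
shows "open S ==> (!!x. x \<in> S ==> f x ~= 0) ==> smooth_on S f ==> smooth_on S (%x. inverse (f x))"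
by (simp add: smooth_on_def Ck_on_inverse)

lemma smooth_on_linear: "open S ==> bounded_linear h ==> smooth_on S h"
by (simp add: smooth_on_def Ck_on_bounded_linear)

lemma smooth_on_cong: "open S ==> smooth_on S f ==> (!!x. x \<in> S ==> f x = g x) ==> smooth_on S g"
unfolding smooth_on_def using Ck_on_cong by metis

lemma smooth_on_vec:
fixes f :: "'a::real_normed_vector => real ^ 'n::finite"
assumes "open S" "!!i. smooth_on S (%x. f x $ i)" shows "smooth_on S f"
proof -
have bl: "bounded_linear (%c. c *R axis i (1::real) :: real ^ 'n)" for i by (rule bounded_linear_scaleR_left)
have "Ck_on m S (%x. \<Sum>i\<in>UNIV. (f x $ i) *R axis i (1::real))" for m
 by (intro Ck_on_sum assms(1) Ck_on_compose_linear[OF assms(1) bl] smooth_onD[OF assms(2)])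
moreover have "(%x. \<Sum>i\<in>UNIV. (f x $ i) *R axis i (1::real)) = f"
 by (rule ext) (rule lin_axis[OF linear_ident, symmetric])
ultimately show ?thesis unfolding smooth_on_def by simp
qed

lemma smooth_on_component:
fixes f :: "'a::real_normed_vector => real ^ 'n::finite"
assumes "open S" "smooth_on S f" shows "smooth_on S (%x. f x $ i)"
unfolding smooth_on_def using Ck_on_compose_linear[OF assms(1) bounded_linear_vec_nth smooth_onD[OF assms(2)]] by blast

lemma smooth_on_det:
fixes A :: "'a::real_normed_vector => real ^ 'n::finite ^ 'n"
assumes "open S" "!!i j. smooth_on S (%x. A x $ i $ j)" shows "smooth_on S (%x. det (A x))"
unfolding det_def by (intro smooth_on_sum smooth_on_mult smooth_on_prod smooth_on_const assms)

text \<open>In coordinates \<open>v\<close> solves a linear system with smooth coefficients, and by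
  Cramer's rule its components are quotients of determinants.\<close>

lemma smooth_on_riesz:
fixes v :: "'a::real_normed_vector => real ^ 'n::finite"
assumes S: "open S"
 and g: "!!z. z \<in> S ==> linear (%v. g z v w)" "!!z v. z \<in> S ==> linear (g z v)"
   "!!z v. z \<in> S ==> v ~= 0 ==> 0 < (g z v v :: real)" "!!u w. smooth_on S (%z. g z u w)"
 and glin: "!!z w. z \<in> S ==> linear (%v. g z v w)"
 and l: "!!w. smooth_on S (%z. l z w)" "!!z w. z \<in> S ==> g z (v z) w = l z w"
shows "smooth_on S v"
proof (rule smooth_on_vec[OF S])
fix k
define A where "A z = (\<chi> i j. g z (axis j 1) (axis i 1))" for z
define b where "b z = (\<chi> i. l z (axis i 1))" for z
have Av: "A z *v u = (\<chi> i. g z u (axis i 1))" if "z \<in> S" for z u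
 using lin_axis[OF glin[OF that], where u = u]
 by (simp add: A_def matrix_vector_mult_def vec_eq_iff mult_ac)
have det: "det (A z) ~= 0" if "z \<in> S" for z
proof -
 have "u = 0" if "A z *v u = 0" for u
 proof (rule ccontr)
  assume "u ~= 0"
  have "g z u u = 0"
   by (rule linear_ext_axis[OF g(2)[OF \<open>z \<in> S\<close>] linear_zero])
     (use that Av[OF \<open>z \<in> S\<close>] in "simp add: vec_eq_iff")
  thus False using g(3)[OF \<open>z \<in> S\<close> \<open>u ~= 0\<close>] by simp
 qed
 hence "invertible (A z)" by (metis invertible_left_inverse matrix_left_invertible_ker)
 thus ?thesis using invertible_det_nz by blast
qed
have e: "v z $ k = det (\<chi> i j. if j = k then b z $ i else A z $ i $ j) * inverse (det (A z))" if "z \<in> S" for z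
proof -
 have "A z *v v z = b z" unfolding Av[OF that] b_def by (simp add: l(2)[OF that])
 thus ?thesis using cramer[OF det[OF that], of "v z" "b z"] by (simp add: divide_inverse)
qed
have f: "smooth_on S (%z. det (\<chi> i j. if j = k then b z $ i else A z $ i $ j) * inverse (det (A z)))"
proof (intro smooth_on_mult smooth_on_inverse smooth_on_det S det)
 show "smooth_on S (%x. A x $ i $ j)" for i j by (simp add: A_def g(4))
 show "smooth_on S (%x. (\<chi> i j. if j = k then b x $ i else A x $ i $ j) $ i $ j)" for i j
  by (cases "j = k") (simp_all add: A_def b_def g(4) l(1))
qed auto
show "smooth_on S (%x. v x $ k)"
 by (rule smooth_on_cong[OF S f]) (rule e[symmetric])
qed

text \<open>The product rule for a point-dependent linear map applied to a moving vector. The map is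
  known only through its values on fixed vectors, so everything is expanded in the standard
  basis.\<close>

lemma hfd_moving:
fixes v :: "'a::real_normed_vector => real ^ 'n::finite" and B :: "'a => real ^ 'n => 'c::real_normed_vector"
assumes B: "!!u. ((%z. B z u) hfd (%h. B' h u)) (at z within T)"
 and lin: "!!w. w \<in> T ==> linear (B w)" "z \<in> T" "!!h. linear (B' h)"
 and v: "(v hfd v') (at z within T)"
shows "((%z. B z (v z)) hfd (%h. B' h (v z) + B z (v' h))) (at z within T)"
proof -
have vi: "((%z. v z $ i) hfd (%h. v' h $ i)) (at z within T)" for i
 by (rule bounded_linear.has_derivative[OF bounded_linear_vec_nth v])
have "((%z. \<Sum>i\<in>UNIV. v z $ i *R B z (axis i 1)) hfd
  (%h. \<Sum>i\<in>UNIV. v z $ i *R B' h (axis i 1) + v' h $ i *R B z (axis i 1))) (at z within T)"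
 by (rule has_derivative_sum) (rule has_derivative_scaleR[OF vi B])
moreover have "(%h. \<Sum>i\<in>UNIV. v z $ i *R B' h (axis i 1) + v' h $ i *R B z (axis i 1))
  = (%h. B' h (v z) + B z (v' h))"
 by (rule ext) (simp add: sum.distrib lin_axis[OF lin(3), symmetric] lin_axis[OF lin(1)[OF lin(2)], symmetric])
ultimately have "((%z. \<Sum>i\<in>UNIV. v z $ i *R B z (axis i 1)) hfd (%h. B' h (v z) + B z (v' h))) (at z within T)"
 by simp
thus ?thesis
 by (rule has_derivative_transform[OF lin(2), rotated]) (rule lin_axis[OF lin(1)])
qed

text \<open>Polarisation and the parallelogram law bound \<open>b v w\<close> by the arithmetic mean
  of \<open>g v v\<close> and \<open>g w w\<close>; normalising both vectors turns it into the
  geometric mean. With \<open>b = g\<close> this is the Cauchy-Schwarz inequality, and for a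
  curvature operator it passes from flag curvatures to all entries.\<close>

lemma sym_form_polarization:
fixes g b :: "'a::real_vector => 'a => real"
assumes g: "!!w. linear (%v. g v w)" "!!u w. g u w = g w u" "!!v. v ~= 0 ==> 0 < g v v"
 and b: "!!w. linear (%v. b v w)" "!!u w. b u w = b w u" "!!v. \<bar>b v v\<bar> <= K * g v v"
shows "\<bar>b v w\<bar> <= K * (sqrt (g v v) * sqrt (g w w))"
proof -
have lg: "linear (g v)" and lb: "linear (b v)" for v
proof -
 have "(%w. g w v) = g v" "(%w. b w v) = b v" using g(2) b(2) by auto
 thus "linear (g v)" "linear (b v)" using g(1)[of v] b(1)[of v] by simp_all
qed
note add = linear_add[OF g(1)] linear_add[OF lg] linear_add[OF b(1)] linear_add[OF lb]
note dif = linear_diff[OF g(1)] linear_diff[OF lg] linear_diff[OF b(1)] linear_diff[OF lb]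
note cm = linear_cmul[OF g(1)] linear_cmul[OF lg] linear_cmul[OF b(1)] linear_cmul[OF lb]
have 1: "2 * \<bar>b v w\<bar> <= K * (g v v + g w w)" for v w
proof -
 have "4 * b v w = b (v + w) (v + w) - b (v - w) (v - w)"
  using b(2)[of v w] by (simp add: add dif)
 moreover have "g (v + w) (v + w) + g (v - w) (v - w) = 2 * g v v + 2 * g w w"
  using g(2)[of v w] by (simp add: add dif)
 ultimately have "4 * b v w = b (v + w) (v + w) - b (v - w) (v - w)"
  "K * g (v + w) (v + w) + K * g (v - w) (v - w) = K * (2 * g v v + 2 * g w w)"
  by (simp, metis distrib_left)
 hence "4 * \<bar>b v w\<bar> <= K * (2 * g v v + 2 * g w w)"
  using b(3)[of "v + w"] b(3)[of "v - w"] by linarith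
 thus ?thesis by (simp add: algebra_simps)
qed
show ?thesis
proof (cases "v = 0 \<or> w = 0")
 case True
 thus ?thesis using linear_0[OF b(1)] linear_0[OF lb] linear_0[OF g(1)] by auto
next
 case False
 define p q where "p = sqrt (g v v)" and "q = sqrt (g w w)"
 have pq: "p > 0" "q > 0" "g v v = p^2" "g w w = q^2"
  using g(3)[of v] g(3)[of w] False by (auto simp: p_def q_def)
 have "2 * \<bar>b ((1/p) *R v) ((1/q) *R w)\<bar> <= K * (1 + 1)"
  using 1[of "(1/p) *R v" "(1/q) *R w"] pq by (simp add: cm power2_eq_square)
 thus ?thesis using pq unfolding p_def[symmetric] q_def[symmetric]
  by (simp add: cm abs_mult field_simps)
qed
qed

context cmetric
begin

lemma smooth_Q2_moving: "smooth_on S v ==> smooth_on S (%z. Q2 (0, w) (v z, 0) z)"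
and smooth_DG_moving: "smooth_on S v ==> smooth_on S (%z. DG z (0, v z) u w)"
and smooth_DG_moving1: "smooth_on S v ==> smooth_on S (%z. DG z (v z, 0) u w)"
and smooth_DG_moving2: "smooth_on S v ==> smooth_on S (%z. DG z (X, 0) u (v z))"
proof -
assume v: "smooth_on S v"
have c: "smooth_on S (%z. v z $ i)" for i by (rule smooth_on_component[OF openS v])
have D: "smooth_on S (%z. DG z X u w)" for X u w
proof (rule smooth_on_cong[OF openS smooth_on_fd[OF G_smooth]])
 fix z :: "'n tpoint" assume "z \<in> S"
 thus "fd (%z. G z u w) z X = DG z X u w" by (simp add: fd_eqI[OF G_has_derivative])
qed
have *: "smooth_on S (%z. f z (v z))" if "!!z. z \<in> S ==> linear (f z)" "!!a. smooth_on S (%z. f z a)"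
 for f :: "'n tpoint => real ^ 'n => real"
proof (rule smooth_on_cong[OF openS])
 show "smooth_on S (%z. \<Sum>i\<in>UNIV. v z $ i * f z (axis i 1))"
  by (intro smooth_on_sum smooth_on_mult openS c that)
 show "(\<Sum>i\<in>UNIV. v z $ i * f z (axis i 1)) = f z (v z)" if "z \<in> S" for z
  using lin_axis[OF \<open>!!z. z \<in> S ==> linear (f z)\<close>[OF that], of "v z"] by simp
qed
show "smooth_on S (%z. Q2 (0, w) (v z, 0) z)"
 by (rule *) (auto intro: linear_Pair0 linear_Q2 smoothQ2 simp del: mem_Times_iff)
show "smooth_on S (%z. DG z (0, v z) u w)" by (rule *) (use D in "auto intro: linear_Pair0 linear_DG simp del: mem_Times_iff")
show "smooth_on S (%z. DG z (v z, 0) u w)" by (rule *) (use D in "auto intro: linear_Pair0 linear_DG simp del: mem_Times_iff")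
show "smooth_on S (%z. DG z (X, 0) u (v z))" by (rule *) (use D in "auto intro: linear_DG simp del: mem_Times_iff")
qed

lemma koszul_formula:
assumes "(x, y) \<in> S"
shows "2 * G (x, y) (Ga (x, y) u X) w = DG (x, y) (X, 0) u w + DG (x, y) (u, 0) X w - DG (x, y) (w, 0) u X
 - DG (x, y) (0, Ga (x, y) y X) u w - DG (x, y) (0, Ga (x, y) y u) X w + DG (x, y) (0, Ga (x, y) y w) u X"
using metric_derivative[OF assms, of "(X, 0)" u w] metric_derivative[OF assms, of "(u, 0)" X w]
 metric_derivative[OF assms, of "(w, 0)" u X]
 Ga_sym[OF assms, of X u] Ga_sym[OF assms, of X w] Ga_sym[OF assms, of u w]
 G_sym[OF assms, of u] G_sym[OF assms, of X] by simp

text \<open>The Koszul stages once more: \<open>Ga z y y\<close>, \<open>Ga z y u\<close> and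
  \<open>Ga z u v\<close>, where \<open>y = snd z\<close>, are successive Riesz representatives, and
  smoothness of each makes the Cartan terms of the next right-hand side smooth.\<close>

lemma smooth_Ga: "smooth_on S (%z. Ga z u v)"
proof -
have snd: "smooth_on S snd" "smooth_on S (%z. snd z)" by (rule smooth_on_linear[OF openS bounded_linear_snd])+
have half: "smooth_on S (%z. 1/2 * f z)" if "smooth_on S f" for f :: "'n tpoint => real"
 by (intro smooth_on_mult smooth_on_const openS that)
have dif: "smooth_on S (%z. f z - g z)" if "smooth_on S f" "smooth_on S g" for f g :: "'n tpoint => real"
 using smooth_on_add[OF openS that(1) smooth_on_mult[OF openS smooth_on_const[OF openS, of "-1"] that(2)]] by simp
have rz: "smooth_on S v" if "!!w. smooth_on S (%z. l z w)" "!!x y w. (x, y) \<in> S ==> G (x, y) (v (x, y)) w = l (x, y) w"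
 for l and v :: "'n tpoint => real ^ 'n"
proof (rule smooth_on_riesz[OF openS, where g = G and l = l])
 fix z :: "'n tpoint" and v :: "real ^ 'n" and w assume z: "z \<in> S"
 show "linear (%v. G z v w)" "linear (%v. G z v w)" "linear (G z v)" using lin_G[OF z] by auto
 show "0 < G z v v" if "v ~= 0" using G_pos z that by (cases z) auto
next
 fix z :: "'n tpoint" and w assume "z \<in> S"
 thus "G z (v z) w = l z w" using that(2) by (cases z) auto
qed (use that(1) G_smooth in auto)
have N0: "smooth_on S (%z. Ga z (snd z) (snd z))"
proof (rule rz[where l = "%z w. 1/2 * (Q2 (0, w) (snd z, 0) z - Q1 (w, 0) z)"])
 show "smooth_on S (%z. 1/2 * (Q2 (0, w) (snd z, 0) z - Q1 (w, 0) z))" for w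
  by (intro half dif smooth_Q2_moving snd smoothQ1)
 show "G (x, y) (Ga (x, y) (snd (x, y)) (snd (x, y))) w = 1/2 * (Q2 (0, w) (snd (x, y), 0) (x, y) - Q1 (w, 0) (x, y))"
  if "(x, y) \<in> S" for x y w using spray[OF that, of w] by simp
qed
have N: "smooth_on S (%z. Ga z (snd z) u)" for u
proof (rule rz[where l = "%z w. 1/2 * (DG z (snd z, 0) u w + DG z (u, 0) w (snd z) - DG z (w, 0) u (snd z)
  - DG z (0, Ga z (snd z) (snd z)) u w)"])
 show "smooth_on S (%z. 1/2 * (DG z (snd z, 0) u w + DG z (u, 0) w (snd z) - DG z (w, 0) u (snd z)
  - DG z (0, Ga z (snd z) (snd z)) u w))" for w
  by (intro half dif smooth_on_add openS smooth_DG_moving smooth_DG_moving1 smooth_DG_moving2 snd N0)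
 show "G (x, y) (Ga (x, y) (snd (x, y)) u) w = 1/2 * (DG (x, y) (snd (x, y), 0) u w + DG (x, y) (u, 0) w (snd (x, y))
  - DG (x, y) (w, 0) u (snd (x, y)) - DG (x, y) (0, Ga (x, y) (snd (x, y)) (snd (x, y))) u w)"
  if z: "(x, y) \<in> S" for x y w
  using koszul_formula[OF z, of u y w] Ga_sym[OF z, of u y] DG_sym(1)[OF z] DG_y(1)[OF z] by simp
qed
show ?thesis
proof (rule rz[where l = "%z w. 1/2 * (DG z (v, 0) u w + DG z (u, 0) v w - DG z (w, 0) u v
 - DG z (0, Ga z (snd z) v) u w - DG z (0, Ga z (snd z) u) v w + DG z (0, Ga z (snd z) w) u v)"])
 have c: "smooth_on S (%z. DG z (v, 0) u w)" for v u w
  by (rule smooth_DG_moving1) (rule smooth_on_const[OF openS])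
 show "smooth_on S (%z. 1/2 * (DG z (v, 0) u w + DG z (u, 0) v w - DG z (w, 0) u v
 - DG z (0, Ga z (snd z) v) u w - DG z (0, Ga z (snd z) u) v w + DG z (0, Ga z (snd z) w) u v))" for w
  by (intro half dif smooth_on_add openS smooth_DG_moving c N)
 show "G (x, y) (Ga (x, y) u v) w = 1/2 * (DG (x, y) (v, 0) u w + DG (x, y) (u, 0) v w - DG (x, y) (w, 0) u v
  - DG (x, y) (0, Ga (x, y) (snd (x, y)) v) u w - DG (x, y) (0, Ga (x, y) (snd (x, y)) u) v w
  + DG (x, y) (0, Ga (x, y) (snd (x, y)) w) u v)"
  if "(x, y) \<in> S" for x y w using koszul_formula[OF that, of u v w] by simp
qed
qed

end

subsection \<open>Berwald charts and their curvature\<close>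

text \<open>From dimension two on the punctured space is connected. In dimension one it falls into
  two half lines; the function is constant on each, and \<open>one\<close> links them. This mirrors
  the second clause of \<open>berwald\<close>.\<close>

lemma connected_slit_or_line:
fixes f :: "real ^ 'n::finite => 'b::real_normed_vector"
assumes der: "!!y. y ~= 0 ==> (f hfd (%_. 0)) (at y)"
 and one: "!!y. y ~= 0 ==> CARD('n) = 1 ==> f (- y) = f y"
 and "y ~= 0" "y' ~= 0"
shows "f y = f y'"
proof (cases "CARD('n) = 1")
case False
hence "2 <= CARD('n)" using zero_less_card_finite[where 'a = 'n] by linarith
hence "2 <= DIM(real ^ 'n)" by simp
hence "connected (UNIV - {0::real ^ 'n})"
 using connected_punctured_universe[of "0::real ^ 'n"] by (simp add: Compl_eq_Diff_UNIV)
from has_derivative_zero_unique_connected[OF _ this, of f y y'] show ?thesis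
 using assms open_delete[OF open_UNIV, of "0::real ^ 'n"] by auto
next
case True
then obtain i where i: "(UNIV :: 'n set) = {i}" by (auto simp: card_1_singleton_iff)
have ex: "v = (v $ i) *R axis i 1" for v :: "real ^ 'n"
proof -
 have "v $ j = ((v $ i) *R axis i 1) $ j" for j
  using i by (metis (full_types) UNIV_I axis_nth mult.right_neutral real_scaleR_def singletonD vector_scaleR_component)
 thus ?thesis unfolding vec_eq_iff by blast
qed
have seg: "f (s *R axis i 1) = f (t *R axis i 1)" if "0 < s" "0 < t" for s t
proof -
 let ?C = "(%t. t *R axis i (1::real)) ` {0<..}"
 have "convex ?C" by (intro convex_linear_image linearI) (auto simp: algebra_simps)
 moreover have "(f hfd (%_. 0)) (at x within ?C)" if "x \<in> ?C" for x
  by (rule has_derivative_at_withinI[OF der]) (use that in auto)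
 ultimately obtain c where "!!x. x \<in> ?C ==> f x = c"
  using has_derivative_zero_constant[of ?C f] by blast
 thus ?thesis using that by auto
qed
have pos: "f v = f (\<bar>v $ i\<bar> *R axis i 1)" if "v ~= 0" for v
proof (cases "v $ i > 0")
 case True thus ?thesis using ex[of v] by simp
next
 case False
 hence "\<bar>v $ i\<bar> *R axis i 1 = - v" using ex[of v] by (metis abs_of_nonpos linorder_not_less scaleR_minus_left)
 thus ?thesis using one[OF that True] by simp
qed
have "v $ i ~= 0" if "v ~= 0" for v :: "real ^ 'n" using ex[of v] that by auto
thus ?thesis using pos[OF assms(3)] pos[OF assms(4)] seg[of "\<bar>y $ i\<bar>" "\<bar>y' $ i\<bar>"] assms(3,4) by auto
qed

locale cberwald = cmetric L U for L :: "'n::finite lmetric" and U +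
assumes bw_pd: "x \<in> U ==> y ~= 0 ==> pd_y s (%z. chern L z i j k) (x, y) = 0"
 and bw1: "x \<in> U ==> y ~= 0 ==> CARD('n) = 1 ==> chern L (x, - y) = chern L (x, y)"
begin

lemma chern_eq_Ga: "chern L z i j k = Ga z (axis j 1) (axis k 1) $ i"
unfolding Ga_def Gam_axis(2) by simp

lemma smooth_chern: "smooth_on S (%z. chern L z i j k)"
unfolding chern_eq_Ga by (rule smooth_on_component[OF openS smooth_Ga])

lemma chern_const: assumes x: "x \<in> U" and "y ~= 0" "y' ~= 0" shows "chern L (x, y) = chern L (x, y')"
proof -
have "chern L (x, y) i j k = chern L (x, y') i j k" for i j k
proof (rule connected_slit_or_line[of "%y. chern L (x, y) i j k", OF _ _ assms(2,3)])
 fix y :: "real ^ 'n" assume y: "y ~= 0"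
 thus "chern L (x, - y) i j k = chern L (x, y) i j k" if "CARD('n) = 1"
  using bw1[OF x y that] by simp
 let ?f = "%z. chern L z i j k"
 have z: "(x, y) \<in> S" using x y by simp
 have d: "?f differentiable (at (x, y))"
  using smooth_on_hfd[OF smooth_chern z] unfolding differentiable_def by blast
 have "fd ?f (x, y) (0, axis s 1) = 0" for s
  using bw_pd[OF x y] pd_y_eq_fd[OF d] by metis
 hence "fd ?f (x, y) (0, h) = 0" for h
  using linear_ext_axis[OF linear_Pair0(1)[OF fd_linear[OF d]] linear_zero] by blast
 moreover have "((%y. (x, y)) hfd (%h. (0, h))) (at y)"
  by (auto intro!: derivative_eq_intros)
 from diff_chain_at[OF this fd_works[OF d]]
 have "((%y. ?f (x, y)) hfd (%h. fd ?f (x, y) (0, h))) (at y)" by (simp add: o_def)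
 ultimately show "((%y. ?f (x, y)) hfd (%_. 0)) (at y)" by simp
qed
thus ?thesis by (simp add: fun_eq_iff)
qed

text \<open>The connection at \<open>x\<close>. The reference vector is an arbitrary nonzero one,
  since the coefficients are the same for all of them.\<close>

definition Gx where "Gx x = Ga (x, axis undefined 1)"

lemma Ga_eq: "x \<in> U ==> y ~= 0 ==> Ga (x, y) = Gx x"
unfolding Gx_def Ga_def using chern_const[of x y "axis undefined 1"] by simp

lemma Gx_lin: "linear (%u. Gx x u v)" "linear (Gx x u)"
unfolding Gx_def by (rule Ga_lin)+

lemma Gx_sym: "x \<in> U ==> Gx x u v = Gx x v u"
unfolding Gx_def by (rule Ga_sym) simp

lemma smooth_Gx: "smooth_on U (%x. Gx x u v)"
proof -
have "Ck_on m U (%x. Ga ((0, axis undefined 1) + (x, 0)) u v)" for m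
 by (rule Ck_on_compose_affine[OF openS openU, where f = "%z. Ga z u v"])
   (auto intro: smooth_onD[OF smooth_Ga] bounded_linear_Pair bounded_linear_ident bounded_linear_zero)
thus ?thesis by (simp add: smooth_on_def Gx_def)
qed

section \<open>The curvature tensor and its symmetries\<close>

definition dGx where "dGx x X u v = fd (%x. Gx x u v) x X"

lemma Gx_has_derivative: "x \<in> U ==> ((%x. Gx x u v) hfd (%X. dGx x X u v)) (at x)"
unfolding dGx_def by (rule smooth_on_hfd[OF smooth_Gx])

lemma dGx_lin: assumes "x \<in> U"
shows "linear (%X. dGx x X u v)" "linear (%u. dGx x X u v)" "linear (dGx x X u)"
proof -
note D = Gx_has_derivative[OF assms]
show "linear (%X. dGx x X u v)"
 using has_derivative_linear[OF D] .
have "dGx x X (a + b) v = dGx x X a v + dGx x X b v" for X v a b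
 using has_derivative_unique[OF D[of "a + b" v] has_derivative_add[OF D[of a v] D[of b v],
  folded linear_add[OF Gx_lin(1)]]] by (rule fun_cong)
moreover have "dGx x X u (a + b) = dGx x X u a + dGx x X u b" for X u a b
 using has_derivative_unique[OF D[of u "a + b"] has_derivative_add[OF D[of u a] D[of u b],
  folded linear_add[OF Gx_lin(2)]]] by (rule fun_cong)
moreover have "dGx x X (c *R a) v = c *R dGx x X a v" for X v a c
 using has_derivative_unique[OF D[of "c *R a" v] has_derivative_scaleR_right[OF D[of a v], of c,
  folded linear_cmul[OF Gx_lin(1)]]] by (rule fun_cong)
moreover have "dGx x X u (c *R a) = c *R dGx x X u a" for X u a c
 using has_derivative_unique[OF D[of u "c *R a"] has_derivative_scaleR_right[OF D[of u a], of c,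
  folded linear_cmul[OF Gx_lin(2)]]] by (rule fun_cong)
ultimately show "linear (%u. dGx x X u v)" "linear (dGx x X u)" by (auto intro: linearI)
qed

lemma dGx_sym: assumes "x \<in> U" shows "dGx x X u v = dGx x X v u"
unfolding dGx_def by (subst fd_cong_open(1)[OF openU assms Gx_sym]) simp_all

text \<open>The curvature operator \<open>R(X, Y) w\<close> of the affine connection with
  Christoffel symbols \<open>Gx\<close>.\<close>

definition Rm where
"Rm x X Y w = dGx x X w Y - dGx x Y w X + Gx x (Gx x w Y) X - Gx x (Gx x w X) Y"

lemma Rm_lin: assumes "x \<in> U" shows "linear (Rm x X Y)" "linear (%X. Rm x X Y w)" "linear (%Y. Rm x X Y w)"
proof -
have c: "linear (%w. Gx x (Gx x w X) Y)" "linear (%X. Gx x (Gx x w X) Y)" for X Y w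
 using linear_compose[OF Gx_lin(1) Gx_lin(1)] linear_compose[OF Gx_lin(2) Gx_lin(1)] by (auto simp: o_def)
show "linear (Rm x X Y)" "linear (%X. Rm x X Y w)" "linear (%Y. Rm x X Y w)"
 unfolding Rm_def by (intro linear_compose_sub linear_compose_add c Gx_lin dGx_lin assms)+
qed

lemma Rm_antisym: "Rm x X Y w = - Rm x Y X w" by (simp add: Rm_def)

lemma Rm_self: "Rm x X X w = 0" by (simp add: Rm_def)

lemma bianchi: "x \<in> U ==> Rm x X Y w + Rm x Y w X + Rm x w X Y = 0"
unfolding Rm_def using dGx_sym[of x X w Y] dGx_sym[of x Y X w] dGx_sym[of x w X Y]
 Gx_sym[of x w Y] Gx_sym[of x w X] Gx_sym[of x X Y] by (simp add: algebra_simps)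

lemma metric_derivative_x:
"(x, y) \<in> S ==> DG (x, y) (X, v) u w = G (x, y) (Gx x u X) w + G (x, y) u (Gx x w X) + DG (x, y) (0, v + Gx x y X) u w"
using metric_derivative[of "(x, y)" "(X, v)" u w] Ga_eq[of x y] by simp

lemma Q_horizontal_x: "(x, y) \<in> S ==> Q1 (X, 0) (x, y) = Q1 (0, Gx x y X) (x, y)"
using Q_horizontal[of x y X] Ga_eq[of x y] by simp

text \<open>\<open>F^2\<close> is constant along horizontal vectors, hence along brackets of
  horizontal fields, and such a bracket is vertical with component given by the curvature applied to
  \<open>y\<close>. Instead of brackets, the horizontal identity is differentiated once more and the
  symmetry of second derivatives is used.\<close>

lemma Q1_Rm: assumes z: "(x, y) \<in> S" shows "Q1 (0, Rm x X Y y) (x, y) = 0"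
proof -
have x: "x \<in> U" using z by simp
have H: "Q2 (X, 0) (Y, - Gx x y Y) (x, y) - Q2 (0, Gx x y X) (Y, - Gx x y Y) (x, y)
  = Q1 (0, dGx x Y y X - Gx x (Gx x y Y) X) (x, y)" for X Y
proof -
 have dv: "((%z. Gx (fst z) (snd z) X) hfd (%h. dGx x (fst h) y X + Gx x (snd h) X)) (at (x, y) within S)"
 proof -
  have f: "((%z. Gx (fst z) u X) hfd (%h. dGx x (fst h) u X)) (at (x, y) within S)" for u
   using diff_chain_within[of fst fst "(x, y)" S "%x. Gx x u X" "%h. dGx x h u X"]
    has_derivative_at_withinI[OF Gx_has_derivative[OF x]]
    bounded_linear_imp_has_derivative[OF bounded_linear_fst] by (auto simp: o_def)
  have "((%z. Gx (fst z) (snd z) X) hfd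
    (%h. dGx x (fst h) (snd (x, y)) X + Gx (fst (x, y)) (snd h) X)) (at (x, y) within S)"
   by (rule hfd_moving[OF f]) (auto intro!: Gx_lin dGx_lin x derivative_eq_intros z[simplified])
  thus ?thesis by simp
 qed
 have B: "((%z. Q1 (0, u) z) hfd (%h. Q2 (0, u) h (x, y))) (at (x, y) within S)" for u
  unfolding Q2_def by (rule has_derivative_at_withinI[OF fd_works[OF diff_Q(2)[OF z]]])
 have 1: "((%z. Q1 (0, Gx (fst z) (snd z) X) z) hfd
   (%h. Q2 (0, Gx (fst (x, y)) (snd (x, y)) X) h (x, y) + Q1 (0, dGx x (fst h) y X + Gx x (snd h) X) (x, y)))
   (at (x, y) within S)"
  by (rule hfd_moving[OF B _ z _ dv]) (use z in "auto intro!: linear_Pair0(1)[OF linear_Q1] linear_Pair0(1)[OF linear_Q2(2)]")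
 have 2: "((%z. Q1 (X, 0) z) hfd (%h. Q2 (X, 0) h (x, y))) (at (x, y) within S)"
  unfolding Q2_def by (rule has_derivative_at_withinI[OF fd_works[OF diff_Q(2)[OF z]]])
 have 3: "((%z. Q1 (X, 0) z) hfd
   (%h. Q2 (0, Gx (fst (x, y)) (snd (x, y)) X) h (x, y) + Q1 (0, dGx x (fst h) y X + Gx x (snd h) X) (x, y)))
   (at (x, y) within S)"
  by (rule has_derivative_transform[OF z _ 1]) (use Q_horizontal_x in "metis prod.collapse")
 have "Q2 (X, 0) h (x, y) = Q2 (0, Gx x y X) h (x, y) + Q1 (0, dGx x (fst h) y X + Gx x (snd h) X) (x, y)" for h
  using has_derivative_unique[OF 2[unfolded at_within_open[OF z openS]] 3[unfolded at_within_open[OF z openS]]]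
  by (metis fst_conv snd_conv)
 from this[of "(Y, - Gx x y Y)"] show ?thesis by (simp add: linear_neg[OF Gx_lin(1)])
qed
have lin: "Q2 (X, - b) k (x, y) = Q2 (X, 0) k (x, y) - Q2 (0, b) k (x, y)" for X b k
 using linear_diff[OF linear_Q2(2)[OF z, of k], of "(X, 0)" "(0, b)"] by simp
have "Q1 (0, dGx x Y y X - Gx x (Gx x y Y) X) (x, y) = Q1 (0, dGx x X y Y - Gx x (Gx x y X) Y) (x, y)"
 using H[of X Y] H[of Y X] Q2_sym[OF z, of "(X, - Gx x y X)" "(Y, - Gx x y Y)"] lin by (metis)
moreover have "Rm x X Y y = (dGx x X y Y - Gx x (Gx x y X) Y) - (dGx x Y y X - Gx x (Gx x y Y) X)"
 by (simp add: Rm_def)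
ultimately show ?thesis
 using linear_diff[OF linear_Pair0(1)[OF linear_Q1[OF z]]] by (metis cancel_comm_monoid_add_class.diff_cancel)
qed

text \<open>The second part is the fibre derivative, along \<open>w\<close>, of the first.\<close>

lemma G_y_Rm: assumes z: "(x, y) \<in> S"
shows "G (x, y) y (Rm x X Y y) = 0" "G (x, y) y (Rm x X Y w) = - G (x, y) w (Rm x X Y y)"
proof -
have x: "x \<in> U" using z by simp
show "G (x, y) y (Rm x X Y y) = 0"
 unfolding G_y(1)[OF z] Q1_Rm[OF z] by simp
have B: "((%a. Q1 (0, u) (x, a)) hfd (%h. Q2 (0, u) (0, h) (x, y))) (at y within UNIV - {0})" for u
proof -
 have 1: "((%a. (x, a)) hfd (%h. (0, h))) (at y)" by (auto intro!: derivative_eq_intros)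
 show ?thesis using diff_chain_at[OF 1 fd_works[OF diff_Q(2)[OF z]]]
  unfolding Q2_def by (auto simp: o_def intro: has_derivative_at_withinI)
qed
have "((%a. Q1 (0, Rm x X Y a) (x, a)) hfd
  (%h. Q2 (0, Rm x X Y y) (0, h) (x, y) + Q1 (0, Rm x X Y h) (x, y))) (at y within UNIV - {0})"
 by (rule hfd_moving[OF B])
   (use z x in "auto intro!: linear_Pair0 linear_Q1 linear_Q2 linear_imp_has_derivative Rm_lin")
hence 1: "((%a. Q1 (0, Rm x X Y a) (x, a)) hfd
  (%h. Q2 (0, Rm x X Y y) (0, h) (x, y) + Q1 (0, Rm x X Y h) (x, y))) (at y)"
 using at_within_open[of y "UNIV - {0}"] slit z by auto
have 2: "((%a. Q1 (0, Rm x X Y a) (x, a)) hfd (%_. 0)) (at y)"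
 by (rule htw_open[OF has_derivative_const slit]) (use z Q1_Rm in auto)
have "Q2 (0, Rm x X Y y) (0, w) (x, y) + Q1 (0, Rm x X Y w) (x, y) = 0"
 using has_derivative_unique[OF 1 2] by metis
thus "G (x, y) y (Rm x X Y w) = - G (x, y) w (Rm x X Y y)"
 using G_y(1)[OF z, of "Rm x X Y w"] Q2_sym[OF z, of "(0, w)"] by (simp add: G_def)
qed

text \<open>Skewness of the curvature has been obtained for pairings with \<open>y\<close>; the
  first Bianchi identity brings every term into that form.\<close>

lemma Rm_selfadjoint: assumes z: "(x, y) \<in> S"
shows "G (x, y) w (Rm x V y y) = G (x, y) V (Rm x w y y)"
proof -
have x: "x \<in> U" using z by simp
have "G (x, y) w (Rm x V y y) = - G (x, y) y (Rm x V y w)" using G_y_Rm(2)[OF z, of V y w] by simp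
also have "... = G (x, y) y (Rm x y w V) + G (x, y) y (Rm x w V y)"
proof -
 have "Rm x V y w = - (Rm x y w V + Rm x w V y)" using bianchi[OF x, of V y w] by (simp only: eq_neg_iff_add_eq_0 add.assoc)
 thus ?thesis
  by (simp add: linear_neg[OF lin_G(1)[OF z]] linear_add[OF lin_G(1)[OF z]] linear_diff[OF lin_G(1)[OF z]])
qed
also have "... = - G (x, y) V (Rm x y w y)"
 using G_y_Rm(1)[OF z, of w V] G_y_Rm(2)[OF z, of y w V] by simp
also have "... = G (x, y) V (Rm x w y y)"
 using Rm_antisym[of x y w y] linear_neg[OF lin_G(1)[OF z]] by simp
finally show ?thesis .
qed

section \<open>Identification with the curvature defined through forms\<close>

lemma curv_form_eq:
assumes z: "(x, y) \<in> S"
shows "curv_form L i j (x, y) X Y = Rm x (fst X) (fst Y) (axis j 1) $ i"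
proof -
have x: "x \<in> U" using z by simp
have cf: "conn_form L i j w X = Gx (fst w) (axis j 1) (fst X) $ i" if "w \<in> S" for w X i j
proof -
 have "Ga w = Gx (fst w)" using that Ga_eq by (cases w) auto
 thus ?thesis
  unfolding conn_form_def conn_of_def Ga_def[symmetric] by (metis (no_types, lifting) Gam_axis(1) Ga_def vec_lambda_beta sum.cong)
qed
have d: "dird (%w. conn_form L i j w Y) (x, y) X = dGx x (fst X) (axis j 1) (fst Y) $ i" for X Y
proof -
 have 1: "((%w. Gx (fst w) (axis j 1) (fst Y) $ i) hfd (%h. dGx x (fst h) (axis j 1) (fst Y) $ i)) (at (x, y))"
 proof (rule bounded_linear.has_derivative[OF bounded_linear_vec_nth])
  have f: "(fst hfd fst) (at (x, y))" by (auto intro!: derivative_eq_intros)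
  show "((%w. Gx (fst w) (axis j 1) (fst Y)) hfd (%h. dGx x (fst h) (axis j 1) (fst Y))) (at (x, y))"
   using diff_chain_at[OF f, of "%x. Gx x (axis j 1) (fst Y)" "%h. dGx x h (axis j 1) (fst Y)"] Gx_has_derivative[OF x]
   by (simp add: o_def)
 qed
 have 2: "((%w. conn_form L i j w Y) hfd (%h. dGx x (fst h) (axis j 1) (fst Y) $ i)) (at (x, y))"
  by (rule htw_open[OF 1 openS z]) (rule cf[symmetric])
 have "(%w. conn_form L i j w Y) differentiable (at (x, y))" using 2 unfolding differentiable_def by blast
 thus ?thesis using fd_eqI[OF 2] by (simp add: dird_eq_fd)
qed
have w: "(\<Sum>k\<in>UNIV. wedge (conn_form L k j (x, y)) (conn_form L i k (x, y)) X Y)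
 = Gx x (Gx x (axis j 1) (fst X)) (fst Y) $ i - Gx x (Gx x (axis j 1) (fst Y)) (fst X) $ i"
proof -
 have e: "Gx x u v $ i = (\<Sum>k\<in>UNIV. u $ k * Gx x (axis k 1) v $ i)" for u v
  using lin_axis[OF Gx_lin(1)[of x v], of u] by simp
 show ?thesis
  unfolding wedge_def cf[OF z] fst_conv sum_subtractf
  by (subst (3 4) e) simp
qed
show ?thesis
 unfolding curv_form_def ext_deriv_def d w by (simp add: Rm_def)
qed

text \<open>Uniqueness: on horizontal lifts of two coordinate vectors the forms
  \<open>dely_form\<close> vanish, so \<open>P\<close> drops out and the antisymmetric coefficient
  can be read off. Existence: one may take \<open>P = 0\<close>, because the connection forms depend
  on \<open>x\<close> only.\<close>

lemma hh_curv_eq: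
assumes z: "(x, y) \<in> S"
shows "hh_curv L (x, y) i j k l = Rm x (axis k 1) (axis l 1) (axis j 1) $ i"
proof -
have x: "x \<in> U" using z by simp
define R0 where "R0 i j k l = Rm x (axis k 1) (axis l 1) (axis j 1) $ i" for i j k l
let ?P = "%R :: 'n => 'n => 'n => 'n => real. (ALL i j k l. R i j k l = - R i j l k) &
  (EX P :: 'n => 'n => 'n => 'n => real. ALL i j X Y. curv_form L i j (x, y) X Y =
   1/2 * (\<Sum>k\<in>UNIV. \<Sum>l\<in>UNIV. R i j k l * wedge (dx_form k) (dx_form l) X Y)
   + (\<Sum>k\<in>UNIV. \<Sum>l\<in>UNIV. P i j k l * wedge (dx_form k) (dely_form L (x, y) l) X Y))"
have "?P R0"
proof (intro conjI exI[of _ "%_ _ _ _. 0"] allI)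
 show "R0 i j k l = - R0 i j l k" for i j k l unfolding R0_def using Rm_antisym[of x "axis k 1"] by (metis vector_uminus_component)
 fix i j :: 'n and X Y :: "'n tpoint"
 have e: "Rm x (fst X) (fst Y) w = (\<Sum>k\<in>UNIV. \<Sum>l\<in>UNIV. (fst X $ k * fst Y $ l) *R Rm x (axis k 1) (axis l 1) w)" for X Y :: "'n tpoint" and w
 proof -
  have "Rm x (fst X) (fst Y) w = (\<Sum>k\<in>UNIV. fst X $ k *R Rm x (axis k 1) (fst Y) w)"
   by (rule lin_axis[OF Rm_lin(2)[OF x]])
  also have "... = (\<Sum>k\<in>UNIV. fst X $ k *R (\<Sum>l\<in>UNIV. fst Y $ l *R Rm x (axis k 1) (axis l 1) w))"
   by (intro sum.cong refl arg_cong2[where f = scaleR] lin_axis[OF Rm_lin(3)[OF x]])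
  finally show ?thesis by (simp add: scaleR_sum_right)
 qed
 let ?T = "\<Sum>k\<in>UNIV. \<Sum>l\<in>UNIV. R0 i j k l * (fst X $ k * fst Y $ l)"
 have 1: "curv_form L i j (x, y) X Y = ?T" unfolding curv_form_eq[OF z] e R0_def by (simp add: mult_ac)
 have 2: "(\<Sum>k\<in>UNIV. \<Sum>l\<in>UNIV. R0 i j k l * (fst Y $ k * fst X $ l)) = - ?T"
 proof -
  have "(\<Sum>k\<in>UNIV. \<Sum>l\<in>UNIV. R0 i j k l * (fst Y $ k * fst X $ l)) = Rm x (fst Y) (fst X) (axis j 1) $ i"
   unfolding e R0_def by (simp add: mult_ac)
  also have "... = - Rm x (fst X) (fst Y) (axis j 1) $ i" by (subst Rm_antisym) simp
  finally show ?thesis using 1 unfolding curv_form_eq[OF z] by simp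
 qed
 show "curv_form L i j (x, y) X Y =
   1/2 * (\<Sum>k\<in>UNIV. \<Sum>l\<in>UNIV. R0 i j k l * wedge (dx_form k) (dx_form l) X Y)
   + (\<Sum>k\<in>UNIV. \<Sum>l\<in>UNIV. 0 * wedge (dx_form k) (dely_form L (x, y) l) X Y)"
  unfolding 1 wedge_def dx_form_def right_diff_distrib sum_subtractf 2 by simp
qed
moreover have "R = R0" if P: "?P R" for R
proof -
 have "R i j k l = R0 i j k l" for i j k l
 proof -
  define N where "N u = - Gam (chern L (x, y)) u y" for u
  define X where "X = (axis k (1::real), N (axis k 1))"
  define Y where "Y = (axis l (1::real), N (axis l 1))"
  have del: "dely_form L (x, y) m (axis k 1, N (axis k 1)) = 0" for m k
   unfolding dely_form_def nonlin_of_eq fst_conv snd_conv sum_axis by (simp add: N_def)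
  obtain P' where P': "ALL i j X Y. curv_form L i j (x, y) X Y =
    1/2 * (\<Sum>k\<in>UNIV. \<Sum>l\<in>UNIV. R i j k l * wedge (dx_form k) (dx_form l) X Y)
    + (\<Sum>k\<in>UNIV. \<Sum>l\<in>UNIV. P' i j k l * wedge (dx_form k) (dely_form L (x, y) l) X Y)"
   using P by blast
  have w0: "wedge (dx_form a) (dely_form L (x, y) b) X Y = 0" for a b
   unfolding wedge_def X_def Y_def del by simp
  have "Rm x (axis k 1) (axis l 1) (axis j 1) $ i
    = 1/2 * (\<Sum>a\<in>UNIV. \<Sum>b\<in>UNIV. R i j a b * wedge (dx_form a) (dx_form b) X Y)"
   using P'[rule_format, of i j X Y] unfolding curv_form_eq[OF z] w0 by (simp add: X_def Y_def)
  also have "(\<Sum>a\<in>UNIV. \<Sum>b\<in>UNIV. R i j a b * wedge (dx_form a) (dx_form b) X Y) = R i j k l - R i j l k"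
  proof -
   have s: "(\<Sum>a\<in>UNIV. \<Sum>b\<in>UNIV. R i j a b * (axis p (1::real) $ a * axis q (1::real) $ b)) = R i j p q" for p q
   proof -
    have "(\<Sum>b\<in>UNIV. R i j a b * (axis p 1 $ a * axis q 1 $ b)) = (R i j a q) * axis p 1 $ a" for a
     using sum_axis[of "%b. R i j a b * axis p 1 $ a" q] by (simp add: mult_ac)
    thus ?thesis by (simp add: sum_axis)
   qed
   have "(\<Sum>a\<in>UNIV. \<Sum>b\<in>UNIV. R i j a b * wedge (dx_form a) (dx_form b) X Y) =
    (\<Sum>a\<in>UNIV. \<Sum>b\<in>UNIV. R i j a b * (axis k (1::real) $ a * axis l (1::real) $ b)) -
    (\<Sum>a\<in>UNIV. \<Sum>b\<in>UNIV. R i j a b * (axis l (1::real) $ a * axis k (1::real) $ b))"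
    unfolding wedge_def dx_form_def X_def Y_def fst_conv right_diff_distrib sum_subtractf by simp
   thus ?thesis unfolding s .
  qed
  also have "R i j l k = - R i j k l" using P by blast
  finally show ?thesis by (simp add: R0_def)
 qed
 thus ?thesis by (simp add: fun_eq_iff)
qed
ultimately have "hh_curv L (x, y) = R0" unfolding hh_curv_def by (rule the_equality)
thus ?thesis by (simp add: R0_def)
qed

lemma flag_curv_eq:
assumes z: "(x, y) \<in> S"
shows "flag_curv L (x, y) V = G (x, y) V (Rm x V y y) / (Q (x, y) * G (x, y) V V - (G (x, y) y V)^2)"
proof -
have x: "x \<in> U" using z by simp
let ?g = "G (x, y)"
have e: "Rm x u y y $ s = (\<Sum>j\<in>UNIV. \<Sum>k\<in>UNIV. \<Sum>l\<in>UNIV. y $ j * u $ k * y $ l * hh_curv L (x, y) s j k l)" for u s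
proof -
 have "Rm x u y y $ s = (\<Sum>j\<in>UNIV. y $ j * Rm x u y (axis j 1) $ s)"
  using lin_axis[OF Rm_lin(1)[OF x], of u y y] by simp
 also have "... = (\<Sum>j\<in>UNIV. y $ j * (\<Sum>k\<in>UNIV. u $ k * Rm x (axis k 1) y (axis j 1) $ s))"
 proof -
  have "Rm x u y w $ s = (\<Sum>k\<in>UNIV. u $ k * Rm x (axis k 1) y w $ s)" for w
   using lin_axis[OF Rm_lin(2)[OF x, of y w], of u] by simp
  thus ?thesis by (intro sum.cong refl arg_cong2[where f = "(*)"])
 qed
 also have "... = (\<Sum>j\<in>UNIV. y $ j * (\<Sum>k\<in>UNIV. u $ k * (\<Sum>l\<in>UNIV. y $ l * hh_curv L (x, y) s j k l)))"
 proof -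
  have "Rm x (axis k 1) y (axis j 1) $ s = (\<Sum>l\<in>UNIV. y $ l * hh_curv L (x, y) s j k l)" for k j
   using lin_axis[OF Rm_lin(3)[OF x, of "axis k 1" "axis j 1"], of y] by (simp add: hh_curv_eq[OF z])
  thus ?thesis by (intro sum.cong refl arg_cong2[where f = "(*)"])
 qed
 finally show ?thesis by (simp add: sum_distrib_left mult_ac)
qed
have "(\<Sum>i\<in>UNIV. \<Sum>j\<in>UNIV. \<Sum>k\<in>UNIV. \<Sum>l\<in>UNIV. V $ i * y $ j * low_curv L (x, y) j i k l * y $ l * V $ k)
  = ?g V (Rm x V y y)"
proof -
 have "(\<Sum>j\<in>UNIV. \<Sum>k\<in>UNIV. \<Sum>l\<in>UNIV. V $ i * y $ j * low_curv L (x, y) j i k l * y $ l * V $ k)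
   = V $ i * ?g (axis i 1) (Rm x V y y)" for i
 proof -
  have "?g (axis i 1) (Rm x V y y) = (\<Sum>s\<in>UNIV. Rm x V y y $ s * fund L i s (x, y))"
   using lin_axis[OF lin_G(1)[OF z], where u = "Rm x V y y"]
   by (simp add: fund_eq[OF z] G_sym[OF z, of "axis i 1"])
  also have "... = (\<Sum>s\<in>UNIV. \<Sum>j\<in>UNIV. \<Sum>k\<in>UNIV. \<Sum>l\<in>UNIV. fund L i s (x, y) * hh_curv L (x, y) s j k l * y $ j * V $ k * y $ l)"
   unfolding e by (simp add: sum_distrib_left sum_distrib_right mult_ac)
  also have "... = (\<Sum>j\<in>UNIV. \<Sum>k\<in>UNIV. \<Sum>l\<in>UNIV. \<Sum>s\<in>UNIV. fund L i s (x, y) * hh_curv L (x, y) s j k l * y $ j * V $ k * y $ l)"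
  proof -
   let ?h = "%s j k l. fund L i s (x, y) * hh_curv L (x, y) s j k l * y $ j * V $ k * y $ l"
   have "(\<Sum>s\<in>UNIV. \<Sum>j\<in>UNIV. \<Sum>k\<in>UNIV. \<Sum>l\<in>UNIV. ?h s j k l)
     = (\<Sum>j\<in>UNIV. \<Sum>s\<in>UNIV. \<Sum>k\<in>UNIV. \<Sum>l\<in>UNIV. ?h s j k l)" by (rule sum.swap)
   also have "... = (\<Sum>j\<in>UNIV. \<Sum>k\<in>UNIV. \<Sum>s\<in>UNIV. \<Sum>l\<in>UNIV. ?h s j k l)"
    by (rule sum.cong[OF refl]) (rule sum.swap)
   also have "... = (\<Sum>j\<in>UNIV. \<Sum>k\<in>UNIV. \<Sum>l\<in>UNIV. \<Sum>s\<in>UNIV. ?h s j k l)"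
    by (rule sum.cong[OF refl], rule sum.cong[OF refl]) (rule sum.swap)
   finally show ?thesis .
  qed
  finally show ?thesis by (simp add: low_curv_def sum_distrib_left sum_distrib_right mult_ac)
 qed
 thus ?thesis using lin_axis[OF lin_G(2)[OF z, of "Rm x V y y"], of V] by simp
qed
thus ?thesis
 unfolding flag_curv_def Let_def snd_conv fund_form_eq[OF z] G_y(2)[OF z] by simp
qed

lemma cauchy_strict:
assumes z: "(x, y) \<in> S" and V: "V \<notin> span {y}"
shows "(G (x, y) y V)^2 < Q (x, y) * G (x, y) V V"
proof -
have q: "Q (x, y) > 0" using G_pos[OF z, of y] G_y(2)[OF z] z by simp
define c where "c = G (x, y) y V / Q (x, y)"
have "V - c *R y ~= 0" using V by (metis eq_iff_diff_eq_0 span_base span_mul singletonI)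
from G_pos[OF z this] have "0 < G (x, y) V V - 2 * c * G (x, y) y V + c^2 * Q (x, y)"
 by (simp add: linear_diff[OF lin_G(1)[OF z]] linear_diff[OF lin_G(2)[OF z]] linear_cmul[OF lin_G(1)[OF z]]
  linear_cmul[OF lin_G(2)[OF z]] G_sym[OF z, of V y] G_y(2)[OF z] power2_eq_square algebra_simps)
hence "0 < Q (x, y) * (G (x, y) V V - 2 * c * G (x, y) y V + c^2 * Q (x, y))" using q by simp
also have "... = Q (x, y) * G (x, y) V V - (G (x, y) y V)^2"
 using q by (simp add: c_def power2_eq_square field_simps)
finally show ?thesis by simp
qed

text \<open>The flag curvature bounds the quadratic form of the self-adjoint operator
  \<open>V \<mapsto> R(V, y) y\<close>, and polarisation extends this to all entries. For
  \<open>V\<close> a multiple of \<open>y\<close> there is no flag, but the operator vanishes there.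
  The absolute value covers a negative \<open>k\<close>, which the hypothesis admits when there are
  no flags at all.\<close>

lemma Rm_bound:
assumes fb: "!!V. V \<notin> span {y} ==> flag_curv L (x, y) V \<in> {- k..k}" and z: "(x, y) \<in> S"
shows "\<bar>G (x, y) W (Rm x V y y)\<bar> <= \<bar>k\<bar> * Q (x, y) * (sqrt (G (x, y) W W) * sqrt (G (x, y) V V))"
proof -
have x: "x \<in> U" using z by simp
have q: "Q (x, y) > 0" using G_pos[OF z, of y] G_y(2)[OF z] z by simp
show ?thesis
proof (rule sym_form_polarization[where g = "G (x, y)" and b = "%w v. G (x, y) w (Rm x v y y)"])
 show "\<bar>G (x, y) V (Rm x V y y)\<bar> <= \<bar>k\<bar> * Q (x, y) * G (x, y) V V" for V
 proof (cases "V \<in> span {y}")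
  case True
  then obtain c where "V = c *R y" by (auto simp: span_singleton)
  hence "Rm x V y y = 0" using linear_cmul[OF Rm_lin(2)[OF x]] Rm_self by simp
  moreover have "0 <= G (x, y) V V" using G_pos[OF z, of V] linear_0[OF lin_G(1)[OF z]] by (cases "V = 0") auto
  ultimately show ?thesis using q linear_0[OF lin_G(1)[OF z]] by simp
 next
  case False
  define d where "d = Q (x, y) * G (x, y) V V - (G (x, y) y V)^2"
  have d: "0 < d" using cauchy_strict[OF z False] by (simp add: d_def)
  have "\<bar>G (x, y) V (Rm x V y y) / d\<bar> <= \<bar>k\<bar>"
   using fb[OF False] unfolding flag_curv_eq[OF z] d_def[symmetric] by (auto simp del: abs_divide)
  hence "\<bar>G (x, y) V (Rm x V y y)\<bar> <= \<bar>k\<bar> * d" using d by (simp add: abs_divide pos_divide_le_eq)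
  also have "... <= \<bar>k\<bar> * (Q (x, y) * G (x, y) V V)" by (intro mult_left_mono) (auto simp: d_def)
  finally show ?thesis by (simp add: mult.assoc)
 qed
qed (use z in "auto intro: lin_G G_sym G_pos Rm_selfadjoint")
qed

end

section \<open>Ordinary differential equations\<close>

lemma vector_derivative_bound:
fixes u :: "real => 'b::real_normed_vector"
assumes "!!t. t \<in> {a..b} ==> (u hvd u' t) (at t within {a..b})"
 and "!!t. t \<in> {a..b} ==> norm (u' t) <= B" "s \<in> {a..b}" "t \<in> {a..b}"
shows "norm (u t - u s) <= B * \<bar>t - s\<bar>"
proof -
have "norm (u t - u s) <= B * norm (t - s)"
proof (rule differentiable_bound[OF convex_real_interval(5) _ _ assms(4,3)])
 fix r assume r: "r \<in> {a..b}"
 show "(u hfd (%h. h *R u' r)) (at r within {a..b})"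
  using assms(1)[OF r] by (simp add: has_vector_derivative_def)
 show "onorm (%h. h *R u' r) <= B"
 proof (rule onorm_le)
  fix h :: real
  have "\<bar>h\<bar> * norm (u' r) <= \<bar>h\<bar> * B" by (rule mult_left_mono[OF assms(2)[OF r]]) simp
  thus "norm (h *R u' r) <= B * norm h" by (simp add: mult.commute)
 qed
qed
thus ?thesis by simp
qed

lemma vd_continuous_on:
assumes "!!t. t \<in> A ==> (u hvd u' t) (at t within A)" shows "continuous_on A u"
unfolding continuous_on_eq_continuous_within using has_vector_derivative_continuous[OF assms] by blast

text \<open>When \<open>K * (b - a) <= 1/2\<close>, the maximum of the norm absorbs half of itself;
  this takes the place of an exponential bound.\<close>

lemma gronwall_short:
fixes u :: "real => 'b::real_normed_vector"
assumes u: "!!t. t \<in> {a..b} ==> (u hvd u' t) (at t within {a..b})"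
 and bd: "!!t. t \<in> {a..b} ==> norm (u' t) <= K * norm (u t) + e"
 and "K * (b - a) <= 1/2" "0 <= K" "0 <= e" and t: "t \<in> {a..b}"
shows "norm (u t) <= 2 * (norm (u a) + e * (b - a))"
proof -
have "continuous_on {a..b} u"
 by (rule vd_continuous_on[OF u])
hence "continuous_on {a..b} (%t. norm (u t))" by (rule continuous_on_norm)
moreover have "{a..b} ~= {}" using t by auto
ultimately obtain m where m: "m \<in> {a..b}" "!!t. t \<in> {a..b} ==> norm (u t) <= norm (u m)"
 using continuous_attains_sup[of "{a..b}" "%t. norm (u t)"] by auto
have a: "a \<in> {a..b}" using t by auto
have "norm (u m - u a) <= (K * norm (u m) + e) * \<bar>m - a\<bar>"
proof (rule vector_derivative_bound[OF u _ a m(1)])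
 fix t assume t: "t \<in> {a..b}"
 have "K * norm (u t) <= K * norm (u m)" using m(2)[OF t] assms(4) by (rule mult_left_mono)
 thus "norm (u' t) <= K * norm (u m) + e" using bd[OF t] by linarith
qed
also have "... <= (K * norm (u m) + e) * (b - a)"
 using m(1) assms(4,5) by (intro mult_left_mono) auto
also have "... = K * (b - a) * norm (u m) + e * (b - a)" by (simp add: algebra_simps)
also have "K * (b - a) * norm (u m) <= 1/2 * norm (u m)" by (rule mult_right_mono[OF assms(3)]) simp
finally have "norm (u m - u a) <= 1/2 * norm (u m) + e * (b - a)" by simp
moreover have "norm (u m) <= norm (u m - u a) + norm (u a)" using norm_triangle_ineq[of "u m - u a" "u a"] by simp
ultimately have "norm (u m) <= 2 * (norm (u a) + e * (b - a))" by simp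
thus ?thesis using m(2)[OF t] by simp
qed

text \<open>The contraction acts on bounded continuous functions on the whole line; clamping the
  time to \<open>{0..d}\<close> by \<open>cl\<close> makes the integral operator map this Banach
  space into itself, with factor \<open>K * d <= 1/2\<close>.\<close>

lemma picard:
fixes F :: "real => 'b::banach => 'b"
assumes d: "0 < d" "K * d <= 1/2" and cont: "continuous_on ({0..d} \<times> UNIV) (%(t, x). F t x)"
 and lip: "!!t x y. t \<in> {0..d} ==> norm (F t x - F t y) <= K * norm (x - y)" and K: "0 <= K"
obtains ph where "ph 0 = x0" "!!t. t \<in> {0..d} ==> (ph hvd F t (ph t)) (at t within {0..d})"
proof -
define cl where "cl t = max 0 (min d t)" for t :: real
have cl: "cl t \<in> {0..d}" for t using d by (auto simp: cl_def)
have clc: "continuous_on A cl" for A unfolding cl_def by (intro continuous_intros)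
define I where "I ph t = x0 + integral {0..t} (%s. F s (ph s))" for ph t
have contF: "continuous_on {0..d} (%s. F s (ph s))" if "continuous_on UNIV ph" for ph
proof -
 have "continuous_on {0..d} (%s. (s, ph s))"
  by (intro continuous_intros continuous_on_subset[OF that]) auto
 from continuous_on_compose2[OF cont this] show ?thesis by auto
qed
have contI: "continuous_on {0..d} (I ph)" if "continuous_on UNIV ph" for ph
 unfolding I_def using contF[OF that]
 by (intro continuous_intros indefinite_integral_continuous_1 integrable_continuous_real)
have Ib: "(%t. I ph (cl t)) \<in> bcontfun" if "continuous_on UNIV ph" for ph
proof -
 have "cl ` UNIV <= {0..d}" using cl by blast
 from continuous_on_compose2[OF contI[OF that] clc this] have "continuous_on UNIV (%t. I ph (cl t))" .
 moreover have "bounded (range (%t. I ph (cl t)))"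
  using compact_imp_bounded[OF compact_continuous_image[OF contI[OF that] compact_Icc]]
  by (rule bounded_subset) (use cl in auto)
 ultimately show ?thesis by (simp add: bcontfun_def)
qed
define T where "T (ph :: real \<Rightarrow>\<^sub>C 'b) = Bcontfun (%t. I (apply_bcontfun ph) (cl t))" for ph
have cb: "continuous_on UNIV (apply_bcontfun ph)" for ph :: "real \<Rightarrow>\<^sub>C 'b"
 using apply_bcontfun[of ph] by (simp add: bcontfun_def)
have T: "apply_bcontfun (T ph) t = I (apply_bcontfun ph) (cl t)" for ph t
 unfolding T_def by (subst Bcontfun_inverse[OF Ib[OF cb]]) simp
have "dist (T ph) (T \<psi>) <= 1/2 * dist ph \<psi>" for ph \<psi>
proof (rule dist_bound)
 fix t
 let ?t = "cl t"
 have sub: "{0..?t} <= {0..d}" using cl[of t] by auto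
 have int: "(%s. F s (apply_bcontfun ph s)) integrable_on {0..?t}" for ph
  by (intro integrable_continuous_real continuous_on_subset[OF contF[OF cb] sub])
 have "dist (apply_bcontfun (T ph) t) (apply_bcontfun (T \<psi>) t)
  = norm (integral {0..?t} (%s. F s (apply_bcontfun ph s) - F s (apply_bcontfun \<psi> s)))"
  by (simp add: T I_def dist_norm integral_diff[OF int int])
 also have "... <= (K * dist ph \<psi>) * (?t - 0)"
 proof (rule integral_bound)
  show "0 <= ?t" using cl[of t] by simp
  show "continuous_on {0..?t} (%s. F s (apply_bcontfun ph s) - F s (apply_bcontfun \<psi> s))"
   by (intro continuous_on_diff continuous_on_subset[OF contF[OF cb] sub])
  fix s assume "s \<in> {0..?t}"
  hence "norm (F s (apply_bcontfun ph s) - F s (apply_bcontfun \<psi> s)) <= K * norm (apply_bcontfun ph s - apply_bcontfun \<psi> s)"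
   using sub by (intro lip) auto
  also have "... <= K * dist ph \<psi>"
   using dist_bounded[of ph s \<psi>] K by (intro mult_left_mono) (auto simp: dist_norm)
  finally show "norm (F s (apply_bcontfun ph s) - F s (apply_bcontfun \<psi> s)) <= K * dist ph \<psi>" .
 qed
 also have "... <= (K * dist ph \<psi>) * d" using cl[of t] K by (intro mult_left_mono) auto
 also have "... = K * d * dist ph \<psi>" by simp
 also have "... <= 1/2 * dist ph \<psi>" using d(2) by (rule mult_right_mono) simp
 finally show "dist (apply_bcontfun (T ph) t) (apply_bcontfun (T \<psi>) t) <= 1/2 * dist ph \<psi>" .
qed
hence "\<exists>!ph. T ph = ph"
 by (intro banach_fix_type[of "1/2"]) auto
then obtain ph where ph: "T ph = ph" by blast
have eq: "apply_bcontfun ph t = I (apply_bcontfun ph) t" if "t \<in> {0..d}" for t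
 using T[of ph t] ph that by (simp add: cl_def)
show ?thesis
proof (rule that[of "I (apply_bcontfun ph)"])
 show "I (apply_bcontfun ph) 0 = x0" by (simp add: I_def)
 fix t assume t: "t \<in> {0..d}"
 have "((%t. integral {0..t} (%s. F s (apply_bcontfun ph s))) hvd F t (apply_bcontfun ph t)) (at t within {0..d})"
  by (rule integral_has_vector_derivative[OF contF[OF cb] t])
 from has_vector_derivative_add[OF has_vector_derivative_const[of x0] this]
 have "(I (apply_bcontfun ph) hvd F t (apply_bcontfun ph t)) (at t within {0..d})"
  unfolding I_def[abs_def] by simp
 thus "(I (apply_bcontfun ph) hvd F t (I (apply_bcontfun ph) t)) (at t within {0..d})"
  using eq[OF t] by simp
qed
qed

lemma has_derivative_quadratic:
fixes f :: "'a::euclidean_space => 'b::real_normed_vector"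
assumes "linear D" "0 < ep" "!!h. norm h < ep ==> norm (f (z + h) - f z - D h) <= C * (norm h)^2"
shows "(f hfd D) (at z)"
unfolding has_derivative_at_alt
proof (intro conjI allI impI)
show "bounded_linear D" using assms(1) by (simp add: linear_conv_bounded_linear)
fix e :: real assume e: "0 < e"
define d where "d = min ep (e / (\<bar>C\<bar> + 1))"
have d: "0 < d" using e assms(2) by (simp add: d_def)
have "norm (f y - f z - D (y - z)) <= e * norm (y - z)" if "norm (y - z) < d" for y
proof -
 have "norm (f y - f z - D (y - z)) <= C * (norm (y - z))^2"
  using assms(3)[of "y - z"] that by (simp add: d_def)
 also have "... <= (\<bar>C\<bar> + 1) * (norm (y - z) * norm (y - z))"
  unfolding power2_eq_square by (rule mult_right_mono) auto
 also have "... <= (\<bar>C\<bar> + 1) * (e / (\<bar>C\<bar> + 1) * norm (y - z))"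
  using that by (intro mult_left_mono mult_right_mono) (auto simp: d_def)
 also have "... = e * norm (y - z)" using add_nonneg_pos[of "\<bar>C\<bar>" 1] by simp
 finally show ?thesis .
qed
with d show "EX d>0. ALL y. norm (y - z) < d --> norm (f y - f z - D (y - z)) <= e * norm (y - z)" by blast
qed

text \<open>Differentiable dependence on the initial value. Composing \<open>f\<close> with the
  projection onto a ball makes it globally Lipschitz, and solutions started in the half ball do not
  notice, as they move less than \<open>R / 2\<close>. The candidate for the derivative solves the
  linearised equation; the error obeys a linear inequality whose forcing term is quadratic in
  \<open>h\<close>.\<close>

lemma local_flow:
fixes f :: "'a::euclidean_space => 'a"
assumes W: "open W" "z0 \<in> W" and C2: "Ck_on 2 W f"
obtains r d ph D where "0 < r" "0 < d" "cball z0 r <= W"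
 "!!z. z \<in> ball z0 r ==> ph 0 z = z"
 "!!z t. z \<in> ball z0 r ==> t \<in> {0..d} ==> ph t z \<in> W"
 "!!z t. z \<in> ball z0 r ==> t \<in> {0..d} ==>
   ((%t. ph t z) hvd f (ph t z)) (at t within {0..d})"
 "!!z t. z \<in> ball z0 r ==> t \<in> {0..d} ==> (ph t hfd D t z) (at z)"
 "!!z h. z \<in> ball z0 r ==> D 0 z h = h"
 "!!z t h. z \<in> ball z0 r ==> t \<in> {0..d} ==>
   ((%t. D t z h) hvd fd f (ph t z) (D t z h)) (at t within {0..d})"
proof -
obtain R where R: "0 < R" "cball z0 R <= W" using W open_contains_cball by blast
let ?C = "cball z0 R"
have C1: "Ck_on (Suc 0) W f" using Ck_on_le[OF C2, of 1] by simp
obtain K where K: "0 < K" "!!x y. x \<in> ?C ==> y \<in> ?C ==> norm (f x - f y) <= K * norm (x - y)"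
  "!!x v. x \<in> ?C ==> norm (fd f x v) <= K * norm v"
 using C1_lipschitz[OF C1 compact_cball R(2) convex_cball] by blast
obtain C where C': "0 < C" "!!x y v. x \<in> ?C ==> y \<in> ?C ==> norm (fd f x v - fd f y v) <= C * norm (x - y) * norm v"
  "!!x y. x \<in> ?C ==> y \<in> ?C ==> norm (f y - f x - fd f x (y - x)) <= C * (norm (y - x))^2"
 using C2_taylor[OF C2 compact_cball R(2) convex_cball] by blast
note C = C'(1,3)
have cf: "continuous_on ?C f" using Ck_on_continuous[OF C2] R(2) continuous_on_subset by blast
hence "bounded (f ` ?C)" using compact_continuous_image compact_imp_bounded compact_cball by blast
then obtain B where B: "0 < B" "!!x. x \<in> ?C ==> norm (f x) <= B" by (auto simp: bounded_pos)
\<comment> \<open>The first entry makes the Picard and Gronwall factors at most \<open>1/2\<close>,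
  the second limits every displacement to \<open>R / 4\<close>.\<close>
define d where "d = min (1 / (2 * K)) (R / (4 * B))"
have d: "0 < d" "K * d <= 1/2" "B * d < R/2"
proof -
 show "0 < d" using K B R by (simp add: d_def)
 have "K * d <= K * (1 / (2 * K))" using K by (intro mult_left_mono) (auto simp: d_def)
 thus "K * d <= 1/2" using K by simp
 have "B * d <= B * (R / (4 * B))" using B by (intro mult_left_mono) (auto simp: d_def)
 thus "B * d < R/2" using B R by simp
qed
define c where "c = closest_point ?C"
have ne: "?C ~= {}" using R(1) by simp
have c: "c x \<in> ?C" "norm (c x - c y) <= norm (x - y)" "x \<in> ?C ==> c x = x" for x y
 unfolding c_def using closest_point_in_set[OF closed_cball ne]
  closest_point_lipschitz[OF convex_cball closed_cball ne, of x y] closest_point_self[of x ?C]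
 by (auto simp: dist_norm simp del: mem_cball)
have cc: "continuous_on UNIV c" unfolding c_def by (rule continuous_on_closest_point[OF convex_cball closed_cball ne])
have fc: "continuous_on ({0..d} \<times> UNIV) (%(t, x). f (c x))"
proof -
 have "continuous_on ({0..d} \<times> UNIV) (%p. c (snd p))"
  by (rule continuous_on_compose2[OF cc]) (auto intro!: continuous_intros)
 moreover have "(%p. c (snd p)) ` ({0..d} \<times> UNIV) <= ?C" using c(1) by blast
 ultimately show ?thesis using continuous_on_compose2[OF cf] by (simp add: case_prod_beta)
qed
have fl: "norm (f (c x) - f (c y)) <= K * norm (x - y)" for x y
 using K(2)[OF c(1) c(1)] c(2) K(1) by (meson mult_left_mono less_imp_le order_trans)
have "EX ph. ph 0 = z & (ALL t:{0..d}. (ph hvd f (c (ph t))) (at t within {0..d}))" for z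
 using picard[OF d(1,2) fc fl, of z] K(1) by (metis less_imp_le)
then obtain Ph where Ph: "!!z. Ph z 0 = z"
 "!!z t. t \<in> {0..d} ==> (Ph z hvd f (c (Ph z t))) (at t within {0..d})" by metis
have z0: "0 \<in> {0..d}" using d by simp
have inC: "Ph z t \<in> ?C" if "z \<in> ball z0 (R/2)" "t \<in> {0..d}" for z t
proof -
 have "norm (Ph z t - Ph z 0) <= B * \<bar>t - 0\<bar>"
  by (rule vector_derivative_bound[OF Ph(2) _ z0 that(2)]) (use B c in auto)
 also have "... <= B * d" using that B by (intro mult_left_mono) auto
 finally have "norm (Ph z t - z) < R/2" using d Ph(1) by simp
 moreover have "norm (z - z0) < R/2" using that by (simp add: dist_norm norm_minus_commute)
 ultimately have "norm (Ph z t - z0) < R" using norm_triangle_ineq[of "Ph z t - z" "z - z0"] by simp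
 thus ?thesis by (simp add: dist_norm norm_minus_commute)
qed
have sol: "(Ph z hvd f (Ph z t)) (at t within {0..d})" if "z \<in> ball z0 (R/2)" "t \<in> {0..d}" for z t
 using Ph(2)[OF that(2), of z] c(3)[OF inC[OF that]] by simp
have lipz: "norm (Ph z t - Ph w t) <= 2 * norm (z - w)"
 if "z \<in> ball z0 (R/2)" "w \<in> ball z0 (R/2)" "t \<in> {0..d}" for z w t
proof -
 have "norm (Ph z t - Ph w t) <= 2 * (norm (Ph z 0 - Ph w 0) + 0 * (d - 0))"
 proof (rule gronwall_short[where u' = "%t. f (Ph z t) - f (Ph w t)" and K = K, OF _ _ _ _ _ that(3)])
  show "((%t. Ph z t - Ph w t) hvd f (Ph z t) - f (Ph w t)) (at t within {0..d})"
   if "t \<in> {0..d}" for t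
   using \<open>z \<in> _\<close> \<open>w \<in> _\<close> that by (intro has_vector_derivative_diff sol)
 qed (use that K d inC in auto)
 thus ?thesis using Ph(1) by simp
qed
have "EX u. u 0 = h & (ALL t:{0..d}. (u hvd fd f (Ph z t) (u t)) (at t within {0..d}))"
 if z: "z \<in> ball z0 (R/2)" for z h
proof -
 have lin: "linear (fd f (Ph z t))" if "t \<in> {0..d}" for t
  using inC[OF z that] R(2) C1 by (intro fd_linear) auto
 have cPh: "continuous_on {0..d} (Ph z)"
  by (rule vd_continuous_on[OF sol[OF z]])
 have "continuous_on {0..d} (%t. fd f (Ph z t) b)" for b
 proof (rule continuous_on_compose2[OF _ cPh])
  show "continuous_on ?C (%x. fd f x b)" using C1 R(2) by (auto intro: continuous_on_subset)
 qed (use inC[OF z] in auto)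
 hence cb: "continuous_on ({0..d} \<times> UNIV) (%p. fd f (Ph z (fst p)) b)" for b
  by (rule continuous_on_compose2) (auto intro!: continuous_intros)
 have "continuous_on ({0..d} \<times> UNIV) (%p. \<Sum>b\<in>Basis. (snd p \<bullet> b) *R fd f (Ph z (fst p)) b)"
  by (intro continuous_intros cb)
 moreover have "(\<Sum>b\<in>Basis. (snd p \<bullet> b) *R fd f (Ph z (fst p)) b) = (%(t, x). fd f (Ph z t) x) p"
  if "p \<in> {0..d} \<times> UNIV" for p
 proof -
  have l: "linear (fd f (Ph z (fst p)))" using that by (intro lin) auto
  have "fd f (Ph z (fst p)) (snd p) = fd f (Ph z (fst p)) (\<Sum>b\<in>Basis. (snd p \<bullet> b) *R b)"
   by (simp add: euclidean_representation)
  thus ?thesis by (simp add: linear_sum[OF l] linear_cmul[OF l] case_prod_beta)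
 qed
 ultimately have "continuous_on ({0..d} \<times> UNIV) (%(t, x). fd f (Ph z t) x)"
  by (subst continuous_on_cong[OF refl, symmetric])
 from picard[OF d(1,2) this, of h] show ?thesis
  using K(3)[OF inC[OF z]] K(1) linear_diff[OF lin] by (metis less_imp_le)
qed
hence "ALL z h. EX u. z \<in> ball z0 (R/2) -->
 u 0 = h & (ALL t:{0..d}. (u hvd fd f (Ph z t) (u t)) (at t within {0..d}))" by metis
then obtain U where U: "!!z h. z \<in> ball z0 (R/2) ==> U z h 0 = h"
 "!!z h t. z \<in> ball z0 (R/2) ==> t \<in> {0..d} ==> (U z h hvd fd f (Ph z t) (U z h t)) (at t within {0..d})"
 by metis
have uniq: "u t = 0" if z: "z \<in> ball z0 (R/2)" "t \<in> {0..d}" and u: "u 0 = 0"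
 "!!t. t \<in> {0..d} ==> (u hvd fd f (Ph z t) (u t)) (at t within {0..d})" for u z t
proof -
 have "norm (u t) <= 2 * (norm (u 0) + 0 * (d - 0))"
  by (rule gronwall_short[OF u(2) _ _ _ _ z(2), where K = K]) (use K(1) K(3)[OF inC[OF z(1)]] d in auto)
 thus ?thesis using u(1) by simp
qed
have Dlin: "linear (%h. U z h t)" if z: "z \<in> ball z0 (R/2)" "t \<in> {0..d}" for z t
proof (rule linearI)
 have lin: "linear (fd f (Ph z t))" if "t \<in> {0..d}" for t
  using inC[OF z(1) that] R(2) C1 by (intro fd_linear) auto
 show "U z (h + k) t = U z h t + U z k t" for h k
 proof -
  have "(%t. U z (h + k) t - U z h t - U z k t) t = 0"
  proof (rule uniq[OF z])
   show "((%t. U z (h + k) t - U z h t - U z k t) hvd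
    fd f (Ph z t) (U z (h + k) t - U z h t - U z k t)) (at t within {0..d})" if "t \<in> {0..d}" for t
    unfolding linear_diff[OF lin[OF that]] by (intro has_vector_derivative_diff U z that)
  qed (simp add: U(1)[OF z(1)])
  thus ?thesis by (simp add: algebra_simps)
 qed
 show "U z (a *R h) t = a *R U z h t" for a h
 proof -
  have "(%t. U z (a *R h) t - a *R U z h t) t = 0"
  proof (rule uniq[OF z])
   show "((%t. U z (a *R h) t - a *R U z h t) hvd
    fd f (Ph z t) (U z (a *R h) t - a *R U z h t)) (at t within {0..d})" if "t \<in> {0..d}" for t
    unfolding linear_diff[OF lin[OF that]] linear_cmul[OF lin[OF that]]
    by (intro has_vector_derivative_diff bounded_linear.has_vector_derivative[OF bounded_linear_scaleR_right] U z that)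
  qed (simp add: U(1)[OF z(1)])
  thus ?thesis by simp
 qed
qed
have der: "((%z. Ph z t) hfd (%h. U z h t)) (at z)" if z: "z \<in> ball z0 (R/2)" and t: "t \<in> {0..d}" for z t
proof -
 obtain ep where ep: "0 < ep" "ball z ep <= ball z0 (R/2)" using z open_contains_ball open_ball by blast
 show ?thesis
 proof (rule has_derivative_quadratic[OF Dlin[OF z t] ep(1)])
  fix h :: 'a assume h: "norm h < ep"
  hence "z + h \<in> ball z ep" by (simp add: dist_norm)
  hence zh: "z + h \<in> ball z0 (R/2)" using ep(2) by blast
  let ?e = "%t. Ph (z + h) t - Ph z t - U z h t"
  have "norm (?e t) <= 2 * (norm (?e 0) + (C * (2 * norm h)^2) * (d - 0))"
  proof (rule gronwall_short[where K = K and u' = "%t. f (Ph (z + h) t) - f (Ph z t) - fd f (Ph z t) (U z h t)", OF _ _ _ _ _ t])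
   show "(?e hvd f (Ph (z + h) t) - f (Ph z t) - fd f (Ph z t) (U z h t)) (at t within {0..d})"
    if "t \<in> {0..d}" for t by (intro has_vector_derivative_diff U sol z zh that)
   show "norm (f (Ph (z + h) t) - f (Ph z t) - fd f (Ph z t) (U z h t)) <= K * norm (?e t) + C * (2 * norm h)^2"
    if t: "t \<in> {0..d}" for t
   proof -
    have lin: "linear (fd f (Ph z t))" using inC[OF z t] R(2) C1 by (intro fd_linear) auto
    have "f (Ph (z + h) t) - f (Ph z t) - fd f (Ph z t) (U z h t)
     = (f (Ph (z + h) t) - f (Ph z t) - fd f (Ph z t) (Ph (z + h) t - Ph z t)) + fd f (Ph z t) (?e t)"
     unfolding linear_diff[OF lin] by simp
    also have "norm ... <= C * (norm (Ph (z + h) t - Ph z t))^2 + K * norm (?e t)"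
     by (rule norm_triangle_le) (rule add_mono[OF C(2)[OF inC[OF z t] inC[OF zh t]] K(3)[OF inC[OF z t]]])
    also have "(norm (Ph (z + h) t - Ph z t))^2 <= (2 * norm h)^2"
     using lipz[OF zh z t] by (intro power_mono) auto
    finally show ?thesis using C(1) by simp
   qed
  qed (use K d C in auto)
  also have "norm (?e 0) = 0" using U(1)[OF z] Ph(1) by simp
  finally show "norm (Ph (z + h) t - Ph z t - U z h t) <= (8 * C * d) * (norm h)^2"
   by (simp add: power_mult_distrib mult_ac)
 qed
qed
show ?thesis
proof (rule that[of "R/2" d "%t z. Ph z t" "%t z h. U z h t"])
 show "cball z0 (R/2) <= W" using R by auto
 show "Ph z t \<in> W" if "z \<in> ball z0 (R/2)" "t \<in> {0..d}" for z t using inC[OF that] R(2) by blast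
qed (use R d Ph sol der U in auto)
qed

lemma ode_unique_local:
fixes f :: "'a::euclidean_space => 'a"
assumes W: "open W" and C1: "Ck_on (Suc 0) W f" and "a < b"
 and x: "!!t. t \<in> {a..b} ==> (x hvd f (x t)) (at t within {a..b})"
 and y: "!!t. t \<in> {a..b} ==> (y hvd f (y t)) (at t within {a..b})"
 and "x a = y a" "x a \<in> W"
obtains e where "0 < e" "!!t. t \<in> {a..b} ==> t <= a + e ==> x t = y t"
proof -
obtain R where R: "0 < R" "cball (x a) R <= W" using W assms(7) open_contains_cball by blast
let ?C = "cball (x a) R"
obtain K where K: "0 < K" "!!p q. p \<in> ?C ==> q \<in> ?C ==> norm (f p - f q) <= K * norm (p - q)"
  "!!p v. p \<in> ?C ==> norm (fd f p v) <= K * norm v"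
 using C1_lipschitz[OF C1 compact_cball R(2) convex_cball] by blast
have a: "a \<in> {a..b}" using assms(3) by simp
have nb: "EX e>0. ALL t:{a..b}. t <= a + e --> u t \<in> ?C"
 if u: "(u hvd u') (at a within {a..b})" "u a = x a" for u u'
proof -
 have "continuous (at a within {a..b}) u" using has_vector_derivative_continuous[OF u(1)] .
 then obtain e where "0 < e" "!!t. t \<in> {a..b} ==> dist t a < e ==> dist (u t) (u a) < R"
  using R(1) unfolding continuous_within_eps_delta by blast
 have "u t \<in> ?C" if "t \<in> {a..b}" "t <= a + e/2" for t
 proof -
  have "dist t a < e" using that \<open>0 < e\<close> by (simp add: dist_real_def)
  from \<open>!!t. t \<in> {a..b} ==> dist t a < e ==> dist (u t) (u a) < R\<close>[OF that(1) this]
  show ?thesis using u(2) by (simp add: dist_commute)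
 qed
 thus ?thesis using \<open>0 < e\<close> by (intro exI[of _ "e/2"]) simp
qed
obtain e1 where e1: "0 < e1" "!!t. t \<in> {a..b} ==> t <= a + e1 ==> x t \<in> ?C" using nb[OF x[OF a]] by auto
obtain e2 where e2: "0 < e2" "!!t. t \<in> {a..b} ==> t <= a + e2 ==> y t \<in> ?C" using nb[OF y[OF a]] assms(6) by auto
define e where "e = min (min e1 e2) (min (1 / (2 * K)) (b - a))"
have e: "0 < e" "e <= e1" "e <= e2" "K * e <= 1/2" "e <= b - a"
proof -
 show "0 < e" "e <= e1" "e <= e2" "e <= b - a" using e1 e2 K assms(3) by (auto simp: e_def)
 have "K * e <= K * (1 / (2 * K))" using K by (intro mult_left_mono) (auto simp: e_def)
 thus "K * e <= 1/2" using K by simp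
qed
have "x t = y t" if t: "t \<in> {a..b}" "t <= a + e" for t
proof -
 have sub: "{a..a + e} <= {a..b}" using e by auto
 have "norm (x t - y t) <= 2 * (norm (x a - y a) + 0 * (a + e - a))"
 proof (rule gronwall_short[where K = K and u' = "%t. f (x t) - f (y t)"])
  fix s assume s: "s \<in> {a..a + e}"
  show "((%t. x t - y t) hvd f (x s) - f (y s)) (at s within {a..a + e})"
   using s sub by (intro has_vector_derivative_diff hvd_sub[OF x sub]
    hvd_sub[OF y sub]) auto
  show "norm (f (x s) - f (y s)) <= K * norm (x s - y s) + 0" using K(2) e1 e2 s e sub by auto
 qed (use e K t in auto)
 thus ?thesis using assms(6) by simp
qed
with e(1) that show ?thesis by blast
qed

text \<open>Induction along an interval: the property extends a little beyond every initial segment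
  and survives limits. It carries the continuation arguments below: uniqueness of geodesics,
  regularity of the flow, confinement of short curves.\<close>

lemma real_induct:
fixes P :: "real => bool"
assumes ab: "a <= b" and base: "P a"
 and step: "!!t. a <= t ==> t < b ==> (!!s. a <= s ==> s <= t ==> P s) ==> EX e>0. ALL s. t < s & s <= t + e & s <= b --> P s"
 and lim: "!!t. a < t ==> t <= b ==> (!!s. a <= s ==> s < t ==> P s) ==> P t"
 and t: "a <= t" "t <= b"
shows "P t"
proof (rule ccontr)
assume np: "\<not> P t"
define A where "A = {s. a <= s & s <= b & \<not> P s}"
have A: "A ~= {}" "bdd_below A" using np t by (auto simp: A_def)
define m where "m = Inf A"
have am: "a <= m" unfolding m_def by (rule cInf_greatest[OF A(1)]) (simp add: A_def)
have mt: "m <= t" unfolding m_def using np t by (intro cInf_lower A) (simp add: A_def)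
have below: "P s" if "a <= s" "s < m" for s
proof (rule ccontr)
 assume "\<not> P s"
 hence "s \<in> A" using that mt t by (simp add: A_def)
 thus False using cInf_lower[OF _ A(2)] that unfolding m_def by fastforce
qed
have Pm: "P m"
proof (cases "m = a")
 case False thus ?thesis using lim[of m] below am mt t by auto
qed (simp add: base)
hence mb: "m < b" using np mt t by (cases "m = t") auto
obtain e where e: "0 < e" "!!s. m < s ==> s <= m + e ==> s <= b ==> P s"
 using step[OF am mb] below Pm by (metis le_less)
have "m + e <= s" if "s \<in> A" for s
proof (rule ccontr)
 assume "\<not> m + e <= s"
 moreover have "m <= s" using that A(2) unfolding m_def by (rule cInf_lower)
 ultimately have "P s" using e(2)[of s] Pm that by (cases "s = m") (auto simp: A_def)
 thus False using that by (simp add: A_def)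
qed
hence "m + e <= Inf A" by (rule cInf_greatest[OF A(1)])
thus False using e(1) by (simp add: m_def)
qed

section \<open>Berwald manifolds in charts\<close>

lemma fd_component:
fixes f :: "'a::real_normed_vector => real ^ 'n::finite"
assumes "f differentiable (at x)" shows "fd (%x. f x $ i) x v = fd f x v $ i"
using fd_eqI[OF bounded_linear.has_derivative[OF bounded_linear_vec_nth fd_works[OF assms]]] by simp

lemma fd_fd_commute_vec:
fixes f :: "'a::real_normed_vector => real ^ 'n::finite"
assumes S: "open S" "x \<in> S" and C: "smooth_on S f"
shows "fd (%y. fd f y u) x v = fd (%y. fd f y v) x u"
proof -
have d: "f differentiable (at y)" "(%y. fd f y u) differentiable (at y)" if "y \<in> S" for y u
 using smooth_on_hfd[OF C that] smooth_on_hfd[OF smooth_on_fd[OF C] that]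
 unfolding differentiable_def by blast+
have "fd (%y. fd f y u) x v $ i = fd (%y. fd (%x. f x $ i) y u) x v" for i u v
proof -
 have "fd (%y. fd f y u) x v $ i = fd (%y. fd f y u $ i) x v"
  by (rule fd_component[OF d(2)[OF S(2)], symmetric])
 also have "... = fd (%y. fd (%x. f x $ i) y u) x v"
  by (subst fd_cong_open(1)[OF S, where g = "%y. fd (%x. f x $ i) y u"]) (simp_all add: fd_component d)
 finally show ?thesis .
qed
thus ?thesis
 using fd_fd_commute[OF S smooth_onD[OF smooth_on_component[OF S(1) C]]] by (simp add: vec_eq_iff)
qed

declare split_paired_All[simp del] split_paired_Ex[simp del]

locale finsler_mfd =
fixes M :: "('m, 'n::finite) finsler_space"
assumes fin: "finsler_manifold M"
begin

abbreviation "PM \<equiv> points M"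
abbreviation "vlc \<equiv> velocity M"
abbreviation "AM \<equiv> atlas M"
abbreviation "dst \<equiv> fdist M"
abbreviation "Ch \<equiv> charts_at M"
abbreviation "TM \<equiv> tangent M"
abbreviation "cmap I \<equiv> continuous_map (top_of_set I) (topo M)"
abbreviation "cdom c \<equiv> snd c ` fst (c :: ('m, 'n) chart)"
abbreviation "LM \<equiv> local_metric M"
abbreviation "Dt c c' x \<equiv> fd (transition c c') (snd c x)"

lemma mfd: "smooth_manifold M" using fin by (simp add: finsler_manifold_def)

lemma haus: "Hausdorff_space (topo M)" using mfd by (simp add: smooth_manifold_def)

lemma chart_open: assumes "c \<in> AM" shows "openin (topo M) (fst c)" "open (cdom c)"
 "homeomorphic_map (subtopology (topo M) (fst c)) (top_of_set (cdom c)) (snd c)"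
using mfd assms unfolding smooth_manifold_def by blast+

lemma chart_sub: "c \<in> AM ==> fst c <= PM"
using chart_open(1) openin_subset by blast

lemma cover: assumes "x \<in> PM" obtains c where "c \<in> Ch x"
proof -
have "(\<Union>c\<in>AM. fst c) = PM" using mfd unfolding smooth_manifold_def by blast
thus ?thesis using assms that unfolding charts_at_def by blast
qed

lemma chD: "c \<in> Ch x ==> c \<in> AM" "c \<in> Ch x ==> x \<in> fst c"
 "c \<in> Ch x ==> x \<in> PM"
unfolding charts_at_def using chart_sub by blast+

lemma chart_inj: assumes "c \<in> AM" shows "inj_on (snd c) (fst c)"
proof -
have "topspace (subtopology (topo M) (fst c)) = fst c" using chart_sub[OF assms] by auto
thus ?thesis using homeomorphic_imp_injective_map[OF chart_open(3)[OF assms]] by simp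
qed

lemma chart_inv: assumes "c \<in> AM"
shows "x \<in> fst c ==> ci c (snd c x) = x" "xi \<in> cdom c ==> snd c (ci c xi) = xi"
 "xi \<in> cdom c ==> ci c xi \<in> fst c"
unfolding chart_inv_def using chart_inj[OF assms]
by (auto simp: inv_into_f_f f_inv_into_f inv_into_into)

lemma chart_cont: assumes "c \<in> AM"
shows "continuous_map (subtopology (topo M) (fst c)) euclidean (snd c)"
 "continuous_map (top_of_set (cdom c)) (topo M) (ci c)"
proof -
have "continuous_map (subtopology (topo M) (fst c)) (top_of_set (cdom c)) (snd c)"
 by (rule homeomorphic_imp_continuous_map[OF chart_open(3)[OF assms]])
thus "continuous_map (subtopology (topo M) (fst c)) euclidean (snd c)"
 using continuous_map_into_fulltopology by blast
obtain g where g: "homeomorphic_maps (subtopology (topo M) (fst c)) (top_of_set (cdom c)) (snd c) g"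
 using chart_open(3)[OF assms] homeomorphic_map_maps by blast
have "continuous_map (top_of_set (cdom c)) (topo M) g"
 using g continuous_map_into_fulltopology unfolding homeomorphic_maps_def by blast
moreover have "g xi = ci c xi" if xi: "xi \<in> topspace (top_of_set (cdom c))" for xi
proof -
 obtain x where x: "x \<in> fst c" "xi = snd c x" using xi by auto
 hence "x \<in> topspace (subtopology (topo M) (fst c))" using chart_sub[OF assms] by auto
 hence "g (snd c x) = x" using g unfolding homeomorphic_maps_def by blast
 thus ?thesis using x chart_inv(1)[OF assms] by simp
qed
ultimately show "continuous_map (top_of_set (cdom c)) (topo M) (ci c)"
 by (rule continuous_map_eq)
qed

lemma transition_chart: "c \<in> Ch x ==> transition c c' (snd c x) = snd c' x"
using chD chart_inv(1) by (simp add: transition_def)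

lemma overlap_open: assumes "c \<in> AM" "c' \<in> AM" shows "open (snd c ` (fst c Int fst c'))"
proof -
have "openin (subtopology (topo M) (fst c)) (fst c Int fst c')"
 using chart_open(1)[OF assms(2)] by (metis Int_commute openin_subtopology_Int)
hence "openin (top_of_set (cdom c)) (snd c ` (fst c Int fst c'))"
 using homeomorphic_imp_open_map[OF chart_open(3)[OF assms(1)]] unfolding open_map_def by blast
thus ?thesis using openin_open_trans chart_open(2)[OF assms(1)] by blast
qed

lemma transition_smooth: "c \<in> AM ==> c' \<in> AM ==> smooth_on (snd c ` (fst c Int fst c')) (transition c c')"
using mfd unfolding smooth_manifold_def by blast

lemma in_overlap: "c \<in> Ch x ==> c' \<in> Ch x ==> snd c x \<in> snd c ` (fst c Int fst c')"
by (auto simp: charts_at_def)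

lemma transition_deriv: assumes "c \<in> Ch x" "c' \<in> Ch x"
shows "(transition c c' hfd Dt c c' x) (at (snd c x))"
using smooth_on_hfd[OF transition_smooth[OF chD(1)[OF assms(1)] chD(1)[OF assms(2)]] in_overlap[OF assms]] .

lemma Dt_linear: "c \<in> Ch x ==> c' \<in> Ch x ==> linear (Dt c c' x)"
using has_derivative_linear[OF transition_deriv] .

lemma Dt_compose: assumes "c \<in> Ch x" "c' \<in> Ch x" "c'' \<in> Ch x"
shows "Dt c' c'' x (Dt c c' x u) = Dt c c'' x u"
proof -
have d: "(transition c' c'' hfd Dt c' c'' x) (at (transition c c' (snd c x)))"
 using transition_deriv[OF assms(2,3)] transition_chart[OF assms(1)] by simp
note a = chD(1)[OF assms(1)] chD(1)[OF assms(2)] chD(1)[OF assms(3)]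
have "(transition c c'' hfd (%u. Dt c' c'' x (Dt c c' x u))) (at (snd c x))"
proof (rule htw_open[OF diff_chain_at[OF transition_deriv[OF assms(1,2)] d, unfolded o_def]
  overlap_open[OF a(1,2)] in_overlap[OF assms(1,2)]])
 fix xi assume "xi \<in> snd c ` (fst c Int fst c')"
 then obtain x where x: "x \<in> fst c" "x \<in> fst c'" "xi = snd c x" by auto
 thus "transition c' c'' (transition c c' xi) = transition c c'' xi"
  using a chart_inv(1) by (simp add: transition_def)
qed
thus ?thesis using fd_eqI by metis
qed

lemma Dt_self: assumes "c \<in> Ch x" shows "Dt c c x u = u"
proof -
note a = chD(1)[OF assms]
have "(transition c c hfd (%u. u)) (at (snd c x))"
 by (rule htw_open[OF has_derivative_ident chart_open(2)[OF a]])
   (use assms a in "auto simp: transition_def chart_inv charts_at_def")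
thus ?thesis using fd_eqI by metis
qed

lemma Dt_inv: "c \<in> Ch x ==> c' \<in> Ch x ==> Dt c' c x (Dt c c' x u) = u"
using Dt_compose[of c x c' c] Dt_self by simp

lemma Dt_zero: "c \<in> Ch x ==> c' \<in> Ch x ==> Dt c c' x u = 0 \<longleftrightarrow> u = 0"
using Dt_inv linear_0[OF Dt_linear] by metis

lemma coord_tvec_tangent: assumes "c \<in> Ch x" shows "coord_tvec M c x u \<in> TM x" "coord_tvec M c x u c = u"
using assms Dt_compose Dt_self by (auto simp: tangent_def coord_tvec_def)

lemma tangentD: "v \<in> TM x ==> c \<in> Ch x ==> c' \<in> Ch x ==> v c' = Dt c c' x (v c)"
"v \<in> TM x ==> c \<notin> Ch x ==> v c = 0"
unfolding tangent_def by blast+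

lemma tangent_coord: assumes "v \<in> TM x" "c \<in> Ch x" shows "coord_tvec M c x (v c) = v"
proof
fix c' show "coord_tvec M c x (v c) c' = v c'"
 using tangentD(1)[OF assms, of c'] tangentD(2)[OF assms(1), of c'] by (simp add: coord_tvec_def)
qed

lemma tangent_eqI: "v \<in> TM x ==> w \<in> TM x ==> c \<in> Ch x ==> v c = w c ==> v = w"
using tangent_coord[of v x c] tangent_coord[of w x c] by metis

lemma tangent_linear:
assumes v: "v \<in> TM x" and w: "w \<in> TM x"
shows "(%c. a *R v c + b *R w c) \<in> TM x"
unfolding tangent_def
proof (intro CollectI conjI ballI allI impI)
fix c c' assume c: "c \<in> Ch x" "c' \<in> Ch x"
show "a *R v c' + b *R w c' = Dt c c' x (a *R v c + b *R w c)"
 unfolding linear_add[OF Dt_linear[OF c]] linear_cmul[OF Dt_linear[OF c]]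
 by (simp only: tangentD(1)[OF v c] tangentD(1)[OF w c])
qed (use v w in "simp add: tangentD(2)")

lemma tangent_tscale: "v \<in> TM x ==> tscale a v \<in> TM x"
using tangent_linear[of v x v a 0] by (simp add: tscale_def)

lemma tangent_tzero: "tzero \<in> TM x"
unfolding tangent_def tzero_def
proof (intro CollectI conjI ballI allI impI)
fix c c' assume c: "c \<in> Ch x" "c' \<in> Ch x"
show "0 = Dt c c' x 0" using linear_0[OF Dt_linear[OF c]] by simp
qed simp

lemma coord_tvec_tscale:
assumes "c \<in> Ch x" shows "coord_tvec M c x (a *R u) = tscale a (coord_tvec M c x u)"
proof
fix c'
show "coord_tvec M c x (a *R u) c' = tscale a (coord_tvec M c x u) c'"
 using linear_cmul[OF Dt_linear[OF assms, of c']] by (cases "c' \<in> Ch x") (simp_all add: coord_tvec_def tscale_def)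
qed

lemma coord_tvec_change: "c \<in> Ch x ==> c' \<in> Ch x ==> coord_tvec M c' x (Dt c c' x u) = coord_tvec M c x u"
using Dt_compose by (auto simp: coord_tvec_def fun_eq_iff)

lemma fnorm_coord: "c \<in> Ch x ==> v \<in> TM x ==> fnorm M x v = LM c (snd c x, v c)"
using chD chart_inv(1) tangent_coord by (simp add: local_metric_def)

lemma LM_change: "c \<in> Ch x ==> c' \<in> Ch x ==> LM c' (snd c' x, Dt c c' x u) = LM c (snd c x, u)"
using chD chart_inv(1) coord_tvec_change by (simp add: local_metric_def)

lemma charts_at_inv: "c \<in> AM ==> xi \<in> cdom c ==> c \<in> Ch (ci c xi)"
by (simp add: charts_at_def chart_inv(3))

lemma cmetric: assumes "c \<in> AM" shows "cmetric (LM c) (cdom c)"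
proof
show "open (cdom c)" by (rule chart_open(2)[OF assms])
show "smooth_on (cdom c \<times> (UNIV - {0})) (LM c)" using fin assms unfolding finsler_manifold_def by blast
fix xi y assume "xi \<in> cdom c"
hence x: "c \<in> Ch (ci c xi)" and p: "ci c xi \<in> PM"
 using charts_at_inv[OF assms] chD by blast+
show "LM c (xi, t *R y) = t * LM c (xi, y)" if "0 < t" for t
 using fin p coord_tvec_tangent(1)[OF x] that unfolding finsler_manifold_def local_metric_def
 by (simp add: coord_tvec_tscale[OF x])
show "0 <= LM c (xi, y)"
 using fin p coord_tvec_tangent(1)[OF x] unfolding finsler_manifold_def local_metric_def by simp
next
fix xi y v :: "real ^ 'n" assume "xi \<in> cdom c" "y ~= 0" "v ~= 0"
thus "0 < fund_form (LM c) (xi, y) v v" using fin assms unfolding finsler_manifold_def by blast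
qed

lemmas chm = cmetric[OF chD(1)]

abbreviation "QQ c \<equiv> cmetric.Q (LM c)"
abbreviation "QQ1 c \<equiv> cmetric.Q1 (LM c)"
abbreviation "GG c \<equiv> cmetric.G (LM c)"

lemma in_cdom: "c \<in> Ch x ==> snd c x \<in> cdom c"
by (auto simp: charts_at_def)

section \<open>Change of charts for the metric\<close>

lemma QQ_change: assumes "c \<in> Ch x" "c' \<in> Ch x"
shows "QQ c' (snd c' x, Dt c c' x u) = QQ c (snd c x, u)"
using LM_change[OF assms] cmetric.Q_def[OF cmetric] chD(1)[OF assms(1)] chD(1)[OF assms(2)] by simp

lemma pair_in_S: "c \<in> Ch x ==> y ~= 0 ==> (snd c x, y) \<in> cdom c \<times> (UNIV - {0})"
by (simp add: in_cdom)

lemma QQ1_change: assumes c: "c \<in> Ch x" "c' \<in> Ch x" and y: "y ~= 0"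
shows "QQ1 c' (0, Dt c c' x w) (snd c' x, Dt c c' x y) = QQ1 c (0, w) (snd c x, y)"
proof -
interpret C: cmetric "LM c" "cdom c" by (rule cmetric[OF chD(1)[OF c(1)]])
interpret C': cmetric "LM c'" "cdom c'" by (rule cmetric[OF chD(1)[OF c(2)]])
let ?A = "Dt c c' x"
have Ay: "?A y ~= 0" using Dt_zero[OF c] y by simp
have d: "((%y. (snd c x, y)) hfd (%h. (0, h))) (at y)" by (auto intro!: derivative_eq_intros)
have d': "((%y. (snd c' x, ?A y)) hfd (%h. (0, ?A h))) (at y)"
 using linear_imp_has_derivative[OF Dt_linear[OF c]] by (auto intro!: derivative_eq_intros)
have 1: "((%y. C.Q (snd c x, y)) hfd (%h. C.Q1 (0, h) (snd c x, y))) (at y)"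
 using diff_chain_at[OF d fd_works[OF C.diff_Q(1)[OF pair_in_S[OF c(1) y]]]] by (simp add: o_def C.Q1_def)
have 2: "((%y. C'.Q (snd c' x, ?A y)) hfd (%h. C'.Q1 (0, ?A h) (snd c' x, ?A y))) (at y)"
 using diff_chain_at[OF d' fd_works[OF C'.diff_Q(1)[OF pair_in_S[OF c(2) Ay]]]] by (simp add: o_def C'.Q1_def)
show ?thesis using has_derivative_unique[OF 1 2[unfolded QQ_change[OF c]]] by metis
qed

text \<open>A transition map acts linearly on each tangent space, so fibre derivatives of the
  invariant function \<open>F^2\<close> transform without correction terms.\<close>

lemma GG_change: assumes c: "c \<in> Ch x" "c' \<in> Ch x" and y: "y ~= 0"
shows "GG c' (snd c' x, Dt c c' x y) (Dt c c' x u) (Dt c c' x w) = GG c (snd c x, y) u w"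
proof -
interpret C: cmetric "LM c" "cdom c" by (rule cmetric[OF chD(1)[OF c(1)]])
interpret C': cmetric "LM c'" "cdom c'" by (rule cmetric[OF chD(1)[OF c(2)]])
let ?A = "Dt c c' x"
have Ay: "?A y ~= 0" using Dt_zero[OF c] y by simp
have d: "((%y. (snd c x, y)) hfd (%h. (0, h))) (at y)" by (auto intro!: derivative_eq_intros)
have d': "((%y. (snd c' x, ?A y)) hfd (%h. (0, ?A h))) (at y)"
 using linear_imp_has_derivative[OF Dt_linear[OF c]] by (auto intro!: derivative_eq_intros)
have 1: "((%y. C.Q1 (0, u) (snd c x, y)) hfd (%h. C.Q2 (0, u) (0, h) (snd c x, y))) (at y)"
 using diff_chain_at[OF d fd_works[OF C.diff_Q(2)[OF pair_in_S[OF c(1) y]]]] by (simp add: o_def C.Q2_def)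
have 2: "((%y. C'.Q1 (0, ?A u) (snd c' x, ?A y)) hfd (%h. C'.Q2 (0, ?A u) (0, ?A h) (snd c' x, ?A y))) (at y)"
 using diff_chain_at[OF d' fd_works[OF C'.diff_Q(2)[OF pair_in_S[OF c(2) Ay]]]] by (simp add: o_def C'.Q2_def)
have 3: "((%y. C.Q1 (0, u) (snd c x, y)) hfd (%h. C'.Q2 (0, ?A u) (0, ?A h) (snd c' x, ?A y))) (at y)"
 by (rule htw_open[OF 2 C.slit]) (use y QQ1_change[OF c] in auto)
show ?thesis unfolding C.G_def C'.G_def using has_derivative_unique[OF 1 3] by metis
qed

end

locale berwald_mfd = finsler_mfd M for M :: "('m, 'n::finite) finsler_space" +
assumes bw: "berwald M"
begin

lemma cberwald: assumes "c \<in> AM" shows "cberwald (LM c) (cdom c)"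
proof -
interpret C: cmetric "LM c" "cdom c" by (rule cmetric[OF assms])
show ?thesis
proof
 fix x y :: "real ^ 'n" assume "x \<in> cdom c" and y: "y ~= 0"
 then obtain p where p: "p \<in> fst c" "x = snd c p" by auto
 show "pd_y s (%z. chern (LM c) z i j k) (x, y) = 0" for s i j k
  using bw assms p y unfolding berwald_def by blast
 show "chern (LM c) (x, - y) = chern (LM c) (x, y)" if "CARD('n) = 1"
  using bw assms p y that unfolding berwald_def by blast
qed
qed

lemmas chb = cberwald[OF chD(1)]

abbreviation "Gm c \<equiv> cberwald.Gx (LM c)"
abbreviation "Rc c \<equiv> cberwald.Rm (LM c)"

section \<open>Transformation law of the connection\<close>

definition D2t where "D2t c c' x u w = fd (%xi. fd (transition c c') xi u) (snd c x) w"

lemma D2t: assumes c: "c \<in> Ch x" "c' \<in> Ch x"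
shows "((%xi. fd (transition c c') xi u) hfd D2t c c' x u) (at (snd c x))"
 "D2t c c' x u w = D2t c c' x w u" "linear (D2t c c' x u)" "linear (%u. D2t c c' x u w)"
proof -
note sm = transition_smooth[OF chD(1)[OF c(1)] chD(1)[OF c(2)]]
show 1: "((%xi. fd (transition c c') xi u) hfd D2t c c' x u) (at (snd c x))" for u
 unfolding D2t_def[abs_def] by (rule smooth_on_hfd[OF smooth_on_fd[OF sm] in_overlap[OF c]])
show 2: "D2t c c' x u w = D2t c c' x w u" for u w
 unfolding D2t_def
 by (rule fd_fd_commute_vec[OF overlap_open[OF chD(1)[OF c(1)] chD(1)[OF c(2)]] in_overlap[OF c] sm])
show 3: "linear (D2t c c' x u)" for u by (rule has_derivative_linear[OF 1])
have "(%u. D2t c c' x u w) = D2t c c' x w" using 2 by blast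
thus "linear (%u. D2t c c' x u w)" using 3 by simp
qed

text \<open>By \<open>spray\<close>, the vectors on both sides are determined by derivatives of
  \<open>F^2\<close>. Base derivatives pick up the second derivative of the transition map, since
  \<open>y\<close> is transported by a differential that depends on the point; definiteness of
  \<open>g\<close> then isolates the vector identity.\<close>

lemma spray_change: assumes c: "c \<in> Ch x" "c' \<in> Ch x"
shows "Gm c' (snd c' x) (Dt c c' x y) (Dt c c' x y) = Dt c c' x (Gm c (snd c x) y y) - D2t c c' x y y"
proof (cases "y = 0")
interpret C: cberwald "LM c" "cdom c" by (rule chb[OF c(1)])
interpret C': cberwald "LM c'" "cdom c'" by (rule chb[OF c(2)])
case True
thus ?thesis using linear_0[OF Dt_linear[OF c]] linear_0[OF C.Gx_lin(1)] linear_0[OF C'.Gx_lin(1)]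
 linear_0[OF D2t(3)[OF c]] by simp
next
case y: False
interpret C: cberwald "LM c" "cdom c" by (rule chb[OF c(1)])
interpret C': cberwald "LM c'" "cdom c'" by (rule chb[OF c(2)])
note a = chD(1)[OF c(1)] chD(1)[OF c(2)]
let ?A = "Dt c c' x" and ?O = "snd c ` (fst c Int fst c')"
let ?xi = "snd c x" and ?xi' = "snd c' x" and ?B = "D2t c c' x" and ?t = "transition c c'"
have Ay: "?A y ~= 0" using Dt_zero[OF c] y by simp
have zS: "(?xi, y) \<in> C.S" and zS': "(?xi', ?A y) \<in> C'.S" using pair_in_S c y Ay by blast+
have pt: "EX p. c \<in> Ch p & c' \<in> Ch p & xi = snd c p" if "xi \<in> ?O" for xi
 using that a by (auto simp: charts_at_def)
have dP: "((%xi. (?t xi, fd ?t xi y)) hfd (%h. (?A h, ?B y h))) (at ?xi)"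
 by (intro has_derivative_Pair transition_deriv c D2t)
have at: "(?t ?xi, fd ?t ?xi y) = (?xi', ?A y)" using transition_chart[OF c(1)] by simp
have dI: "((%xi. (xi, y)) hfd (%h. (h, 0))) (at ?xi)" by (auto intro!: derivative_eq_intros)
have 1: "C.Q1 (w, 0) (?xi, y) = C'.Q1 (?A w, ?B y w) (?xi', ?A y)" for w
proof -
 have p: "((%xi. C.Q (xi, y)) hfd (%h. C.Q1 (h, 0) (?xi, y))) (at ?xi)"
  using diff_chain_at[OF dI fd_works[OF C.diff_Q(1)[OF zS]]] by (simp add: o_def C.Q1_def)
 have "(C'.Q hfd fd C'.Q (?xi', ?A y)) (at (?t ?xi, fd ?t ?xi y))"
  using fd_works[OF C'.diff_Q(1)[OF zS']] unfolding at .
 from diff_chain_at[OF dP this]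
 have q: "((%xi. C'.Q (?t xi, fd ?t xi y)) hfd (%h. C'.Q1 (?A h, ?B y h) (?xi', ?A y))) (at ?xi)"
  by (simp add: o_def C'.Q1_def)
 have "((%xi. C.Q (xi, y)) hfd (%h. C'.Q1 (?A h, ?B y h) (?xi', ?A y))) (at ?xi)"
 proof (rule htw_open[OF q overlap_open[OF a] in_overlap[OF c]])
  fix xi assume "xi \<in> ?O"
  then obtain p where "c \<in> Ch p" "c' \<in> Ch p" "xi = snd c p" using pt by blast
  thus "C'.Q (?t xi, fd ?t xi y) = C.Q (xi, y)" using QQ_change transition_chart by metis
 qed
 from has_derivative_unique[OF p this] show ?thesis by metis
qed
have 2: "C.Q2 (0, w) (y, 0) (?xi, y) = C'.Q2 (0, ?A w) (?A y, ?B y y) (?xi', ?A y) + C'.Q1 (0, ?B w y) (?xi', ?A y)" for w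
proof -
 have p: "((%xi. C.Q1 (0, w) (xi, y)) hfd (%h. C.Q2 (0, w) (h, 0) (?xi, y))) (at ?xi)"
  using diff_chain_at[OF dI fd_works[OF C.diff_Q(2)[OF zS]]] by (simp add: o_def C.Q2_def)
 have dQ: "((%xi. C'.Q1 (0, u) (?t xi, fd ?t xi y)) hfd (%h. C'.Q2 (0, u) (?A h, ?B y h) (?xi', ?A y))) (at ?xi within ?O)" for u
 proof -
  have "(C'.Q1 (0, u) hfd fd (C'.Q1 (0, u)) (?xi', ?A y)) (at (?t ?xi, fd ?t ?xi y))"
   using fd_works[OF C'.diff_Q(2)[OF zS']] unfolding at .
  from diff_chain_at[OF dP this]
  have "((%xi. C'.Q1 (0, u) (?t xi, fd ?t xi y)) hfd (%h. C'.Q2 (0, u) (?A h, ?B y h) (?xi', ?A y))) (at ?xi)"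
   by (simp add: o_def C'.Q2_def)
  thus ?thesis by (rule has_derivative_at_withinI)
 qed
 have q: "((%xi. C'.Q1 (0, fd ?t xi w) (?t xi, fd ?t xi y)) hfd
  (%h. C'.Q2 (0, fd ?t ?xi w) (?A h, ?B y h) (?xi', ?A y) + C'.Q1 (0, ?B w h) (?t ?xi, fd ?t ?xi y))) (at ?xi within ?O)"
 proof (rule hfd_moving[OF dQ _ in_overlap[OF c]])
  fix xi assume "xi \<in> ?O"
  then obtain p where p: "c \<in> Ch p" "c' \<in> Ch p" "xi = snd c p" using pt by blast
  have "(?t xi, fd ?t xi y) \<in> C'.S"
   unfolding p(3) transition_chart[OF p(1)] by (rule pair_in_S[OF p(2)]) (use Dt_zero[OF p(1,2)] y in simp)
  thus "linear (%u. C'.Q1 (0, u) (?t xi, fd ?t xi y))" by (intro linear_Pair0 C'.linear_Q1)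
 next
  show "linear (%u. C'.Q2 (0, u) (?A h, ?B y h) (?xi', ?A y))" for h by (rule linear_Pair0(1)[OF C'.linear_Q2(2)[OF zS']])
 qed (rule has_derivative_at_withinI[OF D2t(1)[OF c]])
 have "((%xi. C.Q1 (0, w) (xi, y)) hfd
  (%h. C'.Q2 (0, ?A w) (?A h, ?B y h) (?xi', ?A y) + C'.Q1 (0, ?B w h) (?xi', ?A y))) (at ?xi)"
 proof (rule htw_open[OF q[unfolded at at_within_open[OF in_overlap[OF c] overlap_open[OF a]]]
    overlap_open[OF a] in_overlap[OF c]])
  fix xi assume "xi \<in> ?O"
  then obtain p where "c \<in> Ch p" "c' \<in> Ch p" "xi = snd c p" using pt by blast
  thus "C'.Q1 (0, fd ?t xi w) (?t xi, fd ?t xi y) = C.Q1 (0, w) (xi, y)"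
   using QQ1_change[OF _ _ y] transition_chart by metis
 qed
 from has_derivative_unique[OF p this] show ?thesis by metis
qed
have "C'.G (?xi', ?A y) (?A (C.Gx ?xi y y)) (?A w) = C'.G (?xi', ?A y) (C'.Gx ?xi' (?A y) (?A y) + ?B y y) (?A w)" for w
proof -
 have l1: "C'.Q1 (a, b) (?xi', ?A y) = C'.Q1 (a, 0) (?xi', ?A y) + C'.Q1 (0, b) (?xi', ?A y)" for a b
  using linear_add[OF C'.linear_Q1[OF zS'], of "(a, 0)" "(0, b)"] by simp
 have l2: "C'.Q2 (0, u) (a, b) (?xi', ?A y) = C'.Q2 (0, u) (a, 0) (?xi', ?A y) + C'.Q2 (0, u) (0, b) (?xi', ?A y)" for a b u
  using linear_add[OF C'.linear_Q2(1)[OF zS', of "(0, u)"], of "(a, 0)" "(0, b)"] by simp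
 have g: "C.Ga (?xi, y) = C.Gx ?xi" "C'.Ga (?xi', ?A y) = C'.Gx ?xi'"
  using C.Ga_eq C'.Ga_eq zS zS' by auto
 have "2 * C.G (?xi, y) (C.Gx ?xi y y) w = 2 * C'.G (?xi', ?A y) (C'.Gx ?xi' (?A y) (?A y)) (?A w)
   + C'.Q2 (0, ?A w) (0, ?B y y) (?xi', ?A y)"
  using C.spray[OF zS, of w] C'.spray[OF zS', of "?A w"] 1[of w] 2[of w] l1[of "?A w" "?B y w"]
   l2[of "?A w" "?A y" "?B y y"] unfolding g D2t(2)[OF c, of w y] by linarith
 moreover have "C'.Q2 (0, ?A w) (0, ?B y y) (?xi', ?A y) = 2 * C'.G (?xi', ?A y) (?B y y) (?A w)"
  unfolding C'.G_def using C'.Q2_sym[OF zS', of "(0, ?A w)" "(0, ?B y y)"] by simp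
 moreover have "C'.G (?xi', ?A y) (?A (C.Gx ?xi y y)) (?A w) = C.G (?xi, y) (C.Gx ?xi y y) w"
  by (rule GG_change[OF c y])
 ultimately show ?thesis unfolding linear_add[OF C'.lin_G(2)[OF zS']] by linarith
qed
note f = this
have e: "C'.G (?xi', ?A y) (?A (C.Gx ?xi y y) - (C'.Gx ?xi' (?A y) (?A y) + ?B y y)) v = 0" for v
 using f[of "Dt c' c x v"] unfolding linear_diff[OF C'.lin_G(2)[OF zS']] Dt_inv[OF c(2,1)] by simp
have "?A (C.Gx ?xi y y) - (C'.Gx ?xi' (?A y) (?A y) + ?B y y) = 0"
 using C'.G_pos[OF zS'] e by (metis less_irrefl)
thus ?thesis by (simp add: algebra_simps)
qed

text \<open>The difference of the two sides is symmetric bilinear and vanishes on the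
  diagonal.\<close>

lemma Gm_change: assumes c: "c \<in> Ch x" "c' \<in> Ch x"
shows "Gm c' (snd c' x) (Dt c c' x u) (Dt c c' x w) = Dt c c' x (Gm c (snd c x) u w) - D2t c c' x u w"
proof -
interpret C: cberwald "LM c" "cdom c" by (rule chb[OF c(1)])
interpret C': cberwald "LM c'" "cdom c'" by (rule chb[OF c(2)])
let ?l = "%u w. C'.Gx (snd c' x) (Dt c c' x u) (Dt c c' x w) - Dt c c' x (C.Gx (snd c x) u w) + D2t c c' x u w"
note lin = linear_add[OF Dt_linear[OF c]] linear_add[OF C.Gx_lin(1)] linear_add[OF C.Gx_lin(2)]
 linear_add[OF C'.Gx_lin(1)] linear_add[OF C'.Gx_lin(2)] linear_add[OF D2t(3)[OF c]] linear_add[OF D2t(4)[OF c]]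
have z: "?l y y = 0" for y using spray_change[OF c, of y] by simp
have s: "?l u w = ?l w u"
 using C.Gx_sym[OF in_cdom[OF c(1)], of u w] C'.Gx_sym[OF in_cdom[OF c(2)], of "Dt c c' x u" "Dt c c' x w"]
  D2t(2)[OF c, of u w] by simp
have "?l (u + w) (u + w) = ?l u u + ?l u w + ?l w u + ?l w w" by (simp add: lin)
hence "?l u w + ?l u w = 0" using z s by simp
hence "2 *R ?l u w = 0" unfolding scaleR_2 .
hence "?l u w = 0" by (simp only: scaleR_eq_0_iff) simp
thus ?thesis by (simp add: algebra_simps)
qed

text \<open>The geodesic vector field. As the coefficients of a Berwald connection do not involve
  the fibre, it is a quadratic polynomial in the velocity and smooth across the zero section, so
  that the flow is regular near zero vectors as well.\<close>

definition fld :: "('m, 'n) chart => 'n tpoint => 'n tpoint" where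
"fld c z = (snd z, - Gm c (fst z) (snd z) (snd z))"

lemma Ck_Gm: assumes "c \<in> AM" shows "Ck_on m (cdom c) (%xi. Gm c xi u w)"
by (rule smooth_onD[OF cberwald.smooth_Gx[OF cberwald[OF assms]]])

lemma fld_Ck: assumes c: "c \<in> AM" shows "Ck_on m (cdom c \<times> UNIV) (fld c)"
proof -
interpret C: cberwald "LM c" "cdom c" by (rule cberwald[OF c])
let ?W = "cdom c \<times> (UNIV :: (real ^ 'n) set)"
have W: "open ?W" using chart_open(2)[OF c] by (intro open_Times open_UNIV)
have e: "C.Gx x u u = (\<Sum>i\<in>UNIV. \<Sum>j\<in>UNIV. (u $ i * u $ j) *R C.Gx x (axis i 1) (axis j 1))" for x u
proof -
 have "C.Gx x u u = (\<Sum>i\<in>UNIV. u $ i *R C.Gx x (axis i 1) u)" by (rule lin_axis[OF C.Gx_lin(1)])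
 also have "... = (\<Sum>i\<in>UNIV. u $ i *R (\<Sum>j\<in>UNIV. u $ j *R C.Gx x (axis i 1) (axis j 1)))"
  by (intro sum.cong refl arg_cong2[where f = scaleR] lin_axis[OF C.Gx_lin(2)])
 finally show ?thesis by (simp add: scaleR_sum_right)
qed
have comp: "Ck_on m ?W (%z. snd z $ i)" for i
 by (rule Ck_on_bounded_linear[OF W]) (rule bounded_linear_compose[OF bounded_linear_vec_nth bounded_linear_snd])
have "Ck_on m ?W (%z. C.Gx (0 + fst z) u w)" for u w
 by (rule Ck_on_compose_affine[OF chart_open(2)[OF c] W bounded_linear_fst _ Ck_Gm[OF c]]) auto
hence g: "Ck_on m ?W (%z. C.Gx (fst z) (snd z) (snd z))"
 unfolding e by (intro Ck_on_sum Ck_on_scaleR Ck_on_mult W comp) simp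
have b1: "bounded_linear (%u. (0, - u) :: 'n tpoint)" and b2: "bounded_linear (%z :: 'n tpoint. (snd z, 0) :: 'n tpoint)"
 by (auto intro!: bounded_linear_Pair bounded_linear_zero bounded_linear_minus bounded_linear_ident bounded_linear_snd)
have "Ck_on m ?W (%z. (snd z, 0) + (0, - C.Gx (fst z) (snd z) (snd z)))"
 by (intro Ck_on_add W Ck_on_bounded_linear b2 Ck_on_compose_linear[OF W b1] g)
thus ?thesis by (simp add: fld_def[abs_def])
qed

lemma fld_fd: assumes c: "c \<in> AM" "xi \<in> cdom c"
shows "fd (fld c) (xi, v) (a, b)
 = (b, - (cberwald.dGx (LM c) xi a v v + Gm c xi b v + Gm c xi v b))"
proof -
interpret C: cberwald "LM c" "cdom c" by (rule cberwald[OF c(1)])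
let ?W = "cdom c \<times> (UNIV :: (real ^ 'n) set)"
have W: "open ?W" and z: "(xi, v) \<in> ?W" using chart_open(2)[OF c(1)] c(2) by (auto intro: open_Times)
have f: "((%z. C.Gx (fst z) u w) hfd (%h. C.dGx xi (fst h) u w)) (at (xi, v) within ?W)" for u w
 using diff_chain_within[of fst fst "(xi, v)" ?W "%x. C.Gx x u w" "%h. C.dGx xi h u w"]
  has_derivative_at_withinI[OF C.Gx_has_derivative[OF c(2)]] bounded_linear_imp_has_derivative[OF bounded_linear_fst]
 by (auto simp: o_def)
have sn: "(snd hfd snd) (at (xi, v) within ?W)" by (rule bounded_linear_imp_has_derivative[OF bounded_linear_snd])
have 1: "((%z. C.Gx (fst z) (snd z) w) hfd
  (%h. C.dGx xi (fst h) (snd (xi, v)) w + C.Gx (fst (xi, v)) (snd h) w)) (at (xi, v) within ?W)" for w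
 by (rule hfd_moving[OF f _ z _ sn]) (use c in "auto intro: C.Gx_lin C.dGx_lin")
have l: "linear (%w. C.dGx xi a v w + C.Gx xi b w)" for a b
 using linear_compose_add[OF C.dGx_lin(3)[OF c(2), of a v] C.Gx_lin(2)[of xi b]] by simp
have 2: "((%z. C.Gx (fst z) (snd z) (snd z)) hfd
  (%h. (C.dGx xi (fst h) (snd (xi, v)) (snd (xi, v)) + C.Gx (fst (xi, v)) (snd h) (snd (xi, v)))
   + C.Gx (fst (xi, v)) (snd (xi, v)) (snd h))) (at (xi, v) within ?W)"
 by (rule hfd_moving[OF 1 _ z _ sn]) (use l C.Gx_lin in auto)
have "(fld c hfd (%h. (snd h, - ((C.dGx xi (fst h) v v + C.Gx xi (snd h) v) + C.Gx xi v (snd h))))) (at (xi, v))"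
 unfolding fld_def[abs_def] using has_derivative_Pair[OF sn has_derivative_minus[OF 2]]
 unfolding at_within_open[OF z W] by simp
from fd_eqI[OF this] show ?thesis by simp
qed

end

section \<open>Geodesics\<close>

text \<open>Intervals with more than one point, on which one-sided derivatives are unique.\<close>

definition ivl :: "real set => bool" where "ivl I \<longleftrightarrow> convex I & (EX a:I. EX b:I. a < b)"

lemma ivl_Icc: "a < b ==> ivl {a..b}" and ivl_Ico: "a < b ==> ivl {a..<b}" and ivl_Ici: "ivl {a..}"
proof -
have *: "ivl I" if "convex I" "p \<in> I" "q \<in> I" "p < q" for I p q using that unfolding ivl_def by blast
show "a < b ==> ivl {a..b}" by (rule *[of _ a b]) auto
show "a < b ==> ivl {a..<b}" by (rule *[of _ a "(a + b) / 2"]) auto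
show "ivl {a..}" by (rule *[of _ a "a + 1"]) auto
qed

lemma ivl_nontrivial: assumes "ivl I" "t \<in> I" shows "at t within I ~= bot"
proof -
have "connected I" using assms(1) convex_connected by (auto simp: ivl_def)
moreover have "\<not> (EX a. I = {a})" using assms(1) by (auto simp: ivl_def)
ultimately have "t islimpt I" using connected_imp_perfect assms(2) by blast
thus ?thesis by (simp add: trivial_limit_within)
qed

lemma has_vd_near:
assumes "(f hvd f') (at t within I)" "t \<in> I" "0 < e" "!!s. s \<in> I ==> \<bar>s - t\<bar> < e ==> f s = g s"
shows "(g hvd f') (at t within I)"
by (rule has_vector_derivative_transform_within[OF assms(1,3,2)]) (use assms(4) in "auto simp: dist_real_def")

lemma has_vd_within_local:
assumes "(f hvd f') (at t within J)" "0 < e" "!!s. \<bar>s - t\<bar> < e ==> s \<in> I \<longleftrightarrow> s \<in> J"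
shows "(f hvd f') (at t within I)"
proof -
have "at t within I = at t within J"
 by (rule at_within_nhd[of t "{t - e<..<t + e}"]) (use assms(2,3) in auto)
thus ?thesis using assms(1) by simp
qed

lemma has_vd_compose:
fixes f :: "'a::real_normed_vector => 'b::real_normed_vector"
assumes "(x hvd v) (at t within I)" "(f hfd f') (at (x t))"
shows "((%s. f (x s)) hvd f' v) (at t within I)"
proof -
have "((%s. f (x s)) hfd (%h. f' (h *R v))) (at t within I)"
 using diff_chain_within[OF assms(1)[unfolded has_vector_derivative_def] has_derivative_at_withinI[OF assms(2)]] by (simp add: o_def)
thus ?thesis unfolding has_vector_derivative_def using linear_cmul[OF has_derivative_linear[OF assms(2)]] by simp
qed

lemma has_vd_moving:
fixes v :: "real => real ^ 'n::finite" and B :: "real => real ^ 'n => 'c::real_normed_vector"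
assumes B: "!!u. ((%s. B s u) hvd B' u) (at t within I)" "linear B'"
 and e: "0 < e" "!!s. s \<in> I ==> \<bar>s - t\<bar> < e ==> linear (B s)" "t \<in> I"
 and v: "(v hvd v') (at t within I)"
shows "((%s. B s (v s)) hvd B' (v t) + B t v') (at t within I)"
proof -
let ?T = "I Int {t - e<..<t + e}"
have eq: "at t within ?T = at t within I" by (rule at_within_nhd[of t "{t - e<..<t + e}"]) (use e in auto)
have lt: "linear (B t)" using e by simp
have l: "linear (%u. h *R B' u)" for h using linear_compose_scale_right[OF B(2)] .
have "((%s. B s (v s)) hfd (%h. h *R B' (v t) + B t (h *R v'))) (at t within ?T)"
proof (rule hfd_moving[where B' = "%h u. h *R B' u"])
 show "((%s. B s u) hfd (%h. h *R B' u)) (at t within ?T)" for u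
  using B(1)[of u] unfolding eq has_vector_derivative_def .
 show "(v hfd (%h. h *R v')) (at t within ?T)" using v unfolding eq has_vector_derivative_def .
 show "linear (B w)" if "w \<in> ?T" for w using that e(2)[of w] by (auto simp: abs_less_iff)
 show "t \<in> ?T" using e by auto
qed (rule l)
thus ?thesis
 unfolding eq has_vector_derivative_def linear_cmul[OF lt] by (simp add: scaleR_add_right)
qed

lemma pair_vd:
assumes "(f hvd f') (at t within I)" "(g hvd g') (at t within I)"
shows "((%s. (f s, g s)) hvd (f', g')) (at t within I)"
using has_derivative_Pair[OF assms[unfolded has_vector_derivative_def]] by (simp add: has_vector_derivative_def)

context finsler_mfd
begin

lemma curve_near:
fixes I :: "real set"
assumes "cmap I ga" "t \<in> I" "openin (topo M) V" "ga t \<in> V"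
obtains e where "0 < e" "!!s. s \<in> I ==> \<bar>s - t\<bar> < e ==> ga s \<in> V"
proof -
have "openin (top_of_set I) {s \<in> I. ga s \<in> V}"
 using openin_continuous_map_preimage[OF assms(1,3)] by simp
then obtain T where T: "open T" "{s \<in> I. ga s \<in> V} = I Int T" unfolding openin_open by blast
hence "t \<in> T" using assms by blast
then obtain e where e: "0 < e" "ball t e <= T" using T(1) open_contains_ball by blast
have "ga s \<in> V" if "s \<in> I" "\<bar>s - t\<bar> < e" for s
proof -
 have "s \<in> ball t e" using that(2) by (simp add: dist_real_def abs_minus_commute)
 thus ?thesis using T(2) e(2) that(1) by blast
qed
thus ?thesis using that e(1) by blast
qed

lemma near_chart:
fixes I :: "real set"
assumes "cmap I ga" "t \<in> I" "c \<in> Ch (ga t)"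
obtains e where "0 < e" "!!s. s \<in> I ==> \<bar>s - t\<bar> < e ==> c \<in> Ch (ga s)"
proof -
note a = chD[OF assms(3)]
obtain e where "0 < e" "!!s. s \<in> I ==> \<bar>s - t\<bar> < e ==> ga s \<in> fst c"
 using curve_near[OF assms(1,2) chart_open(1)[OF a(1)] a(2)] by blast
thus ?thesis using that a(1) by (simp add: charts_at_def)
qed

end

context berwald_mfd
begin

text \<open>Here \<open>k\<close> is the covariant derivative of \<open>J\<close> along the curve,
  computed in the chart \<open>c\<close>. The inhomogeneous term of \<open>Gm_change\<close> cancels
  the derivative of the moving transition differential, so \<open>k\<close> transforms as a tangent
  vector.\<close>

lemma cov_change:
assumes cont: "cmap I ga" and t: "t \<in> I" and c: "c \<in> Ch (ga t)" "c' \<in> Ch (ga t)"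
 and x: "((snd c o ga) hvd v) (at t within I)"
 and J: "(J hvd k - Gm c (snd c (ga t)) v (J t)) (at t within I)"
shows "((%s. Dt c c' (ga s) (J s)) hvd
  Dt c c' (ga t) k - Gm c' (snd c' (ga t)) (Dt c c' (ga t) v) (Dt c c' (ga t) (J t))) (at t within I)"
proof -
let ?A = "Dt c c' (ga t)"
obtain e1 where e1: "0 < e1" "!!s. s \<in> I ==> \<bar>s - t\<bar> < e1 ==> c \<in> Ch (ga s)"
 using near_chart[OF cont t c(1)] by blast
obtain e2 where e2: "0 < e2" "!!s. s \<in> I ==> \<bar>s - t\<bar> < e2 ==> c' \<in> Ch (ga s)"
 using near_chart[OF cont t c(2)] by blast
have D: "((%s. Dt c c' (ga s) u) hvd D2t c c' (ga t) u v) (at t within I)" for u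
 using has_vd_compose[OF x, of "%xi. fd (transition c c') xi u" "D2t c c' (ga t) u"] D2t(1)[OF c] by simp
have "((%s. Dt c c' (ga s) (J s)) hvd
  D2t c c' (ga t) (J t) v + ?A (k - Gm c (snd c (ga t)) v (J t))) (at t within I)"
 by (rule has_vd_moving[OF D D2t(4)[OF c] _ _ t J, of "min e1 e2"]) (use e1 e2 in "auto intro: Dt_linear")
moreover have "D2t c c' (ga t) (J t) v + ?A (k - Gm c (snd c (ga t)) v (J t)) = ?A k - Gm c' (snd c' (ga t)) (?A v) (?A (J t))"
 unfolding linear_diff[OF Dt_linear[OF c]] Gm_change[OF c] using D2t(2)[OF c, of "J t" v] by simp
ultimately show ?thesis by simp
qed

lemma coord_change_vd:
assumes cont: "cmap I ga" and t: "t \<in> I" and c: "c \<in> Ch (ga t)" "c' \<in> Ch (ga t)"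
 and x: "((snd c o ga) hvd v) (at t within I)"
shows "((snd c' o ga) hvd Dt c c' (ga t) v) (at t within I)"
proof -
obtain e where e: "0 < e" "!!s. s \<in> I ==> \<bar>s - t\<bar> < e ==> c \<in> Ch (ga s)"
 using near_chart[OF cont t c(1)] by blast
have "((%s. transition c c' ((snd c o ga) s)) hvd Dt c c' (ga t) v) (at t within I)"
 by (rule has_vd_compose[OF x]) (use transition_deriv[OF c] in simp)
thus ?thesis
 by (rule has_vd_near[OF _ t e(1)]) (use transition_chart e(2) in auto)
qed

text \<open>A neighbourhood of \<open>t\<close> is included because the acceleration at
  \<open>t\<close> involves the velocities at nearby parameters.\<close>

definition chart_sol where
"chart_sol I ga c v t e \<longleftrightarrow> 0 < e & (ALL s:I. \<bar>s - t\<bar> < e --> c \<in> Ch (ga s) &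
  ((snd c o ga) hvd v s) (at s within I) &
  (v hvd - Gm c (snd c (ga s)) (v s) (v s)) (at s within I))"

lemma velocity_eq:
assumes "ivl I" "t \<in> I" "c \<in> Ch (ga t)" "((snd c o ga) hvd v) (at t within I)"
shows "vlc I ga t c = v" "vector_derivative (snd c o ga) (at t within I) = v"
using vector_derivative_within[OF ivl_nontrivial[OF assms(1,2)] assms(4)] assms(3) by (auto simp: velocity_def)

lemma chern_quad: assumes "c \<in> Ch x"
shows "(\<chi> i. - (\<Sum>j\<in>UNIV. \<Sum>k\<in>UNIV. chern (LM c) (snd c x, v) i j k * v $ j * v $ k)) = - Gm c (snd c x) v v"
proof -
interpret C: cberwald "LM c" "cdom c" by (rule chb[OF assms])
have "(\<chi> i. - (\<Sum>j\<in>UNIV. \<Sum>k\<in>UNIV. chern (LM c) (snd c x, v) i j k * v $ j * v $ k)) = - C.Ga (snd c x, v) v v"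
 by (simp add: C.Ga_def Gam_def vec_eq_iff)
also have "... = - C.Gx (snd c x) v v"
 using C.Ga_eq[OF in_cdom[OF assms], of v] linear_0[OF C.Gx_lin(1)] linear_0[OF C.Ga_lin(1)] by (cases "v = 0") auto
finally show ?thesis .
qed

text \<open>The definition demands the equation in all charts. As acceleration is covariant, a
  single chart near each parameter suffices.\<close>

lemma geodesicI:
assumes cont: "cmap I ga" and I: "ivl I"
 and ex: "!!t. t \<in> I ==> EX c v e. chart_sol I ga c v t e"
shows "geodesic_on M I ga"
unfolding geodesic_on_def
proof (intro conjI cont ballI)
fix t c' assume t: "t \<in> I" and c': "c' \<in> Ch (ga t)"
obtain c v e where s: "chart_sol I ga c v t e" using ex[OF t] by blast
have e: "0 < e" and c: "!!s. s \<in> I ==> \<bar>s - t\<bar> < e ==> c \<in> Ch (ga s)"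
 and x: "!!s. s \<in> I ==> \<bar>s - t\<bar> < e ==> ((snd c o ga) hvd v s) (at s within I)"
 and v: "!!s. s \<in> I ==> \<bar>s - t\<bar> < e ==> (v hvd - Gm c (snd c (ga s)) (v s) (v s)) (at s within I)"
 using s unfolding chart_sol_def by blast+
obtain e2 where e2: "0 < e2" "!!s. s \<in> I ==> \<bar>s - t\<bar> < e2 ==> c' \<in> Ch (ga s)"
 using near_chart[OF cont t c'] by blast
define w where "w s = Dt c c' (ga s) (v s)" for s
have x': "((snd c' o ga) hvd w s) (at s within I)" if "s \<in> I" "\<bar>s - t\<bar> < min e e2" for s
 unfolding w_def using that by (intro coord_change_vd[OF cont that(1) c e2(2) x]) auto
have wd: "(w hvd - Gm c' (snd c' (ga t)) (w t) (w t)) (at t within I)"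
proof -
 have v0: "(v hvd 0 - Gm c (snd c (ga t)) (v t) (v t)) (at t within I)" using v[OF t] e by simp
 have tt: "\<bar>t - t\<bar> < e" using e by simp
 show ?thesis
  using cov_change[OF cont t c[OF t tt] c' x[OF t tt] v0] linear_0[OF Dt_linear[OF c[OF t tt] c']]
  unfolding w_def by simp
qed
have vd: "vector_derivative (snd c' o ga) (at s within I) = w s" if "s \<in> I" "\<bar>s - t\<bar> < min e e2" for s
 by (rule velocity_eq(2)[OF I that(1) e2(2)[OF that(1)] x'[OF that]]) (use that in simp)
show "(snd c' o ga) differentiable (at t within I)"
proof -
 have "((snd c' o ga) hvd w t) (at t within I)" using x'[OF t] e e2 by simp
 thus ?thesis unfolding has_vector_derivative_def differentiable_def by blast
qed
have "vector_derivative (snd c' o ga) (at t within I) = w t" using vd[OF t] e e2 by simp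
moreover have "((%s. vector_derivative (snd c' o ga) (at s within I)) hvd
  - Gm c' (snd c' (ga t)) (w t) (w t)) (at t within I)"
 by (rule has_vd_near[OF wd t, of "min e e2"]) (use e e2 vd in auto)
ultimately show "((%s. vector_derivative (snd c' o ga) (at s within I)) hvd
  (let x = snd c' (ga t); v = vector_derivative (snd c' o ga) (at t within I) in
  (\<chi> i. - (\<Sum>j\<in>UNIV. \<Sum>k\<in>UNIV. chern (LM c') (x, v) i j k * v $ j * v $ k)))) (at t within I)"
 unfolding Let_def by (simp add: chern_quad[OF c'])
qed

lemma geodesicD:
assumes g: "geodesic_on M I ga" and t: "t \<in> I" and c: "c \<in> Ch (ga t)"
shows "((snd c o ga) hvd vlc I ga t c) (at t within I)"
 "((%s. vlc I ga s c) hvd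
   - Gm c (snd c (ga t)) (vlc I ga t c) (vlc I ga t c)) (at t within I)"
proof -
have cont: "cmap I ga" using g by (simp add: geodesic_on_def)
have vt: "vlc I ga t c = vector_derivative (snd c o ga) (at t within I)" using c by (simp add: velocity_def)
have "(snd c o ga) differentiable (at t within I)" using g t c unfolding geodesic_on_def by blast
thus "((snd c o ga) hvd vlc I ga t c) (at t within I)"
 unfolding vt vector_derivative_works .
obtain e where e: "0 < e" "!!s. s \<in> I ==> \<bar>s - t\<bar> < e ==> c \<in> Ch (ga s)"
 using near_chart[OF cont t c] by blast
have "((%s. vector_derivative (snd c o ga) (at s within I)) hvd
  - Gm c (snd c (ga t)) (vlc I ga t c) (vlc I ga t c)) (at t within I)"
 using g t c unfolding geodesic_on_def Let_def vt chern_quad[OF c, symmetric] by blast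
thus "((%s. vlc I ga s c) hvd
   - Gm c (snd c (ga t)) (vlc I ga t c) (vlc I ga t c)) (at t within I)"
 by (rule has_vd_near[OF _ t e(1)]) (use e(2) in "simp add: velocity_def")
qed

lemma geodesic_cont: "geodesic_on M I ga ==> cmap I ga"
by (simp add: geodesic_on_def)

lemma curve_points: "cmap I ga ==> t \<in> I ==> ga t \<in> PM"
using continuous_map_image_subset_topspace[of "top_of_set I" "topo M" ga] by auto

lemma velocity_tangent:
assumes I: "ivl I" and cont: "cmap I ga" and t: "t \<in> I"
 and d: "c \<in> Ch (ga t)" "((snd c o ga) hvd v) (at t within I)"
shows "vlc I ga t \<in> TM (ga t)"
proof -
have "vlc I ga t c' = coord_tvec M c (ga t) v c'" for c'
proof (cases "c' \<in> Ch (ga t)")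
 case True
 thus ?thesis using velocity_eq(1)[OF I t True coord_change_vd[OF cont t d(1) True d(2)]] by (simp add: coord_tvec_def)
qed (simp add: velocity_def coord_tvec_def)
hence 1: "vlc I ga t = coord_tvec M c (ga t) v" by blast
show "vlc I ga t \<in> TM (ga t)" unfolding 1 by (rule coord_tvec_tangent(1)[OF d(1)])
qed

lemma geodesic_velocity_tangent:
assumes "geodesic_on M I ga" "ivl I" "t \<in> I" shows "vlc I ga t \<in> TM (ga t)"
proof -
obtain c where c: "c \<in> Ch (ga t)" using cover curve_points[OF geodesic_cont[OF assms(1)] assms(3)] by blast
show ?thesis by (rule velocity_tangent[OF assms(2) geodesic_cont[OF assms(1)] assms(3) c geodesicD(1)[OF assms(1,3) c]])
qed

text \<open>The factor \<open>q\<close> may be zero or negative: the equation is quadratic in the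
  velocity with coefficients independent of it, so geodesics can be reversed although
  \<open>F\<close> need not be reversible.\<close>

lemma geodesic_affine:
assumes g: "geodesic_on M I ga" and I: "ivl I" and J: "ivl J" and sub: "!!t. t \<in> J ==> p + q * t \<in> I"
shows "geodesic_on M J (%t. ga (p + q * t))"
 "!!t. t \<in> J ==> vlc J (%t. ga (p + q * t)) t = tscale q (vlc I ga (p + q * t))"
proof -
let ?h = "%t. p + q * t" and ?g = "%t. ga (p + q * t)"
have "continuous_map (top_of_set J) (top_of_set I) ?h"
 using sub by (auto simp: continuous_map_iff_continuous2 intro!: continuous_intros)
from continuous_map_compose[OF this geodesic_cont[OF g]]
have cont: "cmap J ?g" by (simp add: o_def)
have hd: "(?h hvd q) (at t within J)" for t
 by (auto intro!: derivative_eq_intros)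
have ch: "((%t. f (?h t)) hvd q *R f') (at t within J)"
 if "t \<in> J" "(f hvd f') (at (?h t) within I)" for f f' t
proof -
 have "(f hvd f') (at (?h t) within ?h ` J)"
  by (rule hvd_sub[OF that(2)]) (use sub in auto)
 from vector_diff_chain_within[OF hd this] show ?thesis by (simp add: o_def)
qed
have sol: "EX e. chart_sol J ?g c (%s. q *R vlc I ga (?h s) c) t e" if t: "t \<in> J" and c: "c \<in> Ch (?g t)" for t c
proof -
 obtain e where e: "0 < e" "!!s. s \<in> J ==> \<bar>s - t\<bar> < e ==> c \<in> Ch (?g s)"
  using near_chart[OF cont t c] by blast
 have "chart_sol J ?g c (%s. q *R vlc I ga (?h s) c) t e"
  unfolding chart_sol_def
 proof (intro conjI ballI impI e)
  fix s assume s: "s \<in> J" "\<bar>s - t\<bar> < e"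
  interpret C: cberwald "LM c" "cdom c" by (rule chb[OF c])
  note d = geodesicD[OF g sub[OF s(1)] e(2)[OF s]]
  show "((snd c o ?g) hvd q *R vlc I ga (?h s) c) (at s within J)"
   using ch[OF s(1) d(1)] by (simp add: o_def)
  have "((%s. vlc I ga (?h s) c) hvd
    q *R (- C.Gx (snd c (?g s)) (vlc I ga (?h s) c) (vlc I ga (?h s) c))) (at s within J)"
   using ch[OF s(1) d(2)] .
  from bounded_linear.has_vector_derivative[OF bounded_linear_scaleR_right this, of q]
  show "((%s. q *R vlc I ga (?h s) c) hvd
    - C.Gx (snd c (?g s)) (q *R vlc I ga (?h s) c) (q *R vlc I ga (?h s) c)) (at s within J)"
   by (simp add: linear_cmul[OF C.Gx_lin(1)] linear_cmul[OF C.Gx_lin(2)])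
 qed
 thus ?thesis by blast
qed
have ex: "EX c. c \<in> Ch (?g t)" if "t \<in> J" for t
 using cover curve_points[OF cont that] by blast
show "geodesic_on M J ?g"
 by (rule geodesicI[OF cont J]) (use sol ex in blast)
show "vlc J ?g t = tscale q (vlc I ga (?h t))" if t: "t \<in> J" for t
proof -
 have "vlc J ?g t c = q *R vlc I ga (?h t) c" for c
 proof (cases "c \<in> Ch (?g t)")
  case True
  obtain e where "chart_sol J ?g c (%s. q *R vlc I ga (?h s) c) t e" using sol[OF t True] by blast
  hence "((snd c o ?g) hvd q *R vlc I ga (?h t) c) (at t within J)"
   using t unfolding chart_sol_def by force
  thus ?thesis by (rule velocity_eq(1)[where ga = ?g and t = t, OF J t True])
 qed (simp add: velocity_def)
 thus ?thesis by (simp add: tscale_def fun_eq_iff)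
qed
qed

lemma tscale_one: "tscale 1 v = v" by (simp add: tscale_def)

lemma geodesic_restrict:
assumes "geodesic_on M I ga" "ivl I" "ivl J" "J <= I"
shows "geodesic_on M J ga" "!!t. t \<in> J ==> vlc J ga t = vlc I ga t"
using geodesic_affine[OF assms(1-3), of 0 1] assms(4) by (auto simp: tscale_one)

lemma geodesic_fld:
assumes "geodesic_on M I ga" "t \<in> I" "c \<in> Ch (ga t)"
shows "((%s. (snd c (ga s), vlc I ga s c)) hvd fld c (snd c (ga t), vlc I ga t c)) (at t within I)"
unfolding fld_def fst_conv snd_conv using pair_vd[OF geodesicD[OF assms]] by (simp add: o_def)

text \<open>Real induction. The step beyond a parameter is uniqueness for the equation in a chart;
  at a limit the positions agree by the Hausdorff property and the velocities by continuity.\<close>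

lemma geodesic_unique:
assumes g: "geodesic_on M {0..b} ga" "geodesic_on M {0..b} ga'" and b: "0 < b"
 and "ga 0 = ga' 0" "vlc {0..b} ga 0 = vlc {0..b} ga' 0" and t: "0 <= t" "t <= b"
shows "ga t = ga' t & vlc {0..b} ga t = vlc {0..b} ga' t"
proof -
let ?I = "{0..b}" and ?v = "vlc {0..b} ga" and ?v' = "vlc {0..b} ga'"
note I = ivl_Icc[OF b] and c1 = geodesic_cont[OF g(1)] and c2 = geodesic_cont[OF g(2)]
have veq: "?v s = ?v' s" if "s \<in> ?I" "ga s = ga' s" "c \<in> Ch (ga s)" "?v s c = ?v' s c" for s c
 using tangent_eqI geodesic_velocity_tangent[OF g(1) I that(1)] geodesic_velocity_tangent[OF g(2) I that(1)] that by metis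
define P where "P s \<longleftrightarrow> ga s = ga' s & ?v s = ?v' s" for s
have "P t"
proof (rule real_induct[of 0 b P])
 show "P 0" using assms by (simp add: P_def)
next
 fix s assume s: "0 <= s" "s < b" and Ps: "!!r. 0 <= r ==> r <= s ==> P r"
 have sI: "s \<in> ?I" using s by auto
 have P: "ga s = ga' s" "?v s = ?v' s" using Ps[of s] s by (auto simp: P_def)
 obtain c where c: "c \<in> Ch (ga s)" using cover curve_points[OF c1 sI] by blast
 hence c': "c \<in> Ch (ga' s)" using P by simp
 obtain e1 where e1: "0 < e1" "!!r. r \<in> ?I ==> \<bar>r - s\<bar> < e1 ==> c \<in> Ch (ga r)" using near_chart[OF c1 sI c] by blast
 obtain e2 where e2: "0 < e2" "!!r. r \<in> ?I ==> \<bar>r - s\<bar> < e2 ==> c \<in> Ch (ga' r)" using near_chart[OF c2 sI c'] by blast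
 define q where "q = s + min (min e1 e2 / 2) (b - s)"
 have q: "s < q" "q <= b" "!!r. r \<in> {s..q} ==> r \<in> ?I & \<bar>r - s\<bar> < e1 & \<bar>r - s\<bar> < e2"
  using s e1 e2 by (auto simp: q_def min_def split: if_splits)
 have sub: "{s..q} <= ?I" using q(3) by blast
 have W: "open (cdom c \<times> (UNIV :: (real ^ 'n) set))" using chart_open(2)[OF chD(1)[OF c]] by (intro open_Times open_UNIV)
 obtain e where e: "0 < e" "!!r. r \<in> {s..q} ==> r <= s + e ==> (snd c (ga r), ?v r c) = (snd c (ga' r), ?v' r c)"
 proof (rule ode_unique_local[OF W fld_Ck[OF chD(1)[OF c]] q(1)])
  show "((%r. (snd c (ga r), ?v r c)) hvd fld c (snd c (ga r), ?v r c)) (at r within {s..q})" if "r \<in> {s..q}" for r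
   using hvd_sub[OF geodesic_fld[OF g(1) _ e1(2)] sub] q(3)[OF that] by blast
  show "((%r. (snd c (ga' r), ?v' r c)) hvd fld c (snd c (ga' r), ?v' r c)) (at r within {s..q})" if "r \<in> {s..q}" for r
   using hvd_sub[OF geodesic_fld[OF g(2) _ e2(2)] sub] q(3)[OF that] by blast
  show "(snd c (ga s), ?v s c) = (snd c (ga' s), ?v' s c)" using P by simp
  show "(snd c (ga s), ?v s c) \<in> cdom c \<times> UNIV" using in_cdom[OF c] by simp
 qed blast
 have "P r" if "s < r" "r <= s + min e (q - s)" for r
 proof -
  have r: "r \<in> {s..q}" "r <= s + e" using that by auto
  have a: "r \<in> ?I" "c \<in> Ch (ga r)" "c \<in> Ch (ga' r)" using q(3)[OF r(1)] e1 e2 by auto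
  have "snd c (ga r) = snd c (ga' r)" "?v r c = ?v' r c" using e(2)[OF r] by auto
  hence "ga r = ga' r" using chart_inv(1)[OF chD(1)[OF c]] chD(2)[OF a(2)] chD(2)[OF a(3)] by metis
  thus ?thesis using veq a \<open>?v r c = ?v' r c\<close> by (simp add: P_def)
 qed
 thus "EX e>0. ALL r. s < r & r <= s + e & r <= b --> P r"
  using e(1) q(1) by (intro exI[of _ "min e (q - s)"]) auto
next
 fix s assume s: "0 < s" "s <= b" and Ps: "!!r. 0 <= r ==> r < s ==> P r"
 have sI: "s \<in> ?I" using s by auto
 have eq: "ga s = ga' s"
 proof (rule ccontr)
  assume "ga s ~= ga' s"
  then obtain U V where UV: "openin (topo M) U" "openin (topo M) V" "ga s \<in> U" "ga' s \<in> V" "disjnt U V"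
   using haus curve_points[OF c1 sI] curve_points[OF c2 sI] unfolding Hausdorff_space_def by blast
  obtain e1 where e1: "0 < e1" "!!r. r \<in> ?I ==> \<bar>r - s\<bar> < e1 ==> ga r \<in> U" using curve_near[OF c1 sI UV(1,3)] by blast
  obtain e2 where e2: "0 < e2" "!!r. r \<in> ?I ==> \<bar>r - s\<bar> < e2 ==> ga' r \<in> V" using curve_near[OF c2 sI UV(2,4)] by blast
  define r where "r = s - min (min e1 e2 / 2) s"
  have "0 <= r" "r < s" "r \<in> ?I" "\<bar>r - s\<bar> < e1" "\<bar>r - s\<bar> < e2" using e1 e2 s by (auto simp: r_def min_def)
  hence "ga r \<in> U" "ga r \<in> V" using e1(2)[of r] e2(2)[of r] Ps[of r] by (auto simp: P_def)
  thus False using UV(5) by (auto simp: disjnt_def)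
 qed
 obtain c where c: "c \<in> Ch (ga s)" using cover curve_points[OF c1 sI] by blast
 hence c': "c \<in> Ch (ga' s)" using eq by simp
 have "((%r. ?v r c - ?v' r c) \<longlongrightarrow> ?v s c - ?v' s c) (at s within {0..<s})"
 proof (intro tendsto_diff)
  have sub: "{0..<s} <= ?I" using s by auto
  show "((%r. ?v r c) \<longlongrightarrow> ?v s c) (at s within {0..<s})"
   using has_vector_derivative_continuous[OF hvd_sub[OF geodesicD(2)[OF g(1) sI c] sub]]
   by (simp add: continuous_within)
  show "((%r. ?v' r c) \<longlongrightarrow> ?v' s c) (at s within {0..<s})"
   using has_vector_derivative_continuous[OF hvd_sub[OF geodesicD(2)[OF g(2) sI c'] sub]]
   by (simp add: continuous_within)
 qed
 moreover have "((%r. ?v r c - ?v' r c) \<longlongrightarrow> 0) (at s within {0..<s})"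
  by (rule tendsto_eventually) (use Ps in "auto simp: eventually_at_filter P_def")
 moreover have "at s within {0..<s} ~= bot"
 proof -
  have "s islimpt {0..<s}" using s islimpt_Ico by (simp add: islimpt_greaterThanLessThan2 islimpt_subset[of s "{0<..<s}"])
  thus ?thesis by (simp add: trivial_limit_within)
 qed
 ultimately have "?v s c - ?v' s c = 0" using tendsto_unique by blast
 thus "P s" using veq[OF sI eq c] eq by (simp add: P_def)
qed (use b t in auto)
thus ?thesis by (simp add: P_def)
qed

lemma sol_geodesic:
assumes c: "c \<in> AM" and d: "0 < d"
 and W: "!!t. t \<in> {0..d} ==> fst (ph t) \<in> cdom c"
 and sol: "!!t. t \<in> {0..d} ==> (ph hvd fld c (ph t)) (at t within {0..d})"
shows "geodesic_on M {0..d} (%t. ci c (fst (ph t)))"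
 "!!t. t \<in> {0..d} ==> vlc {0..d} (%t. ci c (fst (ph t))) t c = snd (ph t)"
proof -
let ?I = "{0..d}" and ?g = "%t. ci c (fst (ph t))"
have f: "((%t. fst (ph t)) hvd snd (ph t)) (at t within ?I)"
 and s: "((%t. snd (ph t)) hvd - Gm c (fst (ph t)) (snd (ph t)) (snd (ph t))) (at t within ?I)" if "t \<in> ?I" for t
 using bounded_linear.has_vector_derivative[OF bounded_linear_fst sol[OF that]]
  bounded_linear.has_vector_derivative[OF bounded_linear_snd sol[OF that]] by (simp_all add: fld_def)
have "continuous_on ?I (%t. fst (ph t))" by (rule vd_continuous_on[OF f])
hence "continuous_map (top_of_set ?I) (top_of_set (cdom c)) (%t. fst (ph t))"
 using W by (auto simp: continuous_map_iff_continuous2)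
from continuous_map_compose[OF this chart_cont(2)[OF c]]
have cont: "cmap ?I ?g" by (simp add: o_def)
have sn: "snd c (?g t) = fst (ph t)" "c \<in> Ch (?g t)" if "t \<in> ?I" for t
 using chart_inv(2)[OF c W[OF that]] charts_at_inv[OF c W[OF that]] by auto
have x: "((snd c o ?g) hvd snd (ph t)) (at t within ?I)" if "t \<in> ?I" for t
 by (rule has_vd_near[OF f[OF that] that, of 1]) (use sn in auto)
have "chart_sol ?I ?g c (%t. snd (ph t)) t 1" for t
 unfolding chart_sol_def using sn x s by auto
thus "geodesic_on M ?I ?g" by (intro geodesicI[OF cont ivl_Icc[OF d]]) blast
show "vlc ?I ?g t c = snd (ph t)" if "t \<in> ?I" for t
 by (rule velocity_eq(1)[OF ivl_Icc[OF d] that sn(2)[OF that] x[OF that]])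
qed

end

section \<open>Geodesics defined for all positive times\<close>

locale complete_mfd = berwald_mfd M for M :: "('m, 'n::finite) finsler_space" +
assumes fc: "forward_complete M"
begin

lemma open_W: "c \<in> AM ==> open (cdom c \<times> (UNIV :: (real ^ 'n) set))"
using chart_open(2) by (intro open_Times open_UNIV)

text \<open>The local solution in one chart is cut down to a half-open interval, the form in which
  forward completeness extends it.\<close>

lemma geodesic_exists:
assumes y: "y \<in> TM x" and x: "x \<in> PM"
shows "EX ga. geodesic_on M {0..} ga & ga 0 = x & vlc {0..} ga 0 = y"
proof -
obtain c where c: "c \<in> Ch x" using cover x by blast
note a = chD[OF c]
have zW: "(snd c x, y c) \<in> cdom c \<times> UNIV" using in_cdom[OF c] by simp
obtain r d ph D where fl: "0 < r" "0 < d" "cball (snd c x, y c) r <= cdom c \<times> UNIV"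
 "!!z. z \<in> ball (snd c x, y c) r ==> ph 0 z = z"
 "!!z t. z \<in> ball (snd c x, y c) r ==> t \<in> {0..d} ==> ph t z \<in> cdom c \<times> UNIV"
 "!!z t. z \<in> ball (snd c x, y c) r ==> t \<in> {0..d} ==>
   ((%t. ph t z) hvd fld c (ph t z)) (at t within {0..d})"
 "!!z t. z \<in> ball (snd c x, y c) r ==> t \<in> {0..d} ==> (ph t hfd D t z) (at z)"
 "!!z h. z \<in> ball (snd c x, y c) r ==> D 0 z h = h"
 "!!z t h. z \<in> ball (snd c x, y c) r ==> t \<in> {0..d} ==>
   ((%t. D t z h) hvd fd (fld c) (ph t z) (D t z h)) (at t within {0..d})"
 using local_flow[OF open_W[OF a(1)] zW fld_Ck[OF a(1)]] by blast
let ?z = "(snd c x, y c)"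
have z: "?z \<in> ball ?z r" using fl(1) by simp
define ga where "ga t = ci c (fst (ph t ?z))" for t
have W: "fst (ph t ?z) \<in> cdom c" if "t \<in> {0..d}" for t using fl(5)[OF z that] by (simp add: mem_Times_iff)
note sg = sol_geodesic[OF a(1) fl(2), of "%t. ph t ?z", OF W fl(6)[OF z], folded ga_def]
have sub: "{0..<d} <= {0..d}" by auto
obtain ga' where g': "geodesic_on M {0..} ga'" "!!t. t \<in> {0..<d} ==> ga' t = ga t"
 using fc fl(2) geodesic_restrict(1)[OF sg(1) ivl_Icc[OF fl(2)] ivl_Ico[OF fl(2)] sub] unfolding forward_complete_def by blast
have g0: "ga' 0 = x" using g'(2)[of 0] fl(2) fl(4)[OF z] chart_inv(1)[OF a(1,2)] by (simp add: ga_def)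
have "vlc {0..} ga' 0 c = y c"
proof (rule velocity_eq(1)[where ga = ga' and t = 0, OF ivl_Ici _ c[folded g0]])
 have "((snd c o ga) hvd vlc {0..d} ga 0 c) (at 0 within {0..d})"
  using geodesicD(1)[OF sg(1), of 0 c] fl(2) c g0 g'(2)[of 0] by simp
 hence "((snd c o ga) hvd y c) (at 0 within {0..d})"
  using sg(2)[of 0] fl(2) fl(4)[OF z] by simp
 hence 1: "((snd c o ga) hvd y c) (at 0 within {0..})"
  by (rule has_vd_within_local[OF _ fl(2)]) auto
 show "((snd c o ga') hvd y c) (at 0 within {0..})"
  by (rule has_vd_near[OF 1 _ fl(2)]) (use g'(2) in auto)
qed simp
hence "vlc {0..} ga' 0 = y"
 using tangent_eqI[OF geodesic_velocity_tangent[OF g'(1) ivl_Ici] y[folded g0] c[folded g0]] by simp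
thus ?thesis using g'(1) g0 by blast
qed

definition geo where "geo x y = (SOME ga. geodesic_on M {0..} ga & ga 0 = x & vlc {0..} ga 0 = y)"
definition gvel where "gvel x y = vlc {0..} (geo x y)"

context
fixes x y assumes y: "y \<in> TM x" and x: "x \<in> PM"
begin

lemma geo: "geodesic_on M {0..} (geo x y)" "geo x y 0 = x" "gvel x y 0 = y"
using someI_ex[OF geodesic_exists[OF y x]] unfolding geo_def gvel_def by auto

lemma geo_points: "0 <= t ==> geo x y t \<in> PM"
using curve_points[OF geodesic_cont[OF geo(1)]] by simp

lemma gvel_tangent: "0 <= t ==> gvel x y t \<in> TM (geo x y t)"
unfolding gvel_def by (rule geodesic_velocity_tangent[OF geo(1) ivl_Ici]) simp

lemma geo_unique:
assumes "geodesic_on M {0..b} ga" "0 < b" "ga 0 = x" "vlc {0..b} ga 0 = y" "0 <= t" "t <= b"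
shows "ga t = geo x y t" "vlc {0..b} ga t = gvel x y t"
proof -
have sub: "{0..b} <= {0..}" by auto
note r = geodesic_restrict[OF geo(1) ivl_Ici ivl_Icc[OF assms(2)] sub]
have "vlc {0..b} (geo x y) 0 = y" using r(2)[of 0] assms(2) geo(3) by (simp add: gvel_def)
thus "ga t = geo x y t" "vlc {0..b} ga t = gvel x y t"
 using geodesic_unique[OF assms(1) r(1) assms(2) _ _ assms(5,6)] assms geo(2) r(2)[of t] by (auto simp: gvel_def)
qed

text \<open>Shift, scaling and reversal are the cases \<open>q = 1\<close>, \<open>p = 0\<close> and
  \<open>q = -1\<close> of this one consequence of uniqueness.\<close>

lemma geo_affine:
assumes "0 <= p" "0 < b" "!!t. t \<in> {0..b} ==> 0 <= p + q * t" "0 <= t" "t <= b"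
shows "geo (geo x y p) (tscale q (gvel x y p)) t = geo x y (p + q * t)"
 "gvel (geo x y p) (tscale q (gvel x y p)) t = tscale q (gvel x y (p + q * t))"
proof -
have y': "tscale q (gvel x y p) \<in> TM (geo x y p)" by (rule tangent_tscale[OF gvel_tangent[OF assms(1)]])
have h: "p + q * t \<in> {0..}" if "t \<in> {0..b}" for t using assms(3)[OF that] by simp
note a = geodesic_affine[OF geo(1) ivl_Ici ivl_Icc[OF assms(2)] h]
have "vlc {0..b} (%t. geo x y (p + q * t)) 0 = tscale q (gvel x y p)"
 using a(2)[of 0] assms(2) by (simp add: gvel_def)
note u = berwald_mfd.geodesic_unique
have sub: "{0..b} <= {0..}" by auto
obtain ga2 where g2: "ga2 = geo (geo x y p) (tscale q (gvel x y p))" by simp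
have G: "geodesic_on M {0..} ga2" "ga2 0 = geo x y p" "vlc {0..} ga2 0 = tscale q (gvel x y p)"
 using someI_ex[OF geodesic_exists[OF y' geo_points[OF assms(1)]]] unfolding g2 geo_def[of "geo x y p"] by auto
note r = geodesic_restrict[OF G(1) ivl_Ici ivl_Icc[OF assms(2)] sub]
have "ga2 t = geo x y (p + q * t) & vlc {0..b} ga2 t = vlc {0..b} (%t. geo x y (p + q * t)) t"
 by (rule geodesic_unique[OF r(1) a(1) assms(2) _ _ assms(4,5)])
   (use G r(2)[of 0] a(2)[of 0] assms(2) in "auto simp: gvel_def")
thus "geo (geo x y p) (tscale q (gvel x y p)) t = geo x y (p + q * t)"
 "gvel (geo x y p) (tscale q (gvel x y p)) t = tscale q (gvel x y (p + q * t))"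
 using r(2)[of t] a(2)[of t] assms(4,5) unfolding gvel_def g2 by auto
qed

lemma geo_shift: assumes "0 <= s" "0 <= t"
shows "geo (geo x y s) (gvel x y s) t = geo x y (s + t)" "gvel (geo x y s) (gvel x y s) t = gvel x y (s + t)"
using geo_affine[of s "t + 1" 1 t] assms by (auto simp: tscale_one)

lemma geo_scale: assumes "0 <= a" "0 <= t"
shows "geo x (tscale a y) t = geo x y (a * t)" "gvel x (tscale a y) t = tscale a (gvel x y (a * t))"
using geo_affine[of 0 "t + 1" a t] assms geo by auto

lemma geo_reverse: assumes "0 < b" "0 <= t" "t <= b"
shows "geo (geo x y b) (tscale (-1) (gvel x y b)) t = geo x y (b - t)"
 "gvel (geo x y b) (tscale (-1) (gvel x y b)) t = tscale (-1) (gvel x y (b - t))"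
using geo_affine[of b b "-1" t] assms by auto

lemma fexp_eq: "fexp M x y = geo x y 1"
unfolding fexp_def
proof (rule the_equality)
have sub: "{0..1::real} <= {0..}" by auto
note r = geodesic_restrict[OF geo(1) ivl_Ici ivl_Icc[of 0 1] sub]
show "EX ga. geodesic_on M {0..1} ga & ga 0 = x & vlc {0..1} ga 0 = y & ga 1 = geo x y 1"
 using r(1) r(2)[of 0] geo by (intro exI[of _ "geo x y"]) (auto simp: gvel_def)
show "q = geo x y 1" if "EX ga. geodesic_on M {0..1} ga & ga 0 = x & vlc {0..1} ga 0 = y & ga 1 = q" for q
 using that geo_unique(1)[of 1 _ 1] by auto
qed

lemma geo_coord: assumes "0 <= t" "c \<in> Ch (geo x y t)"
shows "((%s. snd c (geo x y s)) hvd gvel x y t c) (at t within {0..})"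
 "((%s. gvel x y s c) hvd - Gm c (snd c (geo x y t)) (gvel x y t c) (gvel x y t c)) (at t within {0..})"
using geodesicD[OF geo(1) _ assms(2)] assms(1) unfolding gvel_def by (auto simp: o_def)

end

end

section \<open>The geodesic flow and Jacobi fields\<close>

context complete_mfd
begin

abbreviation "WW c \<equiv> cdom c \<times> (UNIV :: (real ^ 'n) set)"

definition pt :: "('m, 'n) chart => 'n tpoint => 'm" where "pt c z = ci c (fst z)"
definition vec where "vec c z = coord_tvec M c (pt c z) (snd z)"
abbreviation "gz c z \<equiv> geo (pt c z) (vec c z)"
abbreviation "vz c z \<equiv> gvel (pt c z) (vec c z)"
definition fl where "fl c c' t z = (snd c' (gz c z t), vz c z t c')"

text \<open>Together with \<open>pt_vec_coord\<close> this is the dictionary between tangent vectors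
  and their coordinates. The map \<open>fl c c'\<close> is the geodesic flow with initial values
  read in \<open>c\<close> and states read in \<open>c'\<close>, since a geodesic may leave the
  chart in which it starts.\<close>

lemma pt_vec: assumes "c \<in> AM" "z \<in> WW c"
shows "c \<in> Ch (pt c z)" "pt c z \<in> PM" "vec c z \<in> TM (pt c z)"
 "snd c (pt c z) = fst z" "vec c z c = snd z"
proof -
have f: "fst z \<in> cdom c" using assms(2) by auto
show 1: "c \<in> Ch (pt c z)" unfolding pt_def by (rule charts_at_inv[OF assms(1) f])
show "pt c z \<in> PM" by (rule chD(3)[OF 1])
show "vec c z \<in> TM (pt c z)" "vec c z c = snd z" unfolding vec_def by (rule coord_tvec_tangent[OF 1])+
show "snd c (pt c z) = fst z" unfolding pt_def by (rule chart_inv(2)[OF assms(1) f])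
qed

lemma pt_vec_coord: assumes "c \<in> Ch x" "y \<in> TM x"
shows "pt c (snd c x, y c) = x" "vec c (snd c x, y c) = y" "(snd c x, y c) \<in> WW c"
proof -
show 1: "pt c (snd c x, y c) = x" unfolding pt_def using chart_inv(1)[OF chD(1,2)[OF assms(1)]] by simp
show "vec c (snd c x, y c) = y" unfolding vec_def 1 using tangent_coord[OF assms(2,1)] by simp
show "(snd c x, y c) \<in> WW c" using in_cdom[OF assms(1)] by simp
qed

lemma fl_zero: "c \<in> AM ==> z \<in> WW c ==> fl c c 0 z = z"
using geo(2,3)[OF pt_vec(3,2)] pt_vec(4,5) by (simp add: fl_def)

lemma fl_add:
assumes c: "c \<in> AM" "z \<in> WW c" and t: "0 <= t" "0 <= s" and c': "c' \<in> Ch (gz c z t)"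
shows "fl c c'' (t + s) z = fl c' c'' s (fl c c' t z)"
 "pt c' (fl c c' t z) = gz c z t" "vec c' (fl c c' t z) = vz c z t"
 "fl c c' t z \<in> WW c'"
proof -
note p = pt_vec(3,2)[OF c]
show 1: "pt c' (fl c c' t z) = gz c z t" "vec c' (fl c c' t z) = vz c z t"
 "fl c c' t z \<in> WW c'"
 unfolding fl_def using pt_vec_coord[OF c' gvel_tangent[OF p t(1)]] by auto
show "fl c c'' (t + s) z = fl c' c'' s (fl c c' t z)"
 unfolding fl_def[of c' c'' s] 1 using geo_shift[OF p t] by (simp add: fl_def)
qed

lemma flow_box:
assumes c: "c \<in> AM" and z: "z \<in> WW c" and d: "0 < d" "ph 0 = z"
 and W: "!!t. t \<in> {0..d} ==> ph t \<in> WW c"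
 and sol: "!!t. t \<in> {0..d} ==> (ph hvd fld c (ph t)) (at t within {0..d})"
 and t: "t \<in> {0..d}"
shows "fl c c t z = ph t" "c \<in> Ch (gz c z t)"
proof -
let ?g = "%t. ci c (fst (ph t))"
have W': "fst (ph t) \<in> cdom c" if "t \<in> {0..d}" for t using W[OF that] by auto
have sg1: "geodesic_on M {0..d} ?g" by (rule sol_geodesic(1)[OF c d(1) W' sol])
have sg2: "vlc {0..d} ?g t c = snd (ph t)" if "t \<in> {0..d}" for t
 by (rule sol_geodesic(2)[OF c d(1) W' sol that])
have g0: "?g 0 = pt c z" using d(2) by (simp add: pt_def)
have z0: "0 \<in> {0..d}" using d by simp
have "vlc {0..d} ?g 0 = vec c z"
 using tangent_eqI[OF geodesic_velocity_tangent[OF sg1 ivl_Icc[OF d(1)] z0] _ _ , of "vec c z" c]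
  pt_vec(1,3,5)[OF c z] sg2[OF z0] d(2) unfolding g0 by simp
note u = geo_unique[OF pt_vec(3,2)[OF c z] sg1 d(1) g0 this, of t]
have e: "?g t = gz c z t" "vlc {0..d} ?g t = vz c z t" using u t by auto
show "c \<in> Ch (gz c z t)" unfolding e(1)[symmetric] by (rule charts_at_inv[OF c W'[OF t]])
show "fl c c t z = ph t"
 unfolding fl_def e[symmetric] using chart_inv(2)[OF c W'[OF t]] sg2[OF t] by simp
qed

definition "fbox c W z0 r d D \<longleftrightarrow> 0 < r & 0 < d & ball z0 r <= W & (ALL z:ball z0 r. (ALL h. D 0 z h = h) &
 (ALL t:{0..d}. fl c c t z \<in> W & c \<in> Ch (gz c z t) & (fl c c t hfd D t z) (at z) &
  (ALL h. ((%t. D t z h) hvd fd (fld c) (fl c c t z) (D t z h)) (at t within {0..d}))))"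

lemma fboxD:
assumes "fbox c W z0 r d D"
shows "0 < r" "0 < d" "ball z0 r <= W"
 "z \<in> ball z0 r ==> t \<in> {0..d} ==> fl c c t z \<in> W & c \<in> Ch (gz c z t)"
 "z \<in> ball z0 r ==> t \<in> {0..d} ==> (fl c c t hfd D t z) (at z)" "z \<in> ball z0 r ==> D 0 z h = h"
 "z \<in> ball z0 r ==> t \<in> {0..d} ==> ((%t. D t z h) hvd fd (fld c) (fl c c t z) (D t z h)) (at t within {0..d})"
using assms unfolding fbox_def by blast+

lemma box_in:
assumes c: "c \<in> AM" and W: "open W" "W <= WW c" and z0: "z0 \<in> W"
shows "EX r d D. fbox c W z0 r d D"
proof -
obtain r d ph D where b: "0 < r" "0 < d" "cball z0 r <= W"
 "!!z. z \<in> ball z0 r ==> ph 0 z = z"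
 "!!z t. z \<in> ball z0 r ==> t \<in> {0..d} ==> ph t z \<in> W"
 "!!z t. z \<in> ball z0 r ==> t \<in> {0..d} ==>
   ((%t. ph t z) hvd fld c (ph t z)) (at t within {0..d})"
 "!!z t. z \<in> ball z0 r ==> t \<in> {0..d} ==> (ph t hfd D t z) (at z)"
 "!!z h. z \<in> ball z0 r ==> D 0 z h = h"
 "!!z t h. z \<in> ball z0 r ==> t \<in> {0..d} ==>
   ((%t. D t z h) hvd fd (fld c) (ph t z) (D t z h)) (at t within {0..d})"
 using local_flow[OF W(1) z0 Ck_on_subset[OF fld_Ck[OF c] W(2)]] by blast
have sub: "ball z0 r <= W" using b(3) ball_subset_cball by blast
have phW: "ph t z \<in> WW c" if "z \<in> ball z0 r" "t \<in> {0..d}" for t z using b(5)[OF that] W(2) by blast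
have f: "fl c c t z = ph t z" "c \<in> Ch (gz c z t)" if "z \<in> ball z0 r" "t \<in> {0..d}" for t z
proof -
 have zW: "z \<in> WW c" using sub that(1) W(2) by blast
 show "fl c c t z = ph t z"
  by (rule flow_box(1)[where ph = "%t. ph t z", OF c zW b(2) b(4)[OF that(1)] phW[OF that(1)] b(6)[OF that(1)] that(2)])
 show "c \<in> Ch (gz c z t)"
  by (rule flow_box(2)[where ph = "%t. ph t z", OF c zW b(2) b(4)[OF that(1)] phW[OF that(1)] b(6)[OF that(1)] that(2)])
qed
have D: "(fl c c t hfd D t z) (at z)" if "z \<in> ball z0 r" "t \<in> {0..d}" for t z
 by (rule htw_open[OF b(7)[OF that] open_ball that(1)])
  (rule f(1)[symmetric, OF _ that(2)])
have V: "((%t. D t z h) hvd fd (fld c) (fl c c t z) (D t z h)) (at t within {0..d})"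
 if "z \<in> ball z0 r" "t \<in> {0..d}" for z t h using b(9)[OF that] f(1)[OF that] by simp
have In: "fl c c t z \<in> W & c \<in> Ch (gz c z t)" if "z \<in> ball z0 r" "t \<in> {0..d}" for t z
 using b(5)[OF that] f[OF that] by simp
show ?thesis unfolding fbox_def using b(1,2,8) sub In D V by (intro exI[of _ r] exI[of _ d] exI[of _ D]) blast
qed

definition TT where "TT c c' z = (transition c c' (fst z), fd (transition c c') (fst z) (snd z))"

lemma TT_has_derivative:
assumes c: "c \<in> Ch x" "c' \<in> Ch x"
shows "(TT c c' hfd (%h. (Dt c c' x (fst h), D2t c c' x v (fst h) + Dt c c' x (snd h)))) (at (snd c x, v))"
proof -
let ?O = "snd c ` (fst c Int fst c')" and ?z = "(snd c x, v)"
let ?T = "?O \<times> (UNIV :: (real ^ 'n) set)"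
have T: "open ?T" "?z \<in> ?T"
 using overlap_open[OF chD(1)[OF c(1)] chD(1)[OF c(2)]] in_overlap[OF c] by (auto intro: open_Times)
have f: "(fst hfd fst) (at ?z)" and s: "(snd hfd snd) (at ?z within ?T)"
 by (rule bounded_linear_imp_has_derivative, rule bounded_linear_fst, rule bounded_linear_imp_has_derivative, rule bounded_linear_snd)
have 1: "((%z. transition c c' (fst z)) hfd (%h. Dt c c' x (fst h))) (at ?z)"
 using diff_chain_at[OF f, of "transition c c'" "Dt c c' x"] transition_deriv[OF c] by (simp add: o_def)
have B: "((%z. fd (transition c c') (fst z) u) hfd (%h. D2t c c' x u (fst h))) (at ?z within ?T)" for u
 using diff_chain_at[OF f, of "%xi. fd (transition c c') xi u" "D2t c c' x u"] D2t(1)[OF c]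
 by (auto simp: o_def intro: has_derivative_at_withinI)
have 2: "((%z. fd (transition c c') (fst z) (snd z)) hfd
  (%h. D2t c c' x (snd ?z) (fst h) + fd (transition c c') (fst ?z) (snd h))) (at ?z within ?T)"
proof (rule hfd_moving[OF B _ T(2) _ s])
 fix w assume "w \<in> ?T"
 then obtain p where "fst w = snd c p" "c \<in> Ch p" "c' \<in> Ch p"
  using chD(1)[OF c(1)] chD(1)[OF c(2)] by (auto simp: charts_at_def)
 thus "linear (fd (transition c c') (fst w))" using Dt_linear by simp
next
 show "linear (%u. D2t c c' x u (fst h))" for h by (rule D2t(4)[OF c])
qed
show ?thesis unfolding TT_def[abs_def]
 using has_derivative_Pair[OF 1 2[unfolded at_within_open[OF T(2,1)]]] by simp
qed

lemma fl_change:
assumes "c \<in> AM" "z \<in> WW c" "0 <= t" "c1 \<in> Ch (gz c z t)" "c2 \<in> Ch (gz c z t)"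
shows "fl c c2 t z = TT c1 c2 (fl c c1 t z)"
using transition_chart[OF assms(4)] tangentD(1)[OF gvel_tangent[OF pt_vec(3,2)[OF assms(1,2)] assms(3)] assms(4,5)]
by (simp add: fl_def TT_def)

section \<open>Differentiability of the geodesic flow for all times\<close>

definition regc where
"regc c c1 t z0 \<longleftrightarrow> (EX N. open N & z0 \<in> N & N <= WW c &
  (ALL z:N. c1 \<in> Ch (gz c z t) & fl c c1 t differentiable (at z)))"

lemma continuous_on_fl: "(!!z. z \<in> N ==> f differentiable (at z)) ==> continuous_on N f"
by (simp add: continuous_at_imp_continuous_on differentiable_imp_continuous_within)

lemma regc_change:
assumes c: "c \<in> AM" and t: "0 <= t" and r: "regc c c1 t z0" and c2: "c2 \<in> Ch (gz c z0 t)"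
shows "regc c c2 t z0"
proof -
obtain N where N: "open N" "z0 \<in> N" "N <= WW c"
 "!!z. z \<in> N ==> c1 \<in> Ch (gz c z t)" "!!z. z \<in> N ==> fl c c1 t differentiable (at z)"
 using r unfolding regc_def by blast
have a: "c1 \<in> AM" "c2 \<in> AM" using chD(1)[OF N(4)[OF N(2)]] chD(1)[OF c2] by auto
let ?T = "(snd c1 ` (fst c1 Int fst c2)) \<times> (UNIV :: (real ^ 'n) set)"
have T: "open ?T" using overlap_open[OF a] by (intro open_Times open_UNIV)
define N' where "N' = N Int fl c c1 t -` ?T"
have oN': "open N'" unfolding N'_def Int_commute[of N]
 using continuous_on_open_vimage[OF N(1)] continuous_on_fl[OF N(5)] T by (metis Int_commute)
have c2N: "c2 \<in> Ch (gz c z t)" if z: "z \<in> N'" for z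
proof -
 let ?p = "gz c z t"
 have "snd c1 ?p \<in> snd c1 ` (fst c1 Int fst c2)" using z unfolding N'_def fl_def by auto
 then obtain p where p: "p \<in> fst c1" "p \<in> fst c2" "snd c1 ?p = snd c1 p" by auto
 have "?p \<in> fst c1" using chD(2)[OF N(4)] z by (simp add: N'_def)
 hence "?p = p" using chart_inj[OF a(1)] p by (auto dest: inj_onD)
 thus ?thesis using p a by (simp add: charts_at_def)
qed
have z0': "z0 \<in> N'" unfolding N'_def fl_def using N(2) in_overlap[OF N(4)[OF N(2)] c2] by simp
have df: "fl c c2 t differentiable (at z)" if z: "z \<in> N'" for z
proof -
 have zN: "z \<in> N" and zW: "z \<in> WW c" using z N(3) by (auto simp: N'_def)
 have "(TT c1 c2 hfd (%h. (Dt c1 c2 (gz c z t) (fst h),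
   D2t c1 c2 (gz c z t) (vz c z t c1) (fst h) + Dt c1 c2 (gz c z t) (snd h)))) (at (fl c c1 t z))"
  unfolding fl_def by (rule TT_has_derivative[OF N(4)[OF zN] c2N[OF z]])
 from diff_chain_at[OF fd_works[OF N(5)[OF zN]] this] obtain D where "((TT c1 c2 o fl c c1 t) hfd D) (at z)" by blast
 hence "(fl c c2 t hfd D) (at z)"
 proof (rule htw_open[OF _ oN' z])
  fix w assume w: "w \<in> N'"
  hence "w \<in> N" "w \<in> WW c" using N(3) by (auto simp: N'_def)
  thus "(TT c1 c2 o fl c c1 t) w = fl c c2 t w" using fl_change[OF c _ t N(4) c2N[OF w]] by simp
 qed
 thus ?thesis unfolding differentiable_def by blast
qed
show ?thesis unfolding regc_def using oN' z0' N(3) c2N df by (intro exI[of _ N']) (auto simp: N'_def)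
qed

lemma regc_step:
assumes c: "c \<in> AM" and t: "0 <= t" "0 <= s" and r: "regc c c1 t z0"
 and b: "!!z. z \<in> B ==> c1 \<in> Ch (gz c1 z s)" "!!z. z \<in> B ==> fl c1 c1 s differentiable (at z)"
  "open B" "fl c c1 t z0 \<in> B"
shows "regc c c1 (t + s) z0"
proof -
obtain N where N: "open N" "z0 \<in> N" "N <= WW c"
 "!!z. z \<in> N ==> c1 \<in> Ch (gz c z t)" "!!z. z \<in> N ==> fl c c1 t differentiable (at z)"
 using r unfolding regc_def by blast
define N' where "N' = N Int fl c c1 t -` B"
have oN': "open N'" unfolding N'_def
 using continuous_on_open_vimage[OF N(1)] continuous_on_fl[OF N(5)] b(3) by (metis Int_commute)
have sub: "N' <= WW c" "N' <= N" using N(3) by (auto simp: N'_def)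
have zW: "z \<in> WW c" "z \<in> N" if "z \<in> N'" for z using that sub by blast+
note add = fl_add[OF c zW(1) t N(4)[OF zW(2)]]
have ch: "c1 \<in> Ch (gz c z (t + s))" if z: "z \<in> N'" for z
proof -
 have "fl c c1 t z \<in> B" using z by (simp add: N'_def)
 from b(1)[OF this] show ?thesis
  unfolding add(2,3)[OF z z] using geo_shift[OF pt_vec(3,2)[OF c zW(1)[OF z]] t] by simp
qed
have df: "fl c c1 (t + s) differentiable (at z)" if z: "z \<in> N'" for z
proof -
 have "fl c c1 t z \<in> B" using z by (simp add: N'_def)
 from diff_chain_at[OF fd_works[OF N(5)[OF zW(2)[OF z]]] fd_works[OF b(2)[OF this]]]
 obtain D where "((fl c1 c1 s o fl c c1 t) hfd D) (at z)" by blast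
 hence "(fl c c1 (t + s) hfd D) (at z)"
  by (rule htw_open[OF _ oN' z]) (simp add: add(1))
 thus ?thesis unfolding differentiable_def by blast
qed
show ?thesis unfolding regc_def using oN' N(2) b(4) sub ch df by (intro exI[of _ N']) (auto simp: N'_def)
qed

lemma state_continuous:
assumes c: "c \<in> AM" "z \<in> WW c" and t: "0 <= t" and c1: "c1 \<in> Ch (gz c z t)" and e: "0 < e"
obtains d where "0 < d" "!!s. 0 <= s ==> \<bar>s - t\<bar> < d ==> c1 \<in> Ch (gz c z s) & fl c c1 s z \<in> ball (fl c c1 t z) e"
proof -
note p = pt_vec(3,2)[OF c]
note g = geo_coord[OF p t c1]
have "((%s. fl c c1 s z) hvd fld c1 (fl c c1 t z)) (at t within {0..})"
 unfolding fl_def fld_def using pair_vd[OF g] by simp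
hence "continuous (at t within {0..}) (%s. fl c c1 s z)" by (rule has_vector_derivative_continuous)
then obtain d1 where d1: "0 < d1" "!!s. s \<in> {0..} ==> dist s t < d1 ==> dist (fl c c1 s z) (fl c c1 t z) < e"
 unfolding continuous_within_eps_delta using e by blast
have tt: "t \<in> {0..}" using t by simp
obtain d2 where d2: "0 < d2" "!!s. s \<in> {0..} ==> \<bar>s - t\<bar> < d2 ==> c1 \<in> Ch (gz c z s)"
 using near_chart[OF geodesic_cont[OF geo(1)[OF p]] tt c1] by blast
show ?thesis by (rule that[of "min d1 d2"]) (use d1 d2 in "auto simp: dist_real_def dist_commute")
qed

text \<open>Real induction over the time: the flow to time \<open>t + s\<close> is the flow to time
  \<open>t\<close> followed by a flow box. At a limit time the box is placed around the limiting
  state and entered slightly earlier, which works because a box has the same duration for all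
  initial values in it.\<close>

lemma fl_regular:
assumes c: "c \<in> AM" and z0: "z0 \<in> WW c" and T: "0 <= T" and c1: "c1 \<in> Ch (gz c z0 T)"
shows "regc c c1 T z0"
proof -
let ?g = "gz c z0"
note p = pt_vec(3,2)[OF c z0]
define P where "P t \<longleftrightarrow> (ALL c1:Ch (?g t). regc c c1 t z0)" for t
have boxd: "EX r d. 0 < r & 0 < d & (ALL s:{0..d}. ALL z:ball w r. c1 \<in> Ch (gz c1 z s) & fl c1 c1 s differentiable (at z))"
 if "c1 \<in> AM" "w \<in> WW c1" for c1 w
 using box_in[OF that(1) open_W[OF that(1)] order_refl that(2)] fboxD unfolding differentiable_def by metis
have key: "P (t + s)" if "P t" "0 <= t" "0 <= s" "c1 \<in> Ch (?g t)"
 "!!z. z \<in> ball w r ==> c1 \<in> Ch (gz c1 z s) & fl c1 c1 s differentiable (at z)"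
 "fl c c1 t z0 \<in> ball w r" for t s c1 w r
proof -
 have "regc c c1 t z0" using that(1,4) by (auto simp: P_def)
 from regc_step[OF c that(2,3) this _ _ open_ball that(6)] that(5)
 have "regc c c1 (t + s) z0" by blast
 thus ?thesis unfolding P_def using regc_change[OF c] that(2,3) by (meson add_nonneg_nonneg)
qed
have "P T"
proof (rule real_induct[of 0 T P])
 have "regc c c 0 z0" unfolding regc_def
 proof (intro exI[of _ "WW c"] conjI ballI open_W[OF c] z0 subset_refl)
  fix z assume z: "z \<in> WW c"
  show "c \<in> Ch (gz c z 0)" using geo(2)[OF pt_vec(3,2)[OF c z]] pt_vec(1)[OF c z] by simp
  have "(fl c c 0 hfd (%h. h)) (at z)"
   by (rule htw_open[OF has_derivative_ident open_W[OF c] z]) (simp add: fl_zero[OF c])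
  thus "fl c c 0 differentiable (at z)" unfolding differentiable_def by blast
 qed
 thus "P 0" unfolding P_def using regc_change[OF c] by blast
next
 fix t assume t: "0 <= t" "t < T" and Ps: "!!s. 0 <= s ==> s <= t ==> P s"
 obtain c1 where c1: "c1 \<in> Ch (?g t)" using cover geo_points[OF p t(1)] by blast
 obtain r d where rd: "0 < r" "0 < d" "!!s z. s \<in> {0..d} ==> z \<in> ball (fl c c1 t z0) r ==>
  c1 \<in> Ch (gz c1 z s) & fl c1 c1 s differentiable (at z)"
  using boxd[OF chD(1)[OF c1] fl_add(4)[OF c z0 t(1) order_refl c1]] by blast
 have "P s" if "t < s" "s <= t + d" for s
  using key[OF Ps[OF t(1) order_refl] t(1) _ c1 rd(3)[of "s - t"], of "fl c c1 t z0" r] that rd(1) by simp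
 thus "EX e>0. ALL s. t < s & s <= t + e & s <= T --> P s" using rd(2) by blast
next
 fix t assume t: "0 < t" "t <= T" and Ps: "!!s. 0 <= s ==> s < t ==> P s"
 have t0: "0 <= t" using t by simp
 obtain c1 where c1: "c1 \<in> Ch (?g t)" using cover geo_points[OF p t0] by blast
 obtain r d where rd: "0 < r" "0 < d" "!!s z. s \<in> {0..d} ==> z \<in> ball (fl c c1 t z0) r ==>
  c1 \<in> Ch (gz c1 z s) & fl c1 c1 s differentiable (at z)"
  using boxd[OF chD(1)[OF c1] fl_add(4)[OF c z0 t0 order_refl c1]] by blast
 obtain e where e: "0 < e" "!!s. 0 <= s ==> \<bar>s - t\<bar> < e ==> c1 \<in> Ch (?g s) & fl c c1 s z0 \<in> ball (fl c c1 t z0) r"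
  using state_continuous[OF c z0 t0 c1 rd(1)] by blast
 \<comment> \<open>Late enough that the state already lies in the box and that the remaining time
   fits into its duration.\<close>
 define s where "s = t - min (min (e/2) d) t"
 have s: "0 <= s" "s < t" "\<bar>s - t\<bar> < e" "t - s \<in> {0..d}" using e rd(2) t by (auto simp: s_def min_def)
 have "P (s + (t - s))"
  by (rule key[OF Ps[OF s(1,2)] s(1) _ _ rd(3)[OF s(4)]]) (use s e(2)[OF s(1,3)] in auto)
 thus "P t" by simp
qed (use T in auto)
thus ?thesis using c1 by (simp add: P_def)
qed

lemma fl_differentiable:
assumes "c \<in> AM" "z \<in> WW c" "0 <= t" "c1 \<in> Ch (gz c z t)"
shows "(fl c c1 t hfd fd (fl c c1 t) z) (at z)"
using fl_regular[OF assms] unfolding regc_def by (auto intro: fd_works)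

text \<open>The variation of geodesics with initial displacement \<open>h\<close>: \<open>jf\<close>
  is the Jacobi field in coordinates and \<open>kf\<close> its covariant derivative. The connection
  term makes \<open>kf\<close> transform as a tangent vector.\<close>

definition jf where "jf c z h t c1 = fst (fd (fl c c1 t) z h)"
definition kf where "kf c z h t c1 = snd (fd (fl c c1 t) z h)
+ Gm c1 (fst (fl c c1 t z)) (snd (fl c c1 t z)) (fst (fd (fl c c1 t) z h))"

lemma fd_fl_change:
assumes c: "c \<in> AM" and z: "z \<in> WW c" and t: "0 <= t"
 and c1: "c1 \<in> Ch (gz c z t)" and c2: "c2 \<in> Ch (gz c z t)"
shows "jf c z h t c2 = Dt c1 c2 (gz c z t) (jf c z h t c1)"
 "kf c z h t c2 = Dt c1 c2 (gz c z t) (kf c z h t c1)"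
proof -
let ?x = "gz c z t" and ?v = "vz c z t"
let ?A = "Dt c1 c2 ?x" and ?D = "fd (fl c c1 t) z h"
obtain N where N: "open N" "z \<in> N" "N <= WW c" "!!z. z \<in> N ==> c1 \<in> Ch (gz c z t)"
 using fl_regular[OF c z t c1] unfolding regc_def by blast
obtain N2 where N2: "open N2" "z \<in> N2" "!!z. z \<in> N2 ==> c2 \<in> Ch (gz c z t)"
 using fl_regular[OF c z t c2] unfolding regc_def by blast
have "(TT c1 c2 hfd (%h. (?A (fst h), D2t c1 c2 ?x (?v c1) (fst h) + ?A (snd h)))) (at (fl c c1 t z))"
 unfolding fl_def by (rule TT_has_derivative[OF c1 c2])
from diff_chain_at[OF fl_differentiable[OF c z t c1] this]
have "((TT c1 c2 o fl c c1 t) hfd (%h. (?A (fst (fd (fl c c1 t) z h)),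
  D2t c1 c2 ?x (?v c1) (fst (fd (fl c c1 t) z h)) + ?A (snd (fd (fl c c1 t) z h))))) (at z)" by (simp add: o_def)
hence "(fl c c2 t hfd (%h. (?A (fst (fd (fl c c1 t) z h)),
  D2t c1 c2 ?x (?v c1) (fst (fd (fl c c1 t) z h)) + ?A (snd (fd (fl c c1 t) z h))))) (at z)"
proof (rule htw_open[OF _ open_Int[OF N(1) N2(1)] IntI[OF N(2) N2(2)]])
 show "(TT c1 c2 o fl c c1 t) w = fl c c2 t w" if "w \<in> N Int N2" for w
  using fl_change[OF c _ t N(4) N2(3), of w] that N(3) by auto
qed
from fun_cong[OF fd_eqI[OF this], of h]
have e: "fd (fl c c2 t) z h = (?A (fst ?D), D2t c1 c2 ?x (?v c1) (fst ?D) + ?A (snd ?D))" .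
show "jf c z h t c2 = ?A (jf c z h t c1)" unfolding jf_def e by simp
have v2: "?v c2 = ?A (?v c1)" by (rule tangentD(1)[OF gvel_tangent[OF pt_vec(3,2)[OF c z] t] c1 c2])
show "kf c z h t c2 = ?A (kf c z h t c1)"
 unfolding kf_def e fl_def fst_conv snd_conv v2 Gm_change[OF c1 c2] linear_add[OF Dt_linear[OF c1 c2]] by simp
qed

text \<open>The semigroup law, differentiated at a time \<open>s0\<close> before \<open>t\<close>,
  turns the variational equation inside a flow box into one around \<open>t\<close>.\<close>

lemma fl_variation:
assumes c: "c \<in> AM" and z: "z \<in> WW c" and t: "0 <= t" and c1: "c1 \<in> Ch (gz c z t)"
shows "((%s. fd (fl c c1 s) z h) hvd fd (fld c1) (fl c c1 t z) (fd (fl c c1 t) z h)) (at t within {0..})"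
proof -
let ?g = "gz c z"
note a1 = chD(1)[OF c1]
obtain r d D where "fbox c1 (WW c1) (fl c c1 t z) r d D"
 using box_in[OF a1 open_W[OF a1] order_refl fl_add(4)[OF c z t order_refl c1]] by blast
note b = fboxD[OF this]
obtain e where e: "0 < e" "!!s. 0 <= s ==> \<bar>s - t\<bar> < e ==> c1 \<in> Ch (?g s) & fl c c1 s z \<in> ball (fl c c1 t z) r"
 using state_continuous[OF c z t c1 b(1)] by blast
\<comment> \<open>For \<open>t > 0\<close> this is strictly earlier than \<open>t\<close>, so that
  \<open>t\<close> is interior to the interval covered by the box; for \<open>t = 0\<close> the two
  coincide and a one-sided derivative is all that is asked.\<close>
define s0 where "s0 = t - min (min (e/2) (d/2)) t"
have s0: "0 <= s0" "s0 <= t" "\<bar>s0 - t\<bar> < e" "t - s0 <= d/2" "t = 0 \<or> s0 < t" using e(1) b(2) t by (auto simp: s0_def min_def)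
have c0: "c1 \<in> Ch (?g s0)" and w: "fl c c1 s0 z \<in> ball (fl c c1 t z) r" using e(2)[OF s0(1,3)] by auto
let ?w = "fl c c1 s0 z" and ?k = "fd (fl c c1 s0) z h"
obtain N where N: "open N" "z \<in> N" "N <= WW c" "!!z. z \<in> N ==> c1 \<in> Ch (gz c z s0)"
 using fl_regular[OF c z s0(1) c0] unfolding regc_def by blast
have W: "fd (fl c c1 s) z h = D (s - s0) ?w ?k" "fl c c1 s z = fl c1 c1 (s - s0) ?w" if s: "s \<in> {s0..s0 + d}" for s
proof -
 have sd: "s - s0 \<in> {0..d}" "0 <= s - s0" using s by auto
 have "((fl c1 c1 (s - s0) o fl c c1 s0) hfd (D (s - s0) ?w o fd (fl c c1 s0) z)) (at z)"
  by (rule diff_chain_at[OF fl_differentiable[OF c z s0(1) c0] b(5)[OF w sd(1)]])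
 hence "(fl c c1 s hfd (D (s - s0) ?w o fd (fl c c1 s0) z)) (at z)"
 proof (rule htw_open[OF _ N(1,2)])
  fix y assume y: "y \<in> N"
  hence "y \<in> WW c" using N(3) by blast
  from fl_add(1)[OF c this s0(1) sd(2) N(4)[OF y]]
  show "(fl c1 c1 (s - s0) o fl c c1 s0) y = fl c c1 s y" by simp
 qed
 from fd_eqI[OF this] show "fd (fl c c1 s) z h = D (s - s0) ?w ?k" by simp
 show "fl c c1 s z = fl c1 c1 (s - s0) ?w" using fl_add(1)[OF c z s0(1) sd(2) c0] by simp
qed
have ts: "t \<in> {s0..s0 + d}" using s0 b(2) by auto
have td: "t - s0 \<in> {0..d}" using ts by auto
have "((%s. s - s0) hvd 1) (at t within {s0..s0 + d})" by (auto intro!: derivative_eq_intros)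
moreover have "((%s. D s ?w ?k) hvd fd (fld c1) (fl c1 c1 (t - s0) ?w) (D (t - s0) ?w ?k))
  (at (t - s0) within (%s. s - s0) ` {s0..s0 + d})"
 by (rule hvd_sub[OF b(7)[OF w td]]) auto
ultimately have "(((%s. D s ?w ?k) o (%s. s - s0)) hvd
  1 *R fd (fld c1) (fl c1 c1 (t - s0) ?w) (D (t - s0) ?w ?k)) (at t within {s0..s0 + d})"
 by (rule vector_diff_chain_within)
hence "((%s. D (s - s0) ?w ?k) hvd fd (fld c1) (fl c c1 t z) (fd (fl c c1 t) z h)) (at t within {s0..s0 + d})"
 unfolding W[OF ts] by (simp add: o_def)
hence "((%s. fd (fl c c1 s) z h) hvd fd (fld c1) (fl c c1 t z) (fd (fl c c1 t) z h)) (at t within {s0..s0 + d})"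
 by (rule has_vd_near[OF _ ts zero_less_one]) (rule W(1)[symmetric])
note V = this
show ?thesis
proof (cases "t = 0")
 case True
 hence "s0 = 0" using s0(1,2) by simp
 show ?thesis by (rule has_vd_within_local[OF V b(2)]) (use True \<open>s0 = 0\<close> in auto)
next
 case False
 hence e': "0 < min (t - s0) (d/2)" using s0(5) b(2) by simp
 show ?thesis by (rule has_vd_within_local[OF V e']) (use s0(1,4) in auto)
qed
qed

text \<open>The linearised geodesic equation in covariant form. The derivatives of the coefficients
  along the Jacobi field and along the velocity combine into the curvature.\<close>

lemma jacobi:
assumes c: "c \<in> AM" and z: "z \<in> WW c" and t: "0 <= t" and c1: "c1 \<in> Ch (gz c z t)"
defines "x \<equiv> snd c1 (gz c z t)" and "v \<equiv> vz c z t c1"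
shows "((%s. jf c z h s c1) hvd kf c z h t c1 - Gm c1 x v (jf c z h t c1)) (at t within {0..})"
 "((%s. kf c z h s c1) hvd Rc c1 x v (jf c z h t c1) v - Gm c1 x v (kf c z h t c1)) (at t within {0..})"
proof -
note a1 = chD(1)[OF c1] and p = pt_vec(3,2)[OF c z]
interpret C: cberwald "LM c1" "cdom c1" by (rule cberwald[OF a1])
have xd: "x \<in> cdom c1" unfolding x_def by (rule in_cdom[OF c1])
let ?w = "fd (fl c c1 t) z h"
define a where "a = fst ?w" define b where "b = snd ?w"
have flt: "fl c c1 t z = (x, v)" unfolding fl_def x_def v_def by simp
have j: "jf c z h t c1 = a" and k: "kf c z h t c1 = b + C.Gx x v a" unfolding jf_def kf_def flt a_def b_def by auto
have w: "?w = (a, b)" by (simp add: a_def b_def)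
note V = fl_variation[OF c z t c1, of h, unfolded flt w fld_fd[OF a1 xd]]
have da: "((%s. fst (fd (fl c c1 s) z h)) hvd b) (at t within {0..})"
 using bounded_linear.has_vector_derivative[OF bounded_linear_fst V] by simp
have db: "((%s. snd (fd (fl c c1 s) z h)) hvd - (C.dGx x a v v + C.Gx x b v + C.Gx x v b)) (at t within {0..})"
 using bounded_linear.has_vector_derivative[OF bounded_linear_snd V] by simp
show "((%s. jf c z h s c1) hvd kf c z h t c1 - C.Gx x v (jf c z h t c1)) (at t within {0..})"
 unfolding j k using da by (simp add: jf_def)
note g = geo_coord[OF p t c1, folded x_def v_def]
have tt: "t \<in> {0..}" using t by simp
obtain e where e: "0 < e" "!!s. s \<in> {0..} ==> \<bar>s - t\<bar> < e ==> c1 \<in> Ch (gz c z s)"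
 using near_chart[OF geodesic_cont[OF geo(1)[OF p]] tt c1] by blast
let ?x = "%s. snd c1 (gz c z s)" and ?v = "%s. vz c z s c1"
have B1: "((%s. C.Gx (?x s) u u') hvd C.dGx x v u u') (at t within {0..})" for u u'
 using has_vd_compose[OF g(1), of "%xi. C.Gx xi u u'" "%X. C.dGx x X u u'"] C.Gx_has_derivative[OF xd] by (simp add: x_def)
have B2: "((%s. C.Gx (?x s) (?v s) u') hvd C.dGx x v v u' + C.Gx x (- C.Gx x v v) u') (at t within {0..})" for u'
proof -
 have "((%s. C.Gx (?x s) (?v s) u') hvd C.dGx x v (?v t) u' + C.Gx (?x t) (- C.Gx x v v) u') (at t within {0..})"
  by (rule has_vd_moving[OF B1 _ e(1) _ tt g(2)]) (auto intro: C.Gx_lin C.dGx_lin xd)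
 thus ?thesis by (simp add: x_def v_def)
qed
have B3: "((%s. C.Gx (?x s) (?v s) (fst (fd (fl c c1 s) z h))) hvd
  (C.dGx x v v a + C.Gx x (- C.Gx x v v) a) + C.Gx x v b) (at t within {0..})"
proof -
 have "((%s. C.Gx (?x s) (?v s) (fst (fd (fl c c1 s) z h))) hvd
  (C.dGx x v v (fst ?w) + C.Gx x (- C.Gx x v v) (fst ?w)) + C.Gx (?x t) (?v t) b) (at t within {0..})"
  by (rule has_vd_moving[OF B2 _ e(1) _ tt da]) (auto intro!: C.Gx_lin C.dGx_lin xd linear_compose_add)
 thus ?thesis by (simp add: x_def v_def a_def)
qed
have "((%s. kf c z h s c1) hvd - (C.dGx x a v v + C.Gx x b v + C.Gx x v b)
  + ((C.dGx x v v a + C.Gx x (- C.Gx x v v) a) + C.Gx x v b)) (at t within {0..})"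
proof -
 have e: "fst (fl c c1 s z) = ?x s" "snd (fl c c1 s z) = ?v s" for s by (simp_all add: fl_def)
 show ?thesis unfolding kf_def e by (rule has_vector_derivative_add[OF db B3])
qed
moreover have "- (C.dGx x a v v + C.Gx x b v + C.Gx x v b) + ((C.dGx x v v a + C.Gx x (- C.Gx x v v) a) + C.Gx x v b)
  = C.Rm x v a v - C.Gx x v (b + C.Gx x v a)"
 using C.Gx_sym[OF xd, of b v] C.Gx_sym[OF xd, of "C.Gx x v a" v]
 by (simp add: C.Rm_def linear_add[OF C.Gx_lin(2)] linear_neg[OF C.Gx_lin(1)])
ultimately show "((%s. kf c z h s c1) hvd C.Rm x v (jf c z h t c1) v - C.Gx x v (kf c z h t c1)) (at t within {0..})"
 unfolding j k by simp
qed

lemma jacobi_init: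
assumes c: "c \<in> AM" and z: "z \<in> WW c"
shows "jf c z h 0 c = fst h" "kf c z h 0 c = snd h + Gm c (fst z) (snd z) (fst h)"
proof -
have "(fl c c 0 hfd (%h. h)) (at z)"
 by (rule htw_open[OF has_derivative_ident open_W[OF c] z]) (simp add: fl_zero[OF c])
thus "jf c z h 0 c = fst h" "kf c z h 0 c = snd h + Gm c (fst z) (snd z) (fst h)"
 by (simp_all add: jf_def kf_def fd_eqI fl_zero[OF c z])
qed

end

section \<open>Estimates for Jacobi fields\<close>

text \<open>As \<open>f\<close> may vanish, the square root is differentiated after adding
  \<open>d > 0\<close>; the correction can be made arbitrarily small while the Lipschitz constant
  stays the same.\<close>

lemma sqrt_lipschitz:
fixes f :: "real => real"
assumes f: "!!t. t \<in> {a..b} ==> 0 <= f t" "!!t. t \<in> {a..b} ==> (f hrd f' t) (at t within {a..b})"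
 and bd: "!!t. t \<in> {a..b} ==> \<bar>f' t\<bar> <= 2 * C * sqrt (f t)" and C: "0 <= C" and st: "s \<in> {a..b}" "t \<in> {a..b}"
shows "\<bar>sqrt (f t) - sqrt (f s)\<bar> <= C * \<bar>t - s\<bar>"
proof (rule field_le_epsilon)
fix e :: real assume e: "0 < e"
define d where "d = (e/2)^2"
have d: "0 < d" "sqrt d = e/2" using e by (auto simp: d_def)
have "norm ((%t. sqrt (f t + d)) t - (%t. sqrt (f t + d)) s) <= C * \<bar>t - s\<bar>"
proof (rule vector_derivative_bound[OF _ _ st])
 fix r assume r: "r \<in> {a..b}"
 have p: "0 < f r + d" using f(1)[OF r] d(1) by simp
 have "((%t. sqrt (f t + d)) hrd (f' r / (2 * sqrt (f r + d)))) (at r within {a..b})"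
  using p by (auto intro!: derivative_eq_intros f(2)[OF r] simp: field_simps)
 thus "((%t. sqrt (f t + d)) hvd (f' r / (2 * sqrt (f r + d)))) (at r within {a..b})"
  by (simp add: has_real_derivative_iff_has_vector_derivative)
 have "\<bar>f' r\<bar> <= 2 * C * sqrt (f r + d)"
  using bd[OF r] d(1) C by (smt (verit) mult_left_mono real_sqrt_le_iff)
 thus "norm (f' r / (2 * sqrt (f r + d))) <= C" using p by (simp add: abs_divide pos_divide_le_eq mult.commute)
qed
hence 1: "\<bar>sqrt (f t + d) - sqrt (f s + d)\<bar> <= C * \<bar>t - s\<bar>" by simp
have 2: "sqrt (f r) <= sqrt (f r + d) & sqrt (f r + d) <= sqrt (f r) + e/2" if "r \<in> {a..b}" for r
 using sqrt_add_le_add_sqrt[of "f r" d] f(1)[OF that] d by auto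
show "\<bar>sqrt (f t) - sqrt (f s)\<bar> <= C * \<bar>t - s\<bar> + e" using 1 2[OF st(1)] 2[OF st(2)] by linarith
qed

context cmetric
begin

lemma G_cauchy: assumes "z \<in> S" shows "\<bar>G z u w\<bar> <= sqrt (G z u u) * sqrt (G z w w)"
proof -
have p: "0 < G z v v" if "v ~= 0" for v using G_pos assms that by (cases z) auto
have n: "0 <= G z v v" for v using p[of v] linear_0[OF lin_G(1)[OF assms]] by (cases "v = 0") auto
show ?thesis
 using sym_form_polarization[where g = "G z" and b = "G z" and K = 1, OF lin_G(2)[OF assms] G_sym[OF assms] p
  lin_G(2)[OF assms] G_sym[OF assms]] n by simp
qed

lemma G_nonneg: "z \<in> S ==> 0 <= G z v v"
using G_pos[of "fst z" "snd z" v] linear_0[OF lin_G(1)] by (cases "v = 0") auto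

lemma G_triangle: assumes "z \<in> S" shows "sqrt (G z (u + w) (u + w)) <= sqrt (G z u u) + sqrt (G z w w)"
proof (rule real_le_lsqrt)
have "G z (u + w) (u + w) = G z u u + 2 * G z u w + G z w w"
 using G_sym[OF assms, of u w] by (simp add: linear_add[OF lin_G(1)[OF assms]] linear_add[OF lin_G(2)[OF assms]])
also have "... <= (sqrt (G z u u) + sqrt (G z w w))^2"
 using G_cauchy[OF assms, of u w] G_nonneg[OF assms] by (simp add: power2_sum)
finally show "G z (u + w) (u + w) <= (sqrt (G z u u) + sqrt (G z w w))^2" .
qed (use G_nonneg[OF assms] in auto)

end

context cberwald
begin

text \<open>With covariant derivatives \<open>y'\<close>, \<open>a'\<close>, \<open>b'\<close> the
  product rule has one extra term, the Cartan tensor in direction \<open>y'\<close>. It disappears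
  when the reference vector is parallel or occurs among the arguments.\<close>

lemma metric_along:
assumes x: "(x hvd v) (at t within I)"
 and Y: "(Y hvd y' - Gx (x t) v (Y t)) (at t within I)"
 and A: "(A hvd a' - Gx (x t) v (A t)) (at t within I)"
 and B: "(B hvd b' - Gx (x t) v (B t)) (at t within I)"
 and t: "t \<in> I" and e: "0 < e" "!!s. s \<in> I ==> \<bar>s - t\<bar> < e ==> (x s, Y s) \<in> S"
shows "((%s. G (x s, Y s) (A s) (B s)) hvd
 G (x t, Y t) a' (B t) + G (x t, Y t) (A t) b' + DG (x t, Y t) (0, y') (A t) (B t)) (at t within I)"
proof -
let ?z = "(x t, Y t)" and ?w = "(v, y' - Gx (x t) v (Y t))"
have z: "?z \<in> S" using e(2)[OF t] e(1) by simp
have B0: "((%s. G (x s, Y s) u w) hvd DG ?z ?w u w) (at t within I)" for u w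
 by (rule has_vd_compose[OF pair_vd[OF x Y], where f = "%z. G z u w"]) (rule G_has_derivative[OF z])
have B1: "((%s. G (x s, Y s) (A s) w) hvd DG ?z ?w (A t) w + G ?z (a' - Gx (x t) v (A t)) w) (at t within I)" for w
 by (rule has_vd_moving[OF B0 _ e(1) _ t A]) (use e(2) z in "auto intro: linear_DG lin_G simp del: mem_Times_iff")
have "((%s. G (x s, Y s) (A s) (B s)) hvd
  (DG ?z ?w (A t) (B t) + G ?z (a' - Gx (x t) v (A t)) (B t)) + G ?z (A t) (b' - Gx (x t) v (B t))) (at t within I)"
 by (rule has_vd_moving[OF B1 _ e(1) _ t B])
   (use e(2) z in "auto intro!: linear_compose_add linear_DG lin_G simp del: mem_Times_iff")
moreover have "DG ?z ?w (A t) (B t) = G ?z (Gx (x t) v (A t)) (B t) + G ?z (A t) (Gx (x t) v (B t)) + DG ?z (0, y') (A t) (B t)"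
 using metric_derivative_x[OF z, of v "y' - Gx (x t) v (Y t)" "A t" "B t"] Gx_sym[of "x t" _ v] z by auto
ultimately show ?thesis
 by (simp add: linear_diff[OF lin_G(1)[OF z]] linear_diff[OF lin_G(2)[OF z]] add_ac)
qed

end

lemma has_vd_linear_comb:
assumes "(A hvd a) (at t within I)" "(B hvd b) (at t within I)"
shows "((%s. (1 - s) *R A s + B s) hvd (1 - t) *R a - A t + b) (at t within I)"
using assms by (auto intro!: derivative_eq_intros simp: algebra_simps)

section \<open>The inner products \<open>g_y\<close> without reference to a chart\<close>

context finsler_mfd
begin

definition ip where "ip x y a b = (let c = (SOME c. c \<in> Ch x) in GG c (snd c x, y c) (a c) (b c))"

lemma nz_chart: "y \<in> TM x ==> y ~= tzero ==> c \<in> Ch x ==> y c ~= 0"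
using tangent_eqI[OF _ tangent_tzero, of y x c] by (auto simp: tzero_def)

lemma ip_chart:
assumes y: "y \<in> TM x" "y ~= tzero" and ab: "a \<in> TM x" "b \<in> TM x" and c: "c \<in> Ch x"
shows "ip x y a b = GG c (snd c x, y c) (a c) (b c)"
proof -
define d where "d = (SOME c. c \<in> Ch x)"
have d: "d \<in> Ch x" unfolding d_def using c by (rule someI)
have "ip x y a b = GG d (snd d x, y d) (a d) (b d)" by (simp add: ip_def d_def Let_def)
also have "... = GG c (snd c x, y c) (a c) (b c)"
 using GG_change[OF c d nz_chart[OF y c], of "a c" "b c"] tangentD(1)[OF y(1) c d] tangentD(1)[OF ab(1) c d] tangentD(1)[OF ab(2) c d]
 by simp
finally show ?thesis .
qed

end

locale bounded_mfd = complete_mfd M for M :: "('m, 'n::finite) finsler_space" +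
fixes kb :: real
assumes flag: "flag_curv_bounded M kb"
begin

lemma Rc_bound:
assumes c: "c \<in> Ch x" and y: "y ~= 0"
shows "\<bar>GG c (snd c x, y) W (Rc c (snd c x) V y y)\<bar>
 <= \<bar>kb\<bar> * QQ c (snd c x, y) * (sqrt (GG c (snd c x, y) W W) * sqrt (GG c (snd c x, y) V V))"
proof -
interpret C: cberwald "LM c" "cdom c" by (rule chb[OF c])
show ?thesis
 by (rule C.Rm_bound[OF _ pair_in_S[OF c y]]) (use flag chD[OF c] y in "auto simp: flag_curv_bounded_def")
qed

lemma geo_tzero: assumes x: "x \<in> PM" "0 <= t" shows "geo x tzero t = x" "gvel x tzero t = tzero"
proof -
have z: "tscale 0 tzero = (tzero :: ('m, 'n) tvec)" by (simp add: tscale_def tzero_def)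
show "geo x tzero t = x" "gvel x tzero t = tzero"
 using geo_scale[OF tangent_tzero x(1) order_refl x(2)] geo(2)[OF tangent_tzero x(1)] unfolding z
 by (auto simp: tscale_def tzero_def)
qed

text \<open>Run backwards from a parameter with zero velocity the geodesic is constant, so its
  initial vector would vanish.\<close>

lemma gvel_nonzero: assumes y: "y \<in> TM x" "x \<in> PM" "y ~= tzero" and t: "0 <= t" shows "gvel x y t ~= tzero"
proof
assume z: "gvel x y t = tzero"
have m: "tscale (-1) tzero = (tzero :: ('m, 'n) tvec)" by (simp add: tscale_def tzero_def)
show False
proof (cases "t = 0")
 case True thus False using z geo(3)[OF y(1,2)] y(3) by simp
next
 case False
 hence "tzero = tscale (-1) (gvel x y 0)"
  using geo_reverse(2)[OF y(1,2), of t t] t geo_tzero(2)[OF geo_points[OF y(1,2) t], of t] unfolding z m by simp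
 hence "y = tzero" unfolding geo(3)[OF y(1,2)] by (auto simp: tscale_def tzero_def fun_eq_iff)
 thus False using y(3) by simp
qed
qed

text \<open>The reference vector of the inner product is a multiple \<open>s\<close> of the velocity; both signs of
\<open>s\<close> are needed, as the metric is not reversible.\<close>

context
fixes c :: "('m, 'n) chart" and z h :: "'n tpoint" and s :: real
assumes c: "c \<in> AM" and z: "z \<in> WW c" "snd z ~= 0" and s: "s ~= 0"
begin

abbreviation "gam \<equiv> gz c z"
abbreviation "T \<equiv> vz c z"
definition "NN t = tscale s (T t)"
text \<open>Extended by 0 to the charts not around the point, as the representation of tangent
  vectors requires.\<close>

definition "JJ t = (%c1. if c1 \<in> Ch (gam t) then jf c z h t c1 else 0)"
definition "KK t = (%c1. if c1 \<in> Ch (gam t) then kf c z h t c1 else 0)"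

lemma vec_nonzero: "vec c z ~= tzero"
using pt_vec(5)[OF c z(1)] z(2) by (auto simp: tzero_def)

lemma NN: assumes "0 <= t" shows "NN t \<in> TM (gam t)" "NN t ~= tzero"
proof -
note p = pt_vec(3,2)[OF c z(1)]
show "NN t \<in> TM (gam t)" unfolding NN_def by (rule tangent_tscale[OF gvel_tangent[OF p assms]])
show "NN t ~= tzero" using gvel_nonzero[OF p vec_nonzero assms] s by (auto simp: NN_def tscale_def tzero_def fun_eq_iff)
qed

lemma JJ_tangent: assumes "0 <= t" shows "JJ t \<in> TM (gam t)" "KK t \<in> TM (gam t)"
proof -
have e: "JJ t c2 = Dt c1 c2 (gam t) (JJ t c1)" "KK t c2 = Dt c1 c2 (gam t) (KK t c1)"
 if "c1 \<in> Ch (gam t)" "c2 \<in> Ch (gam t)" for c1 c2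
 unfolding JJ_def KK_def if_P[OF that(1)] if_P[OF that(2)] by (rule fd_fl_change[OF c z(1) assms that])+
show "JJ t \<in> TM (gam t)" "KK t \<in> TM (gam t)"
 unfolding tangent_def
 by (intro CollectI conjI ballI allI impI e; simp add: JJ_def KK_def)+
qed

lemma along_deriv:
assumes t: "0 <= t" and c1: "c1 \<in> Ch (gam t)"
 and A: "((%r. A r c1) hvd a' - Gm c1 (snd c1 (gam t)) (T t c1) (A t c1)) (at t within {0..})"
 and B: "((%r. B r c1) hvd b' - Gm c1 (snd c1 (gam t)) (T t c1) (B t c1)) (at t within {0..})"
 and tan: "!!r. 0 <= r ==> A r \<in> TM (gam r)" "!!r. 0 <= r ==> B r \<in> TM (gam r)"
shows "((%r. ip (gam r) (NN r) (A r) (B r)) hvd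
  GG c1 (snd c1 (gam t), NN t c1) a' (B t c1) + GG c1 (snd c1 (gam t), NN t c1) (A t c1) b') (at t within {0..})"
proof -
note p = pt_vec(3,2)[OF c z(1)]
interpret C: cberwald "LM c1" "cdom c1" by (rule chb[OF c1])
have tt: "t \<in> {0..}" using t by simp
obtain e where e: "0 < e" "!!r. r \<in> {0..} ==> \<bar>r - t\<bar> < e ==> c1 \<in> Ch (gam r)"
 using near_chart[OF geodesic_cont[OF geo(1)[OF p]] tt c1] by blast
note g = geo_coord[OF p t c1]
have Y: "((%r. NN r c1) hvd 0 - C.Gx (snd c1 (gam t)) (T t c1) (NN t c1)) (at t within {0..})"
 using bounded_linear.has_vector_derivative[OF bounded_linear_scaleR_right g(2), of s]
 by (simp add: NN_def tscale_def linear_cmul[OF C.Gx_lin(2)])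
have near: "(snd c1 (gam r), NN r c1) \<in> C.S" if "r \<in> {0..}" "\<bar>r - t\<bar> < e" for r
 using pair_in_S[OF e(2)[OF that]] nz_chart[OF NN e(2)[OF that]] that(1) by auto
have "((%r. C.G (snd c1 (gam r), NN r c1) (A r c1) (B r c1)) hvd
  C.G (snd c1 (gam t), NN t c1) a' (B t c1) + C.G (snd c1 (gam t), NN t c1) (A t c1) b'
  + C.DG (snd c1 (gam t), NN t c1) (0, 0) (A t c1) (B t c1)) (at t within {0..})"
 by (rule C.metric_along[OF g(1) Y A B tt e(1) near])
moreover have "C.DG (snd c1 (gam t), NN t c1) (0, 0) (A t c1) (B t c1) = 0"
 using linear_0[OF C.linear_DG(1)[OF near[OF tt]]] e(1) by (simp add: zero_prod_def)
ultimately have "((%r. C.G (snd c1 (gam r), NN r c1) (A r c1) (B r c1)) hvd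
  C.G (snd c1 (gam t), NN t c1) a' (B t c1) + C.G (snd c1 (gam t), NN t c1) (A t c1) b') (at t within {0..})" by simp
thus ?thesis
 by (rule has_vd_near[OF _ tt e(1)]) (use ip_chart[OF NN tan e(2)] in auto)
qed

lemma JJ_deriv:
assumes t: "0 <= t" and c1: "c1 \<in> Ch (gam t)"
shows "((%r. JJ r c1) hvd KK t c1 - Gm c1 (snd c1 (gam t)) (T t c1) (JJ t c1)) (at t within {0..})"
 "((%r. KK r c1) hvd Rc c1 (snd c1 (gam t)) (T t c1) (JJ t c1) (T t c1)
  - Gm c1 (snd c1 (gam t)) (T t c1) (KK t c1)) (at t within {0..})"
 "((%r. T r c1) hvd 0 - Gm c1 (snd c1 (gam t)) (T t c1) (T t c1)) (at t within {0..})"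
proof -
note p = pt_vec(3,2)[OF c z(1)]
have tt: "t \<in> {0..}" using t by simp
obtain e where e: "0 < e" "!!r. r \<in> {0..} ==> \<bar>r - t\<bar> < e ==> c1 \<in> Ch (gam r)"
 using near_chart[OF geodesic_cont[OF geo(1)[OF p]] tt c1] by blast
note j = jacobi[OF c z(1) t c1, of h]
have jt: "JJ t c1 = jf c z h t c1" "KK t c1 = kf c z h t c1" using c1 by (auto simp: JJ_def KK_def)
show "((%r. JJ r c1) hvd KK t c1 - Gm c1 (snd c1 (gam t)) (T t c1) (JJ t c1)) (at t within {0..})"
 unfolding jt by (rule has_vd_near[OF j(1) tt e(1)]) (use e(2) in "simp add: JJ_def")
show "((%r. KK r c1) hvd Rc c1 (snd c1 (gam t)) (T t c1) (JJ t c1) (T t c1)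
  - Gm c1 (snd c1 (gam t)) (T t c1) (KK t c1)) (at t within {0..})"
 unfolding jt by (rule has_vd_near[OF j(2) tt e(1)]) (use e(2) in "simp add: KK_def")
show "((%r. T r c1) hvd 0 - Gm c1 (snd c1 (gam t)) (T t c1) (T t c1)) (at t within {0..})"
 using geo_coord(2)[OF p t c1] by simp
qed

lemma deriv_zero_const:
fixes f :: "real => real"
assumes "!!t. 0 <= t ==> (f hvd 0) (at t within {0..})" "0 <= t" shows "f t = f 0"
proof -
have "norm (f t - f 0) <= 0 * \<bar>t - 0\<bar>"
proof (rule vector_derivative_bound[where a = 0 and b = t])
 show "(f hvd 0) (at r within {0..t})" if "r \<in> {0..t}" for r
  by (rule hvd_sub[OF assms(1)]) (use that in auto)
qed (use assms(2) in auto)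
thus ?thesis by simp
qed

lemma exists_chart: "0 <= t ==> EX c1. c1 \<in> Ch (gam t)"
using cover geo_points[OF pt_vec(3,2)[OF c z(1)]] by blast

lemma NN_deriv: assumes "0 <= t" "c1 \<in> Ch (gam t)"
shows "((%r. NN r c1) hvd 0 - Gm c1 (snd c1 (gam t)) (T t c1) (NN t c1)) (at t within {0..})"
proof -
interpret C: cberwald "LM c1" "cdom c1" by (rule chb[OF assms(2)])
show ?thesis
 using bounded_linear.has_vector_derivative[OF bounded_linear_scaleR_right JJ_deriv(3)[OF assms], of s]
 by (simp add: NN_def tscale_def linear_cmul[OF C.Gx_lin(2)])
qed

lemma fnorm_NN_const: assumes t: "0 <= t" shows "ip (gam t) (NN t) (NN t) (NN t) = ip (gam 0) (NN 0) (NN 0) (NN 0)"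
proof (rule deriv_zero_const[OF _ t])
fix t :: real assume t: "0 <= t"
obtain c1 where c1: "c1 \<in> Ch (gam t)" using exists_chart[OF t] by blast
interpret C: cberwald "LM c1" "cdom c1" by (rule chb[OF c1])
have z: "(snd c1 (gam t), NN t c1) \<in> C.S" by (rule pair_in_S[OF c1 nz_chart[OF NN[OF t] c1]])
show "((%r. ip (gam r) (NN r) (NN r) (NN r)) hvd 0) (at t within {0..})"
 using along_deriv[OF t c1 NN_deriv[OF t c1] NN_deriv[OF t c1] NN(1) NN(1)]
 by (simp add: linear_0[OF C.lin_G(1)[OF z]] linear_0[OF C.lin_G(2)[OF z]])
qed

text \<open>The derivative is \<open>g_N(N, R(T, J) T)\<close>. It vanishes, because
  \<open>N\<close> is a multiple of \<open>T\<close> and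
  \<open>g_N(N, R(T, J) N) = 0\<close>.\<close>

lemma gauss_const: assumes t: "0 <= t" shows "ip (gam t) (NN t) (NN t) (KK t) = ip (gam 0) (NN 0) (NN 0) (KK 0)"
proof (rule deriv_zero_const[OF _ t])
fix t :: real assume t: "0 <= t"
obtain c1 where c1: "c1 \<in> Ch (gam t)" using exists_chart[OF t] by blast
interpret C: cberwald "LM c1" "cdom c1" by (rule chb[OF c1])
have z: "(snd c1 (gam t), NN t c1) \<in> C.S" by (rule pair_in_S[OF c1 nz_chart[OF NN[OF t] c1]])
have xd: "snd c1 (gam t) \<in> cdom c1" by (rule in_cdom[OF c1])
have "C.Rm (snd c1 (gam t)) (T t c1) (JJ t c1) (NN t c1) = s *R C.Rm (snd c1 (gam t)) (T t c1) (JJ t c1) (T t c1)"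
 by (simp add: NN_def tscale_def linear_cmul[OF C.Rm_lin(1)[OF xd]])
hence "C.G (snd c1 (gam t), NN t c1) (NN t c1) (C.Rm (snd c1 (gam t)) (T t c1) (JJ t c1) (T t c1)) = 0"
 using C.G_y_Rm(1)[OF z, of "T t c1" "JJ t c1"] s by (simp add: linear_cmul[OF C.lin_G(1)[OF z]])
thus "((%r. ip (gam r) (NN r) (NN r) (KK r)) hvd 0) (at t within {0..})"
 using along_deriv[OF t c1 NN_deriv[OF t c1] JJ_deriv(2)[OF t c1] NN(1) JJ_tangent(2)]
 by (simp add: linear_0[OF C.lin_G(2)[OF z]])
qed

text \<open>The Gauss lemma: the tangential component of a Jacobi field is affine in the
  time.\<close>

lemma gauss: assumes t: "0 <= t"
shows "ip (gam t) (NN t) (NN t) (JJ t) = ip (gam 0) (NN 0) (NN 0) (JJ 0) + t * ip (gam 0) (NN 0) (NN 0) (KK 0)"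
proof -
let ?f = "%r. ip (gam r) (NN r) (NN r) (JJ r) - r * ip (gam 0) (NN 0) (NN 0) (KK 0)"
have "?f t = ?f 0"
proof (rule deriv_zero_const[OF _ t])
 fix t :: real assume t: "0 <= t"
 obtain c1 where c1: "c1 \<in> Ch (gam t)" using exists_chart[OF t] by blast
 interpret C: cberwald "LM c1" "cdom c1" by (rule chb[OF c1])
 have z: "(snd c1 (gam t), NN t c1) \<in> C.S" by (rule pair_in_S[OF c1 nz_chart[OF NN[OF t] c1]])
 have "((%r. ip (gam r) (NN r) (NN r) (JJ r)) hvd ip (gam t) (NN t) (NN t) (KK t)) (at t within {0..})"
  using along_deriv[OF t c1 NN_deriv[OF t c1] JJ_deriv(1)[OF t c1] NN(1) JJ_tangent(1)]
   ip_chart[OF NN[OF t] NN(1)[OF t] JJ_tangent(2)[OF t] c1]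
  by (simp add: linear_0[OF C.lin_G(2)[OF z]])
 moreover have "((%r. r * ip (gam 0) (NN 0) (NN 0) (KK 0)) hvd ip (gam 0) (NN 0) (NN 0) (KK 0)) (at t within {0..})"
  by (auto intro!: derivative_eq_intros)
 ultimately show "(?f hvd 0) (at t within {0..})"
  using has_vector_derivative_diff gauss_const[OF t] by fastforce
qed
thus ?thesis by simp
qed

definition "nrm t A = sqrt (ip (gam t) (NN t) A A)"

lemma norm_lip:
assumes tan: "!!t. 0 <= t ==> A t \<in> TM (gam t)"
 and A: "!!t c1. 0 <= t ==> c1 \<in> Ch (gam t) ==>
  ((%r. A r c1) hvd A' t c1 - Gm c1 (snd c1 (gam t)) (T t c1) (A t c1)) (at t within {0..})"
 and bd: "!!t c1. t \<in> {0..1} ==> c1 \<in> Ch (gam t) ==> \<bar>GG c1 (snd c1 (gam t), NN t c1) (A t c1) (A' t c1)\<bar> <= C * nrm t (A t)"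
 and C: "0 <= C" and st: "r \<in> {0..1}" "t \<in> {0..1}"
shows "\<bar>nrm t (A t) - nrm r (A r)\<bar> <= C * \<bar>t - r\<bar>"
proof -
define ch where "ch t = (SOME c1. c1 \<in> Ch (gam t))" for t
have ch: "ch t \<in> Ch (gam t)" if "0 <= t" for t unfolding ch_def using someI_ex[OF exists_chart[OF that]] .
let ?f = "%t. ip (gam t) (NN t) (A t) (A t)"
let ?f' = "%t. GG (ch t) (snd (ch t) (gam t), NN t (ch t)) (A' t (ch t)) (A t (ch t))
  + GG (ch t) (snd (ch t) (gam t), NN t (ch t)) (A t (ch t)) (A' t (ch t))"
show ?thesis unfolding nrm_def
proof (rule sqrt_lipschitz[where f = ?f and f' = ?f', OF _ _ _ C st])
 fix t :: real assume t: "t \<in> {0..1}"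
 hence t0: "0 <= t" by simp
 interpret C: cberwald "LM (ch t)" "cdom (ch t)" by (rule chb[OF ch[OF t0]])
 have z: "(snd (ch t) (gam t), NN t (ch t)) \<in> C.S" by (rule pair_in_S[OF ch[OF t0] nz_chart[OF NN[OF t0] ch[OF t0]]])
 have e: "?f t = C.G (snd (ch t) (gam t), NN t (ch t)) (A t (ch t)) (A t (ch t))"
  by (rule ip_chart[OF NN[OF t0] tan[OF t0] tan[OF t0] ch[OF t0]])
 show "0 <= ?f t" unfolding e by (rule C.G_nonneg[OF z])
 have "(?f hvd ?f' t) (at t within {0..})"
  by (rule along_deriv[OF t0 ch[OF t0] A[OF t0 ch[OF t0]] A[OF t0 ch[OF t0]] tan tan])
 hence "(?f hvd ?f' t) (at t within {0..1})"
  by (rule hvd_sub) auto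
 thus "(?f hrd ?f' t) (at t within {0..1})"
  by (simp add: has_real_derivative_iff_has_vector_derivative)
 show "\<bar>?f' t\<bar> <= 2 * C * sqrt (?f t)"
  using bd[OF t ch[OF t0]] C.G_sym[OF z, of "A' t (ch t)"] by (simp add: nrm_def)
qed
qed

lemma nrm_chart: "0 <= t ==> A \<in> TM (gam t) ==> c1 \<in> Ch (gam t) ==>
 nrm t A = sqrt (GG c1 (snd c1 (gam t), NN t c1) (A c1) (A c1))"
unfolding nrm_def using ip_chart[OF NN] by simp

text \<open>Let \<open>N\<close> be the maximum of the norm of \<open>KK\<close>. The condition at
  time 1 bounds the norm of \<open>JJ\<close> by \<open>N\<close>, hence the curvature term by
  \<open>ka * N\<close>. The field \<open>(1 - t) *R KK t + JJ t\<close> also vanishes at time 1,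
  and in its derivative the \<open>KK\<close> terms cancel, leaving \<open>1 - t\<close> times the
  curvature term. So its initial value is at most \<open>ka * N\<close>, and \<open>N\<close> in
  turn is controlled by \<open>JJ 0\<close>.\<close>

lemma jacobi_estimate:
assumes J1: "JJ 1 = tzero" and ka: "\<bar>kb\<bar> * ip (gam 0) (NN 0) (NN 0) (NN 0) <= s^2 * ka" "ka <= 1/4" "0 <= ka"
shows "nrm 0 (%c. KK 0 c + JJ 0 c) <= 2 * ka * nrm 0 (JJ 0)"
proof -
note tanJ = JJ_tangent(1) and tanK = JJ_tangent(2)
have nn: "0 <= nrm t A" if tA: "0 <= t" "A \<in> TM (gam t)" for t A
proof -
 obtain c1 where c1: "c1 \<in> Ch (gam t)" using exists_chart[OF tA(1)] by blast
 interpret C: cberwald "LM c1" "cdom c1" by (rule chb[OF c1])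
 show ?thesis unfolding nrm_chart[OF tA c1] using C.G_nonneg[OF pair_in_S[OF c1 nz_chart[OF NN[OF tA(1)] c1]]] by simp
qed
have cs: "\<bar>GG c1 (snd c1 (gam t), NN t c1) (A c1) (B c1)\<bar> <= nrm t A * nrm t B"
 if "0 <= t" "A \<in> TM (gam t)" "B \<in> TM (gam t)" "c1 \<in> Ch (gam t)" for t A B c1
proof -
 interpret C: cberwald "LM c1" "cdom c1" by (rule chb[OF that(4)])
 show ?thesis unfolding nrm_chart[OF that(1,2,4)] nrm_chart[OF that(1,3,4)]
  by (rule C.G_cauchy[OF pair_in_S[OF that(4) nz_chart[OF NN[OF that(1)] that(4)]]])
qed
\<comment> \<open>The curvature bound is available with \<open>N = s T\<close> in both slots, which
  produces \<open>s^2\<close>; the hypothesis on \<open>ka\<close> carries the same factor.\<close>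
have Rb: "\<bar>GG c1 (snd c1 (gam t), NN t c1) (A c1) (Rc c1 (snd c1 (gam t)) (T t c1) (JJ t c1) (T t c1))\<bar> <= ka * nrm t (JJ t) * nrm t A"
 if "0 <= t" "A \<in> TM (gam t)" "c1 \<in> Ch (gam t)" for t A c1
proof -
 interpret C: cberwald "LM c1" "cdom c1" by (rule chb[OF that(3)])
 let ?x = "snd c1 (gam t)" and ?N = "NN t c1"
 have xd: "?x \<in> cdom c1" by (rule in_cdom[OF that(3)])
 have z: "(?x, ?N) \<in> C.S" by (rule pair_in_S[OF that(3) nz_chart[OF NN[OF that(1)] that(3)]])
 have N0: "?N ~= 0" using z by simp
 have "C.Rm ?x (JJ t c1) ?N ?N = - (s^2 *R C.Rm ?x (T t c1) (JJ t c1) (T t c1))"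
  using C.Rm_antisym[of ?x "JJ t c1" "T t c1" "T t c1"]
  by (simp add: NN_def tscale_def linear_cmul[OF C.Rm_lin(1)[OF xd]] linear_cmul[OF C.Rm_lin(3)[OF xd]] power2_eq_square)
 hence e: "C.G (?x, ?N) (A c1) (C.Rm ?x (JJ t c1) ?N ?N) = - (s^2 * C.G (?x, ?N) (A c1) (C.Rm ?x (T t c1) (JJ t c1) (T t c1)))"
  by (simp add: linear_neg[OF C.lin_G(1)[OF z]] linear_cmul[OF C.lin_G(1)[OF z]])
 have q: "C.Q (?x, ?N) = ip (gam 0) (NN 0) (NN 0) (NN 0)"
  using fnorm_NN_const[OF that(1)] ip_chart[OF NN[OF that(1)] NN(1)[OF that(1)] NN(1)[OF that(1)] that(3)] C.G_y(2)[OF z] by simp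
 have "s^2 * \<bar>C.G (?x, ?N) (A c1) (C.Rm ?x (T t c1) (JJ t c1) (T t c1))\<bar> <= \<bar>kb\<bar> * C.Q (?x, ?N) * (nrm t A * nrm t (JJ t))"
  using Rc_bound[OF that(3) N0, of "A c1" "JJ t c1"] unfolding e nrm_chart[OF that] nrm_chart[OF that(1) tanJ[OF that(1)] that(3)]
  by (simp add: abs_mult)
 also have "... <= (s^2 * ka) * (nrm t A * nrm t (JJ t))"
  unfolding q by (intro mult_right_mono ka(1) mult_nonneg_nonneg nn that tanJ)
 finally show ?thesis using s by (simp add: mult_ac)
qed
have cK: "continuous_on {0..1} (%t. nrm t (KK t))"
proof -
 have "EX f'. ((%t. ip (gam t) (NN t) (KK t) (KK t)) hvd f') (at t within {0..1})" if "t \<in> {0..1}" for t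
 proof -
  have t: "0 <= t" using that by simp
  obtain c1 where c1: "c1 \<in> Ch (gam t)" using exists_chart[OF t] by blast
  show ?thesis
   using hvd_sub[OF along_deriv[OF t c1 JJ_deriv(2)[OF t c1] JJ_deriv(2)[OF t c1] tanK tanK], of "{0..1}"] by fastforce
 qed
 hence "continuous_on {0..1} (%t. ip (gam t) (NN t) (KK t) (KK t))"
  unfolding continuous_on_eq_continuous_within using has_vector_derivative_continuous by blast
 thus ?thesis unfolding nrm_def by (intro continuous_intros)
qed
have "EX m:{0..1}. ALL t:{0..1}. nrm t (KK t) <= nrm m (KK m)"
 by (rule continuous_attains_sup[OF compact_Icc _ cK]) simp
then obtain m where m: "m \<in> {0..1}" "!!t. t \<in> {0..1} ==> nrm t (KK t) <= nrm m (KK m)" by blast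
define N where "N = nrm m (KK m)"
have N: "0 <= N" unfolding N_def using m(1) by (intro nn tanK) auto
have J: "nrm t (JJ t) <= N" if t: "t \<in> {0..1}" for t
proof -
 have t0: "0 <= t" using t by simp
 have "\<bar>nrm t (JJ t) - nrm 1 (JJ 1)\<bar> <= N * \<bar>t - 1\<bar>"
 proof (rule norm_lip[OF tanJ JJ_deriv(1) _ N _ t])
  fix r :: real and c1 assume r: "r \<in> {0..1}" and c1: "c1 \<in> Ch (gam r)"
  hence r0: "0 <= r" by simp
  have "\<bar>GG c1 (snd c1 (gam r), NN r c1) (JJ r c1) (KK r c1)\<bar> <= nrm r (JJ r) * nrm r (KK r)"
   by (rule cs[OF r0 tanJ[OF r0] tanK[OF r0] c1])
  also have "... <= nrm r (JJ r) * N" unfolding N_def by (intro mult_left_mono m(2) r nn tanJ r0)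
  finally show "\<bar>GG c1 (snd c1 (gam r), NN r c1) (JJ r c1) (KK r c1)\<bar> <= N * nrm r (JJ r)" by (simp add: mult.commute)
 qed auto
 moreover have "nrm 1 (JJ 1) = 0"
 proof -
  obtain c1 where c1: "c1 \<in> Ch (gam 1)" using exists_chart[of 1] by auto
  interpret C: cberwald "LM c1" "cdom c1" by (rule chb[OF c1])
  have z: "(snd c1 (gam 1), NN 1 c1) \<in> C.S" by (rule pair_in_S[OF c1 nz_chart[OF NN c1]]) auto
  show ?thesis using nrm_chart[OF _ tanJ c1] J1 linear_0[OF C.lin_G(1)[OF z]] by (simp add: tzero_def)
 qed
 moreover have "N * \<bar>t - 1\<bar> <= N * 1" using t by (intro mult_left_mono N) auto
 ultimately show ?thesis by linarith
qed
have RJ: "\<bar>GG c1 (snd c1 (gam t), NN t c1) (A c1) (Rc c1 (snd c1 (gam t)) (T t c1) (JJ t c1) (T t c1))\<bar> <= ka * N * nrm t A"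
 if "t \<in> {0..1}" "A \<in> TM (gam t)" "c1 \<in> Ch (gam t)" for t A c1
proof -
 have t0: "0 <= t" using that by simp
 have "ka * nrm t (JJ t) * nrm t A <= ka * N * nrm t A" by (intro mult_right_mono mult_left_mono J ka(3) nn that t0)
 thus ?thesis using Rb[OF t0 that(2,3)] by linarith
qed
have z01: "0 \<in> {0..1::real}" "1 \<in> {0..1::real}" by auto
have ka_N: "0 <= ka * N" using ka(3) N by simp
have "\<bar>nrm m (KK m) - nrm 0 (KK 0)\<bar> <= (ka * N) * \<bar>m - 0\<bar>"
 by (rule norm_lip[OF tanK JJ_deriv(2) RJ[OF _ tanK] ka_N z01(1) m(1)]) auto
moreover have "(ka * N) * \<bar>m - 0\<bar> <= (ka * N) * 1" using m(1) by (intro mult_left_mono ka_N) auto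
ultimately have K: "N <= nrm 0 (KK 0) + ka * N" unfolding N_def by linarith
define W where "W t = (%c. (1 - t) *R KK t c + JJ t c)" for t
have tanW: "W t \<in> TM (gam t)" if "0 <= t" for t
 using tangent_linear[OF tanK[OF that] tanJ[OF that], of "1 - t" 1] by (simp add: W_def)
have "\<bar>nrm 1 (W 1) - nrm 0 (W 0)\<bar> <= (ka * N) * \<bar>1 - 0\<bar>"
proof (rule norm_lip[OF tanW, where A' = "%t c1. (1 - t) *R Rc c1 (snd c1 (gam t)) (T t c1) (JJ t c1) (T t c1)", OF _ _ _ ka_N z01])
 fix t :: real and c1 assume t: "0 <= t" and c1: "c1 \<in> Ch (gam t)"
 interpret C: cberwald "LM c1" "cdom c1" by (rule chb[OF c1])
 show "((%r. W r c1) hvd (1 - t) *R Rc c1 (snd c1 (gam t)) (T t c1) (JJ t c1) (T t c1)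
   - Gm c1 (snd c1 (gam t)) (T t c1) (W t c1)) (at t within {0..})"
 proof -
  have w: "(%r. W r c1) = (%r. (1 - r) *R KK r c1 + JJ r c1)" by (simp add: W_def)
  have "(1 - t) *R Rc c1 (snd c1 (gam t)) (T t c1) (JJ t c1) (T t c1) - Gm c1 (snd c1 (gam t)) (T t c1) (W t c1)
   = (1 - t) *R (Rc c1 (snd c1 (gam t)) (T t c1) (JJ t c1) (T t c1) - Gm c1 (snd c1 (gam t)) (T t c1) (KK t c1))
    - KK t c1 + (KK t c1 - Gm c1 (snd c1 (gam t)) (T t c1) (JJ t c1))"
   unfolding W_def linear_add[OF C.Gx_lin(2)] linear_cmul[OF C.Gx_lin(2)] by (simp add: algebra_simps)
  thus ?thesis unfolding w using has_vd_linear_comb[OF JJ_deriv(2)[OF t c1] JJ_deriv(1)[OF t c1]] by simp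
 qed
next
 fix t :: real and c1 assume t: "t \<in> {0..1}" and c1: "c1 \<in> Ch (gam t)"
 have t0: "0 <= t" using t by simp
 interpret C: cberwald "LM c1" "cdom c1" by (rule chb[OF c1])
 have z: "(snd c1 (gam t), NN t c1) \<in> C.S" by (rule pair_in_S[OF c1 nz_chart[OF NN[OF t0] c1]])
 have "\<bar>1 - t\<bar> * \<bar>GG c1 (snd c1 (gam t), NN t c1) (W t c1) (Rc c1 (snd c1 (gam t)) (T t c1) (JJ t c1) (T t c1))\<bar> <= 1 * (ka * N * nrm t (W t))"
  using t by (intro mult_mono RJ tanW t0 c1) auto
 thus "\<bar>GG c1 (snd c1 (gam t), NN t c1) (W t c1) ((1 - t) *R Rc c1 (snd c1 (gam t)) (T t c1) (JJ t c1) (T t c1))\<bar> <= ka * N * nrm t (W t)"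
  by (simp add: linear_cmul[OF C.lin_G(1)[OF z]] abs_mult)
qed
moreover have "W 1 = (%c. 0)" using J1 by (auto simp: W_def tzero_def)
moreover have "nrm 1 (%c. 0) = 0"
proof -
 obtain c1 where c1: "c1 \<in> Ch (gam 1)" using exists_chart[of 1] by auto
 interpret C: cberwald "LM c1" "cdom c1" by (rule chb[OF c1])
 have z: "(snd c1 (gam 1), NN 1 c1) \<in> C.S" by (rule pair_in_S[OF c1 nz_chart[OF NN c1]]) auto
 show ?thesis using nrm_chart[OF _ tangent_tzero[unfolded tzero_def] c1] linear_0[OF C.lin_G(1)[OF z]] by simp
qed
moreover have "W 0 = (%c. KK 0 c + JJ 0 c)" by (simp add: W_def)
ultimately have W0: "nrm 0 (%c. KK 0 c + JJ 0 c) <= ka * N" by simp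
have tri: "nrm 0 (KK 0) <= nrm 0 (%c. KK 0 c + JJ 0 c) + nrm 0 (JJ 0)"
proof -
 obtain c1 where c1: "c1 \<in> Ch (gam 0)" using exists_chart[of 0] by auto
 interpret C: cberwald "LM c1" "cdom c1" by (rule chb[OF c1])
 have z: "(snd c1 (gam 0), NN 0 c1) \<in> C.S" by (rule pair_in_S[OF c1 nz_chart[OF NN c1]]) auto
 have tW: "(%c. KK 0 c + JJ 0 c) \<in> TM (gam 0)" using tanW[of 0] by (simp add: W_def)
 show ?thesis
  using C.G_triangle[OF z, of "KK 0 c1 + JJ 0 c1" "- JJ 0 c1"]
   nrm_chart[OF order_refl tW c1] nrm_chart[OF order_refl tanK c1] nrm_chart[OF order_refl tanJ c1]
  by (simp add: linear_neg[OF C.lin_G(1)[OF z]] linear_neg[OF C.lin_G(2)[OF z]])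
qed
\<comment> \<open>Closing the loop: \<open>ka <= 1/4\<close> gives \<open>N <= 4/3 * |K|\<close>,
  the triangle inequality then gives \<open>|K| <= 3/2 * |J|\<close>, and so
  \<open>N <= 2 * |J|\<close>, all norms being taken at time 0.\<close>
have "ka * N <= 1/4 * N" by (rule mult_right_mono[OF ka(2) N])
hence N1: "N <= 4/3 * nrm 0 (KK 0)" using K by linarith
have "ka * N <= 1/3 * nrm 0 (KK 0)" using \<open>ka * N <= 1/4 * N\<close> N1 by linarith
hence 2: "nrm 0 (KK 0) <= 3/2 * nrm 0 (JJ 0)" using tri W0 by linarith
have "N <= 2 * nrm 0 (JJ 0)" using N1 2 by linarith
hence "ka * N <= ka * (2 * nrm 0 (JJ 0))" by (rule mult_left_mono[OF _ ka(3)])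
thus "nrm 0 (%c. KK 0 c + JJ 0 c) <= 2 * ka * nrm 0 (JJ 0)" using W0 by linarith
qed

end

end

section \<open>Lengths and distances\<close>

lemma pieces_induct:
fixes P :: "real => real => bool"
assumes "finite S"
 and base: "!!a b. A <= a ==> a < b ==> b <= B ==> {a<..<b} Int S = {} ==> P a b"
 and join: "!!a c b. A <= a ==> a < c ==> c < b ==> b <= B ==> P a c ==> P c b ==> P a b"
shows "A <= a ==> a < b ==> b <= B ==> P a b"
proof (induction "card ({a<..<b} Int S)" arbitrary: a b rule: less_induct)
case less
show ?case
proof (cases "{a<..<b} Int S = {}")
 case True thus ?thesis using base less.prems by blast
next
 case False
 then obtain c where c: "c \<in> {a<..<b}" "c \<in> S" by blast
 have "{a<..<c} Int S \<subset> {a<..<b} Int S" "{c<..<b} Int S \<subset> {a<..<b} Int S" using c by auto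
 hence "card ({a<..<c} Int S) < card ({a<..<b} Int S)" "card ({c<..<b} Int S) < card ({a<..<b} Int S)"
  using assms(1) by (auto intro: psubset_card_mono)
 hence "P a c" "P c b" using less.hyps less.prems c by auto
 thus ?thesis using join[of a c b] less.prems c by auto
qed
qed

context cmetric
begin

text \<open>At a zero vector, where \<open>F\<close> need not be smooth, homogeneity and a bound on
  a compact bundle of unit spheres give \<open>|F| <= C * norm y\<close>.\<close>

lemma L_continuous: "continuous_on (U \<times> UNIV) L"
proof (rule continuous_at_imp_continuous_on, rule ballI)
fix z :: "'n tpoint" assume z: "z \<in> U \<times> UNIV"
show "isCont L z"
proof (cases "snd z = 0")
 case False
 hence "z \<in> S" using z by (cases z) auto
 thus ?thesis using Ck_on_continuous[OF smooth_onD[OF smoothL]] openS continuous_on_eq_continuous_at by blast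
next
 case True
 then obtain x where x: "z = (x, 0)" "x \<in> U" using z by (cases z) auto
 obtain r where r: "0 < r" "cball x r <= U" using x(2) openU open_contains_cball by blast
 have "continuous_on (cball x r \<times> sphere 0 1) L"
  by (rule continuous_on_subset[OF Ck_on_continuous[OF smooth_onD[OF smoothL]]]) (use r in auto)
 hence "bounded (L ` (cball x r \<times> sphere 0 1))"
  by (intro compact_imp_bounded compact_continuous_image compact_Times) auto
 then obtain C where C: "0 < C" "!!w. w \<in> cball x r \<times> sphere 0 1 ==> norm (L w) <= C" by (auto simp: bounded_pos)
 have bd: "\<bar>L w\<bar> <= C * norm (snd w)" if "fst w \<in> cball x r" for w
 proof (cases "snd w = 0")
  case True thus ?thesis using L_zero[of "fst w"] that r(2) by (metis abs_zero mult_zero_right norm_zero order_refl prod.collapse subsetD)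
 next
  case False
  have "L w = L (fst w, norm (snd w) *R ((1 / norm (snd w)) *R snd w))" using False by simp
  also have "... = norm (snd w) * L (fst w, (1 / norm (snd w)) *R snd w)" using False that r(2) by (intro homL) auto
  finally have "\<bar>L w\<bar> = norm (snd w) * \<bar>L (fst w, (1 / norm (snd w)) *R snd w)\<bar>" by (simp add: abs_mult)
  also have "... <= norm (snd w) * C" using C(2)[of "(fst w, (1 / norm (snd w)) *R snd w)"] that False
   by (intro mult_left_mono) auto
  finally show ?thesis by (simp add: mult.commute)
 qed
 show ?thesis unfolding continuous_at_eps_delta
 proof (intro allI impI)
  fix e :: real assume e: "0 < e"
  have "dist (L w) (L z) < e" if w: "dist w z < min r (e / C)" for w
  proof -
   have "dist (fst w) x < r" using dist_fst_le[of w z] w x by simp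
   hence 1: "\<bar>L w\<bar> <= C * norm (snd w)" by (intro bd) (simp add: dist_commute)
   have "norm (snd w) < e / C" using dist_snd_le[of w z] w x by simp
   hence "C * norm (snd w) < e" using C(1) by (simp add: pos_less_divide_eq mult.commute)
   thus ?thesis using 1 L_zero[OF x(2)] x by (simp add: dist_real_def)
  qed
  thus "EX d>0. ALL w. dist w z < d --> dist (L w) (L z) < e" using r(1) e C(1) by (intro exI[of _ "min r (e / C)"]) auto
 qed
qed
qed

end

context finsler_mfd
begin

lemma fnorm_nonneg: "x \<in> PM ==> v \<in> TM x ==> 0 <= fnorm M x v"
using fin unfolding finsler_manifold_def by blast

lemma fnorm_tscale: assumes "x \<in> PM" "v \<in> TM x" "0 <= a" shows "fnorm M x (tscale a v) = a * fnorm M x v"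
proof (cases "a = 0")
case True
obtain c where c: "c \<in> Ch x" using cover assms(1) by blast
have "fnorm M x (tscale a v) = LM c (snd c x, 0)" using fnorm_coord[OF c tangent_tscale[OF assms(2), of 0]] True by (simp add: tscale_def)
thus ?thesis using cmetric.L_zero[OF chm[OF c] in_cdom[OF c]] True by simp
next
case False thus ?thesis using fin assms unfolding finsler_manifold_def by simp
qed

lemma fnorm_pos: assumes "x \<in> PM" "v \<in> TM x" "v ~= tzero" shows "0 < fnorm M x v"
proof -
obtain c where c: "c \<in> Ch x" using cover assms(1) by blast
show ?thesis unfolding fnorm_coord[OF c assms(2)]
 by (rule cmetric.L_pos[OF chm[OF c] in_cdom[OF c] nz_chart[OF assms(2,3) c]])
qed

lemma fnorm_tzero: "x \<in> PM ==> fnorm M x tzero = 0"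
using fnorm_tscale[OF _ tangent_tzero, of x 0] by (simp add: tscale_def tzero_def)

lemma fnorm_ip: assumes "x \<in> PM" "v \<in> TM x" "v ~= tzero" shows "ip x v v v = (fnorm M x v)^2"
proof -
obtain c where c: "c \<in> Ch x" using cover assms(1) by blast
interpret C: cmetric "LM c" "cdom c" by (rule chm[OF c])
show ?thesis
 using ip_chart[OF assms(2,3,2,2) c] C.G_y(2)[OF pair_in_S[OF c nz_chart[OF assms(2,3) c]]] fnorm_coord[OF c assms(2)]
 by (simp add: C.Q_def)
qed

text \<open>Velocities within \<open>UNIV\<close> are two-sided and so independent of the parameter
  interval. The change from one-sided velocities affects only end points, which the integral
  ignores. \<open>HL ga a b l\<close> records a piecewise smooth curve together with its
  length.\<close>

definition "vel ga t = vlc UNIV ga t"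
definition "spd ga t = fnorm M (ga t) (vel ga t)"
definition "pwc ga a b \<longleftrightarrow> (EX S. finite S & (ALL a' b'. a <= a' & a' < b' & b' <= b & {a'<..<b'} Int S = {} --> C1_curve M {a'..b'} ga))"
definition "HL ga a b l \<longleftrightarrow> pwc ga a b & (spd ga has_integral l) {a..b}"

lemma velocity_interior:
assumes "a < t" "t < (b :: real)" shows "vlc {a..b} ga t = vel ga t"
proof -
have e: "at t within {a..b} = at t" by (rule at_within_Icc_at[OF assms])
show ?thesis unfolding vel_def velocity_def e ..
qed

lemma C1_curve_vd:
assumes "C1_curve M I ga" "t \<in> I" "c \<in> Ch (ga t)"
shows "((snd c o ga) hvd vlc I ga t c) (at t within I)"
using assms unfolding C1_curve_def velocity_def by (auto simp: vector_derivative_works)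

lemma speed_continuous:
assumes C: "C1_curve M {a..b} ga" and "a < b"
shows "continuous_on {a..b} (%t. fnorm M (ga t) (vlc {a..b} ga t))"
unfolding continuous_on_eq_continuous_within
proof
fix t assume t: "t \<in> {a..b}"
let ?I = "{a..b}"
have cont: "cmap ?I ga" using C by (simp add: C1_curve_def)
obtain c where c: "c \<in> Ch (ga t)" using cover continuous_map_image_subset_topspace[OF cont] t by fastforce
interpret C: cmetric "LM c" "cdom c" by (rule chm[OF c])
obtain e where e: "0 < e" "!!s. s \<in> ?I ==> \<bar>s - t\<bar> < e ==> c \<in> Ch (ga s)" using near_chart[OF cont t c] by blast
let ?w = "%s. (snd c (ga s), vector_derivative (snd c o ga) (at s within ?I))"
have "continuous (at t within ?I) (snd c o ga)"
 using C t c differentiable_imp_continuous_within unfolding C1_curve_def by blast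
hence "continuous (at t within ?I) ?w"
 using C t c unfolding C1_curve_def o_def by (intro continuous_Pair) auto
moreover have "isCont (LM c) (?w t)"
proof -
 have "ALL z:cdom c \<times> UNIV. isCont (LM c) z"
  using C.L_continuous continuous_on_eq_continuous_at[OF open_Times[OF C.openU open_UNIV]] by blast
 thus ?thesis using in_cdom[OF c] by blast
qed
ultimately have "continuous (at t within ?I) (%s. LM c (?w s))"
 by (rule continuous_within_compose3[rotated])
moreover have "LM c (?w s) = fnorm M (ga s) (vlc ?I ga s)" if s: "s \<in> ?I" "dist s t < e" for s
proof -
 have cs: "c \<in> Ch (ga s)" using e(2) s by (simp add: dist_real_def)
 have E: "vlc ?I ga s = coord_tvec M c (ga s) (vlc ?I ga s c)"
 proof
  fix c' show "vlc ?I ga s c' = coord_tvec M c (ga s) (vlc ?I ga s c) c'"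
  proof (cases "c' \<in> Ch (ga s)")
   case True
   obtain e' where e': "0 < e'" "!!r. r \<in> ?I ==> \<bar>r - s\<bar> < e' ==> c \<in> Ch (ga r)"
    using near_chart[OF cont s(1) cs] by blast
   have "((%r. transition c c' ((snd c o ga) r)) hvd Dt c c' (ga s) (vlc ?I ga s c)) (at s within ?I)"
    by (rule has_vd_compose[OF C1_curve_vd[OF C s(1) cs]]) (use transition_deriv[OF cs True] in simp)
   hence "((snd c' o ga) hvd Dt c c' (ga s) (vlc ?I ga s c)) (at s within ?I)"
    by (rule has_vd_near[OF _ s(1) e'(1)]) (use transition_chart[OF e'(2), of _ c'] in auto)
   from vector_derivative_within[OF ivl_nontrivial[OF ivl_Icc[OF \<open>a < b\<close>] s(1)] this]
   show ?thesis using True by (simp add: velocity_def coord_tvec_def)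
  qed (simp add: velocity_def coord_tvec_def)
 qed
 have "vlc ?I ga s \<in> TM (ga s)" by (subst E) (rule coord_tvec_tangent(1)[OF cs])
 thus ?thesis using fnorm_coord[OF cs] cs by (simp add: velocity_def)
qed
ultimately show "continuous (at t within ?I) (%t. fnorm M (ga t) (vlc ?I ga t))"
 by (rule continuous_transform_within[OF _ e(1) t])
qed

lemma piece_integral:
assumes C: "C1_curve M {a..b} ga" and "a < b"
shows "(spd ga has_integral integral {a..b} (%t. fnorm M (ga t) (vlc {a..b} ga t))) {a..b}"
proof (rule has_integral_spike_finite[of "{a, b}"])
show "((%t. fnorm M (ga t) (vlc {a..b} ga t)) has_integral integral {a..b} (%t. fnorm M (ga t) (vlc {a..b} ga t))) {a..b}"
 by (rule integrable_integral[OF integrable_continuous_real[OF speed_continuous[OF assms]]])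
qed (use velocity_interior[of a _ b ga] in "auto simp: spd_def")

lemma pwc_integrable: assumes "pwc ga a b" "a < b" shows "spd ga integrable_on {a..b}"
proof -
obtain S where S: "finite S" "!!a' b'. a <= a' ==> a' < b' ==> b' <= b ==> {a'<..<b'} Int S = {} ==> C1_curve M {a'..b'} ga"
 using assms(1) unfolding pwc_def by blast
show ?thesis
proof (rule pieces_induct[OF S(1), of a b "%a b. spd ga integrable_on {a..b}" a b])
 show "spd ga integrable_on {p..q}" if "a <= p" "p < q" "q <= b" "{p<..<q} Int S = {}" for p q
  using piece_integral[OF S(2)[OF that] that(2)] by (rule has_integral_integrable)
 show "spd ga integrable_on {p..q}" if "a <= p" "p < r" "r < q" "q <= b" "spd ga integrable_on {p..r}" "spd ga integrable_on {r..q}" for p r q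
  using that by (intro Henstock_Kurzweil_Integration.integrable_combine[of p r q]) auto
qed (use assms(2) in auto)
qed

lemma HL_iff: "pw_C1_curve M ga & curve_length M ga = l \<longleftrightarrow> HL ga 0 1 l"
proof -
have p: "pw_C1_curve M ga \<longleftrightarrow> pwc ga 0 1" unfolding pw_C1_curve_def pwc_def ..
have "curve_length M ga = integral {0..1} (spd ga)"
 unfolding curve_length_def by (rule integral_spike[of "{0, 1}"]) (use velocity_interior[of 0 _ 1 ga] in "auto simp: spd_def")
thus ?thesis unfolding p HL_def using pwc_integrable[of ga 0 1] by (auto simp: has_integral_iff)
qed

text \<open>The infimum of an empty set would carry no meaning, so nonemptiness is carried along
  until connectedness settles it.\<close>

definition "Dset p q = {l. EX ga. HL ga 0 1 l & ga 0 = p & ga 1 = q}"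

lemma fdist_eq: "dst p q = Inf (Dset p q)"
proof -
have "{curve_length M ga | ga. pw_C1_curve M ga & ga 0 = p & ga 1 = q} = Dset p q"
 unfolding Dset_def HL_iff[symmetric] by auto
thus ?thesis by (simp add: fdist_def)
qed

lemma HL_piece: assumes "pwc ga a b"
obtains S where "finite S" "!!t c. a < t ==> t < b ==> t \<notin> S ==> c \<in> Ch (ga t) ==> ((snd c o ga) hvd vel ga t c) (at t)"
 "!!t. a < t ==> t < b ==> t \<notin> S ==> vel ga t \<in> TM (ga t) & ga t \<in> PM"
proof -
obtain S where S: "finite S" "!!a' b'. a <= a' ==> a' < b' ==> b' <= b ==> {a'<..<b'} Int S = {} ==> C1_curve M {a'..b'} ga"
 using assms(1) unfolding pwc_def by blast
have near: "EX a' b'. a <= a' & a' < t & t < b' & b' <= b & C1_curve M {a'..b'} ga" if t: "a < t" "t < b" "t \<notin> S" for t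
proof -
 obtain d where d: "0 < d" "!!s. s \<in> S ==> s ~= t ==> d <= dist t s" using finite_set_avoid[OF S(1), of t] by blast
 let ?a = "max a (t - d)" and ?b = "min b (t + d)"
 have "{?a<..<?b} Int S = {}" using d(2) t(3) by (force simp: dist_real_def)
 hence "C1_curve M {?a..?b} ga" using S(2)[of ?a ?b] t d(1) by auto
 thus ?thesis using t d(1) by (intro exI[of _ ?a] exI[of _ ?b]) auto
qed
have vd: "((snd c o ga) hvd vel ga t c) (at t)" if t: "a < t" "t < b" "t \<notin> S" and c: "c \<in> Ch (ga t)" for t c
proof -
 obtain a' b' where n: "a' < t" "t < b'" "C1_curve M {a'..b'} ga" using near[OF t] by blast
 show ?thesis using C1_curve_vd[OF n(3) _ c] n(1,2) velocity_interior[OF n(1,2)] at_within_Icc_at[OF n(1,2)] by simp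
qed
have tan: "vel ga t \<in> TM (ga t) & ga t \<in> PM" if t: "a < t" "t < b" "t \<notin> S" for t
proof -
 obtain a' b' where n: "a' < t" "t < b'" "C1_curve M {a'..b'} ga" using near[OF t] by blast
 have cont: "cmap {a'..b'} ga" using n(3) by (simp add: C1_curve_def)
 have tI: "t \<in> {a'..b'}" using n by simp
 have pt: "ga t \<in> PM" using continuous_map_image_subset_topspace[OF cont] tI by auto
 have "vel ga t \<in> TM (ga t)" unfolding tangent_def
 proof (intro CollectI conjI ballI allI impI)
  fix c c' assume c: "c \<in> Ch (ga t)" "c' \<in> Ch (ga t)"
  obtain e where e: "0 < e" "!!s. s \<in> {a'..b'} ==> \<bar>s - t\<bar> < e ==> c \<in> Ch (ga s)" using near_chart[OF cont tI c(1)] by blast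
  have "((%r. transition c c' ((snd c o ga) r)) hvd Dt c c' (ga t) (vel ga t c)) (at t)"
   by (rule has_vd_compose[OF vd[OF t c(1)]]) (use transition_deriv[OF c] in simp)
  hence "((snd c' o ga) hvd Dt c c' (ga t) (vel ga t c)) (at t)"
  proof (rule has_vd_near[where e = "min e (min (t - a') (b' - t))"])
   fix s assume "\<bar>s - t\<bar> < min e (min (t - a') (b' - t))"
   hence "s \<in> {a'..b'}" "\<bar>s - t\<bar> < e" by auto
   thus "transition c c' ((snd c o ga) s) = (snd c' o ga) s" using transition_chart[OF e(2), of s c'] by simp
  qed (use e(1) n in auto)
  thus "vel ga t c' = Dt c c' (ga t) (vel ga t c)" by (rule vector_derivative_unique_at[OF vd[OF t c(2)]])
 qed (simp add: vel_def velocity_def)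
 thus ?thesis using pt by blast
qed
show ?thesis by (rule that[OF S(1) vd tan])
qed

lemma HL_nonneg: assumes "HL ga a b l" shows "0 <= l"
proof -
obtain S where S: "finite S" "!!t. a < t ==> t < b ==> t \<notin> S ==> vel ga t \<in> TM (ga t) & ga t \<in> PM"
 using HL_piece[of ga a b] assms unfolding HL_def by metis
have "((%t. if t \<in> insert a (insert b S) then 0 else spd ga t) has_integral l) {a..b}"
 by (rule has_integral_spike_finite[of "insert a (insert b S)" _ _ "spd ga"]) (use S(1) assms in "auto simp: HL_def")
thus ?thesis by (rule has_integral_nonneg) (use S(2) fnorm_nonneg in "auto simp: spd_def")
qed

lemma Dset_bdd: "bdd_below (Dset p q)"
using HL_nonneg unfolding Dset_def by (auto intro!: bdd_belowI[of _ 0])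

lemma fdist_le: "HL ga 0 1 l ==> ga 0 = p ==> ga 1 = q ==> dst p q <= l"
unfolding fdist_eq by (rule cInf_lower[OF _ Dset_bdd]) (auto simp: Dset_def)

lemma fdist_lessD: "dst p q < r ==> Dset p q ~= {} ==> EX ga l. HL ga 0 1 l & ga 0 = p & ga 1 = q & l < r"
unfolding fdist_eq using cInf_lessD[of "Dset p q" r] by (auto simp: Dset_def)

lemma fdist_ge: "Dset p q ~= {} ==> (!!ga l. HL ga 0 1 l ==> ga 0 = p ==> ga 1 = q ==> m <= l) ==> m <= dst p q"
unfolding fdist_eq by (rule cInf_greatest) (auto simp: Dset_def)

section \<open>Reparametrisation and concatenation of curves\<close>

lemma C1_curve_cong:
assumes "C1_curve M I ga" "!!t. t \<in> I ==> ga' t = ga t" shows "C1_curve M I ga'"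
proof -
have hd: "((snd c o ga) hvd v) (at t within I) \<longleftrightarrow> ((snd c o ga') hvd v) (at t within I)"
 if "t \<in> I" for t and c :: "('m, 'n) chart" and v
 using has_vd_near[of "snd c o ga" v t I 1 "snd c o ga'"] has_vd_near[of "snd c o ga'" v t I 1 "snd c o ga"] that assms(2) by auto
have vd: "vector_derivative (snd c o ga) (at t within I) = vector_derivative (snd c o ga') (at t within I)" if "t \<in> I" for t and c :: "('m, 'n) chart"
 unfolding vector_derivative_def hd[OF that] ..
show ?thesis unfolding C1_curve_def
proof (intro conjI ballI)
 show "cmap I ga'"
  by (rule continuous_map_eq[of _ _ ga]) (use assms in "auto simp: C1_curve_def")
 fix t c assume t: "t \<in> I" and c: "c \<in> Ch (ga' t)"
 hence c': "c \<in> Ch (ga t)" using assms(2) by simp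
 show "(snd c o ga') differentiable (at t within I)"
  using C1_curve_vd[OF assms(1) t c'] hd[OF t] unfolding has_vector_derivative_def differentiable_def by blast
 have "continuous (at t within I) (%s. vector_derivative (snd c o ga) (at s within I))" using assms(1) t c' by (simp add: C1_curve_def)
 thus "continuous (at t within I) (%s. vector_derivative (snd c o ga') (at s within I))"
  by (rule continuous_transform_within[where \<delta> = 1]) (use t vd in auto)
qed
qed

lemma C1_curve_affine:
assumes C: "C1_curve M {p + q * a..p + q * b} ga" and q: "0 < q" and ab: "a < b"
shows "C1_curve M {a..b} (%t. ga (p + q * t))"
proof -
let ?h = "%t. p + q * t" and ?J = "{a..b}" and ?I = "{p + q * a..p + q * b}"
have sub: "?h t \<in> ?I" if "t \<in> ?J" for t using that q by auto
have hJ: "?h ` ?J = ?I"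
proof -
 have "?h ` ?J = (%x. q * x + p) ` {a..b}" by (simp add: add.commute)
 also have "... = {q * a + p..q * b + p}" using q ab by (subst image_affinity_atLeastAtMost) auto
 finally show ?thesis by (simp add: add.commute)
qed
have cmap: "continuous_map (top_of_set ?J) (top_of_set ?I) ?h"
 using sub by (auto simp: continuous_map_iff_continuous2 intro!: continuous_intros)
have I: "ivl ?I" and J: "ivl ?J" using ivl_Icc q ab by auto
have ch: "((snd c o (%t. ga (?h t))) hvd q *R vlc ?I ga (?h t) c) (at t within ?J)"
 if "t \<in> ?J" "c \<in> Ch (ga (?h t))" for t c
proof -
 have "(?h hvd q) (at t within ?J)" by (auto intro!: derivative_eq_intros)
 from vector_diff_chain_within[OF this, of "snd c o ga" "vlc ?I ga (?h t) c"]
 show ?thesis using C1_curve_vd[OF C sub[OF that(1)] that(2)] unfolding hJ by (simp add: o_def)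
qed
show ?thesis unfolding C1_curve_def
proof (intro conjI ballI)
 show cont: "cmap ?J (%t. ga (?h t))"
  using continuous_map_compose[OF cmap, of "topo M" ga] C by (simp add: C1_curve_def o_def)
 fix t c assume t: "t \<in> ?J" and c: "c \<in> Ch (ga (?h t))"
 show "(snd c o (%t. ga (?h t))) differentiable (at t within ?J)"
  using ch[OF t c] unfolding has_vector_derivative_def differentiable_def by blast
 obtain e where e: "0 < e" "!!s. s \<in> ?J ==> \<bar>s - t\<bar> < e ==> c \<in> Ch (ga (?h s))" using near_chart[OF cont t c] by blast
 have "continuous (at (?h t) within ?I) (%s. vector_derivative (snd c o ga) (at s within ?I))"
  using C sub[OF t] c by (simp add: C1_curve_def)
 moreover have "continuous (at t within ?J) ?h" by (intro continuous_intros)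
 ultimately have "continuous (at t within ?J) (%s. q *R vector_derivative (snd c o ga) (at (?h s) within ?I))"
  using continuous_within_compose2[of t ?J ?h "%s. vector_derivative (snd c o ga) (at s within ?I)"] unfolding hJ
  by (intro continuous_intros) (simp add: o_def)
 thus "continuous (at t within ?J) (%s. vector_derivative (snd c o (%t. ga (?h t))) (at s within ?J))"
 proof (rule continuous_transform_within[OF _ e(1) t])
  fix s assume s: "s \<in> ?J" "dist s t < e"
  hence "c \<in> Ch (ga (?h s))" using e(2) by (simp add: dist_real_def)
  from vector_derivative_within[OF ivl_nontrivial[OF J s(1)] ch[OF s(1) this]] this
  show "q *R vector_derivative (snd c o ga) (at (?h s) within ?I) = vector_derivative (snd c o (%t. ga (?h t))) (at s within ?J)"
   by (simp add: velocity_def)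
 qed
qed
qed

lemma HL_affine_cong:
assumes H: "HL ga (p + q * a) (p + q * b) l" and q: "0 < q" and ab: "a < b" and eq: "!!t. t \<in> {a..b} ==> ga' t = ga (p + q * t)"
shows "HL ga' a b l"
proof -
let ?h = "%t. p + q * t"
have pw: "pwc ga (?h a) (?h b)" using H by (simp add: HL_def)
obtain S where S: "finite S" "!!a' b'. ?h a <= a' ==> a' < b' ==> b' <= ?h b ==> {a'<..<b'} Int S = {} ==> C1_curve M {a'..b'} ga"
 using pw unfolding pwc_def by blast
obtain S2 where S2: "finite S2" "!!t c. ?h a < t ==> t < ?h b ==> t \<notin> S2 ==> c \<in> Ch (ga t) ==> ((snd c o ga) hvd vel ga t c) (at t)"
 "!!t. ?h a < t ==> t < ?h b ==> t \<notin> S2 ==> vel ga t \<in> TM (ga t) & ga t \<in> PM"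
 using HL_piece[OF pw] by blast
define g where "g t = (t - p) / q" for t
have gh: "g (?h t) = t" "?h (g t) = t" for t using q by (auto simp: g_def)
have pw': "pwc ga' a b" unfolding pwc_def
proof (intro exI[of _ "g ` S"] conjI allI impI finite_imageI S(1))
 fix a' b' assume h: "a <= a' & a' < b' & b' <= b & {a'<..<b'} Int g ` S = {}"
 have "{?h a'<..<?h b'} Int S = {}"
 proof (rule ccontr)
  assume "{?h a'<..<?h b'} Int S ~= {}"
  then obtain s where s: "s \<in> S" "?h a' < s" "s < ?h b'" by auto
  hence "g s \<in> {a'<..<b'}" using q by (auto simp: g_def field_simps)
  thus False using h s(1) by blast
 qed
 hence "C1_curve M {?h a'..?h b'} ga" using h q by (intro S(2)) auto
 hence "C1_curve M {a'..b'} (%t. ga (?h t))" using h by (intro C1_curve_affine q) auto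
 thus "C1_curve M {a'..b'} ga'" by (rule C1_curve_cong) (use h eq in auto)
qed
have spd: "spd ga' t = q * spd ga (?h t)" if t: "a < t" "t < b" "t \<notin> g ` S2" for t
proof -
 have h: "?h a < ?h t" "?h t < ?h b" using t q by auto
 have hS: "?h t \<notin> S2" using t(3) gh(1)[of t] by (metis imageI)
 have et: "ga' t = ga (?h t)" using eq t by simp
 have "vel ga' t = tscale q (vel ga (?h t))"
 proof
  fix c show "vel ga' t c = tscale q (vel ga (?h t)) c"
  proof (cases "c \<in> Ch (ga' t)")
   case True
   have hd: "(?h hvd q) (at t)" by (auto intro!: derivative_eq_intros)
   have "((snd c o ga) hvd vel ga (?h t) c) (at (?h t))" by (rule S2(2)[OF h hS]) (use True et in simp)
   from vector_diff_chain_at[OF hd this]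
   have "((%t. snd c (ga (?h t))) hvd q *R vel ga (?h t) c) (at t)" by (simp add: o_def)
   hence "((snd c o ga') hvd q *R vel ga (?h t) c) (at t)"
   proof (rule has_vd_near[where e = "min (t - a) (b - t)"])
    fix s assume "\<bar>s - t\<bar> < min (t - a) (b - t)"
    hence "s \<in> {a..b}" by auto
    thus "snd c (ga (?h s)) = (snd c o ga') s" using eq by simp
   qed (use t in auto)
   thus ?thesis using True by (simp add: vel_def velocity_def tscale_def vector_derivative_at)
  qed (simp add: vel_def velocity_def tscale_def et)
 qed
 thus ?thesis unfolding spd_def et using fnorm_tscale[of "ga (?h t)" "vel ga (?h t)" q] S2(3)[OF h hS] q by simp
qed
have "(spd ga has_integral l) (cbox (?h a) (?h b))" using H by (simp add: HL_def)
from has_integral_affinity[OF this, of q p] q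
have "((%t. spd ga (q * t + p)) has_integral (1 / q) * l) ((%x. (1 / q) * x + - ((1 / q) * p)) ` {?h a..?h b})" by simp
moreover have "(%x. (1 / q) * x + - ((1 / q) * p)) ` {?h a..?h b} = {a..b}"
 using q ab by (subst image_affinity_atLeastAtMost) (auto simp: field_simps)
ultimately have "((%t. spd ga (?h t)) has_integral (1 / q) * l) {a..b}" by (simp add: add.commute)
from has_integral_mult_right[OF this, of q] q
have "((%t. q * spd ga (?h t)) has_integral l) {a..b}" by simp
note qi = this
have "(spd ga' has_integral l) {a..b}"
 by (rule has_integral_spike_finite[of "insert a (insert b (g ` S2))", OF _ _ qi]) (use S2(1) spd in auto)
thus ?thesis using pw' by (simp add: HL_def)
qed

lemma HL_join: assumes "HL ga a b l" "HL ga b c l'" "a < b" "b < c" shows "HL ga a c (l + l')"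
proof -
obtain S where S: "finite S" "!!a' b'. a <= a' ==> a' < b' ==> b' <= b ==> {a'<..<b'} Int S = {} ==> C1_curve M {a'..b'} ga"
 using assms(1) unfolding HL_def pwc_def by blast
obtain S' where S': "finite S'" "!!a' b'. b <= a' ==> a' < b' ==> b' <= c ==> {a'<..<b'} Int S' = {} ==> C1_curve M {a'..b'} ga"
 using assms(2) unfolding HL_def pwc_def by blast
have "pwc ga a c" unfolding pwc_def
proof (intro exI[of _ "insert b (S Un S')"] conjI allI impI)
 fix a' b' assume h: "a <= a' & a' < b' & b' <= c & {a'<..<b'} Int insert b (S Un S') = {}"
 hence "b' <= b \<or> b <= a'" by auto
 thus "C1_curve M {a'..b'} ga" using S(2)[of a' b'] S'(2)[of a' b'] h by auto
qed (use S S' in auto)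
moreover have "(spd ga has_integral (l + l')) {a..c}"
 by (rule has_integral_combine[of a b c]) (use assms in "auto simp: HL_def")
ultimately show ?thesis by (simp add: HL_def)
qed

lemma HL_concat: assumes "HL ga 0 1 l" "HL ga' 0 1 l'" "ga 1 = ga' 0"
shows "EX \<delta>. HL \<delta> 0 1 (l + l') & \<delta> 0 = ga 0 & \<delta> 1 = ga' 1"
proof -
define \<delta> where "\<delta> t = (if t <= 1/2 then ga (0 + 2 * t) else ga' (-1 + 2 * t))" for t :: real
have "HL \<delta> 0 (1/2) l" by (rule HL_affine_cong[where ga = ga and p = 0 and q = 2]) (use assms in "auto simp: \<delta>_def")
moreover have "HL \<delta> (1/2) 1 l'"
proof (rule HL_affine_cong[where ga = ga' and p = "-1" and q = 2])
 show "\<delta> t = ga' (-1 + 2 * t)" if "t \<in> {1/2..1}" for t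
 proof (cases "t = 1/2")
  case True
  show ?thesis unfolding \<delta>_def True using assms(3) by simp
 qed (use that in "auto simp: \<delta>_def")
qed (use assms in auto)
ultimately have "HL \<delta> 0 1 (l + l')" by (rule HL_join) auto
thus ?thesis by (intro exI[of _ \<delta>]) (auto simp: \<delta>_def)
qed

lemma fdist_triangle: assumes "Dset p q ~= {}" "Dset q r ~= {}"
shows "dst p r <= dst p q + dst q r" "Dset p r ~= {}"
proof -
have cc: "l + l' \<in> Dset p r" if "l \<in> Dset p q" "l' \<in> Dset q r" for l l'
 using that HL_concat unfolding Dset_def by fastforce
thus "Dset p r ~= {}" using assms by blast
have "dst p r <= l + l'" if "l \<in> Dset p q" "l' \<in> Dset q r" for l l'
 unfolding fdist_eq by (rule cInf_lower[OF cc[OF that] Dset_bdd])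
hence "dst p r - l' <= dst p q" if "l' \<in> Dset q r" for l'
 unfolding fdist_eq[of p q] using that by (intro cInf_greatest[OF assms(1)]) (auto simp: algebra_simps)
hence "dst p r - dst p q <= dst q r"
 unfolding fdist_eq[of q r] by (intro cInf_greatest[OF assms(2)]) (auto simp: algebra_simps)
thus "dst p r <= dst p q + dst q r" by simp
qed

text \<open>A calibration argument: if \<open>h\<close> grows along the curve no faster than the
  speed, its increment bounds the length from below. A subinterval is allowed so that parameters
  where \<open>h\<close> fails to be differentiable can be left out; the rest of the curve
  contributes a nonnegative amount.\<close>

lemma HL_lower_bound:
assumes H: "HL ga 0 1 l" and t0: "0 <= t0" "t0 < t1" "t1 <= 1" and cont: "continuous_on {t0..t1} h"
 and der: "!!t. t0 < t ==> t < t1 ==> vel ga t \<in> TM (ga t) ==>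
   (!!c. c \<in> Ch (ga t) ==> ((snd c o ga) hvd vel ga t c) (at t)) ==>
   EX h'. (h hrd h') (at t) & h' <= spd ga t"
shows "h t1 - h t0 <= l"
proof -
have pw: "pwc ga 0 1" and int: "(spd ga has_integral l) {0..1}" using H by (auto simp: HL_def)
obtain S where S: "finite S" "!!a' b'. 0 <= a' ==> a' < b' ==> b' <= 1 ==> {a'<..<b'} Int S = {} ==> C1_curve M {a'..b'} ga"
 using pw unfolding pwc_def by blast
obtain S2 where S2: "finite S2" "!!t c. 0 < t ==> t < 1 ==> t \<notin> S2 ==> c \<in> Ch (ga t) ==> ((snd c o ga) hvd vel ga t c) (at t)"
 "!!t. 0 < t ==> t < 1 ==> t \<notin> S2 ==> vel ga t \<in> TM (ga t) & ga t \<in> PM"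
 using HL_piece[OF pw] by blast
have fS: "finite (S Un S2)" using S(1) S2(1) by simp
have sub: "spd ga integrable_on {p..q}" if "0 <= p" "q <= 1" for p q
 using integrable_on_subinterval[OF has_integral_integrable[OF int], of p q] that by auto
have "h t1 - h t0 <= integral {t0..t1} (spd ga)"
proof (rule pieces_induct[OF fS, of t0 t1 "%a b. h b - h a <= integral {a..b} (spd ga)" t0 t1])
 fix a b assume ab: "t0 <= a" "a < b" "b <= t1" "{a<..<b} Int (S Un S2) = {}"
 have C: "C1_curve M {a..b} ga" using S(2)[of a b] ab t0 by auto
 let ?g = "%t. fnorm M (ga t) (vlc {a..b} ga t)"
 have gc: "continuous_on {a..b} ?g" by (rule speed_continuous[OF C ab(2)])
 have gi: "integral {a..b} (spd ga) = integral {a..b} ?g" using piece_integral[OF C ab(2)] by (simp add: integral_unique)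
 let ?k = "%t. integral {a..t} ?g - h t"
 have "?k a <= ?k b"
 proof (rule DERIV_nonneg_imp_increasing_open[where f = ?k])
  fix t assume t: "a < t" "t < b"
  have tS: "t \<notin> S2" "0 < t" "t < 1" "t0 < t" "t < t1" using t ab t0 by auto
  obtain h' where h': "(h hrd h') (at t)" "h' <= spd ga t"
   using der[OF tS(4,5)] S2(3)[OF tS(2,3,1)] S2(2)[OF tS(2,3,1)] by blast
  have "((%t. integral {a..t} ?g) hrd ?g t) (at t within {a..b})"
   by (rule integral_has_real_derivative[OF gc]) (use t in auto)
  hence "((%t. integral {a..t} ?g) hrd ?g t) (at t)" using at_within_Icc_at[OF t] by simp
  from DERIV_diff[OF this h'(1)] h'(2) velocity_interior[OF t]
  show "EX y. (?k hrd y) (at t) & 0 <= y" by (intro exI[of _ "?g t - h'"]) (simp add: spd_def)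
 next
  show "continuous_on {a..b} ?k"
   by (intro continuous_on_diff indefinite_integral_continuous_1 integrable_continuous_real gc continuous_on_subset[OF cont]) (use ab in auto)
 qed (use ab in auto)
 thus "h b - h a <= integral {a..b} (spd ga)" unfolding gi by simp
next
 fix a c b assume h: "t0 <= a" "a < c" "c < b" "b <= t1" "h c - h a <= integral {a..c} (spd ga)" "h b - h c <= integral {c..b} (spd ga)"
 have "integral {a..c} (spd ga) + integral {c..b} (spd ga) = integral {a..b} (spd ga)"
  by (rule Henstock_Kurzweil_Integration.integral_combine) (use h t0 sub[of a b] in auto)
 thus "h b - h a <= integral {a..b} (spd ga)" using h by linarith
qed (use t0 in auto)
also have "... <= l"
proof -
 have nn: "0 <= integral {p..q} (spd ga)" if "0 <= p" "p <= q" "q <= 1" for p q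
 proof -
  have "((%t. if t \<in> insert p (insert q S2) then 0 else spd ga t) has_integral integral {p..q} (spd ga)) {p..q}"
   by (rule has_integral_spike_finite[of "insert p (insert q S2)" _ _ "spd ga"]) (use S2(1) integrable_integral[OF sub[OF that(1,3)]] in auto)
  thus ?thesis by (rule has_integral_nonneg) (use S2(3) fnorm_nonneg that in "auto simp: spd_def")
 qed
 have "integral {0..t0} (spd ga) + integral {t0..1} (spd ga) = integral {0..1} (spd ga)"
  "integral {t0..t1} (spd ga) + integral {t1..1} (spd ga) = integral {t0..1} (spd ga)"
  by (rule Henstock_Kurzweil_Integration.integral_combine; use t0 sub in auto)+
 thus ?thesis using nn[of 0 t0] nn[of t1 1] t0 integral_unique[OF int] by linarith
qed
finally show ?thesis .
qed

end

section \<open>The exponential map\<close>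

context cmetric
begin

lemma L_has_derivative:
assumes z: "(x, y) \<in> S"
shows "((%y. L (x, y)) hfd (%w. G (x, y) y w / L (x, y))) (at y)"
proof -
have p: "0 < L (x, y)" using L_pos z by auto
have D: "((%y. Q (x, y)) hfd (%w. 2 * G (x, y) y w)) (at y)"
 using has_derivative_compose[where f = "%y. (x, y)" and f' = "%w. (0, w)" and g = Q, OF has_derivative_Pair[OF has_derivative_const has_derivative_ident] fd_works[OF diff_Q(1)[OF z]]] G_y(1)[OF z]
 by (auto simp: Q1_def mult.commute)
have "((%y. sqrt (Q (x, y))) hfd (%w. G (x, y) y w / L (x, y))) (at y)"
 using has_derivative_real_sqrt[OF _ D] p by (simp add: Q_def field_simps)
moreover have "sqrt (Q (x, y)) = L (x, y)" if "y \<in> UNIV" for y using nonnegL[of x y] z by (simp add: Q_def)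
ultimately show ?thesis by simp
qed

text \<open>Strict convexity of \<open>F^2\<close> along the segment from \<open>y\<close> to
  \<open>w\<close>, by two mean value steps. If the segment meets the origin, where
  \<open>F^2\<close> need not be smooth, then \<open>w\<close> is a nonpositive multiple of
  \<open>y\<close> and the left side is nonpositive.\<close>

lemma fundamental_strict:
assumes z: "(x, y) \<in> S" and w: "w ~= y" "L (x, w) = L (x, y)"
shows "G (x, y) y w < Q (x, y)"
proof (cases "EX t:{0..1}. y + t *R (w - y) = 0")
case True
then obtain t where t: "t \<in> {0..1}" "(1 - t) *R y + t *R w = 0" by (auto simp: algebra_simps)
have "t ~= 0" using t z by auto
hence "w = (- (1 - t) / t) *R y" using t(2)
 by (metis (no_types, lifting) add_diff_cancel_left' diff_0 divide_inverse_commute real_vector.scale_minus_left scaleR_left_imp_eq scaleR_scaleR right_inverse mult.commute scaleR_one mult_minus_left minus_diff_eq)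
hence "G (x, y) y w = - (1 - t) / t * Q (x, y)" using G_y(2)[OF z] linear_cmul[OF lin_G(1)[OF z]] by simp
also have "... <= 0" using t(1) by (intro mult_nonpos_nonneg divide_nonpos_nonneg) (auto simp: Q_def)
also have "0 < Q (x, y)" using L_pos[of x y] z by (simp add: Q_def)
finally show ?thesis .
next
case False
let ?p = "%t. (x, y + t *R (w - y))" and ?h = "(0, w - y)"
have pS: "?p t \<in> S" if "0 <= t" "t <= 1" for t using False that z by auto
have ln: "((%t. ?p t) hfd (%s. s *R ?h)) (at t)" for t
 by (auto intro!: derivative_eq_intros simp: fun_eq_iff)
have D1: "DERIV (%t. Q (?p t)) t :> Q1 ?h (?p t)" if "0 <= t" "t <= 1" for t
 using has_derivative_compose[where g = Q, OF ln fd_works[OF diff_Q(1)[OF pS[OF that]]]]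
 by (simp add: has_field_derivative_def Q1_def linear_cmul[OF fd_linear[OF diff_Q(1)[OF pS[OF that]]], of _ ?h, simplified] mult_commute_abs)
have D2: "DERIV (%t. Q1 ?h (?p t)) t :> Q2 ?h ?h (?p t)" if "0 <= t" "t <= 1" for t
 using has_derivative_compose[where g = "Q1 ?h", OF ln fd_works[OF diff_Q(2)[OF pS[OF that], of ?h]]]
 by (simp add: has_field_derivative_def Q2_def linear_cmul[OF fd_linear[OF diff_Q(2)[OF pS[OF that], of ?h]], of _ ?h, simplified] mult_commute_abs)
obtain t where t: "0 < t" "t < 1" "Q (?p 1) - Q (?p 0) = (1 - 0) * Q1 ?h (?p t)"
 using MVT2[OF zero_less_one D1] by blast
obtain s where s: "0 < s" "s < t" "Q1 ?h (?p t) - Q1 ?h (?p 0) = (t - 0) * Q2 ?h ?h (?p s)"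
 using MVT2[OF t(1), of "%t. Q1 ?h (?p t)" "%t. Q2 ?h ?h (?p t)"] D2 t(2) by force
have "0 < Q2 ?h ?h (?p s)" using G_pos[of x "y + s *R (w - y)" "w - y"] pS[of s] s t w(1) by (simp add: G_def)
from mult_pos_pos[OF t(1) this] have "Q1 ?h (?p 0) < 0" using s t w(2) by (simp add: Q_def)
moreover have "Q1 ?h (?p 0) = 2 * (G (x, y) y w - Q (x, y))"
 using G_y(1)[OF z, of "w - y"] G_y(2)[OF z] by (simp add: linear_diff[OF lin_G(1)[OF z]])
ultimately show ?thesis by simp
qed

text \<open>The fundamental inequality of Finsler geometry, from the strict version by rescaling
  \<open>w\<close> to the norm of \<open>y\<close>.\<close>

lemma fundamental:
assumes z: "(x, y) \<in> S" shows "G (x, y) y w <= L (x, y) * L (x, w)"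
proof (cases "w = 0")
case True thus ?thesis using linear_0[OF lin_G(1)[OF z]] z by (simp add: L_zero)
next
case False
have x: "x \<in> U" and p: "0 < L (x, y)" "0 < L (x, w)" using z L_pos False by auto
let ?l = "L (x, y) / L (x, w)"
have l: "0 < ?l" using p by simp
have e: "L (x, ?l *R w) = L (x, y)" using homL[OF x l] p by simp
have "G (x, y) y (?l *R w) <= Q (x, y)" using fundamental_strict[OF z _ e] G_y(2)[OF z] by (cases "?l *R w = y") auto
hence "?l * G (x, y) y w <= L (x, y) * L (x, y)" by (simp add: linear_cmul[OF lin_G(1)[OF z]] Q_def power2_eq_square)
thus ?thesis using p by (simp add: field_simps)
qed

end

context finsler_mfd
begin

lemma ip_fundamental:
assumes x: "x \<in> PM" and y: "y \<in> TM x" "y ~= tzero" and w: "w \<in> TM x"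
shows "ip x y y w <= fnorm M x y * fnorm M x w"
 "fnorm M x w = fnorm M x y ==> w ~= y ==> ip x y y w < (fnorm M x y)^2"
proof -
obtain c where c: "c \<in> Ch x" using cover x by blast
interpret C: cmetric "LM c" "cdom c" by (rule chm[OF c])
note z = pair_in_S[OF c nz_chart[OF y c]] and e = fnorm_coord[OF c] ip_chart[OF y y(1) w c]
show "ip x y y w <= fnorm M x y * fnorm M x w" unfolding e(1)[OF y(1)] e(1)[OF w] e(2) by (rule C.fundamental[OF z])
show "ip x y y w < (fnorm M x y)^2" if "fnorm M x w = fnorm M x y" "w ~= y"
 unfolding e(1)[OF y(1)] e(2) C.Q_def[symmetric]
 by (rule C.fundamental_strict[OF z]) (use that tangent_eqI[OF w y(1) c] e(1)[OF y(1)] e(1)[OF w] in auto)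
qed

end

section \<open>Speed of geodesics and the Gauss lemma in coordinates\<close>

context bounded_mfd
begin

text \<open>Negative \<open>s\<close> is included: the norm of the reversed velocity is constant
  too, which is what measures reversed geodesics.\<close>

lemma fnorm_gvel:
assumes y: "y \<in> TM x" and x: "x \<in> PM" and t: "0 <= t"
shows "fnorm M (geo x y t) (tscale s (gvel x y t)) = fnorm M x (tscale s y)"
proof (cases "y = tzero \<or> s = 0")
case True
have "tscale s (gvel x y t) = tzero" "tscale s y = tzero"
 using True geo_tzero[OF x t] by (auto simp: tscale_def tzero_def)
thus ?thesis using fnorm_tzero x geo_points[OF y x t] by simp
next
case False
obtain c where c: "c \<in> Ch x" using cover x by blast
let ?z = "(snd c x, y c)"
note p = pt_vec_coord[OF c y]
have z: "?z \<in> WW c" "snd ?z ~= 0" and s: "s ~= 0" using p(3) nz_chart[OF y _ c] False by auto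
note N = NN[OF chD(1)[OF c] z s]
have e: "gz c ?z = geo x y" "vz c ?z = gvel x y" using p by auto
have e2: "NN c ?z s r = tscale s (gvel x y r)" for r by (simp add: NN_def[OF chD(1)[OF c] z s] e)
have "(fnorm M (geo x y t) (tscale s (gvel x y t)))^2 = (fnorm M (geo x y 0) (tscale s (gvel x y 0)))^2"
 using fnorm_NN_const[OF chD(1)[OF c] z s t] fnorm_ip[OF geo_points[OF y x t]] fnorm_ip[OF geo_points[OF y x order_refl]]
  N[OF t] N[OF order_refl] unfolding e e2 by metis
moreover have "0 <= fnorm M (geo x y r) (tscale s (gvel x y r))" if "0 <= r" for r
 by (rule fnorm_nonneg[OF geo_points[OF y x that] tangent_tscale[OF gvel_tangent[OF y x that]]])
ultimately show ?thesis using t geo(2,3)[OF y x] by (metis order_refl power2_eq_imp_eq)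
qed

lemma geo_HL:
assumes y: "y \<in> TM x" and x: "x \<in> PM"
shows "HL (geo x y) 0 1 (fnorm M x y)"
proof -
note g = geo(1)[OF y x]
have C: "C1_curve M {a..b} (geo x y)" if "0 <= a" "a < b" for a b
proof -
 have h: "geodesic_on M {a..b} (geo x y)" by (rule geodesic_restrict(1)[OF g ivl_Ici ivl_Icc]) (use that in auto)
 show ?thesis using h has_vector_derivative_continuous unfolding C1_curve_def geodesic_on_def by blast
qed
have v: "vel (geo x y) t = gvel x y t" if "0 < t" for t
 using velocity_interior[of 0 t "t + 1" "geo x y"] geodesic_restrict(2)[OF g ivl_Ici ivl_Icc[of 0 "t + 1"], of t] that
 by (simp add: gvel_def)
have s: "spd (geo x y) t = fnorm M x y" if "0 < t" for t
 using fnorm_gvel[OF y x, of t 1] that by (simp add: spd_def v tscale_one)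
have "(spd (geo x y) has_integral fnorm M x y) {0..1}"
 by (rule has_integral_spike_finite[of "{0}" _ _ "%t. fnorm M x y"]) (use s has_integral_const_real[of "fnorm M x y" 0 1] in auto)
thus ?thesis unfolding HL_def pwc_def using C by (metis finite.emptyI)
qed

text \<open>The initial data are the displacement \<open>fst h\<close> of the foot point and the
  covariant derivative \<open>b\<close>. A field vanishing at time 1 arises when the foot point
  moves while the end point is fixed, which is how the inverse exponential map is differentiated
  later.\<close>

lemma gauss_chart:
fixes h
assumes c: "c \<in> AM" and z: "z \<in> WW c" "snd z ~= 0" and s: "s ~= 0"
 and c1: "c1 \<in> Ch (gz c z 1)"
defines "y \<equiv> s *R snd z" and "b \<equiv> snd h + Gm c (fst z) (snd z) (fst h)"
 and "v \<equiv> s *R vz c z 1 c1"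
shows "GG c1 (snd c1 (gz c z 1), v) v (jf c z h 1 c1) = GG c (fst z, y) y (fst h) + GG c (fst z, y) y b"
 "jf c z h 1 c1 = 0 ==> GG c (fst z, y) y b = - GG c (fst z, y) y (fst h)"
 "jf c z h 1 c1 = 0 ==> \<bar>kb\<bar> * (LM c (fst z, y))^2 <= s^2 * ka ==> ka <= 1/4 ==> 0 <= ka ==>
  sqrt (GG c (fst z, y) (b + fst h) (b + fst h)) <= 2 * ka * sqrt (GG c (fst z, y) (fst h) (fst h))"
proof -
note A = c z s
note P = pt_vec[OF c z(1)]
let ?x = "pt c z"
let ?g = "geo ?x (vec c z)"
have g0: "?g 0 = ?x" "gvel ?x (vec c z) 0 = vec c z" using geo(2,3)[OF P(3,2)] by auto
have c0: "c \<in> Ch (?g 0)" using P(1) g0 by simp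
note T = JJ_tangent[OF A] and N = NN[OF A]
have e0: "NN c z s 0 c = y" "JJ c z h 0 c = fst h" "KK c z h 0 c = b"
 using c0 P(5) jacobi_init[OF c z(1)] g0 by (auto simp: NN_def[OF A] JJ_def[OF A] KK_def[OF A] y_def b_def tscale_def)
have e1: "NN c z s 1 c1 = v" "JJ c z h 1 c1 = jf c z h 1 c1" using c1 by (auto simp: NN_def[OF A] JJ_def[OF A] v_def tscale_def)
have i0: "ip (?g 0) (NN c z s 0) a b = GG c (fst z, y) (a c) (b c)" if "a \<in> TM (?g 0)" "b \<in> TM (?g 0)" for a b
 using ip_chart[OF N[OF order_refl] that c0] P(4) g0 by (simp add: e0)
show G: "GG c1 (snd c1 (?g 1), v) v (jf c z h 1 c1) = GG c (fst z, y) y (fst h) + GG c (fst z, y) y b"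
 using gauss[OF A zero_le_one, of h] ip_chart[OF N[OF zero_le_one] N(1)[OF zero_le_one] T(1)[OF zero_le_one] c1]
 by (simp add: i0 N T e0 e1)
interpret C1: cmetric "LM c1" "cdom c1" by (rule chm[OF c1])
have "v ~= 0" using nz_chart[OF N[OF zero_le_one] c1] e1 by simp
note z1 = pair_in_S[OF c1 this]
show "GG c (fst z, y) y b = - GG c (fst z, y) y (fst h)" if "jf c z h 1 c1 = 0"
 using G that linear_0[OF C1.lin_G(1)[OF z1]] by simp
show "sqrt (GG c (fst z, y) (b + fst h) (b + fst h)) <= 2 * ka * sqrt (GG c (fst z, y) (fst h) (fst h))"
 if "jf c z h 1 c1 = 0" and k: "\<bar>kb\<bar> * (LM c (fst z, y))^2 <= s^2 * ka" "ka <= 1/4" "0 <= ka"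
proof -
 have j: "JJ c z h 1 = tzero"
  by (rule tangent_eqI[OF T(1)[OF zero_le_one] tangent_tzero c1]) (simp add: e1 that tzero_def)
 interpret C: cmetric "LM c" "cdom c" by (rule cmetric[OF c])
 have y: "(fst z, y) \<in> C.S" using z s by (auto simp: y_def)
 have k': "\<bar>kb\<bar> * ip (?g 0) (NN c z s 0) (NN c z s 0) (NN c z s 0) <= s^2 * ka"
  using k(1) by (simp add: i0 N e0 C.G_y(2)[OF y] C.Q_def)
 have t: "(%c1. KK c z h 0 c1 + JJ c z h 0 c1) \<in> TM (?g 0)"
  using tangent_linear[OF T(2,1)[OF order_refl], where a = 1 and b = 1] by simp
 show ?thesis
  using jacobi_estimate[OF A j k' k(2,3)] unfolding nrm_chart[OF A order_refl t c0] nrm_chart[OF A order_refl T(1)[OF order_refl] c0]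
  using P(4) g0 by (simp add: e0)
qed
qed

end

lemma (in cmetric) L_norm_equiv:
assumes C: "compact C" "C <= U"
obtains m K where "0 < m" "0 < K" "!!x y. x \<in> C ==> m * norm y <= L (x, y)" "!!x y. x \<in> C ==> L (x, y) <= K * norm y"
proof (cases "C = {}")
case True thus ?thesis using that[of 1 1] by simp
next
case False
let ?A = "C \<times> sphere (0 :: real ^ 'n) 1"
have A: "compact ?A" "?A ~= {}" using C False by (auto intro!: compact_Times simp: ex_in_conv[symmetric] intro: exI[of _ "axis undefined 1"] norm_axis_1)
have cont: "continuous_on ?A L" by (rule continuous_on_subset[OF L_continuous]) (use C in auto)
obtain a b where a: "a \<in> ?A" "!!z. z \<in> ?A ==> L a <= L z" and b: "b \<in> ?A" "!!z. z \<in> ?A ==> L z <= L b"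
 using continuous_attains_inf[OF A cont] continuous_attains_sup[OF A cont] by blast
have "0 < L z" if z: "z \<in> ?A" for z
proof -
 have "snd z ~= 0" "fst z \<in> U" using z C(2) by force+
 thus ?thesis using L_pos[of "fst z" "snd z"] by simp
qed
hence p: "0 < L a" "0 < L b" using a(1) b(1) by blast+
have h: "L (x, y) = norm y * L (x, y /\<^sub>R norm y)" "(x, y /\<^sub>R norm y) \<in> ?A" if "x \<in> C" "y ~= 0" for x y
 using homL[of x "norm y" "y /\<^sub>R norm y"] that C by auto
show ?thesis
proof (rule that[OF p])
 show "L a * norm y <= L (x, y)" if "x \<in> C" for x y
  using h[OF that, of y] a(2) L_zero[of x] that C by (cases "y = 0") (auto simp: mult.commute)
 show "L (x, y) <= L b * norm y" if "x \<in> C" for x y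
  using h[OF that, of y] b(2) L_zero[of x] that C by (cases "y = 0") (auto simp: mult.commute)
qed
qed

section \<open>Absence of conjugate points and local inverses of the exponential map\<close>

context bounded_mfd
begin

definition ex where "ex c z = gz c z 1"

text \<open>Along a constant geodesic the connection and curvature terms vanish, so the Jacobi field
  is \<open>fst h + t *R snd h\<close>. Negative times are excluded because \<open>geo\<close> is
  controlled only on \<open>{0..}\<close>.\<close>

lemma ex_zero: assumes c: "c \<in> AM" and x: "xi \<in> cdom c"
shows "gz c (xi, 0) t = (if 0 <= t then ci c xi else gz c (xi, 0) t)"
 "jf c (xi, 0) h 1 c = fst h + snd h"
proof -
let ?z = "(xi, 0)"
have z: "?z \<in> WW c" using x by simp
note P = pt_vec[OF c z]
have v: "vec c ?z = tzero" by (rule tangent_eqI[OF P(3) tangent_tzero P(1)]) (use P(5) in "simp add: tzero_def")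
have g: "gz c ?z t = pt c ?z" "vz c ?z t = tzero" if "0 <= t" for t
 using geo_tzero[OF P(2) that] unfolding v by auto
show "gz c (xi, 0) t = (if 0 <= t then ci c xi else gz c (xi, 0) t)"
 using g(1)[of t] by (simp add: pt_def)
interpret C: cberwald "LM c" "cdom c" by (rule cberwald[OF c])
have j: "((%s. jf c ?z h s c) hvd kf c ?z h t c) (at t within {0..})"
 "((%s. kf c ?z h s c) hvd 0) (at t within {0..})" if t: "0 <= t" for t
 using jacobi[where h = h and ?c1.0 = c, OF c z t] P(1,4) linear_0[OF C.Gx_lin(1)] linear_0[OF C.Rm_lin(1)[OF x]]
 by (simp_all add: tzero_def g[OF t])
have k: "kf c ?z h t c = snd h" if "0 <= t" for t
 using has_vector_derivative_zero_constant[of "{0..}" "%s. kf c ?z h s c"] j(2) jacobi_init(2)[OF c z, of h] C.Gx_lin[of xi] that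
 by (metis (no_types, lifting) add.right_neutral atLeast_iff convex_real_interval(1) fst_conv linear_0 order_refl snd_conv)
have "((%s. jf c ?z h s c - s *R snd h) hvd 0) (at t within {0..})" if "0 <= t" for t
 using j(1)[OF that] k[OF that] by (auto intro!: derivative_eq_intros)
hence "jf c ?z h 1 c - 1 *R snd h = jf c ?z h 0 c - 0 *R snd h"
 using has_vector_derivative_zero_constant[of "{0..}" "%s. jf c ?z h s c - s *R snd h"]
 by (metis (no_types, lifting) atLeast_iff convex_real_interval(1) order_refl zero_le_one)
thus "jf c ?z h 1 c = fst h + snd h" using jacobi_init(1)[OF c z, of h] by (simp add: algebra_simps)
qed

text \<open>For a Jacobi field vanishing at both ends the Jacobi estimate bounds the initial
  derivative by 0. At the zero vector the field is explicit.\<close>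

lemma nonconj:
assumes c: "c \<in> AM" and z: "z \<in> WW c" and c1: "c1 \<in> Ch (ex c z)"
 and k: "\<bar>kb\<bar> * (LM c z)^2 <= 1/4" and J: "jf c z (0, b) 1 c1 = 0"
shows "b = 0"
proof (cases "snd z = 0")
case True
then obtain xi where x: "z = (xi, 0)" "xi \<in> cdom c" using z by (metis mem_Sigma_iff prod.collapse)
have "c \<in> Ch (gz c z 1)" unfolding x(1) using ex_zero(1)[OF c x(2), of 1] charts_at_inv[OF c x(2)] by simp
hence "Dt c1 c (ex c z) (jf c z (0, b) 1 c1) = b"
 using fd_fl_change(1)[OF c z zero_le_one c1[unfolded ex_def], of c "(0, b)"] ex_zero(2)[OF c x(2), of "(0, b)"] x by (simp add: ex_def)
moreover have "c \<in> Ch (ex c z)" unfolding x(1) ex_def using ex_zero(1)[OF c x(2), of 1] charts_at_inv[OF c x(2)] by simp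
ultimately show ?thesis unfolding J using linear_0[OF Dt_linear[OF c1]] by metis
next
case False
interpret C: cmetric "LM c" "cdom c" by (rule cmetric[OF c])
interpret B: cberwald "LM c" "cdom c" by (rule cberwald[OF c])
have zS: "(fst z, snd z) \<in> C.S" using z False by auto
have "sqrt (GG c (fst z, snd z) b b) <= 0"
 using gauss_chart(3)[where h = "(0, b)" and ka = "1/4" and s = 1, OF c z False _ c1[unfolded ex_def] J] k
  linear_0[OF C.lin_G(1)[OF zS]] linear_0[OF B.Gx_lin(2)] by simp
thus ?thesis using C.G_pos[OF zS, of b] by fastforce
qed

text \<open>Over a short time \<open>e\<close> the fibre derivative of the flow differs from
  \<open>e\<close> times the identity by at most \<open>e / 2\<close>, so the flow is injective in
  the velocity; rescaling velocities by \<open>1 / e\<close> turns time \<open>e\<close> into time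
  1. All constants are uniform in the foot point.\<close>

lemma local_inj:
assumes c: "c \<in> AM" and x0: "xi\<^sub>0 \<in> cdom c"
obtains r ep where "0 < r" "0 < ep" "cball xi\<^sub>0 r <= cdom c"
 "!!xi et et'. xi \<in> cball xi\<^sub>0 r ==> norm et < ep ==> norm et' < ep ==> ex c (xi, et) = ex c (xi, et') ==> et = et'"
proof -
let ?z0 = "(xi\<^sub>0, 0 :: real ^ 'n)"
have z0: "?z0 \<in> WW c" using x0 by simp
obtain r0 where r0: "0 < r0" "cball ?z0 r0 <= WW c" using open_contains_cball[of "WW c"] open_W[OF c] z0 by blast
obtain K where K: "K > 0" "!!z v. z \<in> cball ?z0 r0 ==> norm (fd (fld c) z v) <= K * norm v"
 using fd_bounded_on_compact[OF fld_Ck[OF c] compact_cball r0(2)] by blast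
have b0: "?z0 \<in> ball ?z0 r0" using r0 by simp
have bW: "ball ?z0 r0 <= WW c" using r0(2) ball_subset_cball by blast
obtain r d D where fb: "fbox c (ball ?z0 r0) ?z0 r d D"
 using box_in[OF c open_ball bW b0] by blast
note r = fboxD(1-3)[OF fb] and In = fboxD(4)[OF fb] and D = fboxD(5-7)[OF fb]
\<comment> \<open>With \<open>K * e <= 1/4\<close> a variation stays below \<open>2 * norm h\<close>
  and hence moves by at most \<open>norm h / 2\<close> from its initial value.\<close>
define e where "e = min d (1 / (4 * K))"
have e: "0 < e" "e <= d" "K * e <= 1/4" using r K by (auto simp: e_def min_def field_simps)
have V: "((%t. D t z h) hvd fd (fld c) (fl c c t z) (D t z h)) (at t within {0..e})"
 if "z \<in> ball ?z0 r" "t \<in> {0..e}" for z t h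
 by (rule hvd_sub[OF D(3)[OF that(1)]]) (use that e in auto)
have est: "norm (fst (D e z (0, h)) - e *R h) <= e / 2 * norm h" if z: "z \<in> ball ?z0 r" for z h
proof -
 let ?u = "%t. D t z (0, h)"
 have flb: "fl c c t z \<in> cball ?z0 r0" if "t \<in> {0..e}" for t using In[OF z, of t] that e by auto
 have nb: "norm (fd (fld c) (fl c c t z) (?u t)) <= K * norm (?u t) + 0" if "t \<in> {0..e}" for t using K(2)[OF flb[OF that]] by simp
 have h0: "norm (0 :: real ^ 'n, h) = norm h" by (simp add: norm_Pair)
 have u2: "norm (?u t) <= 2 * norm h" if "t \<in> {0..e}" for t
  using gronwall_short[OF V[OF z] nb _ _ _ that] e K D(2)[OF z] h0 by simp
 have u3: "norm (?u t - (0, h)) <= norm h / 2" if t: "t \<in> {0..e}" for t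
 proof -
  have nb2: "norm (fd (fld c) (fl c c t z) (?u t)) <= K * (2 * norm h)" if "t \<in> {0..e}" for t
   using order_trans[OF nb[OF that]] mult_left_mono[OF u2[OF that], of K] K(1) by simp
  have e0: "0 \<in> {0..e}" using e by simp
  have "norm (?u t - ?u 0) <= K * (2 * norm h) * \<bar>t - 0\<bar>" by (rule vector_derivative_bound[OF V[OF z] nb2 e0 t])
  also have "... <= K * (2 * norm h) * e" using t K by (intro mult_left_mono) auto
  also have "... = (K * e) * (2 * norm h)" by simp
  also have "... <= 1/4 * (2 * norm h)" by (rule mult_right_mono[OF e(3)]) simp
  finally show ?thesis using D(2)[OF z] by simp
 qed
 have w: "((%t. fst (?u t) - t *R h) hvd snd (?u t) - h) (at t within {0..e})" if t: "t \<in> {0..e}" for t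
 proof -
  have x: "fst (fl c c t z) \<in> cdom c" using subsetD[OF r0(2) flb[OF t]] by (simp add: mem_Times_iff)
  have "fst (fd (fld c) (fl c c t z) (?u t)) = snd (?u t)"
   using fld_fd[OF c x, of "snd (fl c c t z)" "fst (?u t)" "snd (?u t)"] by simp
  hence "((%t. fst (?u t)) hvd snd (?u t)) (at t within {0..e})"
   using bounded_linear.has_vector_derivative[OF bounded_linear_fst V[OF z t, of "(0, h)"]] by simp
  thus ?thesis by (auto intro!: derivative_eq_intros)
 qed
 have wb: "norm (snd (?u t) - h) <= norm h / 2" if "t \<in> {0..e}" for t
  using order_trans[OF norm_snd_le[of "snd (?u t) - h" "fst (?u t)"] _, of "norm h / 2"] u3[OF that] by (cases "?u t") auto
 have "norm ((fst (?u e) - e *R h) - (fst (?u 0) - 0 *R h)) <= norm h / 2 * \<bar>e - 0\<bar>"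
  by (rule vector_derivative_bound[OF w wb]) (use e in auto)
 thus ?thesis using D(2)[OF z] e by (simp add: mult.commute)
qed
have inj: "v = w" if b: "(xi, v) \<in> ball ?z0 r" "(xi, w) \<in> ball ?z0 r" and eq: "fst (fl c c e (xi, v)) = fst (fl c c e (xi, w))" for xi v w
proof -
 let ?A = "{v. (xi, v) \<in> ball ?z0 r}" and ?f = "%v. fst (fl c c e (xi, v)) - e *R v"
 have "?A = snd ` (ball ?z0 r Int ({xi} \<times> UNIV))" by force
 hence cv: "convex ?A" by (simp only:) (intro convex_linear_image convex_Int convex_ball convex_Times convex_UNIV convex_singleton linear_snd)
 have fD: "(?f hfd (%h. fst (D e (xi, v) (0, h)) - e *R h)) (at v within ?A)" if "v \<in> ?A" for v
 proof -
  have "(fl c c e hfd D e (xi, v)) (at (xi, v))" using D(1)[of "(xi, v)" e] that e by auto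
  hence "((%v. fl c c e (xi, v)) hfd (%h. D e (xi, v) (0, h))) (at v)"
   using has_derivative_compose[where f = "%v. (xi, v)" and g = "fl c c e", OF has_derivative_Pair[OF has_derivative_const has_derivative_ident]] by blast
  hence "(?f hfd (%h. fst (D e (xi, v) (0, h)) - e *R h)) (at v)"
   by (intro has_derivative_diff has_derivative_fst has_derivative_scaleR_right has_derivative_ident)
  thus ?thesis by (rule has_derivative_at_withinI)
 qed
 have "onorm (%h. fst (D e (xi, v) (0, h)) - e *R h) <= e / 2" if "v \<in> ?A" for v
  by (rule onorm_bound) (use est[of "(xi, v)"] that e in auto)
 from differentiable_bound[OF cv fD this, of v w] have "norm (?f v - ?f w) <= e / 2 * norm (v - w)" using b by (auto simp del: mem_ball)
 moreover have "?f v - ?f w = - (e *R (v - w))" using eq by (simp add: algebra_simps)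
 ultimately have "e * norm (v - w) <= e / 2 * norm (v - w)" using e by (simp only: norm_minus_cancel norm_scaleR abs_of_pos)
 thus ?thesis using e by simp
qed
show ?thesis
proof
 show "0 < r / 4" "0 < e * (r / 2)" using r e by auto
 have nP: "(xi, v) \<in> ball ?z0 r" if "xi \<in> cball xi\<^sub>0 (r/4)" "norm v < r / 2" for xi v
  using norm_Pair_le[of "xi\<^sub>0 - xi" "- v"] that r(1) by (simp add: dist_norm)
 show "cball xi\<^sub>0 (r / 4) <= cdom c" using nP[of _ 0] r(1,3) bW by fastforce
 fix xi et et' assume a: "xi \<in> cball xi\<^sub>0 (r / 4)" "norm et < e * (r / 2)" "norm et' < e * (r / 2)" "ex c (xi, et) = ex c (xi, et')"
 have b: "(xi, (1/e) *R et) \<in> ball ?z0 r" if "norm et < e * (r / 2)" for et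
  by (rule nP[OF a(1)]) (use that e in "simp add: field_simps")
 have x: "snd c (ex c (xi, et)) = fst (fl c c e (xi, (1/e) *R et))" if h: "norm et < e * (r / 2)" for et
 proof -
  have z: "(xi, (1/e) *R et) \<in> WW c" using b[OF h] r(3) bW by blast
  note P = pt_vec[OF c z]
  have p: "pt c (xi, et) = pt c (xi, (1/e) *R et)" by (simp add: pt_def)
  have "vec c (xi, et) = tscale e (vec c (xi, (1/e) *R et))"
   unfolding vec_def p using coord_tvec_tscale[OF P(1), of e "(1/e) *R et"] e by simp
  thus ?thesis unfolding ex_def fl_def p using geo_scale(1)[OF P(3,2), of e 1] e by simp
 qed
 show "et = et'" using inj[OF b[OF a(2)] b[OF a(3)]] x[OF a(2)] x[OF a(3)] a(4) e by simp
qed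
qed

text \<open>A domain for the exponential map, jointly in foot point and vector, on which the
  curvature condition excludes conjugate points; \<open>g xi\<close> is a left inverse on the fibre
  over \<open>xi\<close>.\<close>

definition nb where "nb Z c g \<longleftrightarrow> c \<in> AM & open Z & Z <= WW c &
(ALL z:Z. \<bar>kb\<bar> * (LM c z)^2 <= 1/4 & g (fst z) (ex c z) = snd z)"

text \<open>\<open>D\<close> is the derivative of the inverse with respect to foot point and end
  point: the Jacobi field with displacement \<open>X\<close> and fibre component
  \<open>D (X, Y)\<close> ends in \<open>Y\<close>.\<close>

definition "nbinv Z c g x w q c1 D e \<longleftrightarrow> ((%z. g (fst z) (ci c1 (snd z))) hfd D) (at (x, snd c1 q)) &
 (ALL X Y. jf c (x, w) (X, D (X, Y)) 1 c1 = Y) & 0 < e & (ALL xi ze. (xi, ze) \<in> ball (x, snd c1 q) e -->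
  ze \<in> cdom c1 & (xi, g xi (ci c1 ze)) \<in> Z & ex c (xi, g xi (ci c1 ze)) = ci c1 ze)"

lemma nbinvD:
assumes "nbinv Z c g x w q c1 D e"
shows "((%z. g (fst z) (ci c1 (snd z))) hfd D) (at (x, snd c1 q))" "jf c (x, w) (X, D (X, Y)) 1 c1 = Y" "0 < e"
 "(xi, ze) \<in> ball (x, snd c1 q) e ==>
  ze \<in> cdom c1 & (xi, g xi (ci c1 ze)) \<in> Z & ex c (xi, g xi (ci c1 ze)) = ci c1 ze"
using assms unfolding nbinv_def by blast+

text \<open>The map \<open>Th\<close> keeps the foot point, so its derivative is injective when
  there are no conjugate points, while \<open>g\<close> makes \<open>Th\<close> itself injective.
  Invariance of domain makes the image open, which yields a whole ball of foot points and end points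
  for the inverse.\<close>

lemma nb_inverse:
assumes nb: "nb Z c g" and w: "(xi\<^sub>0, w) \<in> Z" "ex c (xi\<^sub>0, w) = q" and c1: "c1 \<in> Ch q"
shows "EX D e. nbinv Z c g xi\<^sub>0 w q c1 D e"
proof -
define z0 where "z0 = (xi\<^sub>0, w)"
have z0: "z0 \<in> Z" and c1: "c1 \<in> Ch (ex c z0)" and eq: "fst z0 = xi\<^sub>0" "ex c z0 = q"
 using w c1 by (simp_all add: z0_def)
have c: "c \<in> AM" and Z: "open Z" "Z <= WW c" and g: "!!z. z \<in> Z ==> g (fst z) (ex c z) = snd z"
 and k: "!!z. z \<in> Z ==> \<bar>kb\<bar> * (LM c z)^2 <= 1/4" using nb by (auto simp: nb_def)
have zW: "z0 \<in> WW c" using z0 Z by auto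
obtain N where N: "open N" "z0 \<in> N" "N <= WW c" "!!z. z \<in> N ==> c1 \<in> Ch (ex c z)" "!!z. z \<in> N ==> fl c c1 1 differentiable (at z)"
 using fl_regular[OF c zW zero_le_one c1[unfolded ex_def]] unfolding regc_def ex_def by metis
define Th where "Th z = (fst z, fst (fl c c1 1 z))" for z
define G where "G z = (fst z, g (fst z) (ci c1 (snd z)))" for z
have ft: "fst (fl c c1 1 z) = snd c1 (ex c z)" for z by (simp add: fl_def ex_def)
have inv: "ci c1 (snd c1 (ex c z)) = ex c z" if "z \<in> N" for z using chart_inv(1) chD[OF N(4)[OF that]] by blast
have GT: "G (Th z) = z" if "z \<in> N Int Z" for z
 using g[of z] inv[of z] that by (simp add: G_def Th_def ft)
have TD: "(Th hfd (%h. (fst h, fst (fd (fl c c1 1) z h)))) (at z)" if "z \<in> N" for z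
 unfolding Th_def by (intro has_derivative_Pair has_derivative_fst has_derivative_ident fd_works N(5)[OF that])
have S: "open (N Int Z)" "z0 \<in> N Int Z" using N Z z0 by auto
have cT: "continuous_on (N Int Z) Th"
 by (rule continuous_on_subset[OF continuous_on_fl[of N]]) (use TD in "auto simp: differentiable_def")
let ?T = "%h. (fst h, jf c z0 h 1 c1)"
have TD0: "(Th hfd ?T) (at z0)" using TD[OF N(2)] by (simp add: jf_def)
have lT: "linear ?T" using TD0 by (rule has_derivative_linear)
have "h = 0" if "?T h = 0" for h
 using that nonconj[OF c zW c1 k[OF z0], of "snd h"] by (cases h) (auto simp: zero_prod_def)
hence "inj ?T" using linear_injective_0[OF lT] by blast
then obtain g' where g': "!!x. ?T (g' x) = x" using linear_injective_isomorphism[OF lT] by metis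
have GD: "(G hfd g') (at (Th z0))"
 by (rule has_derivative_inverse_strong[where f = Th and g = G and g' = g', OF S cT GT TD0]) (use g' in "simp_all add: fun_eq_iff")
have t0: "Th z0 = (xi\<^sub>0, snd c1 q)" by (simp add: Th_def ft eq)
have "inj_on Th (N Int Z)" by (rule inj_on_inverseI[where g = G, OF GT])
hence "open (Th ` (N Int Z))" using invariance_of_domain[OF cT S(1)] by blast
then obtain e where e: "0 < e" "ball (Th z0) e <= Th ` (N Int Z)" using S(2) open_contains_ball by (metis imageI)
have 1: "((%z. g (fst z) (ci c1 (snd z))) hfd (%h. snd (g' h))) (at (xi\<^sub>0, snd c1 q))"
  using has_derivative_snd[OF GD] unfolding t0 by (simp add: G_def)
have 2: "jf c (xi\<^sub>0, w) (X, snd (g' (X, Y))) 1 c1 = Y" for X Y using g'[of "(X, Y)"] unfolding z0_def by (metis Pair_inject prod.collapse)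
have "ze \<in> cdom c1 & (xi, g xi (ci c1 ze)) \<in> Z & ex c (xi, g xi (ci c1 ze)) = ci c1 ze"
 if b: "(xi, ze) \<in> ball (xi\<^sub>0, snd c1 q) e" for xi ze
proof -
 obtain z where z: "z \<in> N Int Z" "(xi, ze) = Th z" using e(2) b unfolding t0 by blast
 have "G (xi, ze) = z" unfolding z(2) by (rule GT[OF z(1)])
 hence "(xi, g xi (ci c1 ze)) = z" by (simp add: G_def)
 moreover have "ze = snd c1 (ex c z)" using z(2) by (simp add: Th_def ft)
 ultimately show ?thesis
  using z(1) inv N(4)[of z] in_cdom by auto
qed
with 1 2 e(1) show ?thesis unfolding nbinv_def by (intro exI[of _ "%h. snd (g' h)"] exI[of _ e]) blast
qed

end

section \<open>Normal balls\<close>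

context finsler_mfd
begin

lemma chart_curve_cont:
fixes I :: "real set"
assumes g: "cmap I ga" and t: "t \<in> I" and c: "c \<in> Ch (ga t)"
shows "continuous (at t within I) (%s. snd c (ga s))"
unfolding continuous_within_eps_delta
proof (intro allI impI)
fix e :: real assume e: "0 < e"
note a = chD(1)[OF c]
have "openin (subtopology (topo M) (fst c)) {x \<in> topspace (subtopology (topo M) (fst c)). snd c x \<in> ball (snd c (ga t)) e}"
 by (rule openin_continuous_map_preimage[OF chart_cont(1)[OF a]]) simp
hence "openin (topo M) {x \<in> topspace (subtopology (topo M) (fst c)). snd c x \<in> ball (snd c (ga t)) e}"
 using openin_trans_full chart_open(1)[OF a] by blast
moreover have "ga t \<in> {x \<in> topspace (subtopology (topo M) (fst c)). snd c x \<in> ball (snd c (ga t)) e}"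
 using chD(2,3)[OF c] e by simp
ultimately obtain d where "0 < d" "!!s. s \<in> I ==> \<bar>s - t\<bar> < d ==> snd c (ga s) \<in> ball (snd c (ga t)) e"
 using curve_near[OF g t] by (metis (no_types, lifting) mem_Collect_eq)
thus "EX d>0. ALL s:I. dist s t < d --> dist (snd c (ga s)) (snd c (ga t)) < e"
 by (auto simp: dist_real_def dist_commute)
qed

lemma HL_continuous: assumes "HL ga a b l" "a < b" shows "cmap {a..b} ga"
proof -
obtain S where S: "finite S" "!!a' b'. a <= a' ==> a' < b' ==> b' <= b ==> {a'<..<b'} Int S = {} ==> C1_curve M {a'..b'} ga"
 using assms unfolding HL_def pwc_def by blast
show ?thesis
proof (rule pieces_induct[where A = a and B = b and P = "%a b. cmap {a..b} ga", OF S(1)])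
 fix u c v :: real assume uv: "u < c" "c < v" and co: "cmap {u..c} ga" "cmap {c..v} ga"
 have "subtopology (top_of_set {u..v}) {x \<in> topspace (top_of_set {u..v}). x <= c} = top_of_set {u..c}"
  "subtopology (top_of_set {u..v}) {x \<in> topspace (top_of_set {u..v}). c <= x} = top_of_set {c..v}"
  using uv by (auto simp: subtopology_subtopology intro!: arg_cong[where f = top_of_set])
 thus "cmap {u..v} ga"
  using continuous_map_cases_le[of "top_of_set {u..v}" "%x. x" "%x. c" "topo M" ga ga] co by simp
qed (use S assms in "auto simp: C1_curve_def")
qed

end

context bounded_mfd
begin

lemma fnorm_vec: "c \<in> AM ==> z \<in> WW c ==> fnorm M (pt c z) (vec c z) = LM c z"
using fnorm_coord[OF pt_vec(1,3)] pt_vec(4,5) by simp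

context
fixes c Z g xi \<delta>
assumes nb: "nb Z c g" and xd: "xi \<in> cdom c" and ball: "!!et. LM c (xi, et) < \<delta> ==> (xi, et) \<in> Z"
begin

lemma nb_c: "c \<in> AM" using nb by (simp add: nb_def)

lemma nb_g: "LM c (xi, et) < \<delta> ==> g xi (ex c (xi, et)) = et"
using nb ball[of et] by (fastforce simp: nb_def)

definition "UU = {ex c (xi, et) | et. LM c (xi, et) < \<delta>}"

lemma UU: assumes "q \<in> UU" shows "(xi, g xi q) \<in> Z" "ex c (xi, g xi q) = q" "LM c (xi, g xi q) < \<delta>"
using assms nb_g ball unfolding UU_def by auto

text \<open>The local inverse with the foot point frozen: it is continuous in the end point and
  defined for all nearby end points.\<close>

lemma nb_near:
fixes I :: "real set"
assumes cont: "cmap I ga" and t: "t \<in> I" and q: "ga t \<in> UU"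
shows "continuous (at t within I) (%s. LM c (xi, g xi (ga s)))" "EX e>0. ALL s:I. \<bar>s - t\<bar> < e --> ga s \<in> UU"
proof -
interpret C: cmetric "LM c" "cdom c" by (rule cmetric[OF nb_c])
note u = UU[OF q]
have "ga t \<in> PM" using curve_points[OF cont t] .
then obtain c1 where c1: "c1 \<in> Ch (ga t)" using cover by blast
obtain D e where iv: "nbinv Z c g xi (g xi (ga t)) (ga t) c1 D e" using nb_inverse[OF nb u(1,2) c1] by blast
note D = nbinvD(1)[OF iv] and e = nbinvD(3,4)[OF iv]
obtain e1 where e1: "0 < e1" "!!s. s \<in> I ==> \<bar>s - t\<bar> < e1 ==> c1 \<in> Ch (ga s)" using near_chart[OF cont t c1] by blast
have inv: "ci c1 (snd c1 (ga s)) = ga s" if "s \<in> I" "\<bar>s - t\<bar> < e1" for s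
 using chart_inv(1) chD[OF e1(2)[OF that]] by blast
note cc = chart_curve_cont[OF cont t c1]
have cg: "continuous (at t within I) (%s. g xi (ci c1 (snd c1 (ga s))))"
 using continuous_within_compose3[OF has_derivative_continuous[OF D] continuous_Pair[OF continuous_const cc]] by simp
have "continuous (at t within I) (%s. LM c (xi, g xi (ci c1 (snd c1 (ga s)))))"
proof (rule continuous_within_compose3[OF _ continuous_Pair[OF continuous_const cg]])
 show "isCont (LM c) (xi, g xi (ci c1 (snd c1 (ga t))))"
  by (rule continuous_on_interior[OF C.L_continuous]) (use xd in "simp add: interior_open[OF open_W[OF nb_c]]")
qed
thus h: "continuous (at t within I) (%s. LM c (xi, g xi (ga s)))"
 by (rule continuous_transform_within[OF _ e1(1) t]) (use inv in "auto simp: dist_real_def")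
obtain e2 where e2: "0 < e2" "!!s. s \<in> I ==> \<bar>s - t\<bar> < e2 ==> LM c (xi, g xi (ga s)) < \<delta>"
 using h[unfolded continuous_within_eps_delta, rule_format, of "\<delta> - LM c (xi, g xi (ga t))"] u(3)
 by (fastforce simp: dist_real_def)
obtain e3 where e3: "0 < e3" "!!s. s \<in> I ==> \<bar>s - t\<bar> < e3 ==> dist (snd c1 (ga s)) (snd c1 (ga t)) < e"
 using cc[unfolded continuous_within_eps_delta, rule_format, OF e(1)] by (auto simp: dist_real_def)
have "ga s \<in> UU" if s: "s \<in> I" "\<bar>s - t\<bar> < min e1 (min e2 e3)" for s
proof -
 have "ex c (xi, g xi (ga s)) = ga s"
  using e(2)[of xi "snd c1 (ga s)"] e3(2)[of s] inv[of s] s by (auto simp: dist_Pair_Pair dist_commute)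
 thus ?thesis unfolding UU_def using e2(2)[of s] s by force
qed
thus "EX e>0. ALL s:I. \<bar>s - t\<bar> < e --> ga s \<in> UU" using e1(1) e2(1) e3(1) by (intro exI[of _ "min e1 (min e2 e3)"]) auto
qed

text \<open>First variation of the distance. The radial function is \<open>F\<close> of the inverse
  image, so its derivative is a pairing at the foot point, which the Gauss lemma transports to the
  end point.\<close>

lemma nb_dist_deriv:
fixes ga t
defines "w \<equiv> g xi (ga t)"
assumes cont: "cmap I ga" and t: "t \<in> I" and q: "ga t \<in> UU" and w0: "w ~= 0"
 and u: "u \<in> TM (ga t)" "!!c1. c1 \<in> Ch (ga t) ==> ((%s. snd c1 (ga s)) hvd u c1) (at t within I)"
shows "((%s. LM c (xi, g xi (ga s))) hvd
 ip (ga t) (vz c (xi, w) 1) (vz c (xi, w) 1) u / LM c (xi, w)) (at t within I)"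
proof -
interpret C: cberwald "LM c" "cdom c" by (rule cberwald[OF nb_c])
note U = UU[OF q, folded w_def]
let ?z = "(xi, w)"
have z: "?z \<in> WW c" "snd ?z ~= 0" using xd w0 by auto
have zS: "?z \<in> C.S" using z by simp
note P = pt_vec[OF nb_c z(1)]
let ?N = "vz c ?z 1"
have qe: "gz c ?z 1 = ga t" using U(2) by (simp add: ex_def)
have N: "?N \<in> TM (ga t)" "?N ~= tzero"
 using gvel_tangent[OF P(3,2), of 1] gvel_nonzero[OF P(3,2) _ , of 1] vec_nonzero[OF nb_c z] qe by auto
have "ga t \<in> PM" using curve_points[OF cont t] .
then obtain c1 where c1: "c1 \<in> Ch (ga t)" using cover by blast
obtain D e where iv: "nbinv Z c g xi w (ga t) c1 D e" using nb_inverse[OF nb U(1,2) c1] by blast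
note D = nbinvD(1)[OF iv] and J = nbinvD(2)[OF iv]
obtain e1 where e1: "0 < e1" "!!s. s \<in> I ==> \<bar>s - t\<bar> < e1 ==> c1 \<in> Ch (ga s)" using near_chart[OF cont t c1] by blast
have inv: "ci c1 (snd c1 (ga s)) = ga s" if "s \<in> I" "\<bar>s - t\<bar> < e1" for s
 using chart_inv(1) chD[OF e1(2)[OF that]] by blast
have "((%s. (xi, snd c1 (ga s))) hvd (0, u c1)) (at t within I)"
 by (rule pair_vd[OF has_vector_derivative_const u(2)[OF c1]])
from has_vd_compose[OF this D]
have "((%s. g xi (ci c1 (snd c1 (ga s)))) hvd D (0, u c1)) (at t within I)" by simp
hence wd: "((%s. g xi (ga s)) hvd D (0, u c1)) (at t within I)"
 by (rule has_vd_near[OF _ t e1(1)]) (use inv in auto)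
have G: "GG c ?z w (D (0, u c1)) = ip (ga t) ?N ?N u"
 using gauss_chart(1)[where s = 1 and h = "(0, D (0, u c1))", OF nb_c z _ c1[folded qe]] J[of 0 "u c1"] ip_chart[OF N N(1) u(1) c1]
  linear_0[OF C.lin_G(1)[OF zS]] linear_0[OF C.Gx_lin(2)] qe by simp
show ?thesis
 using has_vd_compose[OF wd C.L_has_derivative[OF zS[unfolded w_def]]] G by (simp add: w_def)
qed

text \<open>The fundamental inequality bounds the first variation by the speed; the strict case is
  what later allows a corner to be cut.\<close>

lemma nb_dist_deriv_le:
fixes ga t
defines "z \<equiv> (xi, g xi (ga t))"
assumes q: "ga t \<in> UU" and w0: "snd z ~= 0" and u: "u \<in> TM (ga t)"
shows "ip (ga t) (vz c z 1) (vz c z 1) u / LM c z <= fnorm M (ga t) u"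
 "fnorm M (ga t) u = LM c z ==> u ~= vz c z 1 ==>
  ip (ga t) (vz c z 1) (vz c z 1) u / LM c z < LM c z"
proof -
interpret C: cmetric "LM c" "cdom c" by (rule cmetric[OF nb_c])
have z: "z \<in> WW c" using xd by (auto simp: z_def)
note P = pt_vec[OF nb_c z]
let ?N = "vz c z 1"
have qe: "gz c z 1 = ga t" using UU(2)[OF q] by (simp add: ex_def z_def)
have N: "?N \<in> TM (ga t)" "?N ~= tzero"
 using gvel_tangent[OF P(3,2), of 1] gvel_nonzero[OF P(3,2) _ , of 1] vec_nonzero[OF nb_c z w0] qe by auto
have pM: "ga t \<in> PM" using geo_points[OF P(3,2), of 1] qe by simp
have e: "fnorm M (ga t) ?N = LM c z" using fnorm_gvel[OF P(3,2), of 1 1] fnorm_vec[OF nb_c z] qe by (simp add: tscale_one)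
have p: "0 < LM c z" using C.L_pos[of "fst z" "snd z"] w0 z by auto
note F = ip_fundamental[OF pM N u, unfolded e]
show "ip (ga t) ?N ?N u / LM c z <= fnorm M (ga t) u" using F(1) p by (simp add: field_simps)
show "ip (ga t) ?N ?N u / LM c z < LM c z" if "fnorm M (ga t) u = LM c z" "u ~= ?N"
 using F(2)[OF that] p by (simp add: field_simps power2_eq_square)
qed

lemma nb_compact: assumes "l < \<delta>" shows "compactin (topo M) {ex c (xi, et) | et. LM c (xi, et) <= l}"
proof -
interpret C: cmetric "LM c" "cdom c" by (rule cmetric[OF nb_c])
obtain m where m: "0 < m" "!!y. m * norm y <= LM c (xi, y)"
proof (rule C.L_norm_equiv[of "{xi}"])
qed (use xd in auto)
let ?K = "{et. LM c (xi, et) <= l}"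
have cL: "continuous_on UNIV (%et. LM c (xi, et))"
 by (rule continuous_on_compose2[OF C.L_continuous continuous_on_Pair[OF continuous_on_const continuous_on_id]]) (use xd in auto)
have "closed ?K" using continuous_closed_vimage[of "{..l}" "%et. LM c (xi, et)"] cL by (auto simp: vimage_def continuous_on_eq_continuous_at)
moreover have "?K <= cball 0 (l / m)" using m(1) order_trans[OF m(2)] by (auto simp: field_simps)
ultimately have K: "compact ?K" using compact_eq_bounded_closed bounded_subset[OF bounded_cball] by blast
have "cmap ?K (%et. ex c (xi, et))"
 unfolding continuous_map_atin limitin_atin
proof (intro ballI conjI allI impI)
 fix et assume e: "et \<in> topspace (top_of_set ?K)"
 have z: "(xi, et) \<in> WW c" using xd by simp
 note P = pt_vec[OF nb_c z]
 show pM: "ex c (xi, et) \<in> PM" unfolding ex_def by (rule geo_points[OF P(3,2)]) simp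
 fix V assume "et \<in> topspace (top_of_set ?K)" and V: "openin (topo M) V & ex c (xi, et) \<in> V"
 obtain c1 where c1: "c1 \<in> Ch (ex c (xi, et))" using cover pM by blast
 note a1 = chD(1)[OF c1]
 obtain N where N: "open N" "(xi, et) \<in> N" "!!z. z \<in> N ==> c1 \<in> Ch (ex c z)" "!!z. z \<in> N ==> fl c c1 1 differentiable (at z)"
  using fl_regular[OF nb_c z zero_le_one c1[unfolded ex_def]] unfolding regc_def ex_def by metis
 have inv: "ci c1 (snd c1 (ex c z)) = ex c z" if "z \<in> N" for z using chart_inv(1) chD[OF N(3)[OF that]] by blast
 have "openin (top_of_set (cdom c1)) {x \<in> topspace (top_of_set (cdom c1)). ci c1 x \<in> V}"
  using openin_continuous_map_preimage[OF chart_cont(2)[OF a1]] V by blast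
 hence oV: "open {x \<in> cdom c1. ci c1 x \<in> V}" using chart_open(2)[OF a1] by (simp add: openin_open_eq)
 have "continuous_on N (%z. fst (fl c c1 1 z))" by (intro continuous_on_fst continuous_on_fl N(4))
 hence "open (N Int (%z. fst (fl c c1 1 z)) -` {x \<in> cdom c1. ci c1 x \<in> V})"
  using continuous_open_preimage[OF _ N(1) oV] by blast
 moreover have "(xi, et) \<in> N Int (%z. fst (fl c c1 1 z)) -` {x \<in> cdom c1. ci c1 x \<in> V}"
  using N(2) V inv in_cdom[OF c1] by (simp add: fl_def ex_def)
 ultimately obtain A B where AB: "open A" "open B" "xi \<in> A" "et \<in> B" "A \<times> B <= N Int (%z. fst (fl c c1 1 z)) -` {x \<in> cdom c1. ci c1 x \<in> V}"
  by (rule open_prod_elim) auto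
 have "ex c (xi, et') \<in> V" if "et' \<in> B" for et'
  using subsetD[OF AB(5), of "(xi, et')"] AB(3) that inv[of "(xi, et')"] by (auto simp: fl_def ex_def)
 thus "EX U. openin (top_of_set ?K) U & et \<in> U & (%et. ex c (xi, et)) ` (U - {et}) <= V"
  using AB(2,4) e by (intro exI[of _ "?K Int B"]) (auto simp: openin_open)
qed
hence "compactin (topo M) ((%et. ex c (xi, et)) ` ?K)"
 by (rule image_compactin[rotated]) (use K in "simp add: compactin_subtopology")
thus ?thesis by (simp add: setcompr_eq_image)
qed

text \<open>The radial function grows at most with the arc length, so real induction keeps the curve
  in the compact ball of radius \<open>l\<close> and it never reaches the edge of the region where
  the radial function is defined.\<close>

lemma nb_curve:
assumes H: "HL ga 0 1 l" and g0: "ga 0 = ci c xi" and l: "l < \<delta>"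
shows "EX et. LM c (xi, et) <= l & ga 1 = ex c (xi, et)"
proof -
interpret C: cmetric "LM c" "cdom c" by (rule cmetric[OF nb_c])
let ?B = "{ex c (xi, et) | et. LM c (xi, et) <= l}" and ?h = "%s. LM c (xi, g xi (ga s))"
have BU: "?B <= UU" using l unfolding UU_def by force
have l0: "0 <= l" by (rule HL_nonneg[OF H])
note cont = HL_continuous[OF H zero_less_one]
have e0: "ex c (xi, 0) = ga 0" using ex_zero(1)[OF nb_c xd, of 1] g0 by (simp add: ex_def)
have h0: "LM c (xi, 0) = 0" by (rule C.L_zero[OF xd])
have gg0: "g xi (ga 0) = 0" using nb_g[of 0] l l0 e0 h0 by simp
have "ga 1 \<in> ?B"
proof (rule real_induct[where a = 0 and b = 1 and P = "%t. ga t \<in> ?B"])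
 show "ga 0 \<in> ?B" using e0 h0 l0 by (intro CollectI exI[of _ 0]) simp
next
 fix t :: real assume t: "0 <= t" "t < 1" and B: "!!s. 0 <= s ==> s <= t ==> ga s \<in> ?B"
 obtain e where e: "0 < e" "!!s. s \<in> {0..1} ==> \<bar>s - t\<bar> < e ==> ga s \<in> UU"
  using nb_near(2)[OF cont, of t] subsetD[OF BU B[OF t(1) order_refl]] t by (meson atLeastAtMost_iff less_imp_le)
 show "EX e>0. ALL s. t < s & s <= t + e & s <= 1 --> ga s \<in> ?B"
 proof (intro exI[of _ "e/2"] conjI allI impI)
  fix s assume s: "t < s & s <= t + e / 2 & s <= 1"
  have U: "ga r \<in> UU" if "r \<in> {0..s}" for r
   using B[of r] BU e(2)[of r] e(1) s t that by (cases "r <= t") auto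
  have ch: "continuous_on {0..s} ?h"
  proof (rule continuous_on_subset[of "{0..s} Int {0..1}"])
   show "continuous_on ({0..s} Int {0..1}) ?h"
    unfolding continuous_on_eq_continuous_within using nb_near(1)[OF cont] U continuous_within_subset by (metis IntD1 IntD2 inf_le2)
  qed (use s in auto)
  have "?h s <= l"
  proof (cases "?h s <= 0")
   case False
   \<comment> \<open>Its maximum \<open>r\<close> is the last parameter at which the curve is at the
     centre. The radial function need not be differentiable there, so the comparison with the length
     starts at \<open>r\<close>.\<close>
   let ?A = "{0..s} Int ?h -` {..0}"
   have "compact ?A" using continuous_closed_preimage[OF ch closed_atLeastAtMost closed_atMost] bounded_subset[OF bounded_closed_interval]
    by (auto simp: compact_eq_bounded_closed)
   moreover have "0 \<in> ?A" using gg0 h0 s t by simp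
   ultimately obtain r where r: "r \<in> ?A" "!!r'. r' \<in> ?A ==> r' <= r" using compact_attains_sup[of ?A] by blast
   have rs: "0 <= r" "r < s" "s <= 1" using r(1) False s by (auto simp: less_le)
   have "?h s - ?h r <= l"
   proof (rule HL_lower_bound[OF H rs continuous_on_subset[OF ch]])
    fix x assume x: "r < x" "x < s" and v: "vel ga x \<in> TM (ga x)"
     and d: "!!c. c \<in> Ch (ga x) ==> ((snd c o ga) hvd vel ga x c) (at x)"
    have xU: "ga x \<in> UU" and w0: "g xi (ga x) ~= 0" using U[of x] r(2)[of x] x rs h0 by fastforce+
    have x1: "x \<in> {0..1}" using x rs by simp
    have i: "at x within {0..1} = at x" by (rule at_within_interior) (use x rs in simp)
    have "!!c1. c1 \<in> Ch (ga x) ==> ((%s. snd c1 (ga s)) hvd vel ga x c1) (at x within {0..1})"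
     unfolding i using d by (simp add: o_def)
    from nb_dist_deriv[OF cont x1 xU w0 v this] nb_dist_deriv_le(1)[where ga = ga and t = x, OF xU _ v] w0
    show "EX h'. (?h hrd h') (at x) & h' <= spd ga x"
     unfolding i by (auto simp: spd_def has_real_derivative_iff_has_vector_derivative)
   qed (use rs in auto)
   moreover have "?h r = 0" using r(1) C.nonnegL[OF xd] by (force intro: antisym)
   ultimately show ?thesis by simp
  qed (use l0 in simp)
  thus "ga s \<in> ?B" using UU(2)[OF U[of s]] s t by force
 qed (use e in simp)
next
 fix t :: real assume t: "0 < t" "t <= 1" and B: "!!s. 0 <= s ==> s < t ==> ga s \<in> ?B"
 show "ga t \<in> ?B"
 proof (rule ccontr)
  assume "ga t \<notin> ?B"
  hence V: "ga t \<in> PM - ?B" using curve_points[OF cont, of t] t by simp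
  have "openin (topo M) (PM - ?B)" using compactin_imp_closedin[OF haus nb_compact[OF l]] by (simp add: closedin_def)
  from curve_near[OF cont _ this V] obtain e where e: "0 < e" "!!s. s \<in> {0..1} ==> \<bar>s - t\<bar> < e ==> ga s \<in> PM - ?B"
   using t by auto
  have "0 <= max 0 (t - e/2)" "max 0 (t - e/2) < t" "\<bar>max 0 (t - e/2) - t\<bar> < e" using e(1) t by (auto simp: max_def)
  with e(2)[of "max 0 (t - e/2)"] B[of "max 0 (t - e/2)"] t show False by auto
 qed
qed simp_all
thus ?thesis by blast
qed

lemma nb_dist:
assumes "LM c (xi, et) < \<delta>" shows "dst (ci c xi) (ex c (xi, et)) = LM c (xi, et)"
proof -
let ?z = "(xi, et)"
have z: "?z \<in> WW c" using xd by simp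
note P = pt_vec[OF nb_c z]
have H: "HL (gz c ?z) 0 1 (LM c ?z)" using geo_HL[OF P(3,2)] fnorm_vec[OF nb_c z] by simp
have e: "gz c ?z 0 = ci c xi" using geo(2)[OF P(3,2)] by (simp add: pt_def)
show ?thesis
proof (rule antisym)
 show "dst (ci c xi) (ex c ?z) <= LM c ?z" by (rule fdist_le[OF H e]) (simp add: ex_def)
 show "LM c ?z <= dst (ci c xi) (ex c ?z)"
 proof (rule fdist_ge)
  show "Dset (ci c xi) (ex c ?z) ~= {}" using H e unfolding Dset_def ex_def by blast
  fix ga l assume h: "HL ga 0 1 l" "ga 0 = ci c xi" "ga 1 = ex c ?z"
  show "LM c ?z <= l"
  proof (rule ccontr)
   assume "\<not> LM c ?z <= l"
   hence l: "l < \<delta>" "l < LM c ?z" using assms by auto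
   obtain et' where "LM c (xi, et') <= l" "ex c (xi, et') = ex c ?z" using nb_curve[OF h(1,2) l(1)] h(3) by metis
   thus False using nb_g[OF assms] nb_g[of et'] l by auto
  qed
 qed
qed
qed

lemma nb_dist_inv:
assumes "Dset (ci c xi) q ~= {}" "dst (ci c xi) q < \<delta>"
shows "EX et. LM c (xi, et) = dst (ci c xi) q & q = ex c (xi, et)"
proof -
obtain ga l where h: "HL ga 0 1 l" "ga 0 = ci c xi" "ga 1 = q" "l < \<delta>" using fdist_lessD[OF assms(2,1)] by blast
obtain et where "LM c (xi, et) <= l" "q = ex c (xi, et)" using nb_curve[OF h(1,2,4)] h(3) by metis
thus ?thesis using nb_dist[of et] h(4) by force
qed

end

end

section \<open>Distance and injectivity radius\<close>

context finsler_mfd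
begin

lemma chart_ball_open:
assumes "c \<in> AM" "open B"
shows "openin (topo M) {x \<in> fst c. snd c x \<in> B}"
proof -
have "openin (subtopology (topo M) (fst c)) {x \<in> topspace (subtopology (topo M) (fst c)). snd c x \<in> B}"
 by (rule openin_continuous_map_preimage[OF chart_cont(1)[OF assms(1)]]) (use assms in simp)
moreover have "topspace (subtopology (topo M) (fst c)) = fst c" using chart_sub[OF assms(1)] by auto
ultimately show ?thesis using openin_trans_full chart_open(1)[OF assms(1)] by fastforce
qed

end

context bounded_mfd
begin

lemma nb_exists:
assumes c: "c \<in> AM" and x0: "xi\<^sub>0 \<in> cdom c"
obtains r \<delta> Z g where "0 < r" "0 < \<delta>" "nb Z c g" "ball xi\<^sub>0 r <= cdom c"
 "!!xi et. xi \<in> ball xi\<^sub>0 r ==> LM c (xi, et) < \<delta> ==> (xi, et) \<in> Z"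
proof -
interpret C: cmetric "LM c" "cdom c" by (rule cmetric[OF c])
obtain r ep where r: "0 < r" "0 < ep" "cball xi\<^sub>0 r <= cdom c"
 and inj: "!!xi et et'. xi \<in> cball xi\<^sub>0 r ==> norm et < ep ==> norm et' < ep ==> ex c (xi, et) = ex c (xi, et') ==> et = et'"
 using local_inj[OF c x0] by blast
obtain m where m: "0 < m" "!!x y. x \<in> cball xi\<^sub>0 r ==> m * norm y <= LM c (x, y)"
 using C.L_norm_equiv[OF compact_cball r(3)] by metis
\<comment> \<open>The first entry turns a bound on \<open>F\<close> into one on the Euclidean norm,
  the second ensures \<open>|kb| * \<delta>^2 <= 1/4\<close>.\<close>
define \<delta> where "\<delta> = min (m * ep) (1 / (2 * (\<bar>kb\<bar> + 1)))"
have d: "0 < \<delta>" "\<delta> <= m * ep" "\<delta> <= 1 / (2 * (\<bar>kb\<bar> + 1))" using m r by (auto simp: \<delta>_def)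
have kd: "\<bar>kb\<bar> * u^2 <= 1/4" if "0 <= u" "u < \<delta>" for u
proof -
 have "u * (2 * (\<bar>kb\<bar> + 1)) <= 1" using mult_right_mono[of u \<delta> "2 * (\<bar>kb\<bar> + 1)"] that d(3) by (simp add: field_simps)
 hence "(u * (2 * (\<bar>kb\<bar> + 1)))^2 <= 1" using that power_le_one[of "u * (2 * (\<bar>kb\<bar> + 1))" 2] by simp
 hence "4 * (u^2 * (\<bar>kb\<bar> + 1)^2) <= 1" by (simp only: power_mult_distrib) simp
 moreover have "\<bar>kb\<bar> * u^2 <= u^2 * (\<bar>kb\<bar> + 1)^2"
  using mult_left_mono[of "\<bar>kb\<bar>" "(\<bar>kb\<bar> + 1)^2" "u^2"] by (simp add: power2_sum mult.commute)
 ultimately show ?thesis by simp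
qed
have bs: "ball xi\<^sub>0 r <= cdom c" using r(3) ball_subset_cball by blast
let ?Z = "(ball xi\<^sub>0 r \<times> UNIV) Int LM c -` {..<\<delta>}"
have oZ: "open ?Z"
 by (rule continuous_open_preimage[OF continuous_on_subset[OF C.L_continuous] open_Times[OF open_ball open_UNIV] open_lessThan]) (use bs in auto)
let ?g = "%xi q. SOME et. (xi, et) \<in> ?Z & ex c (xi, et) = q"
have "?g (fst z) (ex c z) = snd z" if z: "z \<in> ?Z" for z
proof -
 have s: "norm y < ep" if "(fst z, y) \<in> ?Z" for y
 proof -
  have "m * norm y < m * ep" using m(2)[of "fst z" y] that d(2) by auto
  thus ?thesis using m(1) by simp
 qed
 have "(fst z, snd z) \<in> ?Z & ex c (fst z, snd z) = ex c z" using z by simp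
 from someI[of "%et. (fst z, et) \<in> ?Z & ex c (fst z, et) = ex c z", OF this]
 show ?thesis using inj[of "fst z" "?g (fst z) (ex c z)" "snd z"] s s[of "snd z"] z by auto
qed
moreover have "\<bar>kb\<bar> * (LM c z)^2 <= 1/4" if "z \<in> ?Z" for z using kd[of "LM c z"] C.nonnegL[of "fst z" "snd z"] that bs by auto
moreover have "?Z <= WW c" using bs by auto
ultimately have "nb ?Z c ?g" using c oZ unfolding nb_def by blast
thus ?thesis using that[OF r(1) d(1) _ bs] by auto
qed

lemma geo_fdist:
assumes y: "y \<in> TM x" and x: "x \<in> PM"
shows "dst x (geo x y 1) <= fnorm M x y" "Dset x (geo x y 1) ~= {}"
 "dst (geo x y 1) x <= fnorm M x (tscale (- 1) y)" "Dset (geo x y 1) x ~= {}"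
proof -
note H = geo_HL[OF y x]
show "dst x (geo x y 1) <= fnorm M x y" by (rule fdist_le[OF H geo(2)[OF y x] refl])
show "Dset x (geo x y 1) ~= {}" using H geo(2)[OF y x] unfolding Dset_def by blast
let ?q = "geo x y 1" and ?N = "tscale (- 1) (gvel x y 1)"
have q: "?q \<in> PM" "?N \<in> TM ?q" using geo_points[OF y x] tangent_tscale[OF gvel_tangent[OF y x]] by auto
have H: "HL (geo ?q ?N) 0 1 (fnorm M x (tscale (- 1) y))"
 using geo_HL[OF q(2,1)] fnorm_gvel[OF y x, of 1 "-1"] by simp
have e: "geo ?q ?N 0 = ?q" "geo ?q ?N 1 = x" using geo(2)[OF q(2,1)] geo_reverse(1)[OF y x, of 1 1] geo(2)[OF y x] by auto
show "dst ?q x <= fnorm M x (tscale (- 1) y)" by (rule fdist_le[OF H e])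
show "Dset ?q x ~= {}" using H e unfolding Dset_def by blast
qed

text \<open>The points reachable from \<open>p\<close> and those not reachable form two open sets,
  as a point near \<open>q\<close> is joined to \<open>q\<close> in both directions by a geodesic
  and its reversal; connectedness does the rest.\<close>

lemma Dset_nonempty:
assumes p: "p \<in> PM" and q: "q \<in> PM" shows "Dset p q ~= {}"
proof -
have nbh: "EX V. openin (topo M) V & q \<in> V & (ALL x:V. Dset q x ~= {} & Dset x q ~= {})" if q: "q \<in> PM" for q
proof -
 obtain c where c: "c \<in> Ch q" using cover q by blast
 note a = chD(1)[OF c]
 let ?x = "snd c q"
 have x: "?x \<in> cdom c" by (rule in_cdom[OF c])
 obtain r \<delta> Z g where n: "0 < r" "0 < \<delta>" "nb Z c g" "!!xi et. xi \<in> ball ?x r ==> LM c (xi, et) < \<delta> ==> (xi, et) \<in> Z"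
  using nb_exists[OF a x] by metis
 interpret C: cmetric "LM c" "cdom c" by (rule cmetric[OF a])
 have z: "(?x, 0) \<in> Z" using n(1,2,4) C.L_zero[OF x] by simp
 have ci: "ci c ?x = q" using chart_inv(1)[OF a chD(2)[OF c]] .
 have q0: "ex c (?x, 0) = q" using ex_zero(1)[OF a x, of 1] ci by (simp add: ex_def)
 obtain D e where iv: "nbinv Z c g ?x 0 q c D e" using nb_inverse[OF n(3) z q0 c] by blast
 note e = nbinvD(3,4)[OF iv]
 have "Dset q x' ~= {} & Dset x' q ~= {}" if x': "x' \<in> fst c" "snd c x' \<in> ball ?x e" for x'
 proof -
  let ?z = "(?x, g ?x x')"
  have "ex c ?z = x'" using e(2)[of ?x "snd c x'"] x' chart_inv(1)[OF a x'(1)] by (simp add: dist_Pair_Pair)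
  moreover have "?z \<in> WW c" "pt c ?z = q" using x ci by (auto simp: pt_def)
  ultimately show ?thesis using geo_fdist(2,4)[OF pt_vec(3,2)[OF a]] unfolding ex_def by metis
 qed
 thus ?thesis using chart_ball_open[OF a open_ball, of ?x e] e(1) chD(2)[OF c]
  by (intro exI[of _ "{x \<in> fst c. snd c x \<in> ball ?x e}"]) auto
qed
let ?R = "{q \<in> PM. Dset p q ~= {}}" and ?R' = "{q \<in> PM. Dset p q = {}}"
have "openin (topo M) ?R"
proof (subst openin_subopen, intro ballI)
 fix q assume "q \<in> ?R"
 thus "EX T. openin (topo M) T & q \<in> T & T <= ?R"
  using nbh[of q] fdist_triangle(2)[of p q] openin_subset by (smt (verit) mem_Collect_eq subset_iff)
qed
moreover have "openin (topo M) ?R'"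
proof (subst openin_subopen, intro ballI)
 fix q assume "q \<in> ?R'"
 thus "EX T. openin (topo M) T & q \<in> T & T <= ?R'"
  using nbh[of q] fdist_triangle(2)[of p _ q] openin_subset by (smt (verit) mem_Collect_eq subset_iff)
qed
moreover have "p \<in> ?R" using geo_fdist(2)[OF tangent_tzero p] geo_tzero(1)[OF p] p by simp
moreover have "connected_space (topo M)" using mfd by (simp add: smooth_manifold_def)
ultimately have "?R' = {}" unfolding connected_space_def by blast
thus ?thesis using q by blast
qed

lemma fdist_tri: "p \<in> PM ==> q \<in> PM ==> r \<in> PM ==> dst p r <= dst p q + dst q r"
by (rule fdist_triangle(1)[OF Dset_nonempty Dset_nonempty])

lemma fdist_nonneg: "p \<in> PM ==> q \<in> PM ==> 0 <= dst p q"
by (rule fdist_ge[OF Dset_nonempty]) (use HL_nonneg in auto)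

lemma fdist_self: "p \<in> PM ==> dst p p = 0"
using geo_fdist(1)[OF tangent_tzero, of p] geo_tzero(1)[of p 1] fnorm_tzero fdist_nonneg by (simp add: antisym)

lemma geo_fdist_le:
assumes y: "y \<in> TM x" and x: "x \<in> PM" and st: "0 <= s" "s <= t"
shows "dst (geo x y s) (geo x y t) <= (t - s) * fnorm M x y"
proof -
let ?p = "geo x y s" and ?w = "tscale (t - s) (gvel x y s)"
have p: "?p \<in> PM" "gvel x y s \<in> TM ?p" using geo_points[OF y x] gvel_tangent[OF y x] st by auto
have "geo ?p ?w 1 = geo x y t" using geo_affine(1)[OF y x, of s 1 "t - s" 1] st by (simp add: add_nonneg_nonneg)
moreover have "fnorm M ?p ?w = (t - s) * fnorm M x y"
 using fnorm_gvel[OF y x st(1), of "t - s"] fnorm_tscale[OF x y, of "t - s"] st by simp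
ultimately show ?thesis using geo_fdist(1)[OF tangent_tscale[OF p(2)] p(1), of "t - s"] by simp
qed

text \<open>Minimality passes to shorter initial pieces by the triangle inequality. Hence, if it
  failed at length \<open>?l\<close>, the cut time \<open>T\<close> would be at most
  \<open>?l\<close>, and it is positive because of a normal ball; the cut point would lie at
  distance at most \<open>T <= ?l\<close>, against the injectivity radius.\<close>

lemma minimal_below_inj_radius:
assumes p: "p \<in> PM" and y: "y \<in> TM p" and i: "ereal (fnorm M p y) < inj_radius M"
shows "dst p (geo p y 1) = fnorm M p y"
proof (cases "y = tzero")
case True thus ?thesis using geo_tzero(1)[OF p] fdist_self[OF p] fnorm_tzero[OF p] by simp
next
case False
let ?l = "fnorm M p y"
have l: "0 < ?l" by (rule fnorm_pos[OF p y False])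
define u where "u = tscale (1 / ?l) y"
have u: "u \<in> TM p" "fnorm M p u = 1" using tangent_tscale[OF y] fnorm_tscale[OF p y] l by (auto simp: u_def)
have ex: "fexp M p (tscale t u) = geo p u t" if "0 <= t" for t
 using fexp_eq[OF tangent_tscale[OF u(1)] p] geo_scale(1)[OF u(1) p that, of 1] by simp
have gl: "geo p u ?l = geo p y 1" using geo_scale(1)[OF y p, of "1/?l" ?l] l by (simp add: u_def)
have le: "dst p (geo p u t) <= t" if "0 <= t" for t
 using geo_fdist_le[OF u(1) p order_refl that] geo(2)[OF u(1) p] u(2) by simp
have down: "dst p (geo p u s) = s" if st: "0 < s" "s <= t" "dst p (geo p u t) = t" for s t
proof -
 have "t <= dst p (geo p u s) + dst (geo p u s) (geo p u t)"
  using fdist_tri[OF p geo_points[OF u(1) p, of s] geo_points[OF u(1) p, of t]] st by simp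
 thus ?thesis using geo_fdist_le[OF u(1) p, of s t] le[of s] st u(2) by simp
qed
let ?S = "{ereal t | t. 0 < t & dst p (fexp M p (tscale t u)) = t}"
have S: "ereal t \<in> ?S \<longleftrightarrow> 0 < t & dst p (geo p u t) = t" for t using ex[of t] by (cases "0 < t") auto
obtain t0 where t0: "0 < t0" "dst p (geo p u t0) = t0"
proof -
 obtain c where c: "c \<in> Ch p" using cover p by blast
 note a = chD(1)[OF c]
 obtain r \<delta> Z g where n: "0 < r" "0 < \<delta>" "nb Z c g" "!!xi et. xi \<in> ball (snd c p) r ==> LM c (xi, et) < \<delta> ==> (xi, et) \<in> Z"
  using nb_exists[OF a in_cdom[OF c]] by metis
 let ?w = "tscale (\<delta>/2) u"
 have w: "?w \<in> TM p" by (rule tangent_tscale[OF u(1)])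
 have "LM c (snd c p, ?w c) = \<delta> / 2" using fnorm_coord[OF c w] fnorm_tscale[OF p u(1), of "\<delta>/2"] u(2) n(2) by simp
 hence "dst p (geo p u (\<delta>/2)) = \<delta>/2"
  using nb_dist[OF n(3) in_cdom[OF c] n(4), of \<delta> "?w c"] n(1,2) chart_inv(1)[OF a chD(2)[OF c]]
   pt_vec_coord[OF c w] geo_scale(1)[OF u(1) p, of "\<delta>/2" 1] by (simp add: ex_def)
 thus ?thesis using that[of "\<delta>/2"] n(2) by simp
qed
have "dst p (geo p u ?l) = ?l"
proof (rule ccontr)
 assume n: "dst p (geo p u ?l) ~= ?l"
 have "e <= ereal ?l" if "e \<in> ?S" for e
 proof -
  obtain t where t: "e = ereal t" "dst p (geo p u t) = t" using \<open>e \<in> ?S\<close> ex by force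
  thus ?thesis using down[OF l _ t(2)] n by force
 qed
 hence "cut_time M p u <= ereal ?l" unfolding cut_time_def by (rule Sup_least)
 moreover have t0T: "ereal t0 <= cut_time M p u" unfolding cut_time_def by (rule Sup_upper) (use S t0 in blast)
 ultimately obtain T where T: "cut_time M p u = ereal T" "t0 <= T" "T <= ?l" by (cases "cut_time M p u") auto
 have "geo p u T \<in> cut_locus M p"
  unfolding cut_locus_def indicatrix_def using u T ex[of T] t0 by (intro CollectI exI[of _ T] exI[of _ u]) auto
 hence "inj_radius M <= ereal (dst p (geo p u T))"
  unfolding inj_radius_def using p by (meson INF_lower INF_lower2)
 thus False using i le[of T] T t0 by (metis ereal_less_eq(3) leD less_le_trans order_trans less_imp_le)
qed
thus ?thesis using gl by simp
qed

text \<open>Two minimal geodesics meeting in \<open>q\<close> with different velocities form a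
  corner. Follow the second up to \<open>x\<close> shortly before \<open>q\<close>, then go straight
  to a point of the first slightly beyond \<open>q\<close>: strictness in the first variation makes
  this shorter than the first geodesic, which is still minimal there because its length remains
  below the injectivity radius.\<close>

lemma exp_inj:
assumes p: "p \<in> PM" and v: "v1 \<in> TM p" "v2 \<in> TM p"
 and i: "ereal (fnorm M p v1) < inj_radius M" "ereal (fnorm M p v2) < inj_radius M" and eq: "geo p v1 1 = geo p v2 1"
shows "v1 = v2"
proof (rule ccontr)
assume ne: "v1 ~= v2"
define l q where "l = fnorm M p v1" and "q = geo p v1 1"
have l2: "fnorm M p v2 = l" using minimal_below_inj_radius[OF p v(1) i(1)] minimal_below_inj_radius[OF p v(2) i(2)] eq by (simp add: l_def)
have l: "0 < l" using fnorm_pos[OF p v(1)] fnorm_pos[OF p v(2)] l2 ne unfolding l_def by (cases "v1 = tzero") auto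
have q: "q \<in> PM" "geo p v2 1 = q" using geo_points[OF v(1) p, of 1] eq by (auto simp: q_def)
let ?N1 = "gvel p v1 1" and ?N2 = "gvel p v2 1"
have N: "?N1 \<in> TM q" "?N2 \<in> TM q"
 using gvel_tangent[OF v(1) p zero_le_one] gvel_tangent[OF v(2) p zero_le_one] unfolding q(2) by (simp_all add: q_def)
have "?N1 ~= ?N2"
proof
 assume e: "?N1 = ?N2"
 have "tscale (-1) v1 = tscale (-1) v2"
  using geo_reverse(2)[OF v(1) p, of 1 1] geo_reverse(2)[OF v(2) p, of 1 1] geo(3)[OF v(1) p] geo(3)[OF v(2) p] e q by (simp add: q_def)
 thus False using ne by (auto simp: tscale_def fun_eq_iff)
qed
obtain c where c: "c \<in> Ch q" using cover q by blast
note a = chD(1)[OF c]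
obtain r \<delta> Z g where n: "0 < r" "0 < \<delta>" "nb Z c g" "!!xi et. xi \<in> ball (snd c q) r ==> LM c (xi, et) < \<delta> ==> (xi, et) \<in> Z"
 using nb_exists[OF a in_cdom[OF c]] by metis
have c1: "c \<in> Ch (geo p v2 1)" using c q by simp
obtain d where d: "0 < d" "!!s. s \<in> {0..} ==> \<bar>s - 1\<bar> < d ==> geo p v2 s \<in> {x \<in> fst c. snd c x \<in> ball (snd c q) r}"
 by (rule curve_near[OF geodesic_cont[OF geo(1)[OF v(2) p]] _ chart_ball_open[OF a open_ball], of 1 "snd c q" r])
  (use q chD(2)[OF c] n(1) in auto)
\<comment> \<open>The piece from \<open>x\<close> to \<open>q\<close> gets length
  \<open>e * l\<close>, less than the radius of the normal balls, and \<open>x\<close> lies where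
  these balls are uniform.\<close>
define e where "e = min (1/2) (min (d/2) (\<delta> / (2 * l)))"
have e: "0 < e" "e < 1" "e < d" "e * l < \<delta>"
proof -
 have "e * l <= \<delta> / (2 * l) * l" unfolding e_def by (rule mult_right_mono) (use l in auto)
 thus "e * l < \<delta>" using l n(2) by simp
qed (use d n l in "auto simp: e_def")
define x where "x = geo p v2 (1 - e)"
have x: "x \<in> fst c" "snd c x \<in> ball (snd c q) r" using d(2)[of "1 - e"] e by (auto simp: x_def)
have cx: "c \<in> Ch x" and xp: "x \<in> PM" using x a chart_sub[OF a] by (auto simp: charts_at_def)
define w where "w = tscale e (gvel p v2 (1 - e))"
have w: "w \<in> TM x" unfolding w_def x_def by (rule tangent_tscale[OF gvel_tangent[OF v(2) p]]) (use e in simp)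
have xw: "geo x w 1 = q" "gvel x w 1 = tscale e ?N2"
 using geo_affine[OF v(2) p, of "1 - e" 1 e 1] e q by (auto simp: x_def w_def)
have fw: "fnorm M x w = e * l"
 using fnorm_gvel[OF v(2) p, of "1 - e" e] fnorm_tscale[OF p v(2), of e] e l2 by (simp add: x_def w_def)
note pw = pt_vec_coord[OF cx w]
let ?xi = "snd c x"
have Lw: "LM c (?xi, w c) = e * l" using fnorm_coord[OF cx w] fw by simp
have ci: "ci c ?xi = x" using chart_inv(1)[OF a x(1)] .
note B = n(3) in_cdom[OF cx] n(4)[OF x(2)]
have exw: "ex c (?xi, w c) = q" using pw xw by (simp add: ex_def)
have "q = ex c (?xi, w c) & LM c (?xi, w c) < \<delta>" using exw Lw e(4) by simp
hence qU: "q \<in> UU c ?xi \<delta>" using UU_def[OF B, of \<delta>] by blast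
have gq: "g ?xi q = w c" using nb_g[OF B, of \<delta> "w c"] Lw e(4) exw by simp
define u where "u = tscale e ?N1"
have u: "u \<in> TM q" unfolding u_def by (rule tangent_tscale[OF N(1)])
have fu: "fnorm M q u = e * l" using fnorm_gvel[OF v(1) p, of 1 e] fnorm_tscale[OF p v(1), of e] e by (simp add: q_def u_def l_def)
have une: "u ~= vz c (?xi, w c) 1"
 unfolding pw xw u_def using \<open>?N1 ~= ?N2\<close> e by (auto simp: tscale_def fun_eq_iff)
let ?ga = "geo q u"
have ge: "?ga s = geo p v1 (1 + e * s)" if "0 <= s" for s
 using geo_affine(1)[OF v(1) p, of 1 "s + 1" e s] that e by (simp add: q_def u_def)
note gc = geodesic_cont[OF geo(1)[OF u q(1)]]
have g0: "?ga 0 = q" by (rule geo(2)[OF u q(1)])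
have w0: "w c ~= 0" using fw fnorm_tzero[OF xp] nz_chart[OF w _ cx] e l by (cases "w = tzero") auto
let ?h = "%s. LM c (?xi, g ?xi (?ga s))"
have hd: "EX h'. (?h hrd h') (at 0 within {0..}) & h' < e * l"
proof -
 have ud: "((%s. snd c1 (?ga s)) hvd u c1) (at 0 within {0..})" if "c1 \<in> Ch (?ga 0)" for c1
  using geo_coord(1)[OF u q(1) order_refl that] geo(3)[OF u q(1)] by simp
 have "(0::real) \<in> {0..}" by simp
 from nb_dist_deriv[OF B gc this, unfolded g0 gq, OF _ qU w0 u ud[unfolded g0]]
  nb_dist_deriv_le(2)[OF B, of \<delta> ?ga 0 u, unfolded g0 gq, OF _ qU] show ?thesis
  using une fu Lw w0 u unfolding has_real_derivative_iff_has_vector_derivative by auto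
qed
then obtain h' where h': "(?h hrd h') (at 0 within {0..})" "h' < e * l" by blast
have "((%s. ?h s - e * l * s) hrd h' - e * l) (at 0 within {0..})"
 by (rule derivative_eq_intros h'(1) refl | simp)+
from has_real_derivative_neg_dec_right[OF this] h'(2) obtain d1 where d1: "0 < d1" "!!s. 0 < s ==> s < d1 ==> ?h s - e * l * s < ?h 0"
 by auto
obtain d2 where d2: "0 < d2" "!!s. 0 <= s ==> s < d2 ==> ?ga s \<in> UU c ?xi \<delta>"
 using nb_near(2)[OF B gc, of \<delta> 0] g0 qU by auto
\<comment> \<open>Room beyond \<open>q\<close>, since the bound on \<open>v1\<close> is
  strict.\<close>
obtain l' where l': "l < l'" "ereal l' < inj_radius M" using ereal_dense2[OF i(1)] by (auto simp: l_def)
define s where "s = min (d1/2) (min (d2/2) ((l' - l) / (2 * e * l)))"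
have "s * (e * l) <= (l' - l) / (2 * e * l) * (e * l)" unfolding s_def by (rule mult_right_mono) (use e l in auto)
also have "... = (l' - l) / 2" using e l by simp
finally have "(1 + e * s) * l < l'" using l' by (simp add: algebra_simps)
moreover have "0 < s" "s < d1" "s < d2" using d1(1) d2(1) l' e l by (auto simp: s_def)
ultimately have s: "0 < s" "s < d1" "s < d2" "(1 + e * s) * l < l'" by auto
have U: "?ga s \<in> UU c ?xi \<delta>" using d2(2) s by simp
have hs: "?h s = dst x (?ga s)" using nb_dist[OF B, of \<delta> "g ?xi (?ga s)"] UU[OF B, of \<delta>] U ci by simp
have "dst p (geo p (tscale (1 + e * s) v1) 1) = (1 + e * s) * l"
 using minimal_below_inj_radius[OF p tangent_tscale[OF v(1)], of "1 + e * s"] fnorm_tscale[OF p v(1), of "1 + e * s"] s(1,4) e l' order.strict_trans[OF _ l'(2)]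
 by (simp add: l_def)
hence "dst p (?ga s) = (1 + e * s) * l" using geo_scale(1)[OF v(1) p, of "1 + e * s" 1] ge[of s] s e by simp
moreover have "dst p x <= (1 - e) * l" using geo_fdist_le[OF v(2) p, of 0 "1 - e"] geo(2)[OF v(2) p] e l2 by (simp add: x_def)
moreover have "dst p (?ga s) <= dst p x + dst x (?ga s)" using fdist_tri[OF p xp] geo_points[OF u q(1), of s] s by simp
ultimately have "(1 + e * s) * l <= (1 - e) * l + ?h s" using hs by simp
moreover have "?h 0 = e * l" using g0 gq Lw by simp
ultimately show False using d1(2)[OF s(1,2)] by (simp add: algebra_simps)
qed

end

section \<open>The inverse exponential map and its average\<close>

text \<open>\<open>rh\<close> is the working radius. On the left of \<open>kr\<close>, the factor
  \<open>Lm\<close> pays for \<open>F(-y)^2 <= Lm * F(y)^2\<close>. The right side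
  \<open>1 / (8 * Lm)\<close> is the value of \<open>ka\<close> in the Jacobi estimate, chosen so
  that \<open>2 * ka\<close> times a further \<open>Lm\<close>, the price of an arbitrary reference
  vector, is \<open>1/4\<close>.\<close>

locale cm_mfd = bounded_mfd M kb for M :: "('m, 'n::finite) finsler_space" and kb :: real +
fixes Lm rh :: real
assumes unif: "uniformity_const M <= ereal Lm" and L1: "1 <= Lm"
 and r0: "0 < rh" "ereal rh <= inj_radius M" and kr: "\<bar>kb\<bar> * (Lm * rh^2) <= 1 / (8 * Lm)"
begin

text \<open>The uniformity constant compares unit vectors only; \<open>g\<close> is homogeneous of
  degree 0 in the reference vector and quadratic in \<open>v\<close>, so normalising changes
  nothing.\<close>

lemma GG_unif:
assumes c: "c \<in> AM" and x: "xi \<in> cdom c" and y: "y ~= 0" "y' ~= 0"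
shows "GG c (xi, y) v v <= Lm * GG c (xi, y') v v"
proof (cases "v = 0")
case True
interpret C: cmetric "LM c" "cdom c" by (rule cmetric[OF c])
show ?thesis using True linear_0[OF C.lin_G(1)] x y by simp
next
case False
interpret C: cmetric "LM c" "cdom c" by (rule cmetric[OF c])
let ?x = "ci c xi"
note cx = charts_at_inv[OF c x] and sx = chart_inv(2)[OF c x]
define n where "n w = (1 / LM c (xi, w)) *R w" for w
have I: "coord_tvec M c ?x (n w) \<in> indicatrix M ?x" "coord_tvec M c ?x (n w) c = n w" if "w ~= 0" for w
proof -
 show e: "coord_tvec M c ?x (n w) c = n w" by (rule coord_tvec_tangent(2)[OF cx])
 have "LM c (xi, n w) = 1" unfolding n_def using C.homL[OF x, of "1 / LM c (xi, w)" w] C.L_pos[OF x that] by simp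
 thus "coord_tvec M c ?x (n w) \<in> indicatrix M ?x"
  unfolding indicatrix_def using coord_tvec_tangent(1)[OF cx] fnorm_coord[OF cx coord_tvec_tangent(1)[OF cx]] e sx by simp
qed
let ?X = "%w. coord_tvec M c ?x (n w)"
let ?t = "fund_form (LM c) (snd c ?x, ?X y c) (?X v c) (?X v c) / fund_form (LM c) (snd c ?x, ?X y' c) (?X v c) (?X v c)"
have "ereal ?t <= uniformity_const M"
 unfolding uniformity_const_def
 by (rule Sup_upper) (use I(1)[OF y(1)] I(1)[OF y(2)] I(1)[OF False] cx chD(3)[OF cx] in blast)
hence "?t <= Lm" using order_trans[OF _ unif] ereal_less_eq(3) by blast
moreover have p: "(xi, w) \<in> C.S" "(xi, n w) \<in> C.S" "C.G (xi, n w) u u = C.G (xi, w) u u" if "w ~= 0" for w u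
 using that x C.L_pos[OF x that] C.G_scale[of xi w "1 / LM c (xi, w)"] by (auto simp: n_def)
have q: "C.G (xi, w) (n v) (n v) = (1 / LM c (xi, v))^2 * C.G (xi, w) v v" if "w ~= 0" for w
 unfolding n_def linear_cmul[OF C.lin_G(1)[OF p(1)[OF that]]] linear_cmul[OF C.lin_G(2)[OF p(1)[OF that]]] by (simp add: power2_eq_square)
have "?t = C.G (xi, y) v v / C.G (xi, y') v v"
 unfolding I(2)[OF y(1)] I(2)[OF y(2)] I(2)[OF False] sx C.fund_form_eq[OF p(2)[OF y(1)]] C.fund_form_eq[OF p(2)[OF y(2)]]
  p(3)[OF y(1)] p(3)[OF y(2)] q[OF y(1)] q[OF y(2)] using C.L_pos[OF x False] by simp
ultimately show ?thesis using C.G_pos[OF p(1)[OF y(2)] False] by (simp add: field_simps)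
qed

text \<open>\<open>F(-y)^2\<close> is \<open>g_{-y}(y, y)\<close>, to be compared with
  \<open>g_y(y, y) = F(y)^2\<close>.\<close>

lemma LM_minus:
assumes c: "c \<in> AM" and x: "xi \<in> cdom c" shows "(LM c (xi, - y))^2 <= Lm * (LM c (xi, y))^2"
proof (cases "y = 0")
case True
interpret C: cmetric "LM c" "cdom c" by (rule cmetric[OF c])
show ?thesis using True C.L_zero[OF x] by simp
next
case False
interpret C: cmetric "LM c" "cdom c" by (rule cmetric[OF c])
have z: "(xi, y) \<in> C.S" "(xi, - y) \<in> C.S" using x False by auto
show ?thesis
 using GG_unif[OF c x, of "- y" y "- y"] C.G_y(2)[OF z(1)] C.G_y(2)[OF z(2)] False
  linear_neg[OF C.lin_G(1)[OF z(1)]] linear_neg[OF C.lin_G(2)[OF z(1)]] by (simp add: C.Q_def)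
qed

lemma fnorm_minus: assumes x: "x \<in> PM" and y: "y \<in> TM x"
shows "fnorm M x (tscale (- 1) y) <= Lm * fnorm M x y"
proof -
obtain c where c: "c \<in> Ch x" using cover x by blast
have "(fnorm M x (tscale (- 1) y))^2 <= Lm * (fnorm M x y)^2"
 using LM_minus[OF chD(1)[OF c] in_cdom[OF c], of "y c"] fnorm_coord[OF c y] fnorm_coord[OF c tangent_tscale[OF y, of "- 1"]]
 by (simp add: tscale_def)
also have "... <= (Lm * fnorm M x y)^2" using L1 mult_right_mono[of Lm "Lm^2" "(fnorm M x y)^2"] by (simp add: power2_eq_square algebra_simps)
finally show ?thesis by (rule power2_le_imp_le) (use L1 fnorm_nonneg[OF x y] in simp)
qed

lemma kr4: "0 <= u ==> u < rh ==> \<bar>kb\<bar> * (Lm * u^2) <= 1 / (8 * Lm)" "0 <= u ==> u < rh ==> \<bar>kb\<bar> * u^2 <= 1/4"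
proof -
assume u: "0 <= u" "u < rh"
have "u^2 <= rh^2" using u by (intro power_mono) auto
hence "\<bar>kb\<bar> * (Lm * u^2) <= \<bar>kb\<bar> * (Lm * rh^2)" using L1 by (intro mult_left_mono) auto
thus a: "\<bar>kb\<bar> * (Lm * u^2) <= 1 / (8 * Lm)" using kr by simp
have "\<bar>kb\<bar> * u^2 <= \<bar>kb\<bar> * (Lm * u^2)" using L1 mult_right_mono[of 1 Lm "u^2"] by (intro mult_left_mono) auto
also note a
also have "1 / (8 * Lm) <= 1/4" using L1 by (simp add: field_simps)
finally show "\<bar>kb\<bar> * u^2 <= 1/4" .
qed

text \<open>Everything is read at \<open>- snd z\<close>, because the outward radial vector at the
  foot point is the negative of the initial velocity towards the end point. The first bound passes
  from \<open>y\<close> to this vector and back, at a cost of \<open>sqrt Lm\<close> each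
  way.\<close>

lemma conj_estimate:
assumes c: "c \<in> AM" and z: "z \<in> WW c" and L: "LM c z < rh" and c1: "c1 \<in> Ch (ex c z)"
 and J: "jf c z h 1 c1 = 0"
defines "b \<equiv> snd h + Gm c (fst z) (snd z) (fst h)"
shows "y ~= 0 ==> sqrt (GG c (fst z, y) (b + fst h) (b + fst h)) <= 1/4 * sqrt (GG c (fst z, y) (fst h) (fst h))"
 "snd z ~= 0 ==> GG c (fst z, - snd z) (- snd z) b = - GG c (fst z, - snd z) (- snd z) (fst h)"
proof -
interpret C: cmetric "LM c" "cdom c" by (rule cmetric[OF c])
interpret B: cberwald "LM c" "cdom c" by (rule cberwald[OF c])
have x: "fst z \<in> cdom c" using z by auto
show "GG c (fst z, - snd z) (- snd z) b = - GG c (fst z, - snd z) (- snd z) (fst h)" if "snd z ~= 0"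
 using gauss_chart(2)[where s = "- 1", OF c z that _ c1[unfolded ex_def] J] by (simp add: b_def)
assume y: "y ~= 0"
have yS: "(fst z, y) \<in> C.S" using x y by simp
show "sqrt (GG c (fst z, y) (b + fst h) (b + fst h)) <= 1/4 * sqrt (GG c (fst z, y) (fst h) (fst h))"
proof (cases "snd z = 0")
 case True
 hence ze: "z = (fst z, 0)" by (metis prod.collapse)
 have c0: "c \<in> Ch (gz c z 1)"
  using ex_zero(1)[OF c x, of 1] charts_at_inv[OF c x] by (subst (1 2) ze) simp
 have "jf c z h 1 c = 0"
  using fd_fl_change(1)[OF c z zero_le_one c1[unfolded ex_def] c0, of h] linear_0[OF Dt_linear[OF c1[unfolded ex_def] c0]] J by simp
 hence "fst h + snd h = 0" using ex_zero(2)[OF c x, of h] ze by simp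
 hence "b + fst h = 0" unfolding b_def True using linear_0[OF B.Gx_lin(1)] by (simp add: add.commute)
 thus ?thesis using linear_0[OF C.lin_G(1)[OF yS]] C.G_nonneg[OF yS] by simp
next
 case False
 let ?n = "- snd z" and ?k = "1 / (8 * Lm)"
 have nS: "(fst z, ?n) \<in> C.S" "?n ~= 0" using x False by auto
 have k: "0 <= ?k" "?k <= 1/4" using L1 by (auto simp: field_simps)
 have "\<bar>kb\<bar> * (LM c (fst z, ?n))^2 <= \<bar>kb\<bar> * (Lm * (LM c z)^2)"
  using mult_left_mono[OF LM_minus[OF c x, of "snd z"]] by simp
 also have "... <= ?k" using kr4(1)[OF _ L] C.nonnegL[of "fst z" "snd z"] x by simp
 finally have kk: "\<bar>kb\<bar> * (LM c (fst z, (-1) *R snd z))^2 <= (-1)^2 * ?k" by simp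
 let ?N = "%y v. sqrt (GG c (fst z, y) v v)"
 have un: "?N y v <= sqrt Lm * ?N y' v" if "y ~= 0" "y' ~= 0" for y y' v
  using real_sqrt_le_mono[OF GG_unif[OF c x that, of v]] by (simp add: real_sqrt_mult)
 have "?N y (b + fst h) <= sqrt Lm * ?N ?n (b + fst h)" by (rule un[OF y nS(2)])
 also have "... <= sqrt Lm * (2 * ?k * ?N ?n (fst h))"
  using gauss_chart(3)[where s = "- 1", OF c z False _ c1[unfolded ex_def] J kk k(2,1)] L1 by (intro mult_left_mono) (simp_all add: b_def)
 also have "... <= sqrt Lm * (2 * ?k * (sqrt Lm * ?N y (fst h)))"
  using un[OF nS(2) y, of "fst h"] L1 by (intro mult_left_mono) auto
 also have "... = (sqrt Lm)^2 * 2 * ?k * ?N y (fst h)" by (simp add: power2_eq_square)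
 also have "... = 1/4 * ?N y (fst h)" using L1 by simp
 finally show ?thesis .
qed
qed

lemma exp_inv_geo:
assumes x: "x \<in> PM" and v: "v \<in> TM x" "fnorm M x v < rh"
shows "exp_inv M x (geo x v 1) = v" "v \<in> exp_dom M x"
proof -
have d: "w \<in> exp_dom M x" if "w \<in> TM x" "fnorm M x w < rh" for w
 using that order.strict_trans2[OF _ r0(2)] by (simp add: exp_dom_def)
have "inj_on (fexp M x) (exp_dom M x)"
 by (rule inj_onI) (use exp_inj[OF x] fexp_eq[OF _ x] in "auto simp: exp_dom_def")
from the_inv_into_f_f[OF this d[OF v]] show "exp_inv M x (geo x v 1) = v"
 using fexp_eq[OF v(1) x] by (simp add: exp_inv_def)
show "v \<in> exp_dom M x" by (rule d[OF v])
qed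

definition "gE c xi q = exp_inv M (ci c xi) q c"
definition "ZZ c = {z \<in> WW c. LM c z < rh}"

text \<open>Injectivity below the injectivity radius lets \<open>exp_inv\<close> itself serve as the
  left inverse on the whole region \<open>F < rh\<close>.\<close>

lemma nb_ZZ: assumes c: "c \<in> AM" shows "nb (ZZ c) c (gE c)"
proof -
interpret C: cmetric "LM c" "cdom c" by (rule cmetric[OF c])
have "open (ZZ c)" unfolding ZZ_def
 using continuous_open_preimage[OF C.L_continuous open_W[OF c] open_lessThan, of rh] by (simp add: vimage_def Int_def)
moreover have "gE c (fst z) (ex c z) = snd z" if z: "z \<in> WW c" "LM c z < rh" for z
 using exp_inv_geo(1)[OF pt_vec(2,3)[OF c z(1)]] fnorm_vec[OF c z(1)] z pt_vec(5)[OF c z(1)] by (simp add: gE_def ex_def pt_def)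
moreover have "\<bar>kb\<bar> * (LM c z)^2 <= 1/4" if z: "z \<in> WW c" "LM c z < rh" for z
 using kr4(2)[of "LM c z"] C.nonnegL[of "fst z" "snd z"] z by auto
ultimately show ?thesis unfolding nb_def using c by (auto simp: ZZ_def)
qed

lemma exp_inv:
assumes x: "x \<in> PM" and q: "q \<in> PM" and d: "dst x q < rh"
shows "exp_inv M x q \<in> TM x" "fnorm M x (exp_inv M x q) = dst x q" "geo x (exp_inv M x q) 1 = q"
proof -
obtain c where c: "c \<in> Ch x" using cover x by blast
note a = chD(1)[OF c]
have ci: "ci c (snd c x) = x" using chart_inv(1)[OF a chD(2)[OF c]] .
have b: "LM c (snd c x, et) < rh ==> (snd c x, et) \<in> ZZ c" for et using in_cdom[OF c] by (simp add: ZZ_def)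
obtain et where e: "LM c (snd c x, et) = dst x q" "q = ex c (snd c x, et)"
 using nb_dist_inv[OF nb_ZZ[OF a] in_cdom[OF c] b, of rh q] ci d Dset_nonempty[OF x q] by auto
let ?v = "coord_tvec M c x et"
have v: "?v \<in> TM x" "?v c = et" using coord_tvec_tangent[OF c] by auto
have f: "fnorm M x ?v = dst x q" using fnorm_coord[OF c v(1)] v(2) e by simp
have g: "geo x ?v 1 = q" using pt_vec_coord[OF c v(1)] v(2) e by (simp add: ex_def)
have "exp_inv M x q = ?v" using exp_inv_geo(1)[OF x v(1)] f g d by simp
thus "exp_inv M x q \<in> TM x" "fnorm M x (exp_inv M x q) = dst x q" "geo x (exp_inv M x q) 1 = q" using v f g by auto
qed

lemma gE_ZZ:
assumes c: "c \<in> Ch x" and q: "q \<in> PM" and d: "dst x q < rh"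
shows "gE c (snd c x) q = exp_inv M x q c" "(snd c x, exp_inv M x q c) \<in> ZZ c" "ex c (snd c x, exp_inv M x q c) = q"
 "LM c (snd c x, exp_inv M x q c) = dst x q"
proof -
note E = exp_inv[OF chD(3)[OF c] q d]
show "gE c (snd c x) q = exp_inv M x q c" using chart_inv(1)[OF chD(1,2)[OF c]] by (simp add: gE_def)
show L: "LM c (snd c x, exp_inv M x q c) = dst x q" using fnorm_coord[OF c E(1)] E(2) by simp
show "(snd c x, exp_inv M x q c) \<in> ZZ c" using d L in_cdom[OF c] by (simp add: ZZ_def)
show "ex c (snd c x, exp_inv M x q c) = q" using E(3) pt_vec_coord[OF c E(1)] by (simp add: ex_def)
qed

text \<open>With \<open>q\<close> fixed, moving the foot point by \<open>X\<close> gives a Jacobi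
  field vanishing at time 1, so \<open>conj_estimate\<close> applies. The vector
  \<open>D X + Gm c (snd c x) E X\<close> is the covariant derivative of the inverse exponential
  field, which is thus close to \<open>- X\<close>.\<close>

lemma gE_deriv:
assumes c: "c \<in> Ch x" and q: "q \<in> PM" and d: "dst x q < rh"
defines "D \<equiv> fd (%xi. gE c xi q) (snd c x)" and "E \<equiv> exp_inv M x q c"
shows "((%xi. gE c xi q) hfd D) (at (snd c x))"
 "y ~= 0 ==> sqrt (GG c (snd c x, y) (D X + Gm c (snd c x) E X + X) (D X + Gm c (snd c x) E X + X)) <= 1/4 * sqrt (GG c (snd c x, y) X X)"
 "E ~= 0 ==> GG c (snd c x, - E) (- E) (D X + Gm c (snd c x) E X) = - GG c (snd c x, - E) (- E) X"
 "dst x q < r ==> EX e>0. ALL xi:ball (snd c x) e. xi \<in> cdom c & dst (ci c xi) q < r"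
proof -
note a = chD(1)[OF c] and g = gE_ZZ[OF c q d, folded E_def]
obtain c1 where c1: "c1 \<in> Ch q" using cover q by blast
have ci: "ci c1 (snd c1 q) = q" using chart_inv(1)[OF chD(1,2)[OF c1]] .
obtain D1 e where iv: "nbinv (ZZ c) c (gE c) (snd c x) E q c1 D1 e" using nb_inverse[OF nb_ZZ[OF a] g(2,3) c1] by blast
note D = nbinvD(1)[OF iv] and J = nbinvD(2)[OF iv] and e = nbinvD(3,4)[OF iv]
have dv: "((%xi. gE c xi q) hfd (%X. D1 (X, 0))) (at (snd c x))"
 using has_derivative_compose[where f = "%xi. (xi, snd c1 q)" and g = "%z. gE c (fst z) (ci c1 (snd z))",
  OF has_derivative_Pair[OF has_derivative_ident has_derivative_const] D] by (simp add: ci)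
have De: "D = (%X. D1 (X, 0))" unfolding D_def by (rule fd_eqI[OF dv])
show "((%xi. gE c xi q) hfd D) (at (snd c x))" using dv De by simp
have zW: "(snd c x, E) \<in> WW c" "LM c (snd c x, E) < rh" using g(2) by (auto simp: ZZ_def)
have c1': "c1 \<in> Ch (ex c (snd c x, E))" using c1 g(3) by simp
note est = conj_estimate[OF a zW c1', of "(X, D X)", unfolded fst_conv snd_conv]
have j: "jf c (snd c x, E) (X, D X) 1 c1 = 0" using J De by simp
show "y ~= 0 ==> sqrt (GG c (snd c x, y) (D X + Gm c (snd c x) E X + X) (D X + Gm c (snd c x) E X + X)) <= 1/4 * sqrt (GG c (snd c x, y) X X)"
 using est(1)[OF j] by simp
show "E ~= 0 ==> GG c (snd c x, - E) (- E) (D X + Gm c (snd c x) E X) = - GG c (snd c x, - E) (- E) X"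
 using est(2)[OF j] by simp
assume r: "dst x q < r"
interpret C: cmetric "LM c" "cdom c" by (rule cmetric[OF a])
have "isCont (LM c) (snd c x, gE c (snd c x) q)"
 by (rule continuous_on_interior[OF C.L_continuous]) (use in_cdom[OF c] in "simp add: interior_open[OF open_W[OF a]]")
from continuous_within_compose3[OF this continuous_Pair[OF continuous_ident has_derivative_continuous[OF dv]]]
have cL: "isCont (%xi. LM c (xi, gE c xi q)) (snd c x)" .
then obtain e2 where e2: "0 < e2" "!!xi. xi \<in> ball (snd c x) e2 ==> LM c (xi, gE c xi q) < r"
proof -
 have l: "LM c (snd c x, gE c (snd c x) q) < r" using g(1,4) r by simp
 obtain e2 where "0 < e2" "!!xi. dist xi (snd c x) < e2 ==>
   \<bar>LM c (xi, gE c xi q) - LM c (snd c x, gE c (snd c x) q)\<bar> < r - LM c (snd c x, gE c (snd c x) q)"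
  using cL[unfolded continuous_at_eps_delta dist_real_def, rule_format, of "r - LM c (snd c x, gE c (snd c x) q)"] l by auto
 thus ?thesis by (intro that[of e2]) (auto simp: dist_commute abs_less_iff)
qed
have "xi \<in> cdom c & dst (ci c xi) q < r" if "xi \<in> ball (snd c x) (min e e2)" for xi
proof -
 have z: "(xi, gE c xi q) \<in> ZZ c" "ex c (xi, gE c xi q) = q" using e(2)[of xi "snd c1 q"] that ci by (auto simp: dist_Pair_Pair)
 have w: "(xi, gE c xi q) \<in> WW c" using z(1) by (simp add: ZZ_def)
 show ?thesis using geo_fdist(1)[OF pt_vec(3,2)[OF a w]] fnorm_vec[OF a w] z(2) w e2(2)[of xi] that by (simp add: ex_def pt_def)
qed
thus "EX e>0. ALL xi:ball (snd c x) e. xi \<in> cdom c & dst (ci c xi) q < r" using e(1) e2(1) by (metis min_less_iff_conj)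
qed

text \<open>Serves measurability: with the foot point fixed, the local inverse is continuous in the
  end point.\<close>

lemma exp_image_open:
assumes c: "c \<in> Ch x" and B: "open B" and r: "r <= rh"
shows "openin (topo M) {q \<in> PM. dst x q < r & exp_inv M x q c \<in> B}"
proof (subst openin_subopen, intro ballI)
fix q assume "q \<in> {q \<in> PM. dst x q < r & exp_inv M x q c \<in> B}"
hence q: "q \<in> PM" "dst x q < r" "exp_inv M x q c \<in> B" and d: "dst x q < rh" using r by auto
note a = chD(1)[OF c] and g = gE_ZZ[OF c q(1) d]
obtain c1 where c1: "c1 \<in> Ch q" using cover q by blast
have ci: "ci c1 (snd c1 q) = q" using chart_inv(1)[OF chD(1,2)[OF c1]] .
obtain D1 e where iv: "nbinv (ZZ c) c (gE c) (snd c x) (exp_inv M x q c) q c1 D1 e" using nb_inverse[OF nb_ZZ[OF a] g(2,3) c1] by blast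
note D = nbinvD(1)[OF iv] and e = nbinvD(3,4)[OF iv]
interpret C: cmetric "LM c" "cdom c" by (rule cmetric[OF a])
let ?B = "B Int {et. LM c (snd c x, et) < r}"
have "continuous_on UNIV (%et. LM c (snd c x, et))"
 by (rule continuous_on_compose2[OF C.L_continuous continuous_on_Pair[OF continuous_on_const continuous_on_id]]) (use in_cdom[OF c] in auto)
from open_Collect_less[OF this continuous_on_const] have oB: "open ?B" using B by blast
have "isCont (%ze. gE c (snd c x) (ci c1 ze)) (snd c1 q)"
 using continuous_within_compose3[OF has_derivative_continuous[OF D] continuous_Pair[OF continuous_const continuous_ident]] by simp
moreover have "gE c (snd c x) (ci c1 (snd c1 q)) \<in> ?B" using g q ci by simp
ultimately obtain V where V: "open V" "snd c1 q \<in> V" "!!ze. ze \<in> V ==> gE c (snd c x) (ci c1 ze) \<in> ?B"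
 using oB unfolding continuous_at_open by metis
let ?T = "{q' \<in> fst c1. snd c1 q' \<in> V Int ball (snd c1 q) e}"
have "openin (topo M) ?T" by (rule chart_ball_open[OF chD(1)[OF c1] open_Int[OF V(1) open_ball]])
moreover have "q \<in> ?T" using chD(2)[OF c1] V(2) e(1) by simp
moreover have "?T <= {q \<in> PM. dst x q < r & exp_inv M x q c \<in> B}"
proof
 fix q' assume t: "q' \<in> ?T"
 have ci': "ci c1 (snd c1 q') = q'" using chart_inv(1)[OF chD(1)[OF c1]] t by simp
 let ?z = "(snd c x, gE c (snd c x) q')"
 have z: "?z \<in> ZZ c" "ex c ?z = q'" "gE c (snd c x) q' \<in> B" "LM c ?z < r"
  using e(2)[of "snd c x" "snd c1 q'"] V(3)[of "snd c1 q'"] t ci' by (auto simp: dist_Pair_Pair)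
 have w: "?z \<in> WW c" using z(1) by (simp add: ZZ_def)
 have x: "ci c (snd c x) = x" using chart_inv(1)[OF a chD(2)[OF c]] .
 have "dst x q' < r" using geo_fdist(1)[OF pt_vec(3,2)[OF a w]] fnorm_vec[OF a w] z x by (simp add: ex_def pt_def)
 thus "q' \<in> {q \<in> PM. dst x q < r & exp_inv M x q c \<in> B}"
  using t chart_sub[OF chD(1)[OF c1]] z(3) x by (auto simp: gE_def)
qed
ultimately show "EX T. openin (topo M) T & q \<in> T & T <= {q \<in> PM. dst x q < r & exp_inv M x q c \<in> B}" by blast
qed

end

text \<open>Dominated convergence for difference quotients along sequences. Measurability of the
  derivative in the parameter \<open>a\<close> is obtained on the way, as a limit of measurable
  difference quotients.\<close>

lemma has_derivative_integral_prob:
fixes g :: "'b::euclidean_space => 'a => 'c::euclidean_space"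
assumes A: "prob_space A" and e: "0 < e" "0 <= C"
 and m: "!!x. x \<in> ball x0 e ==> g x \<in> borel_measurable A" and i: "integrable A (g x0)"
 and D: "!!a. a \<in> space A ==> ((%x. g x a) hfd D a) (at x0)" and b: "!!a X. a \<in> space A ==> norm (D a X) <= C * norm X"
 and lip: "!!x a. x \<in> ball x0 e ==> a \<in> space A ==> norm (g x a - g x0 a) <= C * norm (x - x0)"
shows "((%x. \<integral>a. g x a \<partial>A) hfd (%X. \<integral>a. D a X \<partial>A)) (at x0)" "integrable A (%a. D a X)"
proof -
interpret A: prob_space A by fact
have lin: "linear (D a)" if "a \<in> space A" for a using D[OF that] has_derivative_linear by blast
let ?R = "%x a. (1 / norm (x - x0)) *R (g x a - g x0 a - D a (x - x0))"
have RD: "((%x. ?R x a) \<longlongrightarrow> 0) (at x0)" if "a \<in> space A" for a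
 using D[OF that] by (simp add: has_derivative_def divide_inverse)
have mD: "(%a. D a X) \<in> borel_measurable A" for X
proof (cases "X = 0")
 case True
 thus ?thesis using lin linear_0 by (subst measurable_cong[where g = "%_. 0"]) auto
next
 case False
 define t where "t n = e / (2 * norm X) * inverse (real (Suc n))" for n
 have t: "t n ~= 0" "norm (t n *R X) < e" for n
 proof -
  have "norm (t n *R X) = e / 2 * inverse (real (Suc n))" using False e by (simp add: t_def)
  also have "... <= e / 2 * 1" using e by (intro mult_left_mono) (auto simp: field_simps)
  finally show "norm (t n *R X) < e" using e by simp
  show "t n ~= 0" using False e by (simp add: t_def)
 qed
 have tp: "0 < t n" for n using False e by (simp add: t_def)
 have "t \<longlonglongrightarrow> 0" unfolding t_def using tendsto_mult_right_zero[OF LIMSEQ_inverse_real_of_nat] by blast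
 from tendsto_add[OF tendsto_const tendsto_scaleR[OF this tendsto_const]]
 have tl: "(%n. x0 + t n *R X) \<longlonglongrightarrow> x0" by simp
 show ?thesis
 proof (rule borel_measurable_LIMSEQ_metric)
  show "(%a. (1 / t n) *R (g (x0 + t n *R X) a - g x0 a)) \<in> borel_measurable A" for n
   using m[of "x0 + t n *R X"] m[of x0] t(2)[of n] e by (simp add: dist_norm)
  fix a assume a: "a \<in> space A"
  have "(%n. ?R (x0 + t n *R X) a) \<longlonglongrightarrow> 0"
   by (rule RD[OF a, unfolded tendsto_at_iff_sequentially comp_def, rule_format, OF _ tl]) (use t(1) False in simp)
  from tendsto_add[OF tendsto_scaleR[OF tendsto_const this, of "norm X"] tendsto_const, of "D a X"]
  have "(%n. norm X *R ?R (x0 + t n *R X) a + D a X) \<longlonglongrightarrow> D a X" by simp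
  moreover have "norm X *R ?R (x0 + t n *R X) a + D a X = (1 / t n) *R (g (x0 + t n *R X) a - g x0 a)" for n
   using tp[of n] False by (simp add: linear_cmul[OF lin[OF a]] scaleR_diff_right)
  ultimately show "(%n. (1 / t n) *R (g (x0 + t n *R X) a - g x0 a)) \<longlonglongrightarrow> D a X" by simp
 qed
qed
show iD: "integrable A (%a. D a X)" for X
 by (rule A.integrable_const_bound[where B = "C * norm X"]) (use b mD in auto)
have ig: "integrable A (g x)" if "x \<in> ball x0 e" for x
proof -
 have "integrable A (%a. g x a - g x0 a)"
  by (rule A.integrable_const_bound[where B = "C * norm (x - x0)"]) (use lip[OF that] m[OF that] m[of x0] e in auto)
 from Bochner_Integration.integrable_add[OF this i] show ?thesis by simp
qed
have bl: "bounded_linear (%X. \<integral>a. D a X \<partial>A)"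
proof (rule linear_conv_bounded_linear[THEN iffD1], rule linearI)
 show "(\<integral>a. D a (X + Y) \<partial>A) = (\<integral>a. D a X \<partial>A) + (\<integral>a. D a Y \<partial>A)" for X Y
  unfolding Bochner_Integration.integral_add[OF iD iD, symmetric]
  by (rule Bochner_Integration.integral_cong[OF refl]) (simp add: linear_add[OF lin])
 show "(\<integral>a. D a (r *R X) \<partial>A) = r *R (\<integral>a. D a X \<partial>A)" for r X
  unfolding integral_scaleR_right[symmetric]
  by (rule Bochner_Integration.integral_cong[OF refl]) (simp add: linear_cmul[OF lin])
qed
have lim: "((%x. \<integral>a. ?R x a \<partial>A) \<longlongrightarrow> 0) (at x0)"
 unfolding tendsto_at_iff_sequentially comp_def
proof (intro allI impI)
 fix X assume X: "ALL i. X i \<in> UNIV - {x0}" "X \<longlonglongrightarrow> x0"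
 obtain N where N: "!!n. N <= n ==> X n \<in> ball x0 e" using X(2) e unfolding lim_sequentially by (auto simp: dist_commute)
 have "(%n. \<integral>a. ?R (X (n + N)) a \<partial>A) \<longlonglongrightarrow> (\<integral>a. 0 \<partial>A)"
 proof (rule integral_dominated_convergence[where w = "%_. 2 * C"])
  show "?R (X (n + N)) \<in> borel_measurable A" for n using m[OF N[of "n + N"]] m[of x0] mD e by simp
  show "AE a in A. (%n. ?R (X (n + N)) a) \<longlonglongrightarrow> 0"
  proof (rule AE_I2)
   fix a assume a: "a \<in> space A"
   show "(%n. ?R (X (n + N)) a) \<longlonglongrightarrow> 0"
    using RD[OF a] unfolding tendsto_at_iff_sequentially comp_def using X LIMSEQ_ignore_initial_segment by blast
  qed
  show "AE a in A. norm (?R (X (n + N)) a) <= 2 * C" for n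
  proof (rule AE_I2)
   fix a assume a: "a \<in> space A"
   let ?x = "X (n + N)"
   have "norm (g ?x a - g x0 a - D a (?x - x0)) <= C * norm (?x - x0) + C * norm (?x - x0)"
    using norm_triangle_ineq4[of "g ?x a - g x0 a" "D a (?x - x0)"] lip[OF N[of "n + N"] a] b[OF a, of "?x - x0"] by simp
   moreover have "0 < norm (?x - x0)" using X(1) by simp
   ultimately show "norm (?R ?x a) <= 2 * C" unfolding norm_scaleR by (simp add: field_simps)
  qed
 qed simp_all
 thus "(%n. \<integral>a. ?R (X n) a \<partial>A) \<longlonglongrightarrow> 0"
  using LIMSEQ_offset[of "%n. \<integral>a. ?R (X n) a \<partial>A" N] by simp
qed
have "((%x. (1 / norm (x - x0)) *R ((\<integral>a. g x a \<partial>A) - (\<integral>a. g x0 a \<partial>A) - (\<integral>a. D a (x - x0) \<partial>A))) \<longlongrightarrow> 0) (at x0)"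
 by (rule Lim_transform_within[OF lim e(1)]) (use ig iD e in "simp add: dist_commute")
thus "((%x. \<integral>a. g x a \<partial>A) hfd (%X. \<integral>a. D a X \<partial>A)) (at x0)"
 using bl by (simp add: has_derivative_def divide_inverse)
qed

section \<open>The averaged field and its covariant derivative\<close>

context cm_mfd
begin

text \<open>Bounds uniform in \<open>q\<close>, to dominate the integrands below. The coordinate
  derivative is the covariant derivative minus a connection term; the former is close to
  \<open>- X\<close>, the latter is bounded on compact sets.\<close>

lemma gE_lipschitz:
assumes c: "c \<in> AM" and r: "cball xi\<^sub>0 r <= cdom c" "0 < r"
obtains C where "0 <= C"
 "!!xi q X. xi \<in> cball xi\<^sub>0 r ==> q \<in> PM ==> dst (ci c xi) q < rh ==> norm (gE c xi q) <= C"
 "!!xi q X. xi \<in> cball xi\<^sub>0 r ==> q \<in> PM ==> dst (ci c xi) q < rh ==> norm (fd (%xi. gE c xi q) xi X) <= C * norm X"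
proof -
interpret C: cberwald "LM c" "cdom c" by (rule cberwald[OF c])
obtain m K where m: "0 < m" "0 < K" "!!x y. x \<in> cball xi\<^sub>0 r ==> m * norm y <= LM c (x, y)" "!!x y. x \<in> cball xi\<^sub>0 r ==> LM c (x, y) <= K * norm y"
 using C.L_norm_equiv[OF compact_cball r(1)] by metis
let ?A = "cball xi\<^sub>0 r \<times> cball (0 :: real ^ 'n) (rh / m)"
obtain K2 where K2: "K2 > 0" "!!z v. z \<in> ?A ==> norm (fd (fld c) z v) <= K2 * norm v"
 by (rule fd_bounded_on_compact[OF fld_Ck[OF c], of ?A]) (use r in "auto intro: compact_Times")
\<comment> \<open>The connection term is read off from the derivative of the geodesic field in a
  fibre direction, where it occurs twice.\<close>
have GmK: "norm (Gm c xi v b) <= K2 * norm b" if "xi \<in> cball xi\<^sub>0 r" "norm v <= rh / m" for xi v b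
proof -
 have x: "xi \<in> cdom c" using that(1) r by blast
 have d0: "C.dGx xi 0 v v = 0" using linear_0[OF C.dGx_lin(1)[OF x]] by simp
 have "fd (fld c) (xi, v) (0, b) = (b, - (2 *R Gm c xi v b))"
  using fld_fd[OF c x, of v 0 b] d0 C.Gx_sym[OF x, of b v] by (simp add: scaleR_2)
 hence "norm (2 *R Gm c xi v b) <= K2 * norm b"
  using K2(2)[of "(xi, v)" "(0, b)"] that norm_snd_le[of "- (2 *R Gm c xi v b)" b] by (simp add: norm_Pair)
 moreover have "norm (Gm c xi v b) <= norm (2 *R Gm c xi v b)" by simp
 ultimately show ?thesis by linarith
qed
define C where "C = rh / m + K2 + Lm * K / m + 1"
have p: "0 <= rh / m" "0 <= Lm * K / m" using r0 m L1 by auto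
have main: "norm (gE c xi q) <= rh / m" "norm (fd (%xi. gE c xi q) xi X) <= C * norm X"
 if x: "xi \<in> cball xi\<^sub>0 r" and q: "q \<in> PM" and d: "dst (ci c xi) q < rh" for xi q X
proof -
 have xc: "xi \<in> cdom c" using x r by blast
 note cx = charts_at_inv[OF c xc] and sx = chart_inv(2)[OF c xc]
 note g = gE_ZZ[OF cx q d, unfolded sx]
 show E: "norm (gE c xi q) <= rh / m" using m(3)[OF x, of "gE c xi q"] g(1,4) d m(1) by (simp add: field_simps)
 let ?D = "fd (%xi. gE c xi q) xi X" and ?G = "Gm c xi (gE c xi q) X"
 define y :: "real ^ 'n" where "y = axis undefined 1"
 have y: "y ~= 0" by (simp add: y_def axis_eq_0_iff)
 let ?b = "?D + ?G + X"
 have e: "sqrt (C.G (xi, y) ?b ?b) <= 1/4 * sqrt (C.G (xi, y) X X)"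
  using gE_deriv(2)[OF cx q d y, of X] g(1) by (simp add: sx)
 have LG: "LM c (xi, v) <= sqrt Lm * sqrt (C.G (xi, y) v v)" "sqrt (C.G (xi, y) v v) <= sqrt Lm * LM c (xi, v)" for v
 proof -
  have "C.Q (xi, v) <= Lm * C.G (xi, y) v v & C.G (xi, y) v v <= Lm * C.Q (xi, v)"
  proof (cases "v = 0")
   case True thus ?thesis using linear_0[OF C.lin_G(1)] xc y by (simp add: C.Q_def C.L_zero)
  next
   case False
   hence vS: "(xi, v) \<in> C.S" using xc by simp
   show ?thesis using GG_unif[OF c xc False y, of v] GG_unif[OF c xc y False, of v] C.G_y(2)[OF vS] by simp
  qed
  thus "LM c (xi, v) <= sqrt Lm * sqrt (C.G (xi, y) v v)" "sqrt (C.G (xi, y) v v) <= sqrt Lm * LM c (xi, v)"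
   using real_sqrt_le_mono C.nonnegL[OF xc, of v] by (fastforce simp: C.Q_def real_sqrt_mult)+
 qed
 have "m * norm ?b <= LM c (xi, ?b)" by (rule m(3)[OF x])
 also note LG(1)[of ?b]
 also have "sqrt Lm * sqrt (C.G (xi, y) ?b ?b) <= sqrt Lm * (1/4 * (sqrt Lm * LM c (xi, X)))"
  by (rule mult_left_mono[OF order_trans[OF e]]) (use LG(2)[of X] L1 in auto)
 also have "... = Lm * LM c (xi, X) / 4" using L1 by simp
 also have "... <= Lm * LM c (xi, X)" using L1 C.nonnegL[OF xc, of X] by simp
 also have "... <= Lm * (K * norm X)" using m(4)[OF x] L1 by (intro mult_left_mono) auto
 finally have "norm ?b <= Lm * K / m * norm X" using m(1) by (simp add: field_simps)
 moreover have "norm ?G <= K2 * norm X" by (rule GmK[OF x E])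
 moreover have "norm ?D <= norm ?b + norm ?G + norm X"
 proof -
  have "norm ?D = norm (?b - (?G + X))" by simp
  thus ?thesis using norm_triangle_ineq4[of ?b "?G + X"] norm_triangle_ineq[of ?G X] by linarith
 qed
 ultimately have "norm ?D <= (Lm * K / m + K2 + 1) * norm X" by (simp add: algebra_simps)
 also have "... <= C * norm X" unfolding C_def using p by (intro mult_right_mono) auto
 finally show "norm ?D <= C * norm X" .
qed
show ?thesis
proof (rule that[of C])
 show "0 <= C" using p K2 by (simp add: C_def)
 show "norm (gE c xi q) <= C" if "xi \<in> cball xi\<^sub>0 r" "q \<in> PM" "dst (ci c xi) q < rh" for xi q
  using main(1)[OF that] p K2 by (simp add: C_def)
qed (rule main(2))
qed

text \<open>The radius \<open>rh / 2\<close> leaves room: foot points close to \<open>x\<close>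
  remain at distance less than \<open>rh\<close> from all values of \<open>f\<close> at
  once.\<close>

definition "near A f x \<longleftrightarrow> (ALL a:space A. dst x (f a) < rh / 2)"

context
fixes A :: "'a measure" and f
assumes A: "prob_space A" and f: "f \<in> A \<rightarrow>\<^sub>M borel_of_space M"
begin

lemma f_points: "a \<in> space A ==> f a \<in> PM"
using measurable_space[OF f] by (simp add: borel_of_space_def space_measure_of_conv)

lemma exp_inv_measurable:
assumes c: "c \<in> Ch x" and d: "!!a. a \<in> space A ==> dst x (f a) < rh"
shows "(%a. exp_inv M x (f a) c) \<in> borel_measurable A"
proof (rule borel_measurableI)
fix S :: "(real ^ 'n) set" assume S: "open S"
have "{q \<in> PM. dst x q < rh & exp_inv M x q c \<in> S} \<in> sets (borel_of_space M)"
 unfolding borel_of_space_def using exp_image_open[OF c S order_refl] openin_subset by (auto intro!: in_measure_of)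
from measurable_sets[OF f this]
have "f -` {q \<in> PM. dst x q < rh & exp_inv M x q c \<in> S} Int space A \<in> sets A" .
moreover have "f -` {q \<in> PM. dst x q < rh & exp_inv M x q c \<in> S} Int space A = (%a. exp_inv M x (f a) c) -` S Int space A"
 using d f_points by auto
ultimately show "(%a. exp_inv M x (f a) c) -` S Int space A \<in> sets A" by simp
qed

lemma field_coords_V: "field_coords c (mass_field M A f) = (%xi. - (\<integral>a. gE c xi (f a) \<partial>A))"
by (simp add: fun_eq_iff field_coords_def mass_field_def gE_def)

text \<open>The covariant derivative of the average is the average of the covariant derivatives, so
  the estimate for single end points survives integration. The reference vector \<open>y\<close> is
  free: later it is \<open>V\<close> itself, the velocity of a geodesic, a radial vector, or
  \<open>X\<close>.\<close>

lemma V_deriv: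
assumes c: "c \<in> Ch x" and n: "near A f x"
defines "DV \<equiv> fd (field_coords c (mass_field M A f)) (snd c x)"
shows "integrable A (%a. exp_inv M x (f a) c)"
 "(field_coords c (mass_field M A f) hfd DV) (at (snd c x))"
 "y ~= 0 ==> GG c (snd c x, y) u X - 1/4 * (sqrt (GG c (snd c x, y) u u) * sqrt (GG c (snd c x, y) X X))
   <= GG c (snd c x, y) u (DV X + Gm c (snd c x) (mass_field M A f x c) X)"
proof -
interpret A: prob_space A by (rule A)
note a = chD(1)[OF c] and xp = chD(3)[OF c]
interpret C: cberwald "LM c" "cdom c" by (rule cberwald[OF a])
let ?xi = "snd c x"
have ci: "ci c ?xi = x" using chart_inv(1)[OF chD(1,2)[OF c]] .
have dx: "dst x (f b) < rh" if "b \<in> space A" for b using n that r0 by (force simp: near_def)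
have "dst x x < rh" "dst x x < rh / 2" using fdist_self[OF xp] r0 by auto
from gE_deriv(4)[OF c xp this] obtain e where e: "0 < e" "!!xi. xi \<in> ball ?xi e ==> xi \<in> cdom c & dst (ci c xi) x < rh / 2" by blast
define r where "r = e / 2"
have r: "0 < r" "cball ?xi r <= ball ?xi e" using e by (auto simp: r_def)
hence rc: "cball ?xi r <= cdom c" using e(2) by blast
have d: "dst (ci c xi) (f b) < rh" if "xi \<in> cball ?xi r" "b \<in> space A" for xi b
proof -
 have "ci c xi \<in> PM" using chD(3)[OF charts_at_inv[OF a]] that(1) rc by blast
 hence "dst (ci c xi) (f b) <= dst (ci c xi) x + dst x (f b)" by (rule fdist_tri[OF _ xp f_points[OF that(2)]])
 thus ?thesis using e(2)[of xi] r that n unfolding near_def by force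
qed
obtain C where C: "0 <= C"
 "!!xi q X. xi \<in> cball ?xi r ==> q \<in> PM ==> dst (ci c xi) q < rh ==> norm (gE c xi q) <= C"
 "!!xi q X. xi \<in> cball ?xi r ==> q \<in> PM ==> dst (ci c xi) q < rh ==> norm (fd (%xi. gE c xi q) xi X) <= C * norm X"
 using gE_lipschitz[OF a rc r(1)] by metis
define D where "D b = fd (%xi. gE c xi (f b)) ?xi" for b
have dD: "((%xi. gE c xi (f b)) hfd fd (%xi. gE c xi (f b)) xi) (at xi)" if "xi \<in> cball ?xi r" "b \<in> space A" for xi b
proof -
 have x: "xi \<in> cdom c" using rc that by blast
 show ?thesis using gE_deriv(1)[OF charts_at_inv[OF a x] f_points[OF that(2)] d[OF that]] chart_inv(2)[OF a x] by simp
qed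
have m: "(%b. gE c xi (f b)) \<in> borel_measurable A" if "xi \<in> ball ?xi r" for xi
 unfolding gE_def by (rule exp_inv_measurable[OF charts_at_inv[OF a]]) (use that rc d in auto)
have i: "integrable A (%b. gE c ?xi (f b))"
 by (rule A.integrable_const_bound[where B = C]) (use C(2)[of ?xi] r m f_points dx ci in auto)
thus "integrable A (%a. exp_inv M x (f a) c)" by (simp add: gE_def ci)
have lip: "norm (gE c xi (f b) - gE c ?xi (f b)) <= C * norm (xi - ?xi)" if x: "xi \<in> ball ?xi r" and b: "b \<in> space A" for xi b
proof (rule differentiable_bound[where S = "cball ?xi r"])
 show "onorm (fd (%xi. gE c xi (f b)) xi') <= C" if "xi' \<in> cball ?xi r" for xi'
  by (rule onorm_bound[OF C(1)]) (rule C(3)[OF that f_points[OF b] d[OF that b]])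
 show "((%xi. gE c xi (f b)) hfd fd (%xi. gE c xi (f b)) xi') (at xi' within cball ?xi r)" if "xi' \<in> cball ?xi r" for xi'
  by (rule has_derivative_at_withinI[OF dD[OF that b]])
qed (use x r in auto)
have b0: "?xi \<in> cball ?xi r" using r by simp
note I = has_derivative_integral_prob[where g = "%xi b. gE c xi (f b)" and D = D, OF A r(1) C(1) m i _ _ lip]
have hd: "((%xi. \<integral>b. gE c xi (f b) \<partial>A) hfd (%X. \<integral>b. D b X \<partial>A)) (at ?xi)"
 by (rule I(1)) (use dD[OF b0] C(3)[OF b0 f_points d[OF b0]] in "auto simp: D_def")
have iD: "integrable A (%b. D b X)" for X
 by (rule I(2)) (use dD[OF b0] C(3)[OF b0 f_points d[OF b0]] in "auto simp: D_def")
have hv: "(field_coords c (mass_field M A f) hfd (%X. - (\<integral>b. D b X \<partial>A))) (at ?xi)"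
 unfolding field_coords_V by (rule has_derivative_minus[OF hd])
have DVe: "DV = (%X. - (\<integral>b. D b X \<partial>A))" unfolding DV_def by (rule fd_eqI[OF hv])
thus "(field_coords c (mass_field M A f) hfd DV) (at (snd c x))" using hv by simp
assume y: "y ~= 0"
have yS: "(?xi, y) \<in> C.S" using y in_cdom[OF c] by simp
let ?N = "%X. sqrt (C.G (?xi, y) X X)"
let ?B = "%b. D b X + Gm c ?xi (gE c ?xi (f b)) X"
have bG: "bounded_linear (%E. Gm c ?xi E X)" "bounded_linear (C.G (?xi, y) u)"
 using C.Gx_lin(1) C.lin_G(1)[OF yS] linear_conv_bounded_linear by blast+
have iB: "integrable A ?B" by (intro Bochner_Integration.integrable_add iD integrable_bounded_linear[OF bG(1) i])
have "C.G (?xi, y) u (?B b) <= 1/4 * (?N u * ?N X) - C.G (?xi, y) u X" if b: "b \<in> space A" for b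
proof -
 have "\<bar>C.G (?xi, y) u (?B b + X)\<bar> <= ?N u * ?N (?B b + X)" by (rule C.G_cauchy[OF yS])
 also have "... <= ?N u * (1/4 * ?N X)"
  using gE_deriv(2)[OF c f_points[OF b] dx[OF b] y, of X] ci by (intro mult_left_mono) (auto simp: D_def gE_def C.G_nonneg[OF yS])
 finally show ?thesis using linear_add[OF C.lin_G(1)[OF yS, of u], of "?B b" X] abs_ge_self[of "C.G (?xi, y) u (?B b + X)"] by linarith
qed
hence "(\<integral>b. C.G (?xi, y) u (?B b) \<partial>A) <= 1/4 * (?N u * ?N X) - C.G (?xi, y) u X"
 by (intro A.integral_le_const integrable_bounded_linear[OF bG(2) iB] AE_I2) auto
moreover have "(\<integral>b. C.G (?xi, y) u (?B b) \<partial>A) = C.G (?xi, y) u (\<integral>b. ?B b \<partial>A)"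
 by (rule integral_bounded_linear[OF bG(2) iB])
moreover have "(\<integral>b. ?B b \<partial>A) = (\<integral>b. D b X \<partial>A) + Gm c ?xi (\<integral>b. gE c ?xi (f b) \<partial>A) X"
 using iD i integrable_bounded_linear[OF bG(1) i] integral_bounded_linear[OF bG(1) i] by simp
moreover have "DV X + Gm c ?xi (mass_field M A f x c) X = - ((\<integral>b. D b X \<partial>A) + Gm c ?xi (\<integral>b. gE c ?xi (f b) \<partial>A) X)"
 unfolding DVe using linear_neg[OF C.Gx_lin(1)] ci by (simp add: mass_field_def gE_def)
ultimately show "C.G (?xi, y) u X - 1/4 * (?N u * ?N X) <= C.G (?xi, y) u (DV X + Gm c ?xi (mass_field M A f x c) X)"
 by (simp only: linear_neg[OF C.lin_G(1)[OF yS]])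
qed

lemma V_tangent: assumes x: "x \<in> PM" and n: "near A f x" shows "mass_field M A f x \<in> TM x"
proof -
have E: "exp_inv M x (f a) \<in> TM x" if "a \<in> space A" for a
 using exp_inv(1)[OF x f_points[OF that]] n that r0 by (force simp: near_def)
have "mass_field M A f x c' = Dt c c' x (mass_field M A f x c)" if c: "c \<in> Ch x" "c' \<in> Ch x" for c c'
proof -
 have "bounded_linear (Dt c c' x)" using Dt_linear[OF c] linear_conv_bounded_linear by blast
 note bl = integral_bounded_linear[OF this V_deriv(1)[OF c(1) n]]
 have "(\<integral>a. exp_inv M x (f a) c' \<partial>A) = (\<integral>a. Dt c c' x (exp_inv M x (f a) c) \<partial>A)"
  by (rule Bochner_Integration.integral_cong[OF refl]) (rule tangentD(1)[OF E c])
 also note bl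
 finally show ?thesis by (simp add: mass_field_def linear_neg[OF Dt_linear[OF c]])
qed
moreover have "mass_field M A f x c = 0" if "c \<notin> Ch x" for c
proof -
 have "(\<integral>a. exp_inv M x (f a) c \<partial>A) = (\<integral>a. 0 \<partial>A)"
  by (rule Bochner_Integration.integral_cong[OF refl]) (rule tangentD(2)[OF E that])
 thus ?thesis by (simp add: mass_field_def)
qed
ultimately show ?thesis unfolding tangent_def by blast
qed

end

end

section \<open>Existence and uniqueness of the centre of mass\<close>

lemma continuous_near:
assumes "continuous (at 0 within {0..d}) h" "0 < (e :: real)"
obtains e1 where "0 < e1" "!!s. 0 <= s ==> s <= d ==> s < e1 ==> dist (h (s :: real)) (h 0) < e"
proof -
obtain e1 where "0 < e1" "!!s. s \<in> {0..d} ==> dist s 0 < e1 ==> dist (h s) (h 0) < e"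
 using assms unfolding continuous_within_eps_delta by blast
thus ?thesis by (intro that[of e1]) auto
qed

context berwald_mfd
begin

lemma ip_along:
assumes cont: "cmap I ga" and t: "t \<in> I" and c: "c \<in> Ch (ga t)"
 and x: "((%s. snd c (ga s)) hvd w) (at t within I)"
 and Y: "((%s. Y s c) hvd y' - Gm c (snd c (ga t)) w (Y t c)) (at t within I)"
 and A: "((%s. A s c) hvd a' - Gm c (snd c (ga t)) w (A t c)) (at t within I)"
 and B: "((%s. B s c) hvd b' - Gm c (snd c (ga t)) w (B t c)) (at t within I)"
 and tan: "!!s. s \<in> I ==> Y s \<in> TM (ga s) & Y s ~= tzero & A s \<in> TM (ga s) & B s \<in> TM (ga s)"
shows "((%s. ip (ga s) (Y s) (A s) (B s)) hrd
 GG c (snd c (ga t), Y t c) a' (B t c) + GG c (snd c (ga t), Y t c) (A t c) b'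
  + cmetric.DG (LM c) (snd c (ga t), Y t c) (0, y') (A t c) (B t c)) (at t within I)"
proof -
interpret C: cberwald "LM c" "cdom c" by (rule chb[OF c])
obtain e where e: "0 < e" "!!s. s \<in> I ==> \<bar>s - t\<bar> < e ==> c \<in> Ch (ga s)" using near_chart[OF cont t c] by blast
have near: "(snd c (ga s), Y s c) \<in> C.S" if "s \<in> I" "\<bar>s - t\<bar> < e" for s
 using pair_in_S[OF e(2)[OF that]] nz_chart[OF _ _ e(2)[OF that]] tan[OF that(1)] by blast
show ?thesis unfolding has_real_derivative_iff_has_vector_derivative
proof (rule has_vd_near[OF C.metric_along[OF x Y A B t e(1) near] t e(1)])
 fix s assume s: "s \<in> I" "\<bar>s - t\<bar> < e"
 thus "C.G (snd c (ga s), Y s c) (A s c) (B s c) = ip (ga s) (Y s) (A s) (B s)"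
  using ip_chart[of "Y s" "ga s" "A s" "B s" c] tan[OF s(1)] e(2)[OF s] by simp
qed
qed

end

section \<open>The distance from the centre of the ball\<close>

context cm_mfd
begin

lemma fdist_continuous:
fixes I :: "real set"
assumes p: "p \<in> PM" and cont: "cmap I ga" and t: "t \<in> I" and d: "dst p (ga t) < rh"
shows "continuous (at t within I) (%s. dst p (ga s))"
proof -
obtain c where c: "c \<in> Ch p" using cover p by blast
note a = chD(1)[OF c]
have b: "LM c (snd c p, et) < rh ==> (snd c p, et) \<in> ZZ c" for et using in_cdom[OF c] by (simp add: ZZ_def)
note B = nb_ZZ[OF a] in_cdom[OF c] b
have ci: "ci c (snd c p) = p" using chart_inv(1)[OF chD(1,2)[OF c]] .
have U: "UU c (snd c p) rh = {ex c (snd c p, et) | et. LM c (snd c p, et) < rh}" by (rule UU_def[OF B])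
have "ga t \<in> UU c (snd c p) rh" unfolding U using gE_ZZ(3,4)[OF c curve_points[OF cont t] d] d by (metis (mono_tags, lifting) mem_Collect_eq)
from nb_near[where ga = ga and t = t and \<delta> = rh, OF B cont t] this obtain e where e: "0 < e" "!!s. s \<in> I ==> \<bar>s - t\<bar> < e ==> ga s \<in> UU c (snd c p) rh"
 and h: "continuous (at t within I) (%s. LM c (snd c p, gE c (snd c p) (ga s)))" by blast
have "LM c (snd c p, gE c (snd c p) (ga s)) = dst p (ga s)" if s: "s \<in> I" "\<bar>s - t\<bar> < e" for s
proof -
 have "dst p (ga s) < rh" using e(2)[OF s] nb_dist[OF B, of rh] ci unfolding U by force
 thus ?thesis using gE_ZZ(1,4)[OF c curve_points[OF cont s(1)]] by simp
qed
thus ?thesis using continuous_transform_within[OF h e(1) t] by (simp add: dist_real_def)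
qed

lemma V_along:
assumes A: "prob_space A" "f \<in> A \<rightarrow>\<^sub>M borel_of_space M" and cont: "cmap I ga" and t: "t \<in> I"
 and c: "c \<in> Ch (ga t)" and n: "near A f (ga t)" and x: "((%s. snd c (ga s)) hvd w) (at t within I)"
defines "V \<equiv> mass_field M A f"
defines "y' \<equiv> fd (field_coords c V) (snd c (ga t)) w + Gm c (snd c (ga t)) (V (ga t) c) w"
shows "((%s. V (ga s) c) hvd y' - Gm c (snd c (ga t)) w (V (ga t) c)) (at t within I)"
proof -
interpret C: cberwald "LM c" "cdom c" by (rule chb[OF c])
obtain e where e: "0 < e" "!!s. s \<in> I ==> \<bar>s - t\<bar> < e ==> c \<in> Ch (ga s)" using near_chart[OF cont t c] by blast
have i: "field_coords c V (snd c (ga s)) = V (ga s) c" if "s \<in> I" "\<bar>s - t\<bar> < e" for s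
 using chart_inv(1) chD[OF e(2)[OF that]] by (simp add: field_coords_def)
have "y' - Gm c (snd c (ga t)) w (V (ga t) c) = fd (field_coords c V) (snd c (ga t)) w"
 unfolding y'_def using C.Gx_sym[OF in_cdom[OF c]] by simp
thus ?thesis
 using has_vd_near[OF has_vd_compose[OF x V_deriv(2)[OF A c n]] t e(1) i[unfolded V_def]] unfolding V_def by simp
qed

text \<open>The outward radial vector: near \<open>p\<close> it is the final velocity of the
  geodesic from \<open>p\<close> to \<open>x\<close>.\<close>

definition "rad p x = tscale (- 1) (exp_inv M x p)"

lemma rho_half: "rh / (2 * Lm) <= rh"
using r0 L1 mult_right_mono[of 1 "2 * Lm" rh] by (simp add: field_simps)

text \<open>A forward distance below \<open>rh / (2 * Lm)\<close> keeps the backward distance below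
  \<open>rh / 2\<close>, so that \<open>exp_inv M x\<close> at \<open>p\<close> finds precisely the
  reversed geodesic.\<close>

lemma rad:
assumes p: "p \<in> PM" and x: "x \<in> PM" and d: "dst p x < rh / (2 * Lm)"
shows "dst x p < rh / 2" "rad p x \<in> TM x" "fnorm M x (rad p x) = dst p x"
proof -
define v where "v = exp_inv M p x"
note v = exp_inv[OF p x order.strict_trans2[OF d rho_half], folded v_def]
let ?N = "gvel p v 1"
have N: "tscale (- 1) ?N \<in> TM x" using tangent_tscale[OF gvel_tangent[OF v(1) p, of 1]] v(3) by simp
have L: "Lm * dst p x < rh / 2" using d L1 by (simp add: field_simps)
have "fnorm M x (tscale (- 1) ?N) = fnorm M p (tscale (- 1) v)" using fnorm_gvel[OF v(1) p, of 1 "- 1"] v(3) by simp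
also have "... <= Lm * dst p x" using fnorm_minus[OF p v(1)] v(2) by simp
finally have F: "fnorm M x (tscale (- 1) ?N) < rh / 2" using L by simp
have g: "geo x (tscale (- 1) ?N) 1 = p" using geo_reverse(1)[OF v(1) p, of 1 1] geo(2)[OF v(1) p] v(3) by simp
show "dst x p < rh / 2" using geo_fdist(1)[OF N x] g F by simp
have "exp_inv M x p = tscale (- 1) ?N" using exp_inv_geo(1)[OF x N] g F r0 by simp
hence T: "rad p x = ?N" by (simp add: rad_def tscale_def)
show "rad p x \<in> TM x" "fnorm M x (rad p x) = dst p x"
 unfolding T using gvel_tangent[OF v(1) p, of 1] fnorm_gvel[OF v(1) p, of 1 1] v by (simp_all add: tscale_one)
qed

text \<open>Exhibits the radial field as the mass field of a constant map, so that the derivative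
  estimates for \<open>V\<close> apply to it.\<close>

lemma point_mass:
assumes p: "p \<in> PM" and A: "prob_space A"
shows "(%_. p) \<in> A \<rightarrow>\<^sub>M borel_of_space M" "mass_field M A (%_. p) = rad p" "dst x p < rh / 2 ==> near A (%_. p) x"
proof -
interpret A: prob_space A by (rule A)
show m: "(%_. p) \<in> A \<rightarrow>\<^sub>M borel_of_space M" using p by (simp add: borel_of_space_def space_measure_of_conv)
show "mass_field M A (%_. p) = rad p" by (simp add: fun_eq_iff mass_field_def rad_def tscale_def A.prob_space)
show "dst x p < rh / 2 ==> near A (%_. p) x" by (simp add: near_def)
qed

text \<open>First variation and convexity of the squared distance from \<open>p\<close>. Cartan
  terms vanish because the radial vector is both reference vector and argument. By the Gauss lemma
  the covariant derivative of the radial field along \<open>w\<close> has the same radial component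
  as \<open>w\<close>. In the second part \<open>B\<close> stands for the velocity of a
  geodesic.\<close>

lemma dist_variation:
assumes p: "p \<in> PM" and cont: "cmap I ga" and t: "t \<in> I"
 and d: "!!s. s \<in> I ==> dst p (ga s) < rh / (2 * Lm) & 0 < dst p (ga s)"
 and c: "c \<in> Ch (ga t)" and x: "((%s. snd c (ga s)) hvd w) (at t within I)"
shows "((%s. (dst p (ga s))^2) hrd 2 * GG c (snd c (ga t), rad p (ga t) c) (rad p (ga t) c) w) (at t within I)"
 "w ~= 0 ==> (!!s. s \<in> I ==> B s \<in> TM (ga s)) ==> B t c = w ==>
  ((%s. B s c) hvd 0 - Gm c (snd c (ga t)) w w) (at t within I) ==>
  EX g'>0. ((%s. ip (ga s) (rad p (ga s)) (rad p (ga s)) (B s)) hrd g') (at t within I)"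
proof -
\<comment> \<open>The one-point probability space, carrying the constant map with value
  \<open>p\<close>.\<close>
have A: "prob_space (return (count_space UNIV) ())" by (rule prob_space_return) simp
note pm = point_mass[OF p A]
interpret C: cberwald "LM c" "cdom c" by (rule chb[OF c])
have T: "dst (ga s) p < rh / 2" "rad p (ga s) \<in> TM (ga s)" "fnorm M (ga s) (rad p (ga s)) = dst p (ga s)" "rad p (ga s) ~= tzero"
 if "s \<in> I" for s
proof -
 note g = curve_points[OF cont that]
 show h: "dst (ga s) p < rh / 2" "rad p (ga s) \<in> TM (ga s)" "fnorm M (ga s) (rad p (ga s)) = dst p (ga s)"
  using rad[OF p g] d[OF that] by auto
 show "rad p (ga s) ~= tzero" using h(3) d[OF that] fnorm_tzero[OF g] by auto
qed
let ?x = "snd c (ga t)" and ?T = "rad p (ga t) c"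
define y' where "y' = fd (field_coords c (rad p)) ?x w + Gm c ?x ?T w"
note n = pm(3)[OF T(1)[OF t]]
note TA = V_along[OF A pm(1) cont t c n x, unfolded pm(2), folded y'_def]
have T0: "?T ~= 0" using nz_chart[OF T(2,4)[OF t] c] .
have zS: "(?x, ?T) \<in> C.S" by (rule pair_in_S[OF c T0])
have "dst (ga t) p < rh" using T(1)[OF t] r0 by simp
note g = gE_deriv[OF c p this]
have Tc: "?T = - exp_inv M (ga t) p c" by (simp add: rad_def tscale_def)
have f: "field_coords c (rad p) = (%xi. - gE c xi p)" by (simp add: fun_eq_iff field_coords_def rad_def tscale_def gE_def)
have "fd (field_coords c (rad p)) ?x = (%X. - fd (%xi. gE c xi p) ?x X)" unfolding f by (rule fd_eqI[OF has_derivative_minus[OF g(1)]])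
hence y'e: "y' = - (fd (%xi. gE c xi p) ?x w + Gm c ?x (exp_inv M (ga t) p c) w)"
 unfolding y'_def Tc linear_neg[OF C.Gx_lin(1)] by simp
have "C.G (?x, ?T) ?T y' = - C.G (?x, ?T) ?T (fd (%xi. gE c xi p) ?x w + Gm c ?x (exp_inv M (ga t) p c) w)"
 unfolding y'e by (rule linear_neg[OF C.lin_G(1)[OF zS]])
hence Ty: "C.G (?x, ?T) ?T y' = C.G (?x, ?T) ?T w" using g(3)[of w] T0 unfolding Tc by simp
have "((%s. ip (ga s) (rad p (ga s)) (rad p (ga s)) (rad p (ga s))) hrd 2 * C.G (?x, ?T) ?T w) (at t within I)"
 using ip_along[where ga = ga and t = t and Y = "%s. rad p (ga s)" and A = "%s. rad p (ga s)" and y' = y' and a' = y' and B = "%s. rad p (ga s)" and b' = y', OF cont t c x TA TA TA] T Ty C.G_sym[OF zS, of y'] C.DG_y(1)[OF zS] by simp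
thus "((%s. (dst p (ga s))^2) hrd 2 * C.G (?x, ?T) ?T w) (at t within I)"
 by (rule has_field_derivative_transform_within[OF _ zero_less_one t]) (use T fnorm_ip[OF curve_points[OF cont]] in auto)
assume w: "w ~= 0" and B: "!!s. s \<in> I ==> B s \<in> TM (ga s)" "B t c = w"
 and Bd: "((%s. B s c) hvd 0 - Gm c ?x w w) (at t within I)"
have "((%s. ip (ga s) (rad p (ga s)) (rad p (ga s)) (B s)) hrd C.G (?x, ?T) y' w) (at t within I)"
 using ip_along[where ga = ga and t = t and Y = "%s. rad p (ga s)" and A = "%s. rad p (ga s)" and y' = y' and a' = y' and B = B and b' = 0, OF cont t c x TA TA] Bd T B C.DG_y(1)[OF zS] linear_0[OF C.lin_G(1)[OF zS]] by simp
moreover have "3/4 * C.G (?x, ?T) w w <= C.G (?x, ?T) w y'"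
 using V_deriv(3)[OF A pm(1) c n T0, of w w, unfolded pm(2), folded y'_def] C.G_nonneg[OF zS, of w] by simp
hence "0 < C.G (?x, ?T) y' w" using C.G_pos[OF zS w] C.G_sym[OF zS, of y' w] by simp
ultimately show "EX g'>0. ((%s. ip (ga s) (rad p (ga s)) (rad p (ga s)) (B s)) hrd g') (at t within I)" by blast
qed

section \<open>The closed ball and the zeros of \<open>V\<close>\<close>

definition "KB p r = {x \<in> PM. dst p x <= r}"

context
fixes p :: 'm and r :: real and A :: "'a measure" and f
assumes p: "p \<in> PM" and r: "0 < r" "8 * Lm^2 * r < rh" and A: "prob_space A" and f: "f \<in> A \<rightarrow>\<^sub>M borel_of_space M"
 and fr0: "ALL a:space A. dst p (f a) < r"
begin

lemmas fr = bspec[OF fr0]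

text \<open>In the factor \<open>8 * Lm^2\<close> one \<open>Lm\<close> pays for reversing distances
  and the other for the radius \<open>rh / (2 * Lm)\<close> on which the radial field is
  controlled.\<close>

lemma rL: "8 * Lm * r < rh" "8 * r < rh" "r <= Lm * r" "3 * Lm * r < rh / (2 * Lm)"
proof -
show a: "r <= Lm * r" using L1 r mult_right_mono[of 1 Lm r] by simp
have b: "Lm * r <= Lm * (Lm * r)" using mult_left_mono[OF a, of Lm] L1 by simp
have c: "8 * (Lm * (Lm * r)) < rh" using r(2) by (simp add: power2_eq_square mult.assoc)
show "8 * Lm * r < rh" "8 * r < rh" using a b c by linarith+
have "Lm * (Lm * (r * 6)) < rh" using a b c r(1) by linarith
thus "3 * Lm * r < rh / (2 * Lm)" using L1 by (simp add: field_simps)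
qed

lemma dist_back: assumes x: "x \<in> PM" and d: "dst p x <= r" shows "dst x p <= Lm * r"
proof -
have "dst p x < rh" using d rL r by linarith
note v = exp_inv[OF p x this]
have "dst x p <= Lm * dst p x" using geo_fdist(3)[OF v(1) p] fnorm_minus[OF p v(1)] v by simp
also have "... <= Lm * r" using d L1 by (intro mult_left_mono) auto
finally show ?thesis .
qed

lemma dist_in: assumes x: "x \<in> PM" "dst p x <= r" and y: "y \<in> PM" "dst p y <= r"
shows "dst x y <= 2 * Lm * r"
using dist_back[OF x] fdist_tri[OF x(1) p y(1)] y rL by linarith

lemma near_KB: assumes "x \<in> PM" "!!a. a \<in> space A ==> dst x (f a) <= 4 * Lm * r" shows "near A f x"
using assms rL by (force simp: near_def)

lemma KB: assumes "x \<in> KB p r" shows "x \<in> PM" "dst p x <= r" "near A f x" "a \<in> space A ==> dst x (f a) < rh"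
proof -
show x: "x \<in> PM" "dst p x <= r" using assms by (auto simp: KB_def)
have d: "dst x (f a) <= 2 * Lm * r" if "a \<in> space A" for a
 using dist_in[OF x f_points[OF A f that]] fr[OF that] by simp
have h: "2 * Lm * r <= 4 * Lm * r" "2 * Lm * r < rh" using rL r by linarith+
show "near A f x" by (rule near_KB[OF x(1) order_trans[OF d h(1)]])
show "a \<in> space A ==> dst x (f a) < rh" by (rule le_less_trans[OF d h(2)])
qed

text \<open>The squared distance from \<open>p\<close> is convex along the geodesic from
  \<open>q\<close> to \<open>y\<close> and falls below its initial value, so its initial derivative
  is negative.\<close>

lemma boundary_angle:
assumes q: "q \<in> KB p r" "dst p q = r" and y: "y \<in> PM" "dst p y < r" and c: "c \<in> Ch q"
shows "GG c (snd c q, rad p q c) (rad p q c) (exp_inv M q y c) < 0"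
proof -
note qp = KB(1,2)[OF q(1)]
have dq: "dst q y <= 2 * Lm * r" "dst q y < rh" using dist_in[OF qp y(1)] y rL r by linarith+
define v where "v = exp_inv M q y"
note v = exp_inv[OF qp(1) y(1) dq(2), folded v_def]
let ?s = "geo q v" and ?w = "gvel q v"
have s0: "?s 0 = q" "?w 0 = v" using geo(2,3)[OF v(1) qp(1)] .
have "v ~= tzero" using geo_tzero(1)[OF qp(1), of 1] v(3) q(2) y(2) by auto
note w0 = gvel_nonzero[OF v(1) qp(1) this]
have sp: "?s t \<in> PM" if "0 <= t" for t by (rule geo_points[OF v(1) qp(1) that])
have bd: "dst p (?s t) < rh / (2 * Lm)" if t: "t \<in> {0..1}" for t
proof -
 have "dst q (?s t) <= t * dst q y" using geo_fdist_le[OF v(1) qp(1), of 0 t] t s0 v(2) by simp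
 also have "... <= 1 * (2 * Lm * r)" using t dq(1) fdist_nonneg[OF qp(1) y(1)] by (intro mult_mono) auto
 finally have "dst p (?s t) <= r + 2 * Lm * r" using fdist_tri[OF p qp(1) sp[of t]] t q(2) by simp
 thus ?thesis using rL by simp
qed
have bd': "dst p (?s t) < rh" if "t \<in> {0..1}" for t
 using bd[OF that] rho_half by linarith
have cont: "cmap J ?s" if "J <= {0..}" for J
 using continuous_map_from_subtopology_mono[OF geodesic_cont[OF geo(1)[OF v(1) qp(1)]]] that by blast
have hc: "continuous_on {0..1} (%t. dst p (?s t))"
 unfolding continuous_on_eq_continuous_within using fdist_continuous[OF p cont _ bd'] by simp
\<comment> \<open>The geodesic is followed only until the distance has fallen to
  \<open>l > 0\<close>: at \<open>p\<close> itself the radial vector is zero and cannot be a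
  reference vector.\<close>
define l where "l = max (dst p y) (r / 2)"
have l: "0 < l" "l < r" "dst p y <= l" using y(2) r by (auto simp: l_def)
let ?S = "{0..1} Int (%t. dst p (?s t)) -` {..l}"
have "compact ?S" using continuous_closed_preimage[OF hc closed_atLeastAtMost closed_atMost] bounded_subset[OF bounded_closed_interval]
 by (auto simp: compact_eq_bounded_closed)
moreover have "1 \<in> ?S" using v(3) l(3) by simp
ultimately obtain u where u: "u \<in> ?S" "!!t. t \<in> ?S ==> u <= t" using compact_attains_inf[of ?S] by blast
have u0: "0 < u" "u <= 1" using u(1) s0 q(2) l by (auto simp: less_le)
have pos: "0 < dst p (?s t)" if "t \<in> {0..<u}" for t using u(2)[of t] that u0 l(1) by force
let ?g = "%t. ip (?s t) (rad p (?s t)) (rad p (?s t)) (?w t)"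
have D: "((%t. (dst p (?s t))^2) hrd 2 * ?g t) (at t within {0..<u})"
 "EX g'>0. (?g hrd g') (at t within {0..<u})" if t: "t \<in> {0..<u}" for t
proof -
 have t0: "0 <= t" using t by simp
 obtain c where c: "c \<in> Ch (?s t)" using cover[OF sp[OF t0]] by blast
 have co: "cmap {0..<u} ?s" by (rule cont) auto
 have dd: "!!s. s \<in> {0..<u} ==> dst p (?s s) < rh / (2 * Lm) & 0 < dst p (?s s)" using bd pos u0 by auto
 note gc = geo_coord[OF v(1) qp(1) t0 c] and wt = gvel_tangent[OF v(1) qp(1)]
 have sub: "{0..<u} <= {0..}" by auto
 note gc' = hvd_sub[OF gc(1) sub] hvd_sub[OF gc(2) sub]
 note dv = dist_variation[OF p co t dd c gc'(1)]
 have T: "rad p (?s t) \<in> TM (?s t)" "rad p (?s t) ~= tzero"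
  using rad[OF p sp[OF t0]] dd[OF t] fnorm_tzero[OF sp[OF t0]] by auto
 show "((%t. (dst p (?s t))^2) hrd 2 * ?g t) (at t within {0..<u})"
  using dv(1) ip_chart[OF T T(1) wt[OF t0] c] by simp
 show "EX g'>0. (?g hrd g') (at t within {0..<u})"
  by (rule dv(2)[where B = ?w]) (use nz_chart[OF wt[OF t0] w0[OF t0] c] wt gc'(2) in auto)
qed
\<comment> \<open>A parameter at which the derivative of the squared distance is negative;
  monotonicity of \<open>?g\<close> carries the sign back to 0.\<close>
obtain s where s: "0 < s" "s < u" "(dst p (?s u))^2 - r^2 = 2 * ?g s * u"
proof (rule mvt[OF u0(1), of "%t. (dst p (?s t))^2" "%t. (*) (2 * ?g t)"])
 show "continuous_on {0..u} (%t. (dst p (?s t))^2)" by (intro continuous_intros continuous_on_subset[OF hc]) (use u0 in auto)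
 show "((%t. (dst p (?s t))^2) hfd (*) (2 * ?g t)) (at t)" if "0 < t" "t < u" for t
  using D(1)[of t] at_within_interior[of t "{0..<u}"] that by (simp add: has_field_derivative_def)
qed (use s0 q(2) in auto)
have "(dst p (?s u))^2 < r^2" using u(1) l fdist_nonneg[OF p sp[of u]] u0 by (intro power_strict_mono) auto
hence n: "2 * ?g s * u < 0" using s(3) by linarith
have gs: "?g s < 0"
proof (rule ccontr)
 assume "\<not> ?g s < 0"
 hence "0 <= 2 * ?g s * u" using u0 by (intro mult_nonneg_nonneg) auto
 thus False using n by linarith
qed
have "EX g'. ALL t:{0..<u}. 0 < g' t & (?g hrd g' t) (at t within {0..<u})"
 by (rule bchoice[OF ballI]) (rule D(2))
then obtain g' where "ALL t:{0..<u}. 0 < g' t & (?g hrd g' t) (at t within {0..<u})" ..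
note g' = bspec[OF this]
have sub: "{0..s} <= {0..<u}" using s by auto
have gd: "(?g hfd (*) (g' t)) (at t within {0..s})" if "0 <= t" "t <= s" for t
proof -
 have "t \<in> {0..<u}" using that s by simp
 from DERIV_subset[OF conjunct2[OF g'[OF this]] sub] show ?thesis by (simp only: has_field_derivative_def)
qed
obtain x where x: "x \<in> {0<..<s}" "?g s - ?g 0 = g' x * (s - 0)" using mvt_simple[OF s(1) gd] by blast
have "0 < g' x * s" using g' x(1) s by auto
hence "?g 0 < ?g s" using x(2) by simp
hence "?g 0 < 0" using gs by simp
moreover have "rad p q \<in> TM q" "rad p q ~= tzero"
 using rad[OF p qp(1)] bd[of 0] fnorm_tzero[OF qp(1)] s0 q(2) r by auto
ultimately show ?thesis using ip_chart[OF _ _ _ v(1) c] s0 by (simp add: v_def)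
qed

text \<open>The vectors averaged all point strictly inwards, and so does their mean;
  \<open>V\<close> carries the opposite sign.\<close>

lemma V_boundary:
assumes q: "q \<in> KB p r" "dst p q = r" and c: "c \<in> Ch q"
shows "0 < GG c (snd c q, rad p q c) (rad p q c) (mass_field M A f q c)"
proof -
interpret A: prob_space A by (rule A)
interpret C: cberwald "LM c" "cdom c" by (rule chb[OF c])
note k = KB[OF q(1)]
have d: "dst p q < rh / (2 * Lm)" using rL q r by linarith
have "rad p q \<in> TM q" "rad p q ~= tzero" using rad[OF p k(1) d] fnorm_tzero[OF k(1)] q(2) r by auto
hence zS: "(snd c q, rad p q c) \<in> C.S" by (intro pair_in_S[OF c] nz_chart[OF _ _ c])
have bG: "bounded_linear (C.G (snd c q, rad p q c) (rad p q c))" using C.lin_G(1)[OF zS] linear_conv_bounded_linear by blast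
note i = V_deriv(1)[OF A f c k(3)]
have "(\<integral>a. C.G (snd c q, rad p q c) (rad p q c) (exp_inv M q (f a) c) \<partial>A) < (\<integral>a. 0 \<partial>A)"
 by (rule A.integral_less_AE_space[OF integrable_bounded_linear[OF bG i]])
  (use boundary_angle[OF q f_points[OF A f] fr c] A.emeasure_space_1 in auto)
thus ?thesis using integral_bounded_linear[OF bG i] linear_neg[OF C.lin_G(1)[OF zS]] by (simp add: mass_field_def)
qed

abbreviation (input) "V \<equiv> mass_field M A f"
abbreviation (input) "K \<equiv> KB p r"

text \<open>With \<open>V\<close> as reference vector the derivative of \<open>F(V)^2\<close> in
  direction \<open>- V\<close> is at most \<open>- 3/2 * F(V)^2\<close>. From an interior point a
  small move stays in the ball; on the boundary \<open>V\<close> points outwards, so the distance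
  from \<open>p\<close> decreases.\<close>

lemma V_decreases:
assumes q: "q \<in> K" and v: "V q ~= tzero"
shows "EX x:K. fnorm M x (V x) < fnorm M q (V q)"
proof -
note k = KB[OF q]
have V: "V q \<in> TM q" by (rule V_tangent[OF A f k(1,3)])
obtain c where c: "c \<in> Ch q" using cover k(1) by blast
note a = chD(1)[OF c]
interpret C: cberwald "LM c" "cdom c" by (rule cberwald[OF a])
let ?x = "snd c q" and ?v = "V q c" and ?F = "field_coords c V"
have v0: "?v ~= 0" by (rule nz_chart[OF V v c])
have zS: "(?x, ?v) \<in> C.S" by (rule pair_in_S[OF c v0])
have Fq: "?F ?x = ?v" using chart_inv(1)[OF chD(1,2)[OF c]] by (simp add: field_coords_def)
obtain e where e: "0 < e" "ball ?x e <= cdom c" using in_cdom[OF c] chart_open(2)[OF a] open_contains_ball by blast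
define d where "d = e / (2 * norm ?v)"
have d: "0 < d" using e v0 by (simp add: d_def)
\<comment> \<open>A straight line in the chart is enough, since only first derivatives at 0
  enter.\<close>
let ?l = "%s. ?x - s *R ?v" and ?g = "%s. ci c (?x - s *R ?v)"
have l: "?l s \<in> cdom c" if "s \<in> {0..d}" for s
proof -
 have "s * norm ?v <= d * norm ?v" by (rule mult_right_mono) (use that in auto)
 also have "... < e" using e v0 by (simp add: d_def)
 finally show ?thesis using e that by (intro subsetD[OF e(2)]) (simp add: dist_norm)
qed
have gl: "snd c (?g s) = ?l s" "c \<in> Ch (?g s)" if "s \<in> {0..d}" for s
 using chart_inv(2)[OF a l[OF that]] charts_at_inv[OF a l[OF that]] by auto
have cl: "continuous_map (top_of_set {0..d}) (top_of_set (cdom c)) ?l"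
 using l by (auto intro!: continuous_intros)
have cont: "cmap {0..d} ?g"
 using continuous_map_compose[OF cl chart_cont(2)[OF a]] by (simp add: o_def)
have z: "0 \<in> {0..d}" using d by simp
have g0: "?g 0 = q" using chart_inv(1)[OF chD(1,2)[OF c]] by simp
have "(?l hvd - ?v) (at 0 within {0..d})" by (auto intro!: derivative_eq_intros)
hence x: "((%s. snd c (?g s)) hvd - ?v) (at 0 within {0..d})"
 by (rule has_vd_near[OF _ z zero_less_one]) (use gl in auto)
let ?L = "%s. LM c (?l s, ?F (?l s))"
define y' where "y' = fd ?F ?x (- ?v) + Gm c ?x ?v (- ?v)"
have lx: "(?l hvd - ?v) (at 0 within {0..d})" by (auto intro!: derivative_eq_intros)
have "(?F hfd fd ?F ?x) (at (?l 0))" using V_deriv(2)[OF A f c k(3)] by simp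
from has_vd_compose[OF lx this]
have "((%s. ?F (?l s)) hvd fd ?F ?x (- ?v)) (at 0 within {0..d})" .
moreover have "fd ?F ?x (- ?v) = y' - Gm c ?x (- ?v) ?v" unfolding y'_def using C.Gx_sym[OF in_cdom[OF c]] by simp
ultimately have Fd: "((%s. ?F (?l s)) hvd y' - Gm c (?l 0) (- ?v) (?F (?l 0))) (at 0 within {0..d})" using Fq by simp
have "continuous (at 0 within {0..d}) (%s. ?F (?l s))" by (rule has_vector_derivative_continuous[OF Fd])
\<comment> \<open>Keeps \<open>V\<close> nonzero along the start of the line, where it is the
  reference vector.\<close>
then obtain e1 where e1: "0 < e1" "!!s. 0 <= s ==> s <= d ==> s < e1 ==> dist (?F (?l s)) (?F (?l 0)) < norm ?v"
 using continuous_near[of d "%s. ?F (?l s)" "norm ?v"] v0 by (metis zero_less_norm_iff)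
have near: "(?l s, ?F (?l s)) \<in> C.S" if "s \<in> {0..d}" "\<bar>s - 0\<bar> < e1" for s using e1(2)[of s] l[of s] that Fq by auto
have "((%s. C.G (?l s, ?F (?l s)) (?F (?l s)) (?F (?l s))) hvd 2 * C.G (?x, ?v) ?v y') (at 0 within {0..d})"
 using C.metric_along[OF lx Fd Fd Fd z e1(1) near] Fq C.DG_y(1)[OF zS] C.G_sym[OF zS, of y'] by simp
hence Q: "((%s. C.Q (?l s, ?F (?l s))) hrd 2 * C.G (?x, ?v) ?v y') (at 0 within {0..d})"
 unfolding has_real_derivative_iff_has_vector_derivative
 by (rule has_vd_near[OF _ z e1(1)]) (use C.G_y(2)[OF near] in simp)
have "3/4 * C.G (?x, ?v) ?v ?v <= - C.G (?x, ?v) ?v y'"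
 using V_deriv(3)[OF A f c k(3) v0, of "- ?v" "- ?v", folded y'_def] C.G_nonneg[OF zS, of ?v]
 by (simp add: linear_neg[OF C.lin_G(1)[OF zS]] linear_neg[OF C.lin_G(2)[OF zS]])
hence "2 * C.G (?x, ?v) ?v y' < 0" using C.G_pos[OF zS v0] by simp
from has_real_derivative_neg_dec_right[OF Q this] obtain d1 where d1: "0 < d1"
 "!!s. 0 < s ==> s <= d ==> s < d1 ==> C.Q (?l s, ?F (?l s)) < C.Q (?x, ?v)" using Fq by fastforce
have "dst p (?g 0) <= r" using k(2) g0 by simp
have rr: "r < rh / (2 * Lm)" "r < rh" using rL r by linarith+
obtain d2 where d2: "0 < d2" "!!s. 0 < s ==> s <= d ==> s < d2 ==> dst p (?g s) <= r"
proof -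
 have "dst p (?g 0) < rh" using k(2) g0 rr by simp
 note hc = fdist_continuous[OF p cont z this]
 show ?thesis
 proof (cases "dst p q < r")
  case True
  hence "0 < r - dst p q" by simp
  from continuous_near[OF hc this] obtain d2 where d2: "0 < d2"
   "!!s. 0 <= s ==> s <= d ==> s < d2 ==> dist (dst p (?g s)) (dst p (?g 0)) < r - dst p q" by blast
  have "dst p (?g s) <= r" if "0 < s" "s <= d" "s < d2" for s
   using d2(2)[of s] that unfolding g0 dist_real_def by linarith
  thus ?thesis by (rule that[OF d2(1)])
 next
  case False
  hence qr: "dst p q = r" using k(2) by simp
  have "0 < min r (rh / (2 * Lm) - r)" using r(1) rr(1) by simp
  from continuous_near[OF hc this] obtain d3 where d3: "0 < d3"
   "!!s. 0 <= s ==> s <= d ==> s < d3 ==> dist (dst p (?g s)) (dst p (?g 0)) < min r (rh / (2 * Lm) - r)" by blast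
  \<comment> \<open>Shortened so that the distance from \<open>p\<close> stays positive and below
    \<open>rh / (2 * Lm)\<close>, as \<open>dist_variation\<close> requires.\<close>
  define I where "I = {0..min d (d3 / 2)}"
  have I: "I <= {0..d}" "0 \<in> I" "!!s. s \<in> I ==> 0 <= s & s <= d & s < d3" using d d3(1) by (auto simp: I_def)
  have fI: "dst p (?g s) < rh / (2 * Lm) & 0 < dst p (?g s)" if "s \<in> I" for s
   using d3(2)[of s] I(3)[OF that] unfolding g0 qr dist_real_def by linarith
  have c0: "c \<in> Ch (?g 0)" using c g0 by simp
  have m1: "((%s. (dst p (?g s))^2) hrd 2 * GG c (?x, rad p q c) (rad p q c) (- ?v)) (at 0 within I)"
   using dist_variation(1)[OF p continuous_map_from_subtopology_mono[OF cont I(1)] I(2) fI c0 hvd_sub[OF x I(1)]] g0 by simp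
  have m2: "2 * GG c (?x, rad p q c) (rad p q c) (- ?v) < 0"
  proof -
   have t: "rad p q \<in> TM q" "rad p q ~= tzero" using rad[OF p k(1)] qr rr r(1) fnorm_tzero[OF k(1)] by auto
   show ?thesis using V_boundary[OF q qr c] linear_neg[OF C.lin_G(1)[OF pair_in_S[OF c nz_chart[OF t c]]]] by simp
  qed
  from has_real_derivative_neg_dec_right[OF m1 m2] obtain d4 where d4: "0 < d4"
   "ALL s>0. 0 + s \<in> I --> s < d4 --> (dst p (?g (0 + s)))^2 < (dst p (?g 0))^2" by blast
  show ?thesis
  proof (rule that[of "min d4 (d3 / 2)"])
   show "0 < min d4 (d3 / 2)" using d3 d4 by simp
   fix s assume "0 < s" "s <= d" "s < min d4 (d3 / 2)"
   hence "(dst p (?g s))^2 < r^2" using d4(2)[unfolded g0 qr add_0, rule_format, of s] by (simp add: I_def)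
   thus "dst p (?g s) <= r" using power2_less_imp_less[of "dst p (?g s)" r] r(1) by simp
  qed
 qed
qed
define s where "s = min d (min (d1 / 2) (d2 / 2))"
have s: "0 < s" "s <= d" "s < d1" "s < d2" "s \<in> {0..d}" using d d1(1) d2(1) by (auto simp: s_def)
have gp: "?g s \<in> PM" by (rule chD(3)[OF gl(2)[OF s(5)]])
hence gK: "?g s \<in> K" using d2(2)[OF s(1,2,4)] by (simp add: KB_def)
have "fnorm M (?g s) (V (?g s)) = LM c (?l s, ?F (?l s))"
 using fnorm_coord[OF gl(2)[OF s(5)] V_tangent[OF A f gp KB(3)[OF gK]]] gl(1)[OF s(5)] by (simp add: field_coords_def)
moreover have "fnorm M q (V q) = LM c (?x, ?v)" by (rule fnorm_coord[OF c V])
ultimately have "(fnorm M (?g s) (V (?g s)))^2 < (fnorm M q (V q))^2" using d1(2)[OF s(1,2,3)] by (simp add: C.Q_def)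
thus ?thesis using power2_less_imp_less[OF _ fnorm_nonneg[OF k(1) V]] gK by blast
qed

lemma K_compact: "compactin (topo M) K"
proof -
obtain c where c: "c \<in> Ch p" using cover p by blast
note a = chD(1)[OF c]
have b: "LM c (snd c p, et) < rh ==> (snd c p, et) \<in> ZZ c" for et using in_cdom[OF c] by (simp add: ZZ_def)
note B = nb_ZZ[OF a] in_cdom[OF c] b
have ci: "ci c (snd c p) = p" using chart_inv(1)[OF chD(1,2)[OF c]] .
have rr: "r < rh" using rL r by linarith
have "K = {ex c (snd c p, et) | et. LM c (snd c p, et) <= r}"
proof (intro equalityI subsetI)
 fix x assume "x \<in> K"
 note k = KB(1,2)[OF this]
 have "dst p x < rh" using k(2) rr by simp
 from gE_ZZ(3,4)[OF c k(1) this] have "x = ex c (snd c p, exp_inv M p x c) & LM c (snd c p, exp_inv M p x c) <= r" using k(2) by simp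
 thus "x \<in> {ex c (snd c p, et) | et. LM c (snd c p, et) <= r}" by blast
next
 fix x assume "x \<in> {ex c (snd c p, et) | et. LM c (snd c p, et) <= r}"
 then obtain et where e: "x = ex c (snd c p, et)" "LM c (snd c p, et) <= r" by blast
 have w: "(snd c p, et) \<in> WW c" using in_cdom[OF c] by simp
 have "x \<in> PM" unfolding e(1) ex_def by (rule geo_points[OF pt_vec(3,2)[OF a w]]) simp
 moreover have "dst p x = LM c (snd c p, et)" using nb_dist[OF B, of rh et] ci e rr by simp
 ultimately show "x \<in> K" using e(2) by (simp add: KB_def)
qed
thus ?thesis using nb_compact[OF B rr] by simp
qed

text \<open>\<open>V_decreases\<close> turns a minimum of \<open>F(V)\<close> on the compact ball
  into a zero, and the strict sign in \<open>V_boundary\<close> keeps it off the boundary.\<close>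

lemma V_zero_exists: "EX q:PM. dst p q < r & V q = tzero"
proof -
let ?N = "%x. fnorm M x (V x)"
have "continuous_map (subtopology (topo M) K) euclideanreal ?N"
 unfolding continuous_map_atin limitin_atin
proof (intro ballI conjI allI impI)
 fix x U assume "x \<in> topspace (subtopology (topo M) K)" and U: "openin euclideanreal U & ?N x \<in> U"
 hence x: "x \<in> K" by simp
 note k = KB[OF x]
 obtain c where c: "c \<in> Ch x" using cover k(1) by blast
 note a = chD(1)[OF c]
 interpret C: cmetric "LM c" "cdom c" by (rule cmetric[OF a])
 let ?L = "%xi. LM c (xi, field_coords c V xi)"
 have "isCont (LM c) (snd c x, field_coords c V (snd c x))"
  by (rule continuous_on_interior[OF C.L_continuous]) (use in_cdom[OF c] in "simp add: interior_open[OF open_W[OF a]]")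
 from continuous_within_compose3[OF this continuous_Pair[OF continuous_ident has_derivative_continuous[OF V_deriv(2)[OF A f c k(3)]]]]
 have cL: "isCont ?L (snd c x)" .
 have LN: "?L (snd c y) = ?N y" if "y \<in> K" "y \<in> fst c" for y
 proof -
  have "c \<in> Ch y" using that a by (simp add: charts_at_def)
  from fnorm_coord[OF this V_tangent[OF A f KB(1,3)[OF that(1)]]] chart_inv(1)[OF a that(2)]
  show ?thesis by (simp add: field_coords_def)
 qed
 obtain B where B: "open B" "snd c x \<in> B" "!!xi. xi \<in> B ==> ?L xi \<in> U"
  using cL U LN[OF x chD(2)[OF c]] unfolding continuous_at_open by auto
 show "EX T. openin (subtopology (topo M) K) T & x \<in> T & ?N ` (T - {x}) <= U"
 proof (intro exI[of _ "{y \<in> fst c. snd c y \<in> B} Int K"] conjI)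
  show "openin (subtopology (topo M) K) ({y \<in> fst c. snd c y \<in> B} Int K)"
   using chart_ball_open[OF a B(1)] openin_subtopology by blast
  show "x \<in> {y \<in> fst c. snd c y \<in> B} Int K" using x B(2) chD(2)[OF c] by simp
  show "?N ` ({y \<in> fst c. snd c y \<in> B} Int K - {x}) <= U" using B(3) LN by force
 qed
qed simp
hence "compactin euclideanreal (?N ` K)"
 by (rule image_compactin[rotated]) (use K_compact in "simp add: compactin_subtopology")
hence "compact (?N ` K)" by simp
moreover have "p \<in> K" using p fdist_self r by (simp add: KB_def)
ultimately obtain q where q: "q \<in> K" "!!x. x \<in> K ==> ?N q <= ?N x" using compact_attains_inf[of "?N ` K"] by blast
note k = KB[OF q(1)]
have z: "V q = tzero" using V_decreases[OF q(1)] q(2) by force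
have "dst p q ~= r"
proof
 assume e: "dst p q = r"
 obtain c where c: "c \<in> Ch q" using cover k(1) by blast
 interpret C: cmetric "LM c" "cdom c" by (rule chm[OF c])
 have "r < rh / (2 * Lm)" using rL r by linarith
 hence t: "rad p q \<in> TM q" "rad p q ~= tzero" using rad[OF p k(1)] e r(1) fnorm_tzero[OF k(1)] by auto
 show False using V_boundary[OF q(1) e c] z linear_0[OF C.lin_G(1)[OF pair_in_S[OF c nz_chart[OF t c]]]]
  by (simp add: tzero_def)
qed
thus ?thesis using k(1,2) z by force
qed

text \<open>On the geodesic between two zeros, the pairing of its velocity \<open>T\<close> with
  \<open>V\<close> vanishes at both ends, while its derivative is at least
  \<open>3/4 * g_T(T, T)\<close>. The geodesic is not known to stay in the ball, but it stays close
  enough to the values of \<open>f\<close> for the estimate.\<close>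

lemma V_zero_unique:
assumes q: "q1 \<in> PM" "q2 \<in> PM" "dst p q1 < r" "dst p q2 < r" and z: "V q1 = tzero" "V q2 = tzero"
shows "q1 = q2"
proof (rule ccontr)
assume ne: "q1 ~= q2"
have d: "dst q1 q2 <= 2 * Lm * r" "dst q1 q2 < rh" using dist_in[OF q(1) _ q(2)] q rL r by linarith+
define v where "v = exp_inv M q1 q2"
note v = exp_inv[OF q(1,2) d(2), folded v_def]
let ?s = "geo q1 v" and ?w = "gvel q1 v"
have s0: "?s 0 = q1" using geo(2)[OF v(1) q(1)] .
have "v ~= tzero" using geo_tzero(1)[OF q(1), of 1] v(3) ne by auto
note w0 = gvel_nonzero[OF v(1) q(1) this]
have sp: "?s t \<in> PM" if "0 <= t" for t by (rule geo_points[OF v(1) q(1) that])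
have n: "near A f (?s t)" if t: "t \<in> {0..1}" for t
proof (rule near_KB[OF sp])
 fix a assume a: "a \<in> space A"
 have "dst (?s t) q2 <= (1 - t) * dst q1 q2" using geo_fdist_le[OF v(1) q(1), of t 1] t v by simp
 also have "... <= 1 * (2 * Lm * r)" using t d(1) fdist_nonneg[OF q(1,2)] by (intro mult_mono) auto
 finally show "dst (?s t) (f a) <= 4 * Lm * r"
  using fdist_tri[OF sp[of t] q(2) f_points[OF A f a]] dist_in[OF q(2) _ f_points[OF A f a]] fr[OF a] q(4) t by auto
qed (use t in auto)
let ?g = "%t. ip (?s t) (?w t) (?w t) (V (?s t))"
have g: "EX g'>0. (?g hrd g') (at t within {0..1})" if t: "t \<in> {0..1}" for t
proof -
 have t0: "0 <= t" using t by simp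
 obtain c where c: "c \<in> Ch (?s t)" using cover[OF sp[OF t0]] by blast
 interpret C: cberwald "LM c" "cdom c" by (rule chb[OF c])
 have sub: "{0..1} <= {0..}" by auto
 have cont: "cmap {0..1} ?s"
  using continuous_map_from_subtopology_mono[OF geodesic_cont[OF geo(1)[OF v(1) q(1)]] sub] .
 note gc = geo_coord[OF v(1) q(1) t0 c] and wt = gvel_tangent[OF v(1) q(1)]
 note gx = hvd_sub[OF gc(1) sub]
 have gw: "((%s. ?w s c) hvd 0 - Gm c (snd c (?s t)) (?w t c) (?w t c)) (at t within {0..1})"
  using hvd_sub[OF gc(2) sub] by simp
 let ?x = "snd c (?s t)" and ?W = "?w t c"
 have W: "?W ~= 0" by (rule nz_chart[OF wt[OF t0] w0[OF t0] c])
 have zS: "(?x, ?W) \<in> C.S" by (rule pair_in_S[OF c W])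
 define y' where "y' = fd (field_coords c V) ?x ?W + Gm c ?x (V (?s t) c) ?W"
 note VA = V_along[OF A f cont t c n[OF t] gx, folded y'_def]
 have d0: "C.DG (?x, ?W) (0, 0) ?W (V (?s t) c) = 0" using linear_0[OF C.linear_DG(1)[OF zS]] by (simp add: zero_prod_def)
 have "(?g hrd C.G (?x, ?W) ?W y') (at t within {0..1})"
  using ip_along[where ga = ?s and t = t and Y = ?w and A = ?w and B = "%s. V (?s s)" and y' = 0 and a' = 0 and b' = y', OF cont t c gx gw gw VA]
   wt w0 V_tangent[OF A f sp n] d0 linear_0[OF C.lin_G(2)[OF zS]] by simp
 moreover have "3/4 * C.G (?x, ?W) ?W ?W <= C.G (?x, ?W) ?W y'"
  using V_deriv(3)[OF A f c n[OF t] W, of ?W ?W, folded y'_def] C.G_nonneg[OF zS, of ?W] by simp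
 moreover have "0 < C.G (?x, ?W) ?W ?W" by (rule C.G_pos[OF zS W])
 ultimately show ?thesis by (intro exI[of _ "C.G (?x, ?W) ?W y'"]) simp
qed
have "EX g'. ALL t:{0..1}. 0 < g' t & (?g hrd g' t) (at t within {0..1})"
 by (rule bchoice[OF ballI]) (rule g)
then obtain g' where "ALL t:{0..1}. 0 < g' t & (?g hrd g' t) (at t within {0..1})" ..
note g' = bspec[OF this]
have gd: "(?g hfd (*) (g' t)) (at t within {0..1})" if "0 <= t" "t <= 1" for t
proof -
 have "t \<in> {0..1}" using that by simp
 from conjunct2[OF g'[OF this]] show ?thesis by (simp only: has_field_derivative_def)
qed
obtain x where x: "x \<in> {0<..<1}" "?g 1 - ?g 0 = g' x * (1 - 0)" using mvt_simple[OF zero_less_one gd] by blast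
have gz: "?g t = 0" if "t \<in> {0..1}" "V (?s t) = tzero" for t
proof -
 have t0: "0 <= t" using that by simp
 obtain c where c: "c \<in> Ch (?s t)" using cover[OF sp[OF t0]] by blast
 interpret C: cberwald "LM c" "cdom c" by (rule chb[OF c])
 note wt = gvel_tangent[OF v(1) q(1) t0]
 show ?thesis
  using ip_chart[OF wt w0[OF t0] wt tangent_tzero c] linear_0[OF C.lin_G(1)[OF pair_in_S[OF c nz_chart[OF wt w0[OF t0] c]]]] that(2)
  by (simp add: tzero_def)
qed
have "?g 0 = 0" "?g 1 = 0" by (rule gz; use z s0 v(3) in simp)+
moreover have "0 < g' x" using g' x(1) by auto
ultimately show False using x(2) by simp
qed

text \<open>At a zero of \<open>V\<close> the connection term vanishes, so the coordinate derivative
  is the covariant one, whose pairing with \<open>X\<close> is at least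
  \<open>3/4 * g_X(X, X)\<close>.\<close>

lemma V_push_bij:
assumes q: "q \<in> PM" "dst p q < r" and z: "V q = tzero" and c: "c \<in> Ch q"
shows "bij (field_push c V q)"
proof -
interpret C: cberwald "LM c" "cdom c" by (rule chb[OF c])
have "q \<in> K" using q by (simp add: KB_def)
note k = KB[OF this]
let ?D = "fd (field_coords c V) (snd c q)"
note hd = V_deriv(2)[OF A f c k(3)]
have dF: "field_coords c V differentiable (at (snd c q))" using hd by (auto simp: differentiable_def)
note lD = fd_linear[OF dF]
have "field_push c V q X = ?D X" for X
proof -
 have "dird (%xi. field_coords c V xi $ k) (snd c q) Y = ?D Y $ k" for k Y
  using dird_eq_fd[OF differentiable_compose[OF bounded_linear_imp_differentiable[OF bounded_linear_vec_nth] dF, of k]] fd_component[OF dF] by simp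
 thus ?thesis unfolding field_push_def lin_axis[OF lD, of X] by (simp add: vec_eq_iff)
qed
hence e: "field_push c V q = ?D" by blast
have "X = 0" if X: "?D X = 0" for X
proof (rule ccontr)
 assume X0: "X ~= 0"
 have zS: "(snd c q, X) \<in> C.S" by (rule pair_in_S[OF c X0])
 have "?D X + Gm c (snd c q) (V q c) X = 0" using X z linear_0[OF C.Gx_lin(1)] by (simp add: tzero_def)
 thus False using V_deriv(3)[OF A f c k(3) X0, of X X] C.G_pos[OF zS X0] linear_0[OF C.lin_G(1)[OF zS]] by simp
qed
hence "inj ?D" using linear_injective_0[OF lD] by blast
thus ?thesis unfolding e bij_def using linear_injective_imp_surjective[OF lD] by simp
qed

lemma closure_K: "topo M closure_of fball M p r <= K"
by (rule closure_of_minimal[OF _ compactin_imp_closedin[OF haus K_compact]]) (auto simp: fball_def KB_def)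

lemma V_defined: assumes x: "x \<in> K" shows "mass_field_defined M A f x"
proof -
note k = KB[OF x]
have "inj_on (fexp M x) (exp_dom M x)"
 by (rule inj_onI) (use exp_inj[OF k(1)] fexp_eq[OF _ k(1)] in "auto simp: exp_dom_def")
moreover have "f a \<in> fexp M x ` exp_dom M x" if a: "a \<in> space A" for a
proof -
 note v = exp_inv[OF k(1) f_points[OF A f a] k(4)[OF a]]
 have "exp_inv M x (f a) \<in> exp_dom M x" using exp_inv_geo(2)[OF k(1) v(1)] v(2) k(4)[OF a] by simp
 thus ?thesis using fexp_eq[OF v(1) k(1)] v(3) by (metis image_eqI)
qed
ultimately show ?thesis unfolding mass_field_defined_def using V_deriv(1)[OF A f _ k(3)] by blast
qed

lemma V_differentiable: "B <= K ==> field_differentiable_on M V B"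
unfolding field_differentiable_on_def
using V_deriv(2)[OF A f _ KB(3)] has_derivative_at_withinI unfolding differentiable_def by blast

end

end

theorem theorem4p4:
  fixes k \<Lambda> \<sigma> :: real
  assumes "\<sigma> > 0"
  shows "\<exists>\<rho>>0. \<forall>M :: ('m, 'n::finite) finsler_space.
    finsler_manifold M \<and> forward_complete M \<and> berwald M \<and> flag_curv_bounded M k \<and>
    uniformity_const M \<le> ereal \<Lambda> \<and> ereal \<sigma> \<le> inj_radius M \<longrightarrow>
    (\<forall>(A :: 'a measure) r p f.
       prob_space A \<and> 0 < r \<and> r < \<rho> \<and> p \<in> points M \<and>
       f \<in> A \<rightarrow>\<^sub>M borel_of_space M \<and> f \<in> space A \<rightarrow> fball M p r \<longrightarrow>
       (\<forall>x \<in> topo M closure_of fball M p r. mass_field_defined M A f x) \<and>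
       (\<exists>!q. q \<in> fball M p r \<and> mass_field M A f q = tzero) \<and>
       field_differentiable_on M (mass_field M A f) (topo M closure_of fball M p r) \<and>
       (\<forall>c \<in> charts_at M (center_of_mass M p r A f).
          bij (field_push c (mass_field M A f) (center_of_mass M p r A f))))"
proof -
\<comment> \<open>The maximum makes \<open>1 <= L\<close> available. The second entry of
  \<open>R\<close> gives \<open>9 * (L * R)^2 * (|k| + 1)^2 <= 1\<close>, which together with
  \<open>|k| <= (|k| + 1)^2\<close> yields the assumption \<open>kr\<close> of
  \<open>cm_mfd\<close>.\<close>
define L R where "L = max 1 \<Lambda>" and "R = min \<sigma> (1 / (3 * L * (\<bar>k\<bar> + 1)))"
have L: "1 <= L" "\<Lambda> <= L" by (auto simp: L_def)
have R: "0 < R" "R <= \<sigma>" "R * (3 * L * (\<bar>k\<bar> + 1)) <= 1"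
proof -
 have X: "0 < 3 * L * (\<bar>k\<bar> + 1)" using L by (intro mult_pos_pos) auto
 thus "0 < R" "R <= \<sigma>" using assms by (auto simp: R_def)
 have "R * (3 * L * (\<bar>k\<bar> + 1)) <= 1 / (3 * L * (\<bar>k\<bar> + 1)) * (3 * L * (\<bar>k\<bar> + 1))"
  unfolding R_def by (rule mult_right_mono) (use X in auto)
 also have "... = 1" by (rule nonzero_eq_divide_eq[THEN iffD1, OF _ refl]) (use X in linarith)
 finally show "R * (3 * L * (\<bar>k\<bar> + 1)) <= 1" .
qed
have kR: "\<bar>k\<bar> * (L * R^2) <= 1 / (8 * L)"
proof -
 have "(R * (3 * L * (\<bar>k\<bar> + 1)))^2 <= 1" using R L power_le_one[of "R * (3 * L * (\<bar>k\<bar> + 1))" 2] by simp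
 hence "9 * (L * R)^2 * (\<bar>k\<bar> + 1)^2 <= 1" by (simp only: power_mult_distrib) (simp add: mult_ac)
 moreover have "\<bar>k\<bar> <= (\<bar>k\<bar> + 1)^2" by (simp add: power2_sum)
 hence "8 * (L * R)^2 * \<bar>k\<bar> <= 9 * (L * R)^2 * (\<bar>k\<bar> + 1)^2" by (intro mult_mono) auto
 ultimately have "8 * (L * R)^2 * \<bar>k\<bar> <= 1" by linarith
 thus ?thesis using L by (simp add: field_simps power2_eq_square)
qed
\<comment> \<open>The witness turns \<open>r < R / (8 * L^2)\<close> into the condition
  \<open>8 * Lm^2 * r < rh\<close> with \<open>rh = R\<close> and \<open>Lm = L\<close>; it involves
  neither the manifold nor the measure.\<close>
show ?thesis
proof (intro exI[of _ "R / (8 * L^2)"] conjI allI impI)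
 show "0 < R / (8 * L^2)" using R L by simp
 fix M :: "('m, 'n) finsler_space" and A :: "'a measure" and r p f
 assume M: "finsler_manifold M & forward_complete M & berwald M & flag_curv_bounded M k &
  uniformity_const M <= ereal \<Lambda> & ereal \<sigma> <= inj_radius M"
  and h: "prob_space A & 0 < r & r < R / (8 * L^2) & p \<in> points M &
   f \<in> A \<rightarrow>\<^sub>M borel_of_space M & f \<in> space A \<rightarrow> fball M p r"
 have "uniformity_const M <= ereal L" "ereal R <= inj_radius M" using M L R order_trans ereal_less_eq(3) by blast+
 then interpret cm_mfd M k L R
  using M L R kR by unfold_locales auto
 have r8: "8 * L^2 * r < R" using h L by (simp add: field_simps)
 note H = conjunct1[OF conjunct2[OF conjunct2[OF conjunct2[OF h]]]] conjunct1[OF conjunct2[OF h]] r8 conjunct1[OF h]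
  conjunct1[OF conjunct2[OF conjunct2[OF conjunct2[OF conjunct2[OF h]]]]]
 have fr: "ALL a:space A. fdist M p (f a) < r" using h by (auto simp: fball_def)
 note c = closure_K[OF H fr]
 show "ALL x:topo M closure_of fball M p r. mass_field_defined M A f x" using V_defined[OF H fr] c by blast
 show u: "\<exists>!q. q \<in> fball M p r & mass_field M A f q = tzero"
  using V_zero_exists[OF H fr] V_zero_unique[OF H fr] unfolding fball_def by blast
 show "field_differentiable_on M (mass_field M A f) (topo M closure_of fball M p r)" by (rule V_differentiable[OF H fr c])
 show "ALL c:charts_at M (center_of_mass M p r A f). bij (field_push c (mass_field M A f) (center_of_mass M p r A f))"
  using V_push_bij[OF H fr] theI'[OF u] unfolding center_of_mass_def fball_def by blast
qed
qed

end
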